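(* There is a deterministic decremental algorithm for $(1+\epsilon)$-approximate all-pairs shortest paths in unweighted directed graphs with a predicted sequence of edge deletions with $O(n^{(3+\omega)/2}\log^2 n)$ preprocessing time and $O(\log n)$ worst-case edge deletion time, such that each query asked between the $i$-th and $(i+1)$-st deletion requires $O(\bar{\bar\eta}_i^2\log\log n)=O(\eta_\infty^2\log\log n)$ time, where $\bar{\bar\eta}_i=\min\{j : \{\hat e_j,\hat e_{j+1},\dots,\hat e_m\}\cap\{e_1,\dots,e_i\}=\emptyset\}-i-1$.
   Context: Problem: on a vertex set $V$ with $|V|=n$, the algorithm first receives (offline) a predicted deletion sequence $\hat e_1,\dots,\hat e_m$ of distinct directed edges; the initial graph has edge set $\{\hat e_1,\dots,\hat e_m\}$. It then receives online an interleaved sequence of edge deletions $e_1,\dots,e_m$ (the same edges, in some order) and queries $(s,t)\in V\times V$; each query must return a number in $[d(s,t),(1+\epsilon)d(s,t)]$, where $d(s,t)$ is the current unweighted shortest-path distance from $s$ to $t$. $\omega$ is the matrix multiplication exponent. With $t(e)=i$ if $e=e_i$ and $\hat t(e)=j$ if $e=\hat e_j$, $\eta_\infty=\max_e|t(e)-\hat t(e)|$.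
   Formalization: In the query bounds the error is replaced by max(1, error), since error 0 (e.g. before any deletion) would literally demand query time 0; ε is a fixed constant, and ω is any exponent for which n×n matrices can be multiplied in O(n^ω) time. *)

theory Defs
  imports
    "HOL-Analysis.Analysis"
    "HOL-Library.Landau_Symbols"
    "Graph_Theory.Graph_Theory"
begin

text \<open>
  The model of computation is the deterministic unit-cost word RAM, presented as a structured
  language: finitely many registers per program, indirect addressing, and one time unit for every
  primitive instruction and every test. All words (values and addresses) have to be smaller than a
  capacity, and a run that would produce or address a larger word is stuck. The capacity will be
  polynomial in \<open>n\<close>, i.e. words consist of \<open>O(log n)\<close> bits.
\<close>

record ram =
  regs :: "nat \<Rightarrow> nat"
  mem :: "nat \<Rightarrow> nat"

datatype arith = Add | Sub | Mul | Div | Less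

fun arith_val :: "arith \<Rightarrow> nat \<Rightarrow> nat \<Rightarrow> nat" where
  "arith_val Add x y = x + y"
| "arith_val Sub x y = x - y"
| "arith_val Mul x y = x * y"
| "arith_val Div x y = x div y"
| "arith_val Less x y = (if x < y then 1 else 0)"

datatype prog =
    Skip
  | SetConst nat nat
  | Arith nat arith nat nat
  | Load nat nat
  | Store nat nat
  | Seq prog prog
  | IfNZ nat prog prog
  | WhileNZ nat prog

text \<open>
  \<open>run W P \<sigma> t \<sigma>'\<close>: started in \<open>\<sigma>\<close>, program \<open>P\<close> halts in \<open>\<sigma>'\<close> after exactly \<open>t\<close> time units, using only
  words smaller than \<open>W\<close>.
\<close>

inductive run :: "nat \<Rightarrow> prog \<Rightarrow> ram \<Rightarrow> nat \<Rightarrow> ram \<Rightarrow> bool" for W :: nat where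
  Skip: "run W Skip \<sigma> 1 \<sigma>"
| SetConst: "k < W \<Longrightarrow> run W (SetConst r k) \<sigma> 1 (\<sigma>\<lparr>regs := (regs \<sigma>)(r := k)\<rparr>)"
| Arith: "arith_val f (regs \<sigma> a) (regs \<sigma> b) < W \<Longrightarrow>
    run W (Arith r f a b) \<sigma> 1 (\<sigma>\<lparr>regs := (regs \<sigma>)(r := arith_val f (regs \<sigma> a) (regs \<sigma> b))\<rparr>)"
| Load: "regs \<sigma> a < W \<Longrightarrow> mem \<sigma> (regs \<sigma> a) < W \<Longrightarrow>
    run W (Load r a) \<sigma> 1 (\<sigma>\<lparr>regs := (regs \<sigma>)(r := mem \<sigma> (regs \<sigma> a))\<rparr>)"
| Store: "regs \<sigma> a < W \<Longrightarrow> regs \<sigma> r < W \<Longrightarrow>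
    run W (Store a r) \<sigma> 1 (\<sigma>\<lparr>mem := (mem \<sigma>)(regs \<sigma> a := regs \<sigma> r)\<rparr>)"
| Seq: "run W P \<sigma> t \<sigma>' \<Longrightarrow> run W Q \<sigma>' t' \<sigma>'' \<Longrightarrow> run W (Seq P Q) \<sigma> (t + t') \<sigma>''"
| IfTrue: "regs \<sigma> r \<noteq> 0 \<Longrightarrow> run W P \<sigma> t \<sigma>' \<Longrightarrow> run W (IfNZ r P Q) \<sigma> (Suc t) \<sigma>'"
| IfFalse: "regs \<sigma> r = 0 \<Longrightarrow> run W Q \<sigma> t \<sigma>' \<Longrightarrow> run W (IfNZ r P Q) \<sigma> (Suc t) \<sigma>'"
| WhileFalse: "regs \<sigma> r = 0 \<Longrightarrow> run W (WhileNZ r P) \<sigma> 1 \<sigma>"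
| WhileTrue: "regs \<sigma> r \<noteq> 0 \<Longrightarrow> run W P \<sigma> t \<sigma>' \<Longrightarrow> run W (WhileNZ r P) \<sigma>' t' \<sigma>'' \<Longrightarrow>
    run W (WhileNZ r P) \<sigma> (Suc (t + t')) \<sigma>''"

inductive_cases run_SkipE: "run W Skip \<sigma> t \<sigma>'"
inductive_cases run_SetConstE: "run W (SetConst r k) \<sigma> t \<sigma>'"
inductive_cases run_ArithE: "run W (Arith r f a b) \<sigma> t \<sigma>'"
inductive_cases run_LoadE: "run W (Load r a) \<sigma> t \<sigma>'"
inductive_cases run_StoreE: "run W (Store a r) \<sigma> t \<sigma>'"
inductive_cases run_SeqE: "run W (Seq P Q) \<sigma> t \<sigma>'"

lemma run_deterministic:
  "run W P \<sigma> t \<sigma>' \<Longrightarrow> run W P \<sigma> u \<sigma>'' \<Longrightarrow> u = t \<and> \<sigma>'' = \<sigma>'"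
proof (induction arbitrary: u \<sigma>'' rule: run.induct)
  case (Skip \<sigma>)
  then show ?case by (rule run_SkipE) simp
next
  case (SetConst k r \<sigma>)
  from SetConst.prems show ?case by (rule run_SetConstE) simp
next
  case (Arith f \<sigma> a b r)
  from Arith.prems show ?case by (rule run_ArithE) simp
next
  case (Load \<sigma> a r)
  from Load.prems show ?case by (rule run_LoadE) simp
next
  case (Store \<sigma> a r)
  from Store.prems show ?case by (rule run_StoreE) simp
next
  case (Seq P \<sigma> t \<sigma>' Q t' \<sigma>2)
  from Seq.prems obtain u1 \<tau> u2 where
    u: "run W P \<sigma> u1 \<tau>" "run W Q \<tau> u2 \<sigma>''" "u = u1 + u2"
    by (rule run_SeqE) blast
  from Seq.IH(1)[OF u(1)] have "u1 = t" "\<tau> = \<sigma>'" by simp_all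
  with Seq.IH(2) u(2,3) show ?case by blast
next
  case (IfTrue \<sigma> r P t \<sigma>' Q)
  from IfTrue.prems IfTrue.hyps(1) obtain u1 where u: "run W P \<sigma> u1 \<sigma>''" "u = Suc u1"
    by (cases rule: run.cases) simp_all
  with IfTrue.IH[OF u(1)] show ?case by simp
next
  case (IfFalse \<sigma> r Q t \<sigma>' P)
  from IfFalse.prems IfFalse.hyps(1) obtain u1 where u: "run W Q \<sigma> u1 \<sigma>''" "u = Suc u1"
    by (cases rule: run.cases) simp_all
  with IfFalse.IH[OF u(1)] show ?case by simp
next
  case (WhileFalse \<sigma> r P)
  from WhileFalse.prems WhileFalse.hyps show ?case
    by (cases rule: run.cases) simp_all
next
  case (WhileTrue \<sigma> r P t \<sigma>' t' \<sigma>2)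
  from WhileTrue.prems WhileTrue.hyps(1) obtain u1 \<tau> u2 where
    u: "run W P \<sigma> u1 \<tau>" "run W (WhileNZ r P) \<tau> u2 \<sigma>''" "u = Suc (u1 + u2)"
    by (cases rule: run.cases) simp_all
  from WhileTrue.IH(1)[OF u(1)] have "u1 = t" "\<tau> = \<sigma>'" by simp_all
  with WhileTrue.IH(2) u(2,3) show ?case by blast
qed

definition capacity :: "nat \<Rightarrow> nat \<Rightarrow> nat" where
  "capacity c n = (n + 2) ^ c"


text \<open>
  \<open>matmul_time \<omega>\<close>: two \<open>N \<times> N\<close> matrices with \<open>O(log N)\<close>-bit integer entries can be multiplied in
  \<open>O(N\<^sup>\<omega>)\<close> time. The infimum of these \<open>\<omega>\<close> need not be attained, so a bound that literally contains
  \<open>N\<^sup>\<omega>\<close> is stated for every \<open>\<omega>\<close> of this kind.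
\<close>

definition matmul_input :: "nat \<Rightarrow> (nat \<Rightarrow> nat \<Rightarrow> nat) \<Rightarrow> (nat \<Rightarrow> nat \<Rightarrow> nat) \<Rightarrow> ram" where
  "matmul_input N A B =
    \<lparr>regs = (\<lambda>_. 0)(0 := N),
     mem = (\<lambda>x. if x < N\<^sup>2 then A (x div N) (x mod N)
                else if x < 2 * N\<^sup>2 then B ((x - N\<^sup>2) div N) ((x - N\<^sup>2) mod N)
                else 0)\<rparr>"

definition matmul_time :: "real \<Rightarrow> bool" where
  "matmul_time \<omega> \<longleftrightarrow>
    (\<forall>k. \<exists>P c. \<exists>T :: nat \<Rightarrow> real. T \<in> O(\<lambda>N. real N powr \<omega>) \<and>
      (\<forall>N A B. (\<forall>i<N. \<forall>j<N. A i j < capacity k N \<and> B i j < capacity k N) \<longrightarrow>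
        (\<exists>t \<sigma>. run (capacity c N) P (matmul_input N A B) t \<sigma> \<and> real t \<le> T N \<and>
          (\<forall>i<N. \<forall>j<N. mem \<sigma> (2 * N\<^sup>2 + i * N + j) = (\<Sum>l<N. A i l * B l j)))))"


type_synonym edge = "nat \<times> nat"

definition dist_in :: "nat \<Rightarrow> edge set \<Rightarrow> nat \<Rightarrow> nat \<Rightarrow> ereal" where
  "dist_in n E s t = wf_digraph.\<mu> (with_proj \<lparr>pverts = {..<n}, parcs = E\<rparr>) (\<lambda>_. 1) s t"


datatype request = Delete edge | Query nat nat

fun deletions :: "request list \<Rightarrow> edge list" where
  "deletions [] = []"
| "deletions (Delete e # rs) = e # deletions rs"
| "deletions (Query s t # rs) = deletions rs"

record algorithm =
  preprocess :: prog
  delete :: prog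
  answer :: prog

definition initial_ram :: "nat \<Rightarrow> edge list \<Rightarrow> ram" where
  "initial_ram n es =
    \<lparr>regs = (\<lambda>_. 0)(0 := n, 1 := length es),
     mem = (\<lambda>x. if x < 2 * length es
                then (if even x then fst (es ! (x div 2)) else snd (es ! (x div 2))) else 0)\<rparr>"

definition set_args :: "nat \<Rightarrow> nat \<Rightarrow> ram \<Rightarrow> ram" where
  "set_args x y \<sigma> = \<sigma>\<lparr>regs := (regs \<sigma>)(0 := x, 1 := y)\<rparr>"

fun handle :: "nat \<Rightarrow> algorithm \<Rightarrow> request \<Rightarrow> ram \<Rightarrow> nat \<Rightarrow> ram \<Rightarrow> bool" where
  "handle W A (Delete e) \<sigma> t \<sigma>' = run W (delete A) (set_args (fst e) (snd e) \<sigma>) t \<sigma>'"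
| "handle W A (Query x y) \<sigma> t \<sigma>' = run W (answer A) (set_args x y \<sigma>) t \<sigma>'"

text \<open>
  The last argument lists, for each request, the time spent on it and the resulting state. Requests
  are served one after the other on the same machine, so the algorithm sees none in advance.
\<close>

inductive serve :: "nat \<Rightarrow> algorithm \<Rightarrow> ram \<Rightarrow> request list \<Rightarrow> (nat \<times> ram) list \<Rightarrow> bool"
  for W :: nat and A :: algorithm where
  Nil: "serve W A \<sigma> [] []"
| Cons: "handle W A r \<sigma> t \<sigma>' \<Longrightarrow> serve W A \<sigma>' rs tr \<Longrightarrow> serve W A \<sigma> (r # rs) ((t, \<sigma>') # tr)"

text \<open>The answer to a query is a fraction; denominator \<open>0\<close> encodes \<open>\<infinity>\<close>.\<close>

definition out_val :: "ram \<Rightarrow> ereal" where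
  "out_val \<sigma> = (if regs \<sigma> 1 = 0 then \<infinity> else ereal (real (regs \<sigma> 0) / real (regs \<sigma> 1)))"

definition valid_input :: "nat \<Rightarrow> edge list \<Rightarrow> request list \<Rightarrow> bool" where
  "valid_input n es' rs \<longleftrightarrow>
    distinct es' \<and> set es' \<subseteq> {..<n} \<times> {..<n} \<and>
    distinct (deletions rs) \<and> set (deletions rs) = set es' \<and>
    (\<forall>s t. Query s t \<in> set rs \<longrightarrow> s < n \<and> t < n)"


text \<open>Below, \<open>es'\<close> is the predicted and \<open>es\<close> the actual deletion sequence; positions start at 1.\<close>

definition pos :: "edge list \<Rightarrow> edge \<Rightarrow> nat" where
  "pos es e = (THE i. 1 \<le> i \<and> i \<le> length es \<and> es ! (i - 1) = e)"

text \<open>The inserted \<open>0\<close> only matters for the empty sequence.\<close>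

definition eta_inf :: "edge list \<Rightarrow> edge list \<Rightarrow> int" where
  "eta_inf es' es = Max (insert 0 ((\<lambda>e. \<bar>int (pos es e) - int (pos es' e)\<bar>) ` set es))"

definition eta_bar :: "edge list \<Rightarrow> edge list \<Rightarrow> nat \<Rightarrow> int" where
  "eta_bar es' es i =
    int (LEAST j. 1 \<le> j \<and> set (drop (j - 1) es') \<inter> set (take i es) = {}) - int i - 1"

end

theory Submission
  imports Defs "HOL-Real_Asymp.Real_Asymp"
begin

text \<open>
  For a threshold \<open>t\<close>, let \<open>G\<^sub>t\<close> be the graph of the edges predicted to be deleted at time \<open>t\<close> or later.
  Preprocessing computes, for \<open>O(log n)\<close> length scales \<open>l\<close> growing by factors of at most \<open>1 + \<epsilon>\<close>, the matrix whose
  \<open>(u, v)\<close> entry is the largest \<open>t\<close> such that \<open>G\<^sub>t\<close> has a walk of length at most \<open>l\<close> from \<open>u\<close> to \<open>v\<close>. Each of these is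
  a (max, min)-product of two earlier ones. Such a product is obtained by sorting the entries, cutting them into
  parts of \<open>n s\<close> consecutive entries, multiplying one pair of Boolean matrices of dimension \<open>2 n\<close> per part and
  scanning a single part for every result entry; the part size is found adaptively, because \<open>\<omega>\<close> is an arbitrary
  real number.

  If \<open>J\<close> is the largest predicted position among the deleted edges, then \<open>G\<^bsub>J + 1\<^esub>\<close> is contained in the current graph and
  only \<open>J - i\<close> further edges are present. A query runs Dijkstra's algorithm with an array on these edges, where the
  distance in \<open>G\<^bsub>J + 1\<^esub>\<close> between two of them is estimated by binary search over the length scales.
\<close>


text \<open>A (max,min)-product is the larger of two one-sided maxima: over the \<open>A i k\<close>
  with \<open>A i k \<le> B k j\<close> and, with the roles exchanged, over the \<open>B k j\<close>
  with \<open>B k j \<le> A i k\<close>. For each of them only one operand is sorted. As values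
  descend, a column \<open>k\<close> and an index \<open>j\<close> meet chunks lying wholly above
  \<open>B k j\<close>, then at most one chunk that may be mixed, then chunks that are wholly
  dominated. The Boolean product handles the last kind, a direct scan the mixed chunk; so each pair
  causes at most one scan. The balancing chunk size \<open>\<sigma>\<close> occurs in the analysis
  only. With \<open>\<sigma>\<close> near \<open>n powr ((\<omega> - 1) / 2)\<close>, the scans and
  about \<open>n / \<sigma>\<close> products both have exponent \<open>(3 + \<omega>) / 2\<close>. A
  given multiplication program expects zeroed memory and may leave garbage in a polynomially large
  range that is too expensive to clear. Hence every call works in a fresh region. In a query the
  relative errors do not accumulate: every segment between two remaining edges is stretched by at
  most \<open>1 + 1 / h\<close>, and these edges themselves are counted exactly.\<close>

declare One_nat_def [simp del]

section \<open>A structured language with arrays on top of the word RAM\<close>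

datatype exp = N nat | V nat | Bin arith exp exp | Rd nat exp | Raw exp

datatype com =
  CSkip
 | Assign nat exp (infix "::=" 61)
 | Wr nat exp exp
 | CSeq com com (infixr ";;" 60)
 | CIf exp com com
 | CWhile exp com

record st =
 vs :: "nat => nat"
 ar :: "nat => nat => nat"
 ck :: nat

definition tick :: "nat => st => st" where
 "tick k s = s\<lparr>ck := ck s + k\<rparr>"

definition setv :: "nat => nat => nat => st => st" where
 "setv k x v s = s\<lparr>vs := (vs s)(x := v), ck := ck s + k\<rparr>"

definition seta :: "nat => nat => nat => nat => st => st" where
 "seta k a i v s = s\<lparr>ar := (ar s)(a := (ar s a)(i := v)), ck := ck s + k\<rparr>"

lemma st_sel [simp]:
 "vs (tick k s) = vs s" "ar (tick k s) = ar s" "ck (tick k s) = ck s + k"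
 "vs (setv k x v s) = (vs s)(x := v)" "ar (setv k x v s) = ar s" "ck (setv k x v s) = ck s + k"
 "vs (seta k a i v s) = vs s" "ar (seta k a i v s) = (ar s)(a := (ar s a)(i := v))"
 "ck (seta k a i v s) = ck s + k"
 by (simp_all add: tick_def setv_def seta_def)

text \<open>
 Cell \<open>x\<close> of array \<open>a < 32\<close> lives at address \<open>32 * x + a\<close>, so distinct arrays are disjoint and
 unbounded. \<open>Raw e\<close> reads the physical address \<open>e\<close>; it serves only to read the input.
\<close>

fun aval :: "exp => st => nat" where
 "aval (N k) s = k"
| "aval (V x) s = vs s x"
| "aval (Bin f a b) s = arith_val f (aval a s) (aval b s)"
| "aval (Rd a e) s = ar s a (aval e s)"
| "aval (Raw e) s = ar s (aval e s mod 32) (aval e s div 32)"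

fun ecost :: "exp => nat" where
 "ecost (N k) = 1"
| "ecost (V x) = 2"
| "ecost (Bin f a b) = ecost a + ecost b + 1"
| "ecost (Rd a e) = ecost e + 5"
| "ecost (Raw e) = ecost e + 1"

text \<open>\<open>B\<close> bounds the stored words; intermediate results of expressions may be larger.\<close>

inductive bs :: "nat => com => st => st => bool" for B :: nat where
 Skip: "bs B CSkip s (tick 1 s)"
| Assign: "aval e s \<le> B ==>
  bs B (x ::= e) s (setv (ecost e + 2) x (aval e s) s)"
| Wr: "aval e' s \<le> B ==>
  bs B (Wr a e e') s (seta (ecost e + ecost e' + 5) a (aval e s) (aval e' s) s)"
| Seq: "bs B c s s' ==> bs B d s' s'' ==> bs B (c ;; d) s s''"
| IfT: "aval e s \<noteq> 0 ==> bs B c (tick (ecost e + 1) s) s' ==> bs B (CIf e c d) s s'"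
| IfF: "aval e s = 0 ==> bs B d (tick (ecost e + 1) s) s' ==> bs B (CIf e c d) s s'"
| WhileF: "aval e s = 0 ==> bs B (CWhile e c) s (tick (ecost e + 1) s)"
| WhileT: "aval e s \<noteq> 0 ==> bs B c (tick (ecost e + 1) s) s' ==>
  bs B (CWhile e c) s' s'' ==> bs B (CWhile e c) s s''"

subsection \<open>Compilation\<close>

fun address :: "nat => nat => prog" where
 "address a d = Seq (SetConst (d+1) 32) (Seq (Arith d Mul d (d+1))
   (Seq (SetConst (d+1) a) (Arith d Add d (d+1))))"

text \<open>The registers from \<open>d\<close> on form an evaluation stack: the value ends up in
  \<open>d\<close>, and lower registers are kept. The machine has no move instruction, so a variable
  is copied by adding it to a zeroed register.\<close>

fun cexp :: "nat => exp => prog" where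
 "cexp d (N k) = SetConst d k"
| "cexp d (V x) = Seq (SetConst d 0) (Arith d Add x d)"
| "cexp d (Bin f a b) = Seq (cexp d a) (Seq (cexp (d+1) b) (Arith d f d (d+1)))"
| "cexp d (Rd a e) = Seq (cexp d e) (Seq (address a d) (Load d d))"
| "cexp d (Raw e) = Seq (cexp d e) (Load d d)"

text \<open>A loop test is compiled twice, before the loop and at the end of its body, because
  \<open>WhileNZ\<close> tests a register and not an expression.\<close>

fun compc :: "nat => com => prog" where
 "compc d CSkip = Skip"
| "compc d (x ::= e) = Seq (cexp d e) (Seq (SetConst (d+1) 0) (Arith x Add d (d+1)))"
| "compc d (Wr a e e') = Seq (cexp d e) (Seq (address a d) (Seq (cexp (d+1) e') (Store d (d+1))))"
| "compc d (c ;; c') = Seq (compc d c) (compc d c')"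
| "compc d (CIf e c c') = Seq (cexp d e) (IfNZ d (compc d c) (compc d c'))"
| "compc d (CWhile e c) = Seq (cexp d e) (WhileNZ d (Seq (compc d c) (cexp d e)))"

text \<open>An exponent such that \<open>B ^ ewidth e\<close> bounds every word arising in the
  evaluation of \<open>e\<close> when all variables and cells are at most \<open>B\<close>. The 2
  added for an array access pays for the address computation with its factor 32, given
  \<open>64 \<le> B\<close>.\<close>

fun ewidth :: "exp => nat" where
 "ewidth (N k) = 1"
| "ewidth (V x) = 1"
| "ewidth (Bin f a b) = ewidth a + ewidth b"
| "ewidth (Rd a e) = ewidth e + 2"
| "ewidth (Raw e) = ewidth e"

fun width :: "com => nat" where
 "width CSkip = 1"
| "width (x ::= e) = ewidth e"
| "width (Wr a e e') = max (ewidth e + 2) (ewidth e')"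
| "width (c ;; c') = max (width c) (width c')"
| "width (CIf e c c') = max (ewidth e) (max (width c) (width c'))"
| "width (CWhile e c) = max (ewidth e) (width c)"

fun esyn :: "nat => nat => exp => bool" where
 "esyn d k (N c) = (c \<le> k)"
| "esyn d k (V x) = (x < d)"
| "esyn d k (Bin f a b) = (esyn d k a \<and> esyn d k b)"
| "esyn d k (Rd a e) = (a < 32 \<and> esyn d k e)"
| "esyn d k (Raw e) = esyn d k e"

fun csyn :: "nat => nat => com => bool" where
 "csyn d k CSkip = True"
| "csyn d k (x ::= e) = (x < d \<and> esyn d k e)"
| "csyn d k (Wr a e e') = (a < 32 \<and> esyn d k e \<and> esyn d k e')"
| "csyn d k (c ;; c') = (csyn d k c \<and> csyn d k c')"
| "csyn d k (CIf e c c') = (esyn d k e \<and> csyn d k c \<and> csyn d k c')"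
| "csyn d k (CWhile e c) = (esyn d k e \<and> csyn d k c)"

lemma esyn_mono: "esyn d k e ==> d \<le> d' ==> k \<le> k' ==> esyn d' k' e"
 by (induction e) auto

lemma csyn_mono: "csyn d k c ==> d \<le> d' ==> k \<le> k' ==> csyn d' k' c"
 by (induction c) (auto intro: esyn_mono)

definition rel :: "nat => st => ram => bool" where
 "rel d s \<sigma> \<longleftrightarrow> (\<forall>x<d. regs \<sigma> x = vs s x) \<and> (\<forall>a<32. \<forall>x. mem \<sigma> (32 * x + a) = ar s a x)"

definition bnd :: "nat => nat => st => bool" where
 "bnd d B s \<longleftrightarrow> (\<forall>x<d. vs s x \<le> B) \<and> (\<forall>a<32. \<forall>x. ar s a x \<le> B)"

lemma ewidth_pos: "ewidth e \<ge> 1"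
 by (induction e) auto

lemma add_le_power_add:
 fixes B :: nat
 assumes "x \<le> B ^ i" "y \<le> B ^ j" "B \<ge> 2" "i \<ge> 1" "j \<ge> 1"
 shows "x + y \<le> B ^ (i + j)"
proof -
 have "B ^ i \<ge> 2" "B ^ j \<ge> 2"
  using assms self_le_power[of B i] self_le_power[of B j] by linarith+
 then obtain u v where "B ^ i = u + 2" "B ^ j = v + 2" by (metis add.commute le_Suc_ex)
 then have "B ^ i + B ^ j \<le> B ^ i * B ^ j" by (simp add: algebra_simps)
 with assms show ?thesis by (simp add: power_add)
qed

lemma mult_64_le_power: "B ^ i * 64 \<le> B ^ (i + 2)" if "B \<ge> 64" for B :: nat
proof -
 have "64 \<le> B * B" using that mult_le_mono[of 64 B 1 B] by simp
 then show ?thesis by (simp add: power_add power2_eq_square)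
qed

lemma power_max_less:
 fixes B :: nat
 assumes "B ^ max i j < W" "B \<ge> 64"
 shows "B ^ i < W" "B ^ j < W"
proof -
 have "B ^ i \<le> B ^ max i j" "B ^ j \<le> B ^ max i j"
  using assms(2) by (intro power_increasing; simp)+
 then show "B ^ i < W" "B ^ j < W" using assms(1) by linarith+
qed

lemma aval_le:
 assumes "esyn d B e" "bnd d B s" "B \<ge> 2"
 shows "aval e s \<le> B ^ ewidth e"
 using assms(1)
proof (induction e)
 case (Bin f a b)
 have a: "aval a s \<le> B ^ ewidth a" and b: "aval b s \<le> B ^ ewidth b" using Bin by auto
 have w: "ewidth a \<ge> 1" "ewidth b \<ge> 1" by (rule ewidth_pos)+
 have le: "B ^ ewidth a \<le> B ^ (ewidth a + ewidth b)"
  using assms(3) by (intro power_increasing) auto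
 have one: "1 \<le> B ^ (ewidth a + ewidth b)" using assms(3) by simp
 show ?case
 proof (cases f)
  case Add then show ?thesis using add_le_power_add[OF a b assms(3) w] by simp
 next
  case Sub then show ?thesis using a le by simp
 next
  case Mul then show ?thesis using mult_le_mono[OF a b] by (simp add: power_add)
 next
  case Div
  have "aval a s div aval b s \<le> aval a s" by simp
  then show ?thesis using a le Div by (simp del: div_le_dividend)
 next
  case Less then show ?thesis using one by auto
 qed
next
 case (Rd a e)
 have "ar s a (aval e s) \<le> B ^ 1" using Rd assms(2) by (auto simp: bnd_def)
 also have "\<dots> \<le> B ^ (ewidth e + 2)" using assms(3) by (intro power_increasing) auto
 finally show ?case by simp
next
 case (Raw e)
 have "ar s (aval e s mod 32) (aval e s div 32) \<le> B ^ 1"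
  using assms(2) by (auto simp: bnd_def)
 also have "\<dots> \<le> B ^ ewidth e" using assms(3) ewidth_pos by (intro power_increasing) auto
 finally show ?case by simp
qed (use assms(2) in \<open>auto simp: bnd_def\<close>)

lemma run_address:
 assumes "32 * regs \<sigma> d + a < W" "32 < W"
 obtains \<sigma>' where "run W (address a d) \<sigma> 4 \<sigma>'" "regs \<sigma>' d = 32 * regs \<sigma> d + a"
  "\<forall>x<d. regs \<sigma>' x = regs \<sigma> x" "mem \<sigma>' = mem \<sigma>"
proof -
 define \<sigma>1 where "\<sigma>1 = \<sigma>\<lparr>regs := (regs \<sigma>)(d+1 := 32)\<rparr>"
 define \<sigma>2 where "\<sigma>2 = \<sigma>1\<lparr>regs := (regs \<sigma>1)(d := arith_val Mul (regs \<sigma>1 d) (regs \<sigma>1 (d+1)))\<rparr>"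
 define \<sigma>3 where "\<sigma>3 = \<sigma>2\<lparr>regs := (regs \<sigma>2)(d+1 := a)\<rparr>"
 define \<sigma>4 where "\<sigma>4 = \<sigma>3\<lparr>regs := (regs \<sigma>3)(d := arith_val Add (regs \<sigma>3 d) (regs \<sigma>3 (d+1)))\<rparr>"
 have "run W (address a d) \<sigma> (1 + (1 + (1 + 1))) \<sigma>4"
  unfolding address.simps
 proof (intro run.Seq)
  show "run W (SetConst (d+1) 32) \<sigma> 1 \<sigma>1" unfolding \<sigma>1_def by (rule run.SetConst) fact
  show "run W (Arith d Mul d (d+1)) \<sigma>1 1 \<sigma>2"
   unfolding \<sigma>2_def by (rule run.Arith) (use assms in \<open>simp add: \<sigma>1_def\<close>)
  show "run W (SetConst (d+1) a) \<sigma>2 1 \<sigma>3"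
   unfolding \<sigma>3_def by (rule run.SetConst) (use assms in simp)
  show "run W (Arith d Add d (d+1)) \<sigma>3 1 \<sigma>4"
   unfolding \<sigma>4_def
   by (rule run.Arith) (use assms in \<open>simp add: \<sigma>3_def \<sigma>2_def \<sigma>1_def mult.commute\<close>)
 qed
 then have "run W (address a d) \<sigma> 4 \<sigma>4" by simp
 then show ?thesis
  by (rule that) (simp_all add: \<sigma>4_def \<sigma>3_def \<sigma>2_def \<sigma>1_def)
qed

text \<open>Here \<open>d0\<close> is the number of program variables and \<open>d\<close> the
  current top of the stack. Keeping them apart lets the induction raise the stack while the
  represented state stays fixed.\<close>

lemma run_cexp:
 assumes "rel d0 s \<sigma>" "d0 \<le> d" "bnd d0 B s" "esyn d0 B e" "B \<ge> 64" "B ^ ewidth e < W"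
 shows "\<exists>\<sigma>'. run W (cexp d e) \<sigma> (ecost e) \<sigma>' \<and> regs \<sigma>' d = aval e s \<and>
  (\<forall>x<d. regs \<sigma>' x = regs \<sigma> x) \<and> mem \<sigma>' = mem \<sigma>"
 using assms
proof (induction e arbitrary: d \<sigma>)
 case (N k)
 then have "k < W" by simp
 then have "run W (SetConst d k) \<sigma> 1 (\<sigma>\<lparr>regs := (regs \<sigma>)(d := k)\<rparr>)" by (rule run.SetConst)
 then show ?case by auto
next
 case (V x)
 define \<sigma>1 where "\<sigma>1 = \<sigma>\<lparr>regs := (regs \<sigma>)(d := 0)\<rparr>"
 have x: "x < d" "regs \<sigma> x = vs s x" "vs s x \<le> B" using V by (auto simp: rel_def bnd_def)
 have "run W (SetConst d 0) \<sigma> 1 \<sigma>1" unfolding \<sigma>1_def by (rule run.SetConst) (use V in simp)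
 moreover have "run W (Arith d Add x d) \<sigma>1 1 (\<sigma>1\<lparr>regs := (regs \<sigma>1)(d := arith_val Add (regs \<sigma>1 x) (regs \<sigma>1 d))\<rparr>)"
  by (rule run.Arith) (use V x in \<open>simp add: \<sigma>1_def\<close>)
 ultimately have "run W (cexp d (V x)) \<sigma> (1 + 1) (\<sigma>1\<lparr>regs := (regs \<sigma>1)(d := arith_val Add (regs \<sigma>1 x) (regs \<sigma>1 d))\<rparr>)"
  unfolding cexp.simps by (rule run.Seq)
 then show ?case using x
  by (intro exI[of _ "\<sigma>1\<lparr>regs := (regs \<sigma>1)(d := arith_val Add (regs \<sigma>1 x) (regs \<sigma>1 d))\<rparr>"] conjI)
   (auto simp: \<sigma>1_def numeral_2_eq_2)
next
 case (Bin f a b)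
 have lea: "B ^ ewidth a \<le> B ^ (ewidth a + ewidth b)" and leb: "B ^ ewidth b \<le> B ^ (ewidth a + ewidth b)"
  using Bin.prems(5) by (intro power_increasing; simp)+
 then have lta: "B ^ ewidth a < W" and ltb: "B ^ ewidth b < W" using Bin.prems(6) by simp_all
 obtain \<sigma>1 where 1: "run W (cexp d a) \<sigma> (ecost a) \<sigma>1" "regs \<sigma>1 d = aval a s"
  "\<forall>x<d. regs \<sigma>1 x = regs \<sigma> x" "mem \<sigma>1 = mem \<sigma>"
  using Bin.IH(1)[of \<sigma> d] Bin.prems lta by auto
 have "rel d0 s \<sigma>1" using 1 Bin.prems by (auto simp: rel_def)
 then obtain \<sigma>2 where 2: "run W (cexp (d+1) b) \<sigma>1 (ecost b) \<sigma>2" "regs \<sigma>2 (d+1) = aval b s"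
  "\<forall>x<d+1. regs \<sigma>2 x = regs \<sigma>1 x" "mem \<sigma>2 = mem \<sigma>1"
  using Bin.IH(2)[of \<sigma>1 "d+1"] Bin.prems ltb by auto
 have "aval (Bin f a b) s \<le> B ^ ewidth (Bin f a b)"
  by (rule aval_le[of d0]) (use Bin.prems in auto)
 then have "run W (Arith d f d (d+1)) \<sigma>2 1 (\<sigma>2\<lparr>regs := (regs \<sigma>2)(d := arith_val f (regs \<sigma>2 d) (regs \<sigma>2 (d+1)))\<rparr>)"
  by (intro run.Arith) (use 1 2 Bin.prems in auto)
 from run.Seq[OF 1(1) run.Seq[OF 2(1) this]] show ?case
  using 1 2 by (intro exI[of _ "\<sigma>2\<lparr>regs := (regs \<sigma>2)(d := arith_val f (regs \<sigma>2 d) (regs \<sigma>2 (d+1)))\<rparr>"])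
   (auto simp: add_ac)
next
 case (Rd a e)
 have le: "B ^ ewidth e * 64 \<le> B ^ (ewidth e + 2)"
  by (rule mult_64_le_power) (rule Rd.prems(5))
 moreover have "B ^ (ewidth e + 2) < W" using Rd.prems(6) by simp
 ultimately have le': "B ^ ewidth e < W" "B ^ ewidth e * 64 < W" by linarith+
 obtain \<sigma>1 where 1: "run W (cexp d e) \<sigma> (ecost e) \<sigma>1" "regs \<sigma>1 d = aval e s"
  "\<forall>x<d. regs \<sigma>1 x = regs \<sigma> x" "mem \<sigma>1 = mem \<sigma>"
  using Rd.IH[of \<sigma> d] Rd.prems le' by auto
 have "aval e s \<le> B ^ ewidth e" by (rule aval_le[of d0]) (use Rd.prems in auto)
 moreover have "1 \<le> B ^ ewidth e" using Rd.prems by simp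
 moreover have "a < 32" using Rd.prems by simp
 ultimately have adr: "32 * aval e s + a < W" "32 < W" using le' by linarith+
 obtain \<sigma>2 where 2: "run W (address a d) \<sigma>1 4 \<sigma>2" "regs \<sigma>2 d = 32 * aval e s + a"
  "\<forall>x<d. regs \<sigma>2 x = regs \<sigma>1 x" "mem \<sigma>2 = mem \<sigma>1"
  by (rule run_address[of \<sigma>1 d a W]) (use 1 adr in auto)
 have m: "mem \<sigma>2 (regs \<sigma>2 d) = ar s a (aval e s)"
  using Rd.prems 1 2 by (auto simp: rel_def)
 have "ar s a (aval e s) \<le> B" using Rd.prems by (auto simp: bnd_def)
 moreover have "B < W"
  using self_le_power[of B "ewidth e"] ewidth_pos[of e] le' Rd.prems by simp
 ultimately have "run W (Load d d) \<sigma>2 1 (\<sigma>2\<lparr>regs := (regs \<sigma>2)(d := mem \<sigma>2 (regs \<sigma>2 d))\<rparr>)"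
  by (intro run.Load) (use 2 adr m in auto)
 from run.Seq[OF 1(1) run.Seq[OF 2(1) this]] show ?case
  using 1 2 m by (intro exI[of _ "\<sigma>2\<lparr>regs := (regs \<sigma>2)(d := mem \<sigma>2 (regs \<sigma>2 d))\<rparr>"])
   (auto simp: add_ac)
next
 case (Raw e)
 obtain \<sigma>1 where 1: "run W (cexp d e) \<sigma> (ecost e) \<sigma>1" "regs \<sigma>1 d = aval e s"
  "\<forall>x<d. regs \<sigma>1 x = regs \<sigma> x" "mem \<sigma>1 = mem \<sigma>"
  using Raw.IH[of \<sigma> d] Raw.prems by auto
 have "aval e s \<le> B ^ ewidth e" by (rule aval_le[of d0]) (use Raw.prems in auto)
 then have adr: "aval e s < W" using Raw.prems by simp
 have "mem \<sigma> (32 * (aval e s div 32) + aval e s mod 32) = ar s (aval e s mod 32) (aval e s div 32)"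
  using Raw.prems(1) unfolding rel_def by (metis mod_less_divisor zero_less_numeral)
 then have m: "mem \<sigma>1 (regs \<sigma>1 d) = ar s (aval e s mod 32) (aval e s div 32)"
  using 1 by simp
 have "ar s (aval e s mod 32) (aval e s div 32) \<le> B" using Raw.prems by (auto simp: bnd_def)
 moreover have "B < W"
  using self_le_power[of B "ewidth e"] ewidth_pos[of e] Raw.prems by simp
 ultimately have "run W (Load d d) \<sigma>1 1 (\<sigma>1\<lparr>regs := (regs \<sigma>1)(d := mem \<sigma>1 (regs \<sigma>1 d))\<rparr>)"
  by (intro run.Load) (use 1 adr m in auto)
 from run.Seq[OF 1(1) this] show ?case
  using 1 m by (intro exI[of _ "\<sigma>1\<lparr>regs := (regs \<sigma>1)(d := mem \<sigma>1 (regs \<sigma>1 d))\<rparr>"]) auto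
qed

lemma rel_ck: "rel d (tick t s) \<sigma> = rel d s \<sigma>" and bnd_ck: "bnd d B (tick t s) = bnd d B s"
 by (simp_all add: rel_def bnd_def)

lemma address_inj: "a < 32 ==> b < 32 ==> 32 * x + a = 32 * y + (b::nat) \<longleftrightarrow> x = y \<and> a = b"
proof -
 assume "a < 32" "b < 32"
 then have "(32 * x + a) div 32 = x" "(32 * y + b) div 32 = y" by simp_all
 then have "32 * x + a = 32 * y + b ==> x = y" by metis
 then show ?thesis by auto
qed

text \<open>The clock charges exactly the compiled instructions, so the running time is the clock
  difference and not merely bounded by it. The condition \<open>B ^ width c < W\<close> makes room
  for intermediate words that exceed \<open>B\<close>.\<close>

theorem run_comp:
 assumes "bs B c s s'" "csyn d B c" "rel d s \<sigma>" "bnd d B s" "B \<ge> 64" "B ^ width c < W"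
 shows "\<exists>\<sigma>'. ck s \<le> ck s' \<and> run W (compc d c) \<sigma> (ck s' - ck s) \<sigma>' \<and> rel d s' \<sigma>' \<and> bnd d B s'"
 using assms
proof (induction arbitrary: \<sigma> rule: bs.induct)
 case (Skip s)
 then show ?case using run.Skip[of W \<sigma>] by (auto simp: rel_ck bnd_ck)
next
 case (Assign e s x)
 obtain \<sigma>1 where 1: "run W (cexp d e) \<sigma> (ecost e) \<sigma>1" "regs \<sigma>1 d = aval e s"
  "\<forall>x<d. regs \<sigma>1 x = regs \<sigma> x" "mem \<sigma>1 = mem \<sigma>"
  using run_cexp[of d s \<sigma> d B e W] Assign.prems by auto
 have BW: "B < W"
  using self_le_power[of B "ewidth e"] ewidth_pos[of e] Assign.prems by simp
 define \<sigma>2 where "\<sigma>2 = \<sigma>1\<lparr>regs := (regs \<sigma>1)(d+1 := 0)\<rparr>"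
 have "run W (SetConst (d+1) 0) \<sigma>1 1 \<sigma>2" unfolding \<sigma>2_def by (rule run.SetConst) (use BW in simp)
 moreover have "run W (Arith x Add d (d+1)) \<sigma>2 1
   (\<sigma>2\<lparr>regs := (regs \<sigma>2)(x := arith_val Add (regs \<sigma>2 d) (regs \<sigma>2 (d+1)))\<rparr>)"
  by (intro run.Arith) (use 1 Assign BW in \<open>auto simp: \<sigma>2_def\<close>)
 ultimately have "run W (compc d (x ::= e)) \<sigma> (ecost e + (1 + 1))
   (\<sigma>2\<lparr>regs := (regs \<sigma>2)(x := arith_val Add (regs \<sigma>2 d) (regs \<sigma>2 (d+1)))\<rparr>)"
  unfolding compc.simps by (intro run.Seq[OF 1(1)] run.Seq)
 then show ?case using 1 Assign
  by (intro exI[of _ "\<sigma>2\<lparr>regs := (regs \<sigma>2)(x := arith_val Add (regs \<sigma>2 d) (regs \<sigma>2 (d+1)))\<rparr>"])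
   (auto simp: \<sigma>2_def rel_def bnd_def)
next
 case (Wr e' s a e)
 have le: "B ^ ewidth e * 64 \<le> B ^ (ewidth e + 2)"
  by (rule mult_64_le_power) (rule Wr.prems(4))
 moreover have "B ^ (ewidth e + 2) \<le> B ^ max (ewidth e + 2) (ewidth e')"
  "B ^ (ewidth e') \<le> B ^ max (ewidth e + 2) (ewidth e')"
  using Wr.prems(4) by (intro power_increasing; simp)+
 moreover have "B ^ max (ewidth e + 2) (ewidth e') < W" using Wr.prems(5) by simp
 ultimately have le': "B ^ ewidth e < W" "B ^ ewidth e' < W" "B ^ ewidth e * 64 < W"
  by linarith+
 obtain \<sigma>1 where 1: "run W (cexp d e) \<sigma> (ecost e) \<sigma>1" "regs \<sigma>1 d = aval e s"
  "\<forall>x<d. regs \<sigma>1 x = regs \<sigma> x" "mem \<sigma>1 = mem \<sigma>"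
  using run_cexp[of d s \<sigma> d B e W] Wr.prems le' by auto
 have "aval e s \<le> B ^ ewidth e" by (rule aval_le[of d]) (use Wr.prems in auto)
 moreover have "1 \<le> B ^ ewidth e" using Wr.prems by simp
 moreover have "a < 32" using Wr.prems by simp
 ultimately have adr: "32 * aval e s + a < W" "32 < W" using le' by linarith+
 obtain \<sigma>2 where 2: "run W (address a d) \<sigma>1 4 \<sigma>2" "regs \<sigma>2 d = 32 * aval e s + a"
  "\<forall>x<d. regs \<sigma>2 x = regs \<sigma>1 x" "mem \<sigma>2 = mem \<sigma>1"
  by (rule run_address[of \<sigma>1 d a W]) (use 1 adr in auto)
 have "rel d s \<sigma>2" using 1 2 Wr.prems by (auto simp: rel_def)
 then obtain \<sigma>3 where 3: "run W (cexp (d+1) e') \<sigma>2 (ecost e') \<sigma>3" "regs \<sigma>3 (d+1) = aval e' s"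
  "\<forall>x<d+1. regs \<sigma>3 x = regs \<sigma>2 x" "mem \<sigma>3 = mem \<sigma>2"
  using run_cexp[of d s \<sigma>2 "d+1" B e' W] Wr.prems le' by auto
 have BW: "B < W"
  using self_le_power[of B "ewidth e"] ewidth_pos[of e] Wr.prems le' by simp
 have "run W (Store d (d+1)) \<sigma>3 1 (\<sigma>3\<lparr>mem := (mem \<sigma>3)(regs \<sigma>3 d := regs \<sigma>3 (d+1))\<rparr>)"
  by (intro run.Store) (use 2 3 Wr BW adr in auto)
 from run.Seq[OF 1(1) run.Seq[OF 2(1) run.Seq[OF 3(1) this]]]
 have "run W (compc d (Wr a e e')) \<sigma> (ecost e + ecost e' + 5)
   (\<sigma>3\<lparr>mem := (mem \<sigma>)(32 * aval e s + a := aval e' s)\<rparr>)"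
  using 1 2 3 by (simp add: add_ac)
 moreover have "rel d (seta k a (aval e s) (aval e' s) s) (\<sigma>3\<lparr>mem := (mem \<sigma>)(32 * aval e s + a := aval e' s)\<rparr>)" for k
  using 1 2 3 Wr.prems by (auto simp: rel_def address_inj)
 moreover have "bnd d B (seta k a (aval e s) (aval e' s) s)" for k
  using Wr.prems Wr.hyps by (auto simp: bnd_def)
 ultimately show ?case by auto
next
 case (Seq c s s' e s'')
 have le: "B ^ width c < W" "B ^ width e < W"
  using Seq.prems by (auto dest: power_max_less)
 obtain \<sigma>1 where 1: "ck s \<le> ck s'" "run W (compc d c) \<sigma> (ck s' - ck s) \<sigma>1" "rel d s' \<sigma>1" "bnd d B s'"
  using Seq.IH(1)[of \<sigma>] Seq.prems le by auto
 obtain \<sigma>2 where 2: "ck s' \<le> ck s''" "run W (compc d e) \<sigma>1 (ck s'' - ck s') \<sigma>2" "rel d s'' \<sigma>2" "bnd d B s''"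
  using Seq.IH(2)[of \<sigma>1] Seq.prems le 1 by auto
 from run.Seq[OF 1(2) 2(2)] show ?case using 1 2 by (intro exI[of _ \<sigma>2]) auto
next
 case (IfT e s c s' c')
 have le: "B ^ width c < W" "B ^ ewidth e < W"
  using IfT.prems by (auto dest: power_max_less)
 obtain \<sigma>1 where 1: "run W (cexp d e) \<sigma> (ecost e) \<sigma>1" "regs \<sigma>1 d = aval e s"
  "\<forall>x<d. regs \<sigma>1 x = regs \<sigma> x" "mem \<sigma>1 = mem \<sigma>"
  using run_cexp[of d s \<sigma> d B e W] IfT.prems le by auto
 have "rel d s \<sigma>1" using 1 IfT.prems by (auto simp: rel_def)
 then obtain \<sigma>2 where 2: "ck s + (ecost e + 1) \<le> ck s'"
  "run W (compc d c) \<sigma>1 (ck s' - (ck s + (ecost e + 1))) \<sigma>2" "rel d s' \<sigma>2" "bnd d B s'"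
  using IfT.IH[of \<sigma>1] IfT.prems le by (auto simp: rel_ck bnd_ck)
 have "run W (IfNZ d (compc d c) (compc d c')) \<sigma>1 (Suc (ck s' - (ck s + (ecost e + 1)))) \<sigma>2"
  by (rule run.IfTrue) (use 1 2 IfT.hyps in auto)
 from run.Seq[OF 1(1) this]
 have "run W (Seq (cexp d e) (IfNZ d (compc d c) (compc d c'))) \<sigma> (ecost e + Suc (ck s' - (ck s + (ecost e + 1)))) \<sigma>2" .
 also have "ecost e + Suc (ck s' - (ck s + (ecost e + 1))) = ck s' - ck s" using 2(1) by linarith
 finally show ?case using 2 by (intro exI[of _ \<sigma>2]) auto
next
 case (IfF e s c s' c')
 have le: "B ^ width c < W" "B ^ ewidth e < W"
  using IfF.prems by (auto dest: power_max_less)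
 obtain \<sigma>1 where 1: "run W (cexp d e) \<sigma> (ecost e) \<sigma>1" "regs \<sigma>1 d = aval e s"
  "\<forall>x<d. regs \<sigma>1 x = regs \<sigma> x" "mem \<sigma>1 = mem \<sigma>"
  using run_cexp[of d s \<sigma> d B e W] IfF.prems le by auto
 have "rel d s \<sigma>1" using 1 IfF.prems by (auto simp: rel_def)
 then obtain \<sigma>2 where 2: "ck s + (ecost e + 1) \<le> ck s'"
  "run W (compc d c) \<sigma>1 (ck s' - (ck s + (ecost e + 1))) \<sigma>2" "rel d s' \<sigma>2" "bnd d B s'"
  using IfF.IH[of \<sigma>1] IfF.prems le by (auto simp: rel_ck bnd_ck)
 have "run W (IfNZ d (compc d c') (compc d c)) \<sigma>1 (Suc (ck s' - (ck s + (ecost e + 1)))) \<sigma>2"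
  by (rule run.IfFalse) (use 1 2 IfF.hyps in auto)
 from run.Seq[OF 1(1) this]
 have "run W (Seq (cexp d e) (IfNZ d (compc d c') (compc d c))) \<sigma> (ecost e + Suc (ck s' - (ck s + (ecost e + 1)))) \<sigma>2" .
 also have "ecost e + Suc (ck s' - (ck s + (ecost e + 1))) = ck s' - ck s" using 2(1) by linarith
 finally show ?case using 2 by (intro exI[of _ \<sigma>2]) auto
next
 case (WhileF e s c)
 have le: "B ^ ewidth e < W"
  using WhileF.prems by (auto dest: power_max_less)
 obtain \<sigma>1 where 1: "run W (cexp d e) \<sigma> (ecost e) \<sigma>1" "regs \<sigma>1 d = aval e s"
  "\<forall>x<d. regs \<sigma>1 x = regs \<sigma> x" "mem \<sigma>1 = mem \<sigma>"
  using run_cexp[of d s \<sigma> d B e W] WhileF.prems le by auto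
 have "run W (WhileNZ d (Seq (compc d c) (cexp d e))) \<sigma>1 1 \<sigma>1"
  by (rule run.WhileFalse) (use 1 WhileF.hyps in auto)
 from run.Seq[OF 1(1) this] show ?case using 1 WhileF.prems
  by (intro exI[of _ \<sigma>1]) (auto simp: rel_def bnd_def)
next
 case (WhileT e s c s' s'')
 have le: "B ^ width c < W" "B ^ ewidth e < W"
  using WhileT.prems by (auto dest: power_max_less)
 obtain \<sigma>1 where 1: "run W (cexp d e) \<sigma> (ecost e) \<sigma>1" "regs \<sigma>1 d = aval e s"
  "\<forall>x<d. regs \<sigma>1 x = regs \<sigma> x" "mem \<sigma>1 = mem \<sigma>"
  using run_cexp[of d s \<sigma> d B e W] WhileT.prems le by auto
 have "rel d s \<sigma>1" using 1 WhileT.prems by (auto simp: rel_def)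
 then obtain \<sigma>2 where 2: "ck s + (ecost e + 1) \<le> ck s'"
  "run W (compc d c) \<sigma>1 (ck s' - (ck s + (ecost e + 1))) \<sigma>2" "rel d s' \<sigma>2" "bnd d B s'"
  using WhileT.IH(1)[of \<sigma>1] WhileT.prems le by (auto simp: rel_ck bnd_ck)
 obtain \<sigma>3 where 3: "ck s' \<le> ck s''" "run W (compc d (CWhile e c)) \<sigma>2 (ck s'' - ck s') \<sigma>3"
  "rel d s'' \<sigma>3" "bnd d B s''"
  using WhileT.IH(2)[of \<sigma>2] WhileT.prems 2 by auto
 \<comment> \<open>The induction hypothesis runs the compiled loop together with its initial test.
   Splitting off this test moves it to the end of the present iteration, where the compiled body
   evaluates it.\<close>
 from 3(2) obtain u1 \<tau> u2 where u: "run W (cexp d e) \<sigma>2 u1 \<tau>"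
  "run W (WhileNZ d (Seq (compc d c) (cexp d e))) \<tau> u2 \<sigma>3" "ck s'' - ck s' = u1 + u2"
  unfolding compc.simps by (rule run_SeqE) blast
 have "run W (WhileNZ d (Seq (compc d c) (cexp d e))) \<sigma>1
   (Suc ((ck s' - (ck s + (ecost e + 1)) + u1) + u2)) \<sigma>3"
  by (rule run.WhileTrue[OF _ run.Seq[OF 2(2) u(1)] u(2)]) (use 1 WhileT.hyps in auto)
 from run.Seq[OF 1(1) this] have "run W (compc d (CWhile e c)) \<sigma>
   (ecost e + Suc ((ck s' - (ck s + (ecost e + 1)) + u1) + u2)) \<sigma>3" by simp
 also have "ecost e + Suc ((ck s' - (ck s + (ecost e + 1)) + u1) + u2) = ck s'' - ck s"
  using u(3) 2(1) 3(1) by linarith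
 finally show ?case using 2 3 by (intro exI[of _ \<sigma>3]) auto
qed

subsection \<open>Weakest preconditions\<close>

fun mv :: "com => nat set" where
 "mv CSkip = {}"
| "mv (x ::= e) = {x}"
| "mv (Wr a e e') = {}"
| "mv (c ;; c') = mv c \<union> mv c'"
| "mv (CIf e c c') = mv c \<union> mv c'"
| "mv (CWhile e c) = mv c"

fun ma :: "com => nat set" where
 "ma CSkip = {}"
| "ma (x ::= e) = {}"
| "ma (Wr a e e') = {a}"
| "ma (c ;; c') = ma c \<union> ma c'"
| "ma (CIf e c c') = ma c \<union> ma c'"
| "ma (CWhile e c) = ma c"

definition same :: "nat set => nat set => st => st => bool" where
 "same X Y s s' \<longleftrightarrow> (\<forall>x. x \<notin> X --> vs s' x = vs s x) \<and> (\<forall>a. a \<notin> Y --> ar s' a = ar s a)"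

lemma same_vs: "same X Y s s' ==> x \<notin> X ==> vs s' x = vs s x"
 and same_ar: "same X Y s s' ==> a \<notin> Y ==> ar s' a = ar s a"
 by (simp_all add: same_def)

lemma same_mono: "same X Y s s' ==> X \<subseteq> X' ==> Y \<subseteq> Y' ==> same X' Y' s s'"
 by (auto simp: same_def)

lemma same_trans: "same X Y s s' ==> same X Y s' s'' ==> same X Y s s''"
 by (auto simp: same_def)

lemma bs_same: "bs B c s s' ==> same (mv c) (ma c) s s'"
 by (induction rule: bs.induct) (auto simp: same_def)

text \<open>Total correctness. The clock is a component of the state, so time bounds are ordinary
  postconditions.\<close>

definition wp :: "nat => com => (st => bool) => st => bool" where
 "wp B c Q s \<longleftrightarrow> (\<exists>s'. bs B c s s' \<and> Q s')"

lemma wp_Skip [simp]: "wp B CSkip Q s \<longleftrightarrow> Q (tick 1 s)"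
proof -
 have "bs B CSkip s s' \<longleftrightarrow> s' = tick 1 s" for s'
  by (subst bs.simps) simp
 then show ?thesis by (simp add: wp_def)
qed

lemma wp_Assign [simp]: "wp B (x ::= e) Q s \<longleftrightarrow>
  aval e s \<le> B \<and> Q (setv (ecost e + 2) x (aval e s) s)"
proof -
 have "bs B (x ::= e) s s' \<longleftrightarrow> aval e s \<le> B \<and> s' = setv (ecost e + 2) x (aval e s) s" for s'
  by (subst bs.simps) auto
 then show ?thesis by (simp add: wp_def)
qed

lemma wp_Wr [simp]: "wp B (Wr a e e') Q s \<longleftrightarrow>
  aval e' s \<le> B \<and> Q (seta (ecost e + ecost e' + 5) a (aval e s) (aval e' s) s)"
proof -
 have "bs B (Wr a e e') s s' \<longleftrightarrow>
   aval e' s \<le> B \<and> s' = seta (ecost e + ecost e' + 5) a (aval e s) (aval e' s) s" for s'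
  by (subst bs.simps) auto
 then show ?thesis by (simp add: wp_def)
qed

lemma wp_Seq [simp]: "wp B (c ;; d) Q s \<longleftrightarrow> wp B c (wp B d Q) s"
proof -
 have "bs B (c ;; d) s s' \<longleftrightarrow> (\<exists>s1. bs B c s s1 \<and> bs B d s1 s')" for s'
  by (subst bs.simps) simp
 then show ?thesis by (auto simp: wp_def)
qed

lemma wp_If [simp]: "wp B (CIf e c d) Q s \<longleftrightarrow>
  (if aval e s \<noteq> 0 then wp B c Q (tick (ecost e + 1) s)
   else wp B d Q (tick (ecost e + 1) s))"
proof -
 have "bs B (CIf e c d) s s' \<longleftrightarrow> (if aval e s \<noteq> 0 then bs B c (tick (ecost e + 1) s) s'
   else bs B d (tick (ecost e + 1) s) s')" for s'
  by (subst bs.simps) auto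
 then show ?thesis by (auto simp: wp_def)
qed

lemma wp_While_unfold: "wp B (CWhile e c) Q s \<longleftrightarrow>
  (if aval e s \<noteq> 0 then wp B c (wp B (CWhile e c) Q) (tick (ecost e + 1) s)
   else Q (tick (ecost e + 1) s))"
proof -
 have "bs B (CWhile e c) s s' \<longleftrightarrow> (if aval e s \<noteq> 0 then
   (\<exists>s1. bs B c (tick (ecost e + 1) s) s1 \<and> bs B (CWhile e c) s1 s')
   else s' = tick (ecost e + 1) s)" for s'
  by (subst bs.simps[of B "CWhile e c"]) auto
 then show ?thesis unfolding wp_def by auto
qed

text \<open>Consequence and frame in one rule: the syntactic sets \<open>mv\<close> and
  \<open>ma\<close> supply everything that the command leaves alone, so specifications only speak
  about changes.\<close>

lemma wp_conseq:
 assumes "wp B c Q s" "\<And>s'. Q s' ==> same (mv c) (ma c) s s' ==> Q' s'"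
 shows "wp B c Q' s"
 using assms bs_same unfolding wp_def by blast

text \<open>The measure \<open>f\<close> yields termination. The frame refers to the state before
  the loop, which keeps variables untouched by the body out of the invariants.\<close>

lemma wp_While:
 fixes f :: "st => nat"
 assumes "I s"
  and step: "\<And>s'. I s' ==> same (mv c) (ma c) s s' ==> aval e s' \<noteq> 0 ==>
   wp B c (\<lambda>s''. I s'' \<and> f s'' < f s') (tick (ecost e + 1) s')"
  and fin: "\<And>s'. I s' ==> same (mv c) (ma c) s s' ==> aval e s' = 0 ==>
   Q (tick (ecost e + 1) s')"
 shows "wp B (CWhile e c) Q (s :: st)"
proof -
 have "I s' ==> same (mv c) (ma c) s s' ==> wp B (CWhile e c) Q s'" for s'
 proof (induction "f s'" arbitrary: s' rule: less_induct)
  case less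
  show ?case
  proof (cases "aval e s' = 0")
   case True
   then show ?thesis by (subst wp_While_unfold) (use fin less.prems in auto)
  next
   case False
   have sm: "same (mv c) (ma c) s (tick t s')" for t
    using less.prems(2) by (simp add: same_def)
   have "wp B c (wp B (CWhile e c) Q) (tick (ecost e + 1) s')"
    by (rule wp_conseq[OF step[OF less.prems False]])
     (use less.hyps same_trans[OF sm] in blast)
   then show ?thesis by (subst wp_While_unfold) (use False in auto)
  qed
 qed
 then show ?thesis using assms(1) by (simp add: same_def)
qed

definition For :: "nat => exp => com => com" where
 "For x e c = (x ::= N 0 ;; CWhile (Bin Less (V x) e) (c ;; x ::= Bin Add (V x) (N 1)))"

lemma mv_For [simp]: "mv (For x e c) = insert x (mv c)"
 and ma_For [simp]: "ma (For x e c) = ma c"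
 by (auto simp: For_def)

text \<open>The clock offsets are the costs of the loop control.\<close>

lemma wp_For:
 assumes "I 0 (setv 3 x 0 s)" and b: "b \<le> B"
  and bound: "\<And>s'. same (insert x (mv c)) (ma c) s s' ==> aval e s' = b"
  and step: "\<And>k s'. I k s' ==> same (insert x (mv c)) (ma c) s s' ==> vs s' x = k ==> k < b ==>
   wp B c (\<lambda>s''. vs s'' x = k \<and>
    I (k + 1) (setv 6 x (k + 1) s'')) (tick (ecost e + 4) s')"
  and fin: "\<And>s'. I b s' ==> same (insert x (mv c)) (ma c) s s' ==> vs s' x = b ==> Q (tick (ecost e + 4) s')"
 shows "wp B (For x e c) Q s"
proof -
 let ?s0 = "setv 3 x 0 s"
 let ?e = "Bin Less (V x) e"
 let ?c = "c ;; x ::= Bin Add (V x) (N 1)"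
 have sm: "same (mv ?c) (ma ?c) ?s0 s' ==> same (insert x (mv c)) (ma c) s s'" for s'
  by (auto simp: same_def)
 have "wp B (CWhile ?e ?c) Q ?s0"
 proof (rule wp_While[where I = "\<lambda>s'. I (vs s' x) s' \<and> vs s' x \<le> b" and f = "\<lambda>s'. b - vs s' x"])
  show "I (vs ?s0 x) ?s0 \<and> vs ?s0 x \<le> b" using assms(1) by simp
 next
  fix s' assume I: "I (vs s' x) s' \<and> vs s' x \<le> b" and s: "same (mv ?c) (ma ?c) ?s0 s'" and nz: "aval ?e s' \<noteq> 0"
  have c4: "ecost ?e + 1 = ecost e + 4" by simp
  have c6: "ecost (Bin Add (V x) (N 1)) + 2 = 6" by simp
  have lt: "vs s' x < b" using nz bound[OF sm[OF s]] by (auto split: if_splits)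
  show "wp B ?c (\<lambda>s''. (I (vs s'' x) s'' \<and> vs s'' x \<le> b) \<and> b - vs s'' x < b - vs s' x)
    (tick (ecost ?e + 1) s')"
   unfolding wp_Seq wp_Assign c4 c6
   by (rule wp_conseq[where Q = "\<lambda>s''. vs s'' x = vs s' x \<and>
    I (vs s' x + 1) (setv 6 x (vs s' x + 1) s'')"])
    (use step[of "vs s' x" s'] I sm[OF s] lt b in \<open>auto\<close>)
 next
  fix s' assume I: "I (vs s' x) s' \<and> vs s' x \<le> b" and s: "same (mv ?c) (ma ?c) ?s0 s'" and z: "aval ?e s' = 0"
  have "vs s' x = b" using z bound[OF sm[OF s]] I by (auto split: if_splits)
  moreover have "ecost ?e + 1 = ecost e + 4" by simp
  ultimately show "Q (tick (ecost ?e + 1) s')" using fin[of s'] I sm[OF s] by presburger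
 qed
 then show ?thesis unfolding For_def by simp
qed

abbreviation (input) plus_exp (infixl "+." 65) where "a +. b \<equiv> Bin Add a b"
abbreviation (input) minus_exp (infixl "-." 65) where "a -. b \<equiv> Bin Sub a b"
abbreviation (input) times_exp (infixl "*." 70) where "a *. b \<equiv> Bin Mul a b"
abbreviation (input) div_exp (infixl "'/." 70) where "a /. b \<equiv> Bin Div a b"
abbreviation (input) less_exp (infix "<." 50) where "a <. b \<equiv> Bin Less a b"

text \<open>The global variables: \<open>vn\<close> and \<open>vm\<close> are the numbers of
  vertices and edges, \<open>vnn\<close> is \<open>n * n\<close>, \<open>vK\<close> the number of
  length scales, \<open>vJ\<close> the largest predicted position deleted so far,
  \<open>vbase\<close> the start of the fresh region of the scratch arrays, \<open>vQ\<close> the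
  size of such a region, \<open>vN\<close> the matrix dimension and \<open>vX\<close> a cost
  counter. The array \<open>aPM\<close> is the memory of the simulated multiplication.\<close>

abbreviation (input) "vn \<equiv> 2 :: nat"
abbreviation (input) "vm \<equiv> 3 :: nat"
abbreviation (input) "vnn \<equiv> 4 :: nat"
abbreviation (input) "vK \<equiv> 5 :: nat"
abbreviation (input) "vJ \<equiv> 6 :: nat"
abbreviation (input) "vbase \<equiv> 7 :: nat"
abbreviation (input) "vQ \<equiv> 8 :: nat"
abbreviation (input) "vN \<equiv> 9 :: nat"
abbreviation (input) "vX \<equiv> 10 :: nat"
abbreviation (input) "vs' \<equiv> 11 :: nat"
abbreviation (input) "aPM \<equiv> 28 :: nat"

lemma lessThan_plus1 [simp]: "{..<k + 1} = insert k {..<k :: nat}"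
 by auto

lemma less_plus1_eq: "(i :: nat) < k + 1 \<longleftrightarrow> i < k \<or> i = k"
 by auto

subsection \<open>Simulating a RAM program inside one array\<close>

abbreviation (input) "inc \<equiv> vX ::= (V vX +. N 1)"

text \<open>
 The simulated memory is the part of array \<open>28\<close> that starts at the variable \<open>7\<close>, the simulated
 registers are the variables from \<open>100\<close> on, and variable \<open>10\<close> counts the simulated time.
\<close>

fun simulate :: "prog => com" where
 "simulate Skip = CSkip ;; inc"
| "simulate (SetConst r k) = (100 + r ::= N k) ;; inc"
| "simulate (Arith r f a b) = (100 + r ::= Bin f (V (100 + a)) (V (100 + b))) ;; inc"
| "simulate (Load r a) = (100 + r ::= Rd aPM (V vbase +. V (100 + a))) ;; inc"
| "simulate (Store a r) = Wr aPM (V vbase +. V (100 + a)) (V (100 + r)) ;; inc"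
| "simulate (Seq P Q) = simulate P ;; simulate Q"
| "simulate (IfNZ r P Q) = inc ;; CIf (V (100 + r)) (simulate P) (simulate Q)"
| "simulate (WhileNZ r P) = inc ;; CWhile (V (100 + r)) (simulate P ;; inc)"

fun nregs :: "prog => nat" where
 "nregs Skip = 0"
| "nregs (SetConst r k) = r + 1"
| "nregs (Arith r f a b) = r + a + b + 1"
| "nregs (Load r a) = r + a + 1"
| "nregs (Store a r) = r + a + 1"
| "nregs (Seq P Q) = max (nregs P) (nregs Q)"
| "nregs (IfNZ r P Q) = max (r + 1) (max (nregs P) (nregs Q))"
| "nregs (WhileNZ r P) = max (r + 1) (nregs P)"

definition simulates :: "nat => st => ram => bool" where
 "simulates R s \<sigma> \<longleftrightarrow> (\<forall>r<R. vs s (100 + r) = regs \<sigma> r) \<and> (\<forall>x. ar s aPM (vs s vbase + x) = mem \<sigma> x)"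

lemma mv_simulate: "mv (simulate P) \<subseteq> insert vX {100..}"
 by (induction P) auto

lemma ma_simulate: "ma (simulate P) \<subseteq> {aPM}"
 by (induction P) auto

text \<open>Loads and stores, the costliest instructions, take 18 ticks with the increment of the
  counter; 20 is a round bound. The increment for every later test of a loop sits at the end of the
  body, so that the remaining iterations are again an instance of the simulated loop.\<close>

lemma wp_simulate:
 assumes "run W P \<sigma> t \<sigma>'" "nregs P \<le> R" "W \<le> B" "simulates R s \<sigma>" "vs s vX + t \<le> B"
 shows "wp B (simulate P) (\<lambda>s'. simulates R s' \<sigma>' \<and> vs s' vbase = vs s vbase \<and>
  vs s' vX = vs s vX + t \<and> ck s' \<le> ck s + 20 * t) s"
 using assms
proof (induction arbitrary: s rule: run.induct)
 case (Seq P \<sigma> t \<sigma>' Q t' \<sigma>'')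
 have 1: "wp B (simulate P) (\<lambda>s'. simulates R s' \<sigma>' \<and> vs s' vbase = vs s vbase \<and>
  vs s' vX = vs s vX + t \<and> ck s' \<le> ck s + 20 * t) s"
  using Seq.prems by (intro Seq.IH(1)) auto
 have 2: "wp B (simulate Q) (\<lambda>s''. simulates R s'' \<sigma>'' \<and> vs s'' vbase = vs s' vbase \<and>
  vs s'' vX = vs s' vX + t' \<and> ck s'' \<le> ck s' + 20 * t') s'"
  if "simulates R s' \<sigma>'" "vs s' vX = vs s vX + t" for s'
  using Seq.prems that by (intro Seq.IH(2)) auto
 show ?case unfolding simulate.simps wp_Seq
  by (rule wp_conseq[OF 1]) (elim conjE, rule wp_conseq[OF 2], auto)
next
 case (IfTrue \<sigma> r P t \<sigma>' Q)
 show ?case unfolding simulate.simps wp_Seq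
  using IfTrue.prems IfTrue.hyps
  by (auto simp: simulates_def intro!: wp_conseq[OF IfTrue.IH])
next
 case (IfFalse \<sigma> r Q t \<sigma>' P)
 show ?case unfolding simulate.simps wp_Seq
  using IfFalse.prems IfFalse.hyps
  by (auto simp: simulates_def intro!: wp_conseq[OF IfFalse.IH])
next
 case (WhileFalse \<sigma> r P)
 then show ?case by (simp add: wp_While_unfold simulates_def)
next
 case (WhileTrue \<sigma> r P t \<sigma>' t' \<sigma>'')
 let ?s = "tick 3 (setv 6 vX (vs s vX + 1) s)"
 have 1: "wp B (simulate P) (\<lambda>s'. simulates R s' \<sigma>' \<and> vs s' vbase = vs ?s vbase \<and>
  vs s' vX = vs ?s vX + t \<and> ck s' \<le> ck ?s + 20 * t) ?s"
  using WhileTrue.prems by (intro WhileTrue.IH(1)) (auto simp: simulates_def)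
 have 2: "wp B (simulate (WhileNZ r P)) (\<lambda>s''. simulates R s'' \<sigma>'' \<and> vs s'' vbase = vs s' vbase \<and>
  vs s'' vX = vs s' vX + t' \<and> ck s'' \<le> ck s' + 20 * t') s'"
  if "simulates R s' \<sigma>'" "vs s' vX = vs ?s vX + t" for s'
  using WhileTrue.prems that by (intro WhileTrue.IH(2)) auto
 have "wp B (simulate P ;; inc) (wp B (CWhile (V (100 + r)) (simulate P ;; inc))
   (\<lambda>s'. simulates R s' \<sigma>'' \<and> vs s' vbase = vs s vbase \<and>
    vs s' vX = vs s vX + Suc (t + t') \<and> ck s' \<le> ck s + 20 * Suc (t + t'))) ?s"
  unfolding wp_Seq
 proof (rule wp_conseq[OF 1])
  fix s' assume s': "simulates R s' \<sigma>' \<and> vs s' vbase = vs ?s vbase \<and>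
   vs s' vX = vs ?s vX + t \<and> ck s' \<le> ck ?s + 20 * t"
  show "wp B inc (wp B (CWhile (V (100 + r)) (simulate P ;; inc))
   (\<lambda>s'. simulates R s' \<sigma>'' \<and> vs s' vbase = vs s vbase \<and>
    vs s' vX = vs s vX + Suc (t + t') \<and> ck s' \<le> ck s + 20 * Suc (t + t'))) s'"
  proof -
   have "wp B (simulate (WhileNZ r P)) (\<lambda>s'. simulates R s' \<sigma>'' \<and> vs s' vbase = vs s vbase \<and>
    vs s' vX = vs s vX + Suc (t + t') \<and> ck s' \<le> ck s + 20 * Suc (t + t')) s'"
    by (rule wp_conseq[OF 2]) (use s' in auto)
   then show ?thesis by simp
  qed
 qed
 then show ?case using WhileTrue.prems WhileTrue.hyps
  by (auto simp: simulates_def wp_While_unfold[of _ _ _ _ "setv 6 10 (vs s 10 + 1) s"])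
qed (auto simp: simulates_def)

text \<open>Addresses are words and hence below the capacity. This confines the garbage of a
  multiplication to a region of known size.\<close>

lemma run_mem_outside: "run W P \<sigma> t \<sigma>' ==> W \<le> x ==> mem \<sigma>' x = mem \<sigma> x"
 by (induction rule: run.induct) auto

text \<open>One time unit changes at most one cell; this yields the lower bound 2 for the exponent
  of matrix multiplication.\<close>

lemma run_mem_changed:
 assumes "run W P \<sigma> t \<sigma>'"
 shows "finite {x. mem \<sigma>' x \<noteq> mem \<sigma> x} \<and> card {x. mem \<sigma>' x \<noteq> mem \<sigma> x} \<le> t"
 using assms
proof (induction rule: run.induct)
 case (Store \<sigma> a r)
 have "{x. mem (\<sigma>\<lparr>mem := (mem \<sigma>)(regs \<sigma> a := regs \<sigma> r)\<rparr>) x \<noteq> mem \<sigma> x} \<subseteq> {regs \<sigma> a}" by auto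
 from finite_subset[OF this] card_mono[OF _ this] show ?case by simp
next
 case (Seq P \<sigma> t \<sigma>' Q t' \<sigma>'')
 have "{x. mem \<sigma>'' x \<noteq> mem \<sigma> x} \<subseteq> {x. mem \<sigma>' x \<noteq> mem \<sigma> x} \<union> {x. mem \<sigma>'' x \<noteq> mem \<sigma>' x}" by auto
 from finite_subset[OF this] card_mono[OF _ this] show ?case
  using Seq.IH card_Un_le[of "{x. mem \<sigma>' x \<noteq> mem \<sigma> x}" "{x. mem \<sigma>'' x \<noteq> mem \<sigma>' x}"] by simp
next
 case (WhileTrue \<sigma> r P t \<sigma>' t' \<sigma>'')
 have "{x. mem \<sigma>'' x \<noteq> mem \<sigma> x} \<subseteq> {x. mem \<sigma>' x \<noteq> mem \<sigma> x} \<union> {x. mem \<sigma>'' x \<noteq> mem \<sigma>' x}" by auto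
 from finite_subset[OF this] card_mono[OF _ this] show ?case
  using WhileTrue.IH card_Un_le[of "{x. mem \<sigma>' x \<noteq> mem \<sigma> x}" "{x. mem \<sigma>'' x \<noteq> mem \<sigma>' x}"] by simp
qed auto

subsection \<open>Multiplication of Boolean matrices in an array\<close>

text \<open>The advance of variable \<open>10\<close> is the measured cost of the multiplication.\<close>

definition mm_spec :: "nat => com => nat => nat => nat => nat => bool" where
 "mm_spec C mm d B Q \<tau> \<longleftrightarrow> mv mm \<subseteq> insert vX {100..} \<and> ma mm \<subseteq> {aPM} \<and>
  (\<forall>s. vs s vN = d --> vs s vX + \<tau> \<le> B --> (\<forall>x. ar s aPM (vs s vbase + x) \<le> 1) -->
   (\<forall>x\<ge>2 * (d * d). ar s aPM (vs s vbase + x) = 0) -->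
   wp B mm (\<lambda>s'. (\<forall>i<d. \<forall>j<d. ar s' aPM (vs s vbase + (2 * (d * d) + i * d + j)) =
     (\<Sum>l<d. ar s aPM (vs s vbase + (i * d + l)) * ar s aPM (vs s vbase + (d * d + l * d + j)))) \<and>
    (\<forall>x\<ge>Q. ar s' aPM (vs s vbase + x) = 0) \<and>
    vs s vX \<le> vs s' vX \<and> vs s' vX \<le> vs s vX + \<tau> \<and>
    ck s' \<le> ck s + C * (vs s' vX - vs s vX) + C) s)"

fun clear_regs :: "nat => com" where
 "clear_regs 0 = CSkip"
| "clear_regs (Suc r) = (clear_regs r ;; 100 + r ::= N 0)"

lemma mv_clear_regs: "mv (clear_regs r) \<subseteq> {100..}" and ma_clear_regs: "ma (clear_regs r) = {}"
 by (induction r) auto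

lemma wp_clear_regs: "wp B (clear_regs R) (\<lambda>s'. (\<forall>r<R. vs s' (100 + r) = 0) \<and> ck s' = ck s + 3 * R + 1) s"
proof (induction R)
 case (Suc R)
 show ?case unfolding clear_regs.simps wp_Seq
  by (rule wp_conseq[OF Suc.IH]) (auto simp: less_Suc_eq)
qed simp

definition matmul_com :: "prog => com" where
 "matmul_com P = (clear_regs (nregs P + 1) ;; 100 ::= V vN ;; simulate P)"

text \<open>The simulated machine has to start exactly in \<open>matmul_input\<close>: all registers
  zero except for the dimension, and zero memory after the two operands. The first is achieved by
  clearing the registers, the second is the reason for the zeros demanded in
  \<open>mm_spec\<close>.\<close>

lemma matmul_com_spec:
 assumes P: "\<And>A B. (\<forall>i<d. \<forall>j<d. A i j \<le> 1 \<and> B i j \<le> 1) ==>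
   \<exists>t \<sigma>. run W P (matmul_input d A B) t \<sigma> \<and> t \<le> \<tau> \<and>
    (\<forall>i<d. \<forall>j<d. mem \<sigma> (2 * d\<^sup>2 + i * d + j) = (\<Sum>l<d. A i l * B l j))"
  and "W \<le> B" "W \<le> Q" "2 * (d * d) \<le> Q" "d \<le> B" "3 * nregs P + 20 \<le> C"
 shows "mm_spec C (matmul_com P) d B Q \<tau>"
 unfolding mm_spec_def
proof (intro conjI allI impI)
 show "mv (matmul_com P) \<subseteq> insert vX {100..}"
  using mv_simulate[of P] mv_clear_regs[of "nregs P + 1"] unfolding matmul_com_def by auto
 show "ma (matmul_com P) \<subseteq> {aPM}"
  using ma_simulate[of P] ma_clear_regs[of "nregs P + 1"] unfolding matmul_com_def by auto
next
 fix s :: st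
 assume N: "vs s vN = d" and X: "vs s vX + \<tau> \<le> B" and le1: "\<forall>x. ar s aPM (vs s vbase + x) \<le> 1"
  and z: "\<forall>x\<ge>2 * (d * d). ar s aPM (vs s vbase + x) = 0"
 define A where "A i j = ar s aPM (vs s vbase + (i * d + j))" for i j
 define A' where "A' i j = ar s aPM (vs s vbase + (d * d + i * d + j))" for i j
 obtain t \<sigma> where run: "run W P (matmul_input d A A') t \<sigma>" and t: "t \<le> \<tau>"
  and res: "\<forall>i<d. \<forall>j<d. mem \<sigma> (2 * d\<^sup>2 + i * d + j) = (\<Sum>l<d. A i l * A' l j)"
  using P[of A A'] le1 by (auto simp: A_def A'_def)
 have minp: "mem (matmul_input d A A') x = ar s aPM (vs s vbase + x)" for x
 proof -
  have "d * d + (x - d * d) div d * d + (x - d * d) mod d = x" if "\<not> x < d * d"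
   using that by (metis add.assoc div_mult_mod_eq le_add_diff_inverse not_less)
  then show ?thesis using z by (auto simp: matmul_input_def A_def A'_def power2_eq_square)
 qed
 let ?s = "\<lambda>s'. setv 4 100 d s'"
 have sim: "simulates (nregs P + 1) (?s s') (matmul_input d A A')"
  if "\<forall>r<nregs P + 1. vs s' (100 + r) = 0" "same {100..} {} s s'" for s'
  using that minp by (auto simp: simulates_def same_def matmul_input_def)
 have 2: "wp B (simulate P) (\<lambda>s''. simulates (nregs P + 1) s'' \<sigma> \<and> vs s'' vbase = vs (?s s') vbase \<and>
   vs s'' vX = vs (?s s') vX + t \<and> ck s'' \<le> ck (?s s') + 20 * t) (?s s')"
  if "\<forall>r<nregs P + 1. vs s' (100 + r) = 0" "same {100..} {} s s'" for s'
  by (rule wp_simulate[OF run _ \<open>W \<le> B\<close>]) (use sim[OF that] X t that in \<open>auto simp: same_vs[OF that(2)]\<close>)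
 have out: "mem \<sigma> x = 0" if "x \<ge> Q" for x
  using run_mem_outside[OF run, of x] minp z that assms(3,4) by simp
 show "wp B (matmul_com P) (\<lambda>s'. (\<forall>i<d. \<forall>j<d. ar s' aPM (vs s vbase + (2 * (d * d) + i * d + j)) =
     (\<Sum>l<d. ar s aPM (vs s vbase + (i * d + l)) * ar s aPM (vs s vbase + (d * d + l * d + j)))) \<and>
    (\<forall>x\<ge>Q. ar s' aPM (vs s vbase + x) = 0) \<and>
    vs s vX \<le> vs s' vX \<and> vs s' vX \<le> vs s vX + \<tau> \<and>
    ck s' \<le> ck s + C * (vs s' vX - vs s vX) + C) s"
  unfolding matmul_com_def wp_Seq
 proof (rule wp_conseq[OF wp_clear_regs])
  fix s' assume s': "(\<forall>r<nregs P + 1. vs s' (100 + r) = 0) \<and> ck s' = ck s + 3 * (nregs P + 1) + 1"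
   and "same (mv (clear_regs (nregs P + 1))) (ma (clear_regs (nregs P + 1))) s s'"
  then have sm: "same {100..} {} s s'"
   using mv_clear_regs[of "nregs P + 1"] ma_clear_regs[of "nregs P + 1"] by (auto intro: same_mono)
  have v: "vs s' vN = d" "vs s' vbase = vs s vbase" "vs s' vX = vs s vX" "ar s' = ar s"
   using sm N by (auto simp: same_def fun_eq_iff)
  have "wp B (simulate P) (\<lambda>s'. (\<forall>i<d. \<forall>j<d. ar s' aPM (vs s vbase + (2 * (d * d) + i * d + j)) =
     (\<Sum>l<d. ar s aPM (vs s vbase + (i * d + l)) * ar s aPM (vs s vbase + (d * d + l * d + j)))) \<and>
    (\<forall>x\<ge>Q. ar s' aPM (vs s vbase + x) = 0) \<and>
    vs s vX \<le> vs s' vX \<and> vs s' vX \<le> vs s vX + \<tau> \<and>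
    ck s' \<le> ck s + C * (vs s' vX - vs s vX) + C) (?s s')"
  proof (rule wp_conseq[OF 2])
   show "\<forall>r<nregs P + 1. vs s' (100 + r) = 0" "same {100..} {} s s'" using s' sm by auto
   fix s'' assume s'': "simulates (nregs P + 1) s'' \<sigma> \<and> vs s'' vbase = vs (?s s') vbase \<and>
    vs s'' vX = vs (?s s') vX + t \<and> ck s'' \<le> ck (?s s') + 20 * t"
   have "20 * t \<le> C * t" using assms(6) by (intro mult_le_mono1) simp
   moreover have d: "ck s'' \<le> ck s + 3 * nregs P + 8 + 20 * t" "vs s'' vX - vs s vX = t" using s' s'' v by auto
   ultimately have "ck s'' \<le> ck s + C * (vs s'' vX - vs s vX) + C" unfolding d(2) using assms(6) by linarith
   moreover have m: "ar s'' aPM (vs s vbase + x) = mem \<sigma> x" for x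
   proof -
    have "vs s'' vbase = vs s vbase" using s'' v by simp
    then show ?thesis using s'' unfolding simulates_def by metis
   qed
   ultimately show "(\<forall>i<d. \<forall>j<d. ar s'' aPM (vs s vbase + (2 * (d * d) + i * d + j)) =
     (\<Sum>l<d. ar s aPM (vs s vbase + (i * d + l)) * ar s aPM (vs s vbase + (d * d + l * d + j)))) \<and>
    (\<forall>x\<ge>Q. ar s'' aPM (vs s vbase + x) = 0) \<and>
    vs s vX \<le> vs s'' vX \<and> vs s'' vX \<le> vs s vX + \<tau> \<and>
    ck s'' \<le> ck s + C * (vs s'' vX - vs s vX) + C"
    using res s'' v t out unfolding m by (simp add: A_def A'_def power2_eq_square)
  qed
  then show "wp B (100 ::= V vN) (wp B (simulate P) (\<lambda>s'. (\<forall>i<d. \<forall>j<d. ar s' aPM (vs s vbase + (2 * (d * d) + i * d + j)) =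
     (\<Sum>l<d. ar s aPM (vs s vbase + (i * d + l)) * ar s aPM (vs s vbase + (d * d + l * d + j)))) \<and>
    (\<forall>x\<ge>Q. ar s' aPM (vs s vbase + x) = 0) \<and>
    vs s vX \<le> vs s' vX \<and> vs s' vX \<le> vs s vX + \<tau> \<and>
    ck s' \<le> ck s + C * (vs s' vX - vs s vX) + C)) s'"
   using v assms(5) by simp
 qed
qed

text \<open>Cubic multiplication covers the exponents above 3, for which the given program is too slow.\<close>

definition naive_com :: com where
 "naive_com =
  (For 104 (V vN *. V vN) (
    100 ::= V 104 /. V vN ;; 101 ::= V 104 -. V 100 *. V vN ;; 103 ::= N 0 ;;
    For 102 (V vN) (103 ::= V 103 +. Rd aPM (V vbase +. (V 100 *. V vN +. V 102)) *.
      Rd aPM (V vbase +. (V vN *. V vN +. V 102 *. V vN +. V 101))) ;;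
    Wr aPM (V vbase +. (N 2 *. (V vN *. V vN) +. V 104)) (V 103)) ;;
   vX ::= V vX +. V vN *. V vN *. V vN)"

lemma cell_less: "i < n ==> j < d ==> i * d + j < n * (d::nat)"
proof -
 assume "i < n" "j < d"
 then have "i * d + j < (i + 1) * d" by (simp add: algebra_simps)
 also have "\<dots> \<le> n * d" using \<open>i < n\<close> by (intro mult_le_mono1) simp
 finally show ?thesis .
qed

lemma cell_eq: "j < d ==> j' < d ==> i * d + j = i' * d + j' \<longleftrightarrow> i = i' \<and> j = (j'::nat)"
proof -
 assume "j < d" "j' < d"
 then have "(i * d + j) div d = i" "(i' * d + j') div d = i'" by simp_all
 then have "i * d + j = i' * d + j' ==> i = i'" by metis
 then show ?thesis by auto
qed

lemma sub_div_mult: "x - x div d * d = x mod (d::nat)"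
 by (simp add: minus_div_mult_eq_mod)

lemma naive_com_spec:
 assumes "3 * (d * d) \<le> Q" "d * d \<le> B" "200 \<le> C"
 shows "mm_spec C naive_com d B Q (d * d * d)"
 unfolding mm_spec_def
proof (intro conjI allI impI)
 show "mv naive_com \<subseteq> insert vX {100..}" "ma naive_com \<subseteq> {aPM}" by (auto simp: naive_com_def)
next
 fix s0 :: st
 assume N: "vs s0 vN = d" and X: "vs s0 vX + d * d * d \<le> B"
  and le1: "\<forall>x. ar s0 aPM (vs s0 vbase + x) \<le> 1"
  and z: "\<forall>x\<ge>2 * (d * d). ar s0 aPM (vs s0 vbase + x) = 0"
 let ?b = "vs s0 vbase"
 define A where "A i l = ar s0 aPM (?b + (i * d + l))" for i l
 define A' where "A' l j = ar s0 aPM (?b + (d * d + l * d + j))" for l j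
 define R where "R f x \<longleftrightarrow>
  (\<forall>y<x. f (?b + (2 * (d * d) + y)) = (\<Sum>l<d. A (y div d) l * A' l (y mod d))) \<and>
  (\<forall>y<2 * (d * d). f (?b + y) = ar s0 aPM (?b + y)) \<and> (\<forall>y\<ge>3 * (d * d). f (?b + y) = 0)" for f x
 have dB: "d \<le> B" using assms(2) le_square[of d] by linarith
 have sumle: "(\<Sum>l<k. A i l * A' l j) \<le> k" for i j k
 proof -
  have "A i l * A' l j \<le> 1" for l
   using le1 mult_le_mono[of "A i l" 1 "A' l j" 1] by (simp add: A_def A'_def)
  then show ?thesis using sum_mono[of "{..<k}" "\<lambda>l. A i l * A' l j" "\<lambda>_. 1"] by simp
 qed
 let ?in = "For 102 (V vN) (103 ::= V 103 +. Rd aPM (V vbase +. (V 100 *. V vN +. V 102)) *.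
      Rd aPM (V vbase +. (V vN *. V vN +. V 102 *. V vN +. V 101)))"
 have inner: "wp B ?in (\<lambda>s'. vs s' 103 = (\<Sum>l<d. A i l * A' l j) \<and> ck s' \<le> ck s + 60 * d + 20) s"
  if "vs s 100 = i" "vs s 101 = j" "vs s 103 = 0" "vs s vN = d" "vs s vbase = ?b" "i < d" "j < d" "R (ar s aPM) x" for s i j x
 proof (rule wp_For[where I = "\<lambda>k s'. vs s' 103 = (\<Sum>l<k. A i l * A' l j) \<and> ck s' \<le> ck s + 60 * k + 3" and b = d], goal_cases)
  case (4 k s')
  from 4(2) have sm: "same {102, 103} {} s s'" by simp
  have lt: "i * d + k < d * d" "k * d + j < d * d" using that 4 by (auto intro: cell_less)
  have a: "ar s aPM (?b + (i * d + k)) = A i k" "ar s aPM (?b + (d * d + k * d + j)) = A' k j"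
   using \<open>R (ar s aPM) x\<close> lt by (auto simp: R_def A_def A'_def)
  have "(\<Sum>l<k + 1. A i l * A' l j) \<le> B" using sumle[of i j "k+1"] 4 dB by linarith
  then show ?case using 4(1,3,4) that a by (simp add: same_vs[OF sm] same_ar[OF sm])
 qed (use that dB in \<open>auto simp: same_vs\<close>)
 let ?I = "\<lambda>k s. R (ar s aPM) k \<and> ck s \<le> ck s0 + (60 * d + 100) * k + 3"
 show "wp B naive_com (\<lambda>s'. (\<forall>i<d. \<forall>j<d. ar s' aPM (?b + (2 * (d * d) + i * d + j)) =
     (\<Sum>l<d. ar s0 aPM (?b + (i * d + l)) * ar s0 aPM (?b + (d * d + l * d + j)))) \<and>
    (\<forall>x\<ge>Q. ar s' aPM (?b + x) = 0) \<and>
    vs s0 vX \<le> vs s' vX \<and> vs s' vX \<le> vs s0 vX + d * d * d \<and>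
    ck s' \<le> ck s0 + C * (vs s' vX - vs s0 vX) + C) s0"
  unfolding naive_com_def wp_Seq
 proof (rule wp_For[where I = ?I and b = "d * d"], goal_cases)
  case 1
  then show ?case using z by (simp add: R_def)
 next
  case (4 k s)
  from 4(2) have sm: "same {100, 101, 102, 103, 104} {28} s0 s" by (simp add: insert_commute)
  have k: "k div d < d" "k mod d < d" using 4(4) by (auto simp: less_mult_imp_div_less intro!: mod_less_divisor gr0I)
  let ?s = "setv 3 103 0 (setv 10 101 (k mod d) (setv 7 100 (k div d) (tick 9 s)))"
  have "wp B ?in (\<lambda>s'. vs s' 103 = (\<Sum>l<d. A (k div d) l * A' l (k mod d)) \<and> ck s' \<le> ck ?s + 60 * d + 20) ?s"
   by (rule inner[where x = k]) (use 4 N k in \<open>auto simp: same_vs[OF sm]\<close>)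
  then have "wp B ?in (wp B (Wr aPM (V vbase +. (N 2 *. (V vN *. V vN) +. V 104)) (V 103))
    (\<lambda>s''. vs s'' 104 = k \<and> ?I (k + 1) (setv 6 104 (k + 1) s''))) ?s"
  proof (rule wp_conseq)
   fix s' assume s': "vs s' 103 = (\<Sum>l<d. A (k div d) l * A' l (k mod d)) \<and> ck s' \<le> ck ?s + 60 * d + 20"
    and "same (mv ?in) (ma ?in) ?s s'"
   then have sm': "same {102, 103} {} ?s s'" by simp
   have "vs s' 103 \<le> B" using s' sumle[of "k div d" "k mod d" d] dB by linarith
   then show "wp B (Wr aPM (V vbase +. (N 2 *. (V vN *. V vN) +. V 104)) (V 103))
    (\<lambda>s''. vs s'' 104 = k \<and> ?I (k + 1) (setv 6 104 (k + 1) s'')) s'"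
    using s' 4(1,3,4) N by (auto simp: same_vs[OF sm'] same_ar[OF sm'] same_vs[OF sm] R_def less_plus1_eq algebra_simps)
  qed
  moreover have "k div d \<le> B" "k mod d \<le> B" using k dB by linarith+
  ultimately show ?case using 4(3,4) N by (simp add: same_vs[OF sm] sub_div_mult)
 next
  case (5 s)
  from 5(2) have sm: "same {100, 101, 102, 103, 104} {28} s0 s" by (simp add: insert_commute)
  have "ck s + 50 \<le> ck s0 + 200 * (d * d * d) + 200"
  proof -
   have "(60 * d + 100) * (d * d) \<le> 160 * (d * d * d) + 100"
    by (cases d) (simp_all add: algebra_simps)
   then show ?thesis using 5(1) by simp
  qed
  also have "\<dots> \<le> ck s0 + C * (d * d * d) + C" using assms(3) by (intro add_le_mono mult_le_mono1) auto
  finally have ck: "ck s + 50 \<le> ck s0 + C * (d * d * d) + C" .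
  have "ar s aPM (?b + (2 * (d * d) + i * d + j)) = (\<Sum>l<d. A i l * A' l j)" if "i < d" "j < d" for i j
   using 5(1) cell_less[OF that] that by (auto simp: R_def add.assoc[symmetric] dest: spec[of _ "i * d + j"])
  moreover have "ar s aPM (?b + x) = 0" if "x \<ge> Q" for x using 5(1) that assms(1) by (simp add: R_def)
  ultimately show ?case using ck N X by (simp add: same_vs[OF sm] A_def A'_def)
 qed (use N assms in \<open>auto simp: same_vs\<close>)
qed

subsection \<open>Counting sort\<close>

text \<open>\<open>aAV\<close> and \<open>aBV\<close> hold row-major copies of the operands and
  \<open>aCV\<close> the one-sided maximum. \<open>aCNT\<close> holds the counters of the sort, and
  \<open>aOI\<close>, \<open>aOK\<close>, \<open>aOA\<close> the row, column and value of each
  sorted position.\<close>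

abbreviation (input) "aAV \<equiv> 7 :: nat"
abbreviation (input) "aBV \<equiv> 8 :: nat"
abbreviation (input) "aCV \<equiv> 9 :: nat"
abbreviation (input) "aCNT \<equiv> 10 :: nat"
abbreviation (input) "aOI \<equiv> 11 :: nat"
abbreviation (input) "aOK \<equiv> 12 :: nat"
abbreviation (input) "aOA \<equiv> 13 :: nat"

definition memset :: "nat => exp => com" where
 "memset a e = For 27 e (Wr a (V 27) (N 0))"

lemma mv_memset [simp]: "mv (memset a e) = {27}" and ma_memset [simp]: "ma (memset a e) = {a}"
 by (auto simp: memset_def)

lemma wp_memset:
 assumes "b \<le> B" "\<And>s'. same {27} {a} s s' ==> aval e s' = b"
 shows "wp B (memset a e) (\<lambda>s'. (\<forall>i<b. ar s' a i = 0) \<and> ck s' \<le> ck s + (ecost e + 20) * (b + 1)) s"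
 unfolding memset_def
proof (rule wp_For[where I = "\<lambda>k s'. (\<forall>i<k. ar s' a i = 0) \<and> ck s' \<le> ck s + (ecost e + 20) * k + 3" and b = b], goal_cases)
 case (4 k s')
 then show ?case by (auto simp: less_plus1_eq algebra_simps)
qed (use assms in \<open>auto simp: algebra_simps\<close>)

text \<open>The target position in a stable sort; breaking ties by the index makes it a
  permutation.\<close>

definition srank :: "(nat => nat) => nat => nat => nat" where
 "srank key M e = card {y. y < M \<and> (key y < key e \<or> key y = key e \<and> y < e)}"

lemma srank_less: "e < M ==> srank key M e < M"
proof -
 assume "e < M"
 then have "{y. y < M \<and> (key y < key e \<or> key y = key e \<and> y < e)} \<subset> {..<M}" by auto
 from psubset_card_mono[OF _ this] show ?thesis by (simp add: srank_def)
qed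

lemma srank_mono:
 assumes "e < M" "key e < key e' \<or> key e = key e' \<and> e < e'"
 shows "srank key M e < srank key M e'"
 unfolding srank_def by (rule psubset_card_mono) (use assms in auto)

lemma srank_inj: "inj_on (srank key M) {..<M}"
proof (rule inj_onI)
 fix e e' assume *: "e \<in> {..<M}" "e' \<in> {..<M}" "srank key M e = srank key M e'"
 show "e = e'"
 proof (rule ccontr)
  assume "e \<noteq> e'"
  then consider "key e < key e' \<or> key e = key e' \<and> e < e'" | "key e' < key e \<or> key e' = key e \<and> e' < e"
   by linarith
  then show False using srank_mono[of e M key e'] srank_mono[of e' M key e] * by cases auto
 qed
qed

lemma srank_image: "srank key M ` {..<M} = {..<M}"
 by (rule endo_inj_surj[OF _ _ srank_inj]) (auto intro: srank_less)

text \<open>The two summands are what counting sort finds in its counter when \<open>e\<close> is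
  placed: the start of the bucket and the number of equal keys placed before.\<close>

lemma srank_eq:
 "e < M ==> srank key M e = card {y. y < M \<and> key y < key e} + card {y. y < e \<and> key y = key e}"
proof -
 assume "e < M"
 then have "{y. y < M \<and> (key y < key e \<or> key y = key e \<and> y < e)} =
   {y. y < M \<and> key y < key e} \<union> {y. y < e \<and> key y = key e}" by auto
 moreover have "card ({y. y < M \<and> key y < key e} \<union> {y. y < e \<and> key y = key e}) =
   card {y. y < M \<and> key y < key e} + card {y. y < e \<and> key y = key e}"
  by (rule card_Un_disjoint) auto
 ultimately show ?thesis unfolding srank_def by presburger
qed

lemma all_less_plus1: "(\<forall>e<k + 1. P e) \<longleftrightarrow> (\<forall>e<k. P e) \<and> P (k::nat)"
 by (auto simp: less_plus1_eq)

lemma card_less_plus1: "card {y. y < k + 1 \<and> P y} = card {y. y < k \<and> P y} + (if P k then 1 else 0)" for k :: nat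
proof (cases "P k")
 case True
 then have "{y. y < k + 1 \<and> P y} = insert k {y. y < k \<and> P y}" by (auto simp: less_plus1_eq)
 then show ?thesis using True by simp
next
 case False
 then have "{y. y < k + 1 \<and> P y} = {y. y < k \<and> P y}" by (auto simp: less_plus1_eq)
 then show ?thesis using False by simp
qed

lemma card_less_bound: "card {y. y < k \<and> P y} \<le> (k::nat)"
 using card_mono[of "{..<k}" "{y. y < k \<and> P y}"] by auto

lemma card_key_step:
 "card {y. y < M \<and> key y < u + 1} = card {y. y < M \<and> key y < u} + card {y. y < M \<and> key y = (u::nat)}" for M :: nat
proof -
 have "{y. y < M \<and> key y < u + 1} = {y. y < M \<and> key y < u} \<union> {y. y < M \<and> key y = u}"
  by (auto simp: less_plus1_eq)
 moreover have "card ({y. y < M \<and> key y < u} \<union> {y. y < M \<and> key y = u}) =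
   card {y. y < M \<and> key y < u} + card {y. y < M \<and> key y = u}"
  by (rule card_Un_disjoint) auto
 ultimately show ?thesis by presburger
qed

text \<open>The multiplicity of key \<open>v\<close> is stored at \<open>v + 1\<close>, so that the
  prefix sum at \<open>v\<close> leaves out \<open>v\<close> itself and is the start of its
  bucket.\<close>

definition count_com :: com where
 "count_com = For 25 (V vnn) (24 ::= V vm +. N 1 -. Rd aAV (V 25) +. N 1 ;;
   Wr aCNT (V 24) (Rd aCNT (V 24) +. N 1))"

definition prefix_com :: com where
 "prefix_com = For 23 (V vm +. N 2) (Wr aCNT (V 23 +. N 1) (Rd aCNT (V 23) +. Rd aCNT (V 23 +. N 1)))"

definition place_com :: com where
 "place_com = For 25 (V vnn) (
   24 ::= V vm +. N 1 -. Rd aAV (V 25) ;; 16 ::= Rd aCNT (V 24) ;; 17 ::= V 25 /. V vn ;;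
   Wr aOI (V 16) (V 17) ;; Wr aOK (V 16) (V 25 -. V 17 *. V vn) ;;
   Wr aOA (V 16) (Rd aAV (V 25)) ;; Wr aCNT (V 24) (V 16 +. N 1))"

definition sort_com :: com where
 "sort_com = (memset aCNT (V vm +. N 3) ;; count_com ;; prefix_com ;; place_com)"

text \<open>Ascending keys are descending values; \<open>m + 1\<close> is the largest value in a
  bottleneck matrix.\<close>

definition keyf :: "nat => (nat => nat) => nat => nat" where
 "keyf m f e = m + 1 - f e"

lemma wp_count:
 assumes "vs s vnn = M" "vs s vm = m" "\<forall>v\<le>m + 2. ar s aCNT v = 0" "M + m + 3 \<le> B"
 shows "wp B count_com (\<lambda>s'. ar s' aCNT 0 = 0 \<and>
  (\<forall>v\<le>m + 1. ar s' aCNT (v + 1) = card {e. e < M \<and> keyf m (ar s aAV) e = v}) \<and> ck s' \<le> ck s + 60 * (M + 1)) s"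
 unfolding count_com_def
proof (rule wp_For[where I = "\<lambda>k s'. ar s' aCNT 0 = 0 \<and>
  (\<forall>v\<le>m + 1. ar s' aCNT (v + 1) = card {e. e < k \<and> keyf m (ar s aAV) e = v}) \<and> ck s' \<le> ck s + 60 * k + 3" and b = M], goal_cases)
 case (4 k s')
 from 4(2) have sm: "same {24, 25} {10} s s'" by (simp add: insert_commute)
 have key: "m + 1 - ar s aAV k = keyf m (ar s aAV) k" "keyf m (ar s aAV) k \<le> m + 1" by (simp_all add: keyf_def)
 have "card {e. e < k \<and> keyf m (ar s aAV) e = keyf m (ar s aAV) k} \<le> k" by (rule card_less_bound)
 then show ?case using 4(1,3,4) assms key
  by (simp add: same_vs[OF sm] same_ar[OF sm] card_less_plus1)
next
 case (5 s')
 then show ?case by (simp add: algebra_simps)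
qed (use assms in \<open>auto simp: same_vs\<close>)

lemma wp_prefix:
 assumes "vs s vm = m" "ar s aCNT 0 = 0"
  "\<forall>v\<le>m + 1. ar s aCNT (v + 1) = card {e. e < M \<and> key e = v}" "M + m + 3 \<le> B"
 shows "wp B prefix_com (\<lambda>s'. (\<forall>v\<le>m + 2. ar s' aCNT v = card {e. e < M \<and> key e < v}) \<and>
  ck s' \<le> ck s + 60 * (m + 3)) s"
 unfolding prefix_com_def
proof (rule wp_For[where I = "\<lambda>k s'. (\<forall>v\<le>k. ar s' aCNT v = card {e. e < M \<and> key e < v}) \<and>
  (\<forall>v\<le>m + 1. k \<le> v --> ar s' aCNT (v + 1) = card {e. e < M \<and> key e = v}) \<and> ck s' \<le> ck s + 60 * k + 3" and b = "m + 2"], goal_cases)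
 case (4 k s')
 from 4(2) have sm: "same {23} {10} s s'" by (simp add: insert_commute)
 have 1: "ar s' aCNT k + ar s' aCNT (k + 1) = card {e. e < M \<and> key e < k + 1}"
  using 4(1,4) by (simp add: card_key_step)
 moreover have "card {e. e < M \<and> key e < k + 1} \<le> M" by (rule card_less_bound)
 ultimately show ?case using 4(1,3,4) assms by (auto simp: le_Suc_eq)
next
 case (5 s')
 then show ?case by (simp add: algebra_simps)
qed (use assms in \<open>auto simp: same_vs\<close>)

definition placed :: "nat => (nat => nat) => nat => (nat => nat => nat) => (nat => nat) => nat => bool" where
 "placed n key M a f e \<longleftrightarrow> a aOI (srank key M e) = e div n \<and> a aOK (srank key M e) = e mod n \<and>
  a aOA (srank key M e) = f e"

lemma wp_place:
 assumes "vs s vnn = M" "vs s vm = m" "vs s vn = n" "key = keyf m (ar s aAV)"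
  "\<forall>v\<le>m + 2. ar s aCNT v = card {e. e < M \<and> key e < v}" "M + m + 3 \<le> B" "\<forall>e<M. ar s aAV e \<le> B"
 shows "wp B place_com (\<lambda>s'. (\<forall>e<M. placed n key M (ar s') (ar s aAV) e) \<and> ck s' \<le> ck s + 150 * (M + 1)) s"
 unfolding place_com_def
proof (rule wp_For[where I = "\<lambda>k s'. (\<forall>e<k. placed n key M (ar s') (ar s aAV) e) \<and>
  (\<forall>v\<le>m + 1. ar s' aCNT v = card {e. e < M \<and> key e < v} + card {e. e < k \<and> key e = v}) \<and>
  ck s' \<le> ck s + 150 * k + 3" and b = M], goal_cases)
 case (4 k s')
 from 4(2) have sm: "same {16, 17, 24, 25} {10, 11, 12, 13} s s'" by (simp add: insert_commute)
 have key: "m + 1 - ar s aAV k = key k" "key k \<le> m + 1" using assms(4) by (simp_all add: keyf_def)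
 have r: "ar s' aCNT (key k) = srank key M k" using 4(1,4) key by (simp add: srank_eq)
 have rl: "srank key M k < M" using 4(4) by (rule srank_less)
 have ne: "srank key M e \<noteq> srank key M k" if "e < k" for e
  using srank_inj[of key M] that 4(4) by (auto simp: inj_on_def)
 have "k div n \<le> B" "k mod n \<le> B"
  using div_le_dividend[of k n] mod_less_eq_dividend[of k n] 4(4) assms(6) by linarith+
 then show ?case using 4(1,3,4) assms key r rl ne
  by (auto simp: same_vs[OF sm] same_ar[OF sm] card_less_plus1 placed_def all_less_plus1 sub_div_mult)
next
 case (5 s')
 then show ?case by (simp add: algebra_simps)
qed (use assms in \<open>auto simp: same_vs\<close>)

lemma wp_sort:
 assumes "vs s vnn = M" "vs s vm = m" "vs s vn = n" "M + m + 3 \<le> B" "\<forall>e<M. ar s aAV e \<le> B"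
 shows "wp B sort_com (\<lambda>s'. (\<forall>e<M. placed n (keyf m (ar s aAV)) M (ar s') (ar s aAV) e) \<and>
  ck s' \<le> ck s + 400 * (M + m + 4)) s"
proof -
 let ?key = "keyf m (ar s aAV)"
 have 1: "wp B (memset aCNT (V vm +. N 3)) (\<lambda>s'. (\<forall>i<m + 3. ar s' aCNT i = 0) \<and> ck s' \<le> ck s + 24 * (m + 4)) s"
  by (rule wp_conseq[OF wp_memset[where b = "m + 3"]]) (use assms in \<open>auto simp: same_vs algebra_simps\<close>)
 show ?thesis unfolding sort_com_def wp_Seq
 proof (rule wp_conseq[OF 1])
  fix s1 assume s1: "(\<forall>i<m + 3. ar s1 aCNT i = 0) \<and> ck s1 \<le> ck s + 24 * (m + 4)"
   and "same (mv (memset aCNT (V vm +. N 3))) (ma (memset aCNT (V vm +. N 3))) s s1"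
  then have sm1: "same {27} {10} s s1" by simp
  have 2: "wp B count_com (\<lambda>s'. ar s' aCNT 0 = 0 \<and>
   (\<forall>v\<le>m + 1. ar s' aCNT (v + 1) = card {e. e < M \<and> ?key e = v}) \<and> ck s' \<le> ck s1 + 60 * (M + 1)) s1"
   using wp_count[of s1 M m B] s1 assms by (simp add: same_vs[OF sm1] same_ar[OF sm1])
  show "wp B count_com (wp B prefix_com (wp B place_com (\<lambda>s'. (\<forall>e<M. placed n ?key M (ar s') (ar s aAV) e) \<and>
   ck s' \<le> ck s + 400 * (M + m + 4)))) s1"
  proof (rule wp_conseq[OF 2])
   fix s2 assume s2: "ar s2 aCNT 0 = 0 \<and>
    (\<forall>v\<le>m + 1. ar s2 aCNT (v + 1) = card {e. e < M \<and> ?key e = v}) \<and> ck s2 \<le> ck s1 + 60 * (M + 1)"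
    and "same (mv count_com) (ma count_com) s1 s2"
   then have sm2: "same {24, 25} {10} s1 s2" by (simp add: count_com_def insert_commute)
   have 3: "wp B prefix_com (\<lambda>s'. (\<forall>v\<le>m + 2. ar s' aCNT v = card {e. e < M \<and> ?key e < v}) \<and>
     ck s' \<le> ck s2 + 60 * (m + 3)) s2"
    by (rule wp_prefix) (use s2 assms in \<open>auto simp: same_vs[OF sm1] same_vs[OF sm2]\<close>)
   show "wp B prefix_com (wp B place_com (\<lambda>s'. (\<forall>e<M. placed n ?key M (ar s') (ar s aAV) e) \<and>
    ck s' \<le> ck s + 400 * (M + m + 4))) s2"
   proof (rule wp_conseq[OF 3])
    fix s3 assume s3: "(\<forall>v\<le>m + 2. ar s3 aCNT v = card {e. e < M \<and> ?key e < v}) \<and> ck s3 \<le> ck s2 + 60 * (m + 3)"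
     and "same (mv prefix_com) (ma prefix_com) s2 s3"
    then have sm3: "same {23} {10} s2 s3" by (simp add: prefix_com_def)
    have av: "ar s3 aAV = ar s aAV" by (simp add: same_ar[OF sm1] same_ar[OF sm2] same_ar[OF sm3])
    have 4: "wp B place_com (\<lambda>s'. (\<forall>e<M. placed n ?key M (ar s') (ar s3 aAV) e) \<and> ck s' \<le> ck s3 + 150 * (M + 1)) s3"
     by (rule wp_place) (use s3 av assms in \<open>auto simp: same_vs[OF sm1] same_vs[OF sm2] same_vs[OF sm3]\<close>)
    show "wp B place_com (\<lambda>s'. (\<forall>e<M. placed n ?key M (ar s') (ar s aAV) e) \<and>
     ck s' \<le> ck s + 400 * (M + m + 4)) s3"
     by (rule wp_conseq[OF 4]) (use s1 s2 s3 av in auto)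
   qed
  qed
 qed
qed

text \<open>
 \<open>sorted_entries n A I K a\<close>: the positions \<open>q < n * n\<close> enumerate the entries \<open>(I q, K q)\<close> of the
 matrix stored row by row in \<open>A\<close>, in descending order of their values \<open>a q\<close>.
\<close>

definition sorted_entries :: "nat => (nat => nat) => (nat => nat) => (nat => nat) => (nat => nat) => bool" where
 "sorted_entries n A I K a \<longleftrightarrow>
  (\<forall>q<n * n. I q < n \<and> K q < n \<and> a q = A (I q * n + K q)) \<and>
  (\<forall>i<n. \<forall>k<n. \<exists>q<n * n. I q = i \<and> K q = k) \<and>
  (\<forall>q q'. q \<le> q' --> q' < n * n --> a q' \<le> a q) \<and>
  (\<forall>q<n * n. \<forall>q'<n * n. I q = I q' --> K q = K q' --> q = q')"

text \<open>The bound \<open>m + 1\<close> on the values prevents truncation in \<open>keyf\<close>,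
  which therefore reverses the order exactly. Existence and uniqueness of positions come from
  \<open>srank\<close> being a permutation.\<close>

lemma sorted_entries_placed:
 assumes "\<forall>e<n * n. placed n (keyf m A) (n * n) f A e" "\<forall>e<n * n. A e \<le> m + 1"
 shows "sorted_entries n A (f aOI) (f aOK) (f aOA)"
proof -
 let ?r = "srank (keyf m A) (n * n)"
 have ex: "\<exists>e<n * n. ?r e = q" if "q < n * n" for q
  using srank_image[of "keyf m A" "n * n"] that by (metis imageE lessThan_iff)
 have p: "f aOI (?r e) = e div n" "f aOK (?r e) = e mod n" "f aOA (?r e) = A e" if "e < n * n" for e
  using assms(1) that by (auto simp: placed_def)
 have npos: "n > 0" if "e < n * n" for e using that by (cases n) auto
 have 1: "f aOI q < n \<and> f aOK q < n \<and> f aOA q = A (f aOI q * n + f aOK q)" if "q < n * n" for q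
  using ex[OF that] p npos by (auto simp: less_mult_imp_div_less)
 have 2: "\<exists>q<n * n. f aOI q = i \<and> f aOK q = k" if "i < n" "k < n" for i k
  using p[of "i * n + k"] cell_less[OF that] that srank_less[of "i * n + k" "n * n" "keyf m A"] by auto
 have 3: "f aOA q' \<le> f aOA q" if qq: "q \<le> q'" "q' < n * n" for q q'
 proof -
  obtain e e' where e: "e < n * n" "?r e = q" "e' < n * n" "?r e' = q'"
   using ex[of q] ex[of q'] le_less_trans[OF qq] qq by blast
  have "\<not> keyf m A e' < keyf m A e" using srank_mono[of e' "n * n" "keyf m A" e] e that by auto
  then show ?thesis using p e assms(2) by (auto simp: keyf_def)
 qed
 have 4: "q = q'" if qq: "q < n * n" "q' < n * n" "f aOI q = f aOI q'" "f aOK q = f aOK q'" for q q'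
 proof -
  obtain e e' where e: "e < n * n" "?r e = q" "e' < n * n" "?r e' = q'"
   using ex[of q] ex[of q'] qq by blast
  then have "e div n = e' div n" "e mod n = e' mod n" using p that by metis+
  then have "e = e'" by (metis div_mult_mod_eq)
  then show ?thesis using e by simp
 qed
 show ?thesis unfolding sorted_entries_def using 1 2 3 4 by blast
qed

subsection \<open>Grouping consecutive entries into chunks\<close>

text \<open>The view of an array from the base \<open>b\<close> on. Moving the base between parts
  takes the place of clearing the arrays.\<close>

definition sh :: "nat => (nat => nat) => nat => nat" where
 "sh b f x = f (b + x)"

lemma sh_upd [simp]: "sh b (f(b + i := v)) = (sh b f)(i := v)"
 by (auto simp: sh_def fun_eq_iff)

text \<open>
 The positions \<open>p0 \<le> q < p\<close> are distributed over \<open>cnt\<close> chunks of at most \<open>S\<close> positions each;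
 the positions of a chunk belong to the same group \<open>g q\<close>, and every group fills its chunks one
 after the other. \<open>rem\<close> is the free space in the current chunk \<open>cur\<close> of a group.
\<close>

definition chunks :: "nat => nat => (nat => nat) => nat => nat => nat => (nat => nat) => (nat => nat) =>
  (nat => nat) => (nat => nat) => (nat => nat) => (nat => nat) => bool" where
 "chunks S n g p0 p cnt rem cur ind len lst ch \<longleftrightarrow>
  (\<forall>q. p0 \<le> q --> q < p --> ch q < cnt \<and> ind (ch q) = g q \<and> (\<exists>c<len (ch q). lst (ch q * S + c) = q)) \<and>
  (\<forall>q q'. p0 \<le> q --> q < q' --> q' < p --> g q = g q' --> ch q \<le> ch q') \<and>
  (\<forall>r<cnt. len r \<le> S \<and> ind r < n \<and>
   (\<forall>c<len r. p0 \<le> lst (r * S + c) \<and> lst (r * S + c) < p \<and> ch (lst (r * S + c)) = r)) \<and>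
  (\<forall>i<n. rem i \<le> S \<and> (rem i \<noteq> 0 --> cur i < cnt \<and> ind (cur i) = i \<and> len (cur i) + rem i = S \<and>
   (\<forall>q. p0 \<le> q --> q < p --> g q = i --> ch q \<le> cur i))) \<and>
  cnt * S = (p - p0) + (\<Sum>i<n. rem i) \<and>
  (\<forall>r\<ge>cnt. len r = 0) \<and> (\<forall>i\<ge>n. rem i = 0)"

lemma sum_fun_upd:
 fixes f :: "nat => nat"
 assumes "i < n"
 shows "(\<Sum>j<n. (f(i := v)) j) + f i = (\<Sum>j<n. f j) + v"
proof -
 have "(\<Sum>j<n. (f(i := v)) j) = v + (\<Sum>j\<in>{..<n} - {i}. f j)"
  using assms by (subst sum.remove[of _ i]) (auto intro!: sum.cong)
 moreover have "(\<Sum>j<n. f j) = f i + (\<Sum>j\<in>{..<n} - {i}. f j)"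
  using assms by (subst sum.remove[of _ i]) auto
 ultimately show ?thesis by simp
qed

text \<open>A chunk is opened only for a group without free space; it adds \<open>S\<close> cells,
  all of them free, to both sides of the counting equation. Its number exceeds all earlier ones,
  which keeps chunk numbers monotone along a group.\<close>

lemma chunks_alloc:
 assumes c: "chunks S n g p0 p cnt rem cur ind len lst ch" and i: "i < n" "rem i = 0"
 shows "chunks S n g p0 p (cnt + 1) (rem(i := S)) (cur(i := cnt)) (ind(cnt := i)) len lst ch"
proof -
 have sum: "(\<Sum>j<n. (rem(i := S)) j) = (\<Sum>j<n. rem j) + S"
  using sum_fun_upd[OF i(1), of rem S] i(2) by simp
 have 1: "\<forall>q. p0 \<le> q --> q < p --> ch q < cnt \<and> ind (ch q) = g q \<and> (\<exists>c<len (ch q). lst (ch q * S + c) = q)"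
  using c unfolding chunks_def by blast
 have 2: "\<forall>r<cnt. len r \<le> S \<and> ind r < n \<and>
   (\<forall>c<len r. p0 \<le> lst (r * S + c) \<and> lst (r * S + c) < p \<and> ch (lst (r * S + c)) = r)"
  using c unfolding chunks_def by blast
 have 3: "\<forall>i<n. rem i \<le> S \<and> (rem i \<noteq> 0 --> cur i < cnt \<and> ind (cur i) = i \<and> len (cur i) + rem i = S \<and>
   (\<forall>q. p0 \<le> q --> q < p --> g q = i --> ch q \<le> cur i))"
  using c unfolding chunks_def by blast
 have 4: "cnt * S = (p - p0) + (\<Sum>i<n. rem i)" "len cnt = 0" "\<forall>r\<ge>cnt. len r = 0" "\<forall>i\<ge>n. rem i = 0"
  using c unfolding chunks_def by auto
 have A: "\<forall>q. p0 \<le> q --> q < p --> ch q < cnt + 1 \<and> (ind(cnt := i)) (ch q) = g q \<and> (\<exists>c<len (ch q). lst (ch q * S + c) = q)"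
  using 1 by auto
 have Cc: "\<forall>r<cnt + 1. len r \<le> S \<and> (ind(cnt := i)) r < n \<and>
   (\<forall>c<len r. p0 \<le> lst (r * S + c) \<and> lst (r * S + c) < p \<and> ch (lst (r * S + c)) = r)"
  using 2 4 i by (auto simp: less_plus1_eq)
 have D: "\<forall>j<n. (rem(i := S)) j \<le> S \<and> ((rem(i := S)) j \<noteq> 0 --> (cur(i := cnt)) j < cnt + 1 \<and>
   (ind(cnt := i)) ((cur(i := cnt)) j) = j \<and> len ((cur(i := cnt)) j) + (rem(i := S)) j = S \<and>
   (\<forall>q. p0 \<le> q --> q < p --> g q = j --> ch q \<le> (cur(i := cnt)) j))"
 proof (intro allI impI)
  fix j assume j: "j < n"
  show "(rem(i := S)) j \<le> S \<and> ((rem(i := S)) j \<noteq> 0 --> (cur(i := cnt)) j < cnt + 1 \<and>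
   (ind(cnt := i)) ((cur(i := cnt)) j) = j \<and> len ((cur(i := cnt)) j) + (rem(i := S)) j = S \<and>
   (\<forall>q. p0 \<le> q --> q < p --> g q = j --> ch q \<le> (cur(i := cnt)) j))"
  proof (cases "j = i")
   case True
   then show ?thesis using 1 4 by (auto simp: less_imp_le)
  next
   case False
   then show ?thesis using 3[rule_format, OF j] by auto
  qed
 qed
 have E: "(cnt + 1) * S = (p - p0) + (\<Sum>j<n. (rem(i := S)) j)" unfolding sum using 4 by (simp add: algebra_simps)
 have F: "\<forall>q q'. p0 \<le> q --> q < q' --> q' < p --> g q = g q' --> ch q \<le> ch q'"
  using c unfolding chunks_def by blast
 have G: "(\<forall>r\<ge>cnt + 1. len r = 0)" "(\<forall>j\<ge>n. (rem(i := S)) j = 0)" using 4 i by auto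
 show ?thesis unfolding chunks_def using A Cc D E F G by blast
qed

text \<open>One free cell turns into a used one, which preserves the counting equation. Monotonicity
  survives because all earlier positions of the group lie in chunks numbered at most
  \<open>cur i\<close>.\<close>

lemma chunks_push:
 assumes c: "chunks S n g p0 p cnt rem cur ind len lst ch" and i: "g p = i" "i < n" "rem i \<noteq> 0" and "p0 \<le> p"
 shows "chunks S n g p0 (p + 1) cnt (rem(i := rem i - 1)) cur ind (len(cur i := len (cur i) + 1))
  (lst(cur i * S + len (cur i) := p)) (ch(p := cur i))"
proof -
 let ?r = "cur i"
 let ?len = "len(?r := len ?r + 1)" and ?lst = "lst(?r * S + len ?r := p)" and ?ch = "ch(p := ?r)"
 have sum: "(\<Sum>j<n. (rem(i := rem i - 1)) j) + 1 = (\<Sum>j<n. rem j)"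
  using sum_fun_upd[OF i(2), of rem "rem i - 1"] i(3) by simp
 have 1: "ch q < cnt" "ind (ch q) = g q" "\<exists>c<len (ch q). lst (ch q * S + c) = q" if "p0 \<le> q" "q < p" for q
  using c that unfolding chunks_def by blast+
 have 2: "len r \<le> S" "ind r < n" "c < len r ==> p0 \<le> lst (r * S + c)" "c < len r ==> lst (r * S + c) < p"
   "c < len r ==> ch (lst (r * S + c)) = r" if "r < cnt" for r c
  using c that unfolding chunks_def by blast+
 have 3: "rem j \<le> S" "rem j \<noteq> 0 ==> cur j < cnt" "rem j \<noteq> 0 ==> ind (cur j) = j"
   "rem j \<noteq> 0 ==> len (cur j) + rem j = S"
   "rem j \<noteq> 0 ==> p0 \<le> q ==> q < p ==> g q = j ==> ch q \<le> cur j" if "j < n" for j q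
  using c that unfolding chunks_def by blast+
 have 4: "cnt * S = (p - p0) + (\<Sum>i<n. rem i)" "\<forall>r\<ge>cnt. len r = 0" "\<forall>i\<ge>n. rem i = 0"
  using c unfolding chunks_def by auto
 have r: "?r < cnt" "ind ?r = i" "len ?r < S" using 3[OF i(2)] i(3) by auto
 have keep: "?lst (r * S + c) = lst (r * S + c)" if "r < cnt" "c < len r" for r c
 proof -
  have "c < S" using 2(1)[OF that(1)] that(2) by linarith
  then have "r * S + c \<noteq> ?r * S + len ?r" using cell_eq[of c S "len ?r" r ?r] r(3) that(2) by auto
  then show ?thesis by simp
 qed
 have A: "?ch q < cnt \<and> ind (?ch q) = g q \<and> (\<exists>c<?len (?ch q). ?lst (?ch q * S + c) = q)" if q: "p0 \<le> q" "q < p + 1" for q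
 proof (cases "q = p")
  case True
  have "len ?r < ?len ?r \<and> ?lst (?r * S + len ?r) = q" using True by simp
  then show ?thesis using True r i by (metis fun_upd_same)
 next
  case False
  with q have q': "p0 \<le> q" "q < p" by auto
  obtain c where c: "c < len (ch q)" "lst (ch q * S + c) = q" using 1(3)[OF q'] by blast
  have "c < ?len (ch q)" using c by auto
  moreover have "?lst (ch q * S + c) = q" using keep[OF 1(1)[OF q'] c(1)] c(2) by simp
  ultimately have "\<exists>c<?len (ch q). ?lst (ch q * S + c) = q" by blast
  then show ?thesis using False 1[OF q'] by simp
 qed
 have F: "?ch q \<le> ?ch q'" if "p0 \<le> q" "q < q'" "q' < p + 1" "g q = g q'" for q q'
 proof (cases "q' = p")
  case True
  then show ?thesis using 3(5)[OF i(2,3), of q] that i by auto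
 next
  case False
  then have "ch q \<le> ch q'" using c that unfolding chunks_def by auto
  then show ?thesis using that False by auto
 qed
 have Cc: "?len r \<le> S \<and> ind r < n \<and>
   (\<forall>c<?len r. p0 \<le> ?lst (r * S + c) \<and> ?lst (r * S + c) < p + 1 \<and> ?ch (?lst (r * S + c)) = r)" if rc: "r < cnt" for r
 proof (intro conjI allI impI)
  show "?len r \<le> S" using 2(1)[OF rc] r(3) by auto
  show "ind r < n" using 2(2)[OF rc] .
  fix x assume x: "x < ?len r"
  show "p0 \<le> ?lst (r * S + x)" "?lst (r * S + x) < p + 1" "?ch (?lst (r * S + x)) = r"
  proof (atomize (full), cases "r = ?r \<and> x = len ?r")
   case True
   then show "p0 \<le> ?lst (r * S + x) \<and> ?lst (r * S + x) < p + 1 \<and> ?ch (?lst (r * S + x)) = r"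
    using \<open>p0 \<le> p\<close> by auto
  next
   case False
   then have x': "x < len r" using x by (auto split: if_splits)
   have l: "?lst (r * S + x) = lst (r * S + x)" by (rule keep[OF rc x'])
   show "p0 \<le> ?lst (r * S + x) \<and> ?lst (r * S + x) < p + 1 \<and> ?ch (?lst (r * S + x)) = r"
    unfolding l using 2(3,4,5)[OF rc x'] by auto
  qed
 qed
 have D: "(rem(i := rem i - 1)) j \<le> S \<and> ((rem(i := rem i - 1)) j \<noteq> 0 --> cur j < cnt \<and>
   ind (cur j) = j \<and> ?len (cur j) + (rem(i := rem i - 1)) j = S \<and>
   (\<forall>q. p0 \<le> q --> q < p + 1 --> g q = j --> ?ch q \<le> cur j))" if j: "j < n" for j
 proof (cases "j = i")
  case True
  then show ?thesis using 3(1,4,5)[OF i(2)] i r by (auto simp: less_plus1_eq)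
 next
  case False
  show ?thesis
  proof (intro conjI impI allI)
   show "(rem(i := rem i - 1)) j \<le> S" using 3(1)[OF j] False by simp
  next
   assume "(rem(i := rem i - 1)) j \<noteq> 0"
   then have nz: "rem j \<noteq> 0" using False by simp
   show "cur j < cnt" "ind (cur j) = j" using 3(2,3)[OF j nz] by auto
   then have "cur j \<noteq> ?r" using r(2) False by auto
   then show "?len (cur j) + (rem(i := rem i - 1)) j = S" using 3(4)[OF j nz] False by simp
   fix q assume q: "p0 \<le> q" "q < p + 1" "g q = j"
   then have "q \<noteq> p" using i False by auto
   then show "?ch q \<le> cur j" using 3(5)[OF j nz, of q] q by auto
  qed
 qed
 have E: "cnt * S = (p + 1 - p0) + (\<Sum>j<n. (rem(i := rem i - 1)) j)" using sum 4(1) \<open>p0 \<le> p\<close> by linarith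
 have G: "(\<forall>r\<ge>cnt. ?len r = 0)" "(\<forall>j\<ge>n. (rem(i := rem i - 1)) j = 0)" using 4 i r by auto
 show ?thesis unfolding chunks_def using A Cc D E F G by blast
qed

text \<open>At most \<open>n * S\<close> cells are used, and each of the \<open>n\<close> groups has
  at most \<open>S\<close> free cells in its current chunk. This is where the dimension
  \<open>2 * n\<close> of the Boolean matrices comes from.\<close>

lemma chunks_count:
 assumes "chunks S n g p0 p cnt rem cur ind len lst ch" "p \<le> p0 + n * S" "0 < S"
 shows "cnt \<le> 2 * n"
proof -
 have "(\<Sum>i<n. rem i) \<le> (\<Sum>i<n. S)" by (rule sum_mono) (use assms(1) in \<open>auto simp: chunks_def\<close>)
 moreover have "cnt * S = (p - p0) + (\<Sum>i<n. rem i)" using assms(1) by (simp add: chunks_def)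
 ultimately have "cnt * S \<le> (2 * n) * S" using assms(2) by simp
 then show ?thesis using assms(3) by simp
qed

lemma chunks_init: "chunks S n g p p 0 rem cur ind len lst ch" if "\<forall>x. rem x = 0" "\<forall>x. len x = 0"
 using that by (auto simp: chunks_def)

text \<open>The parameters are numbers of variables and arrays, so that one command serves rows and
  columns. The array \<open>ch\<close> is indexed by the global position and is therefore the only
  one not shifted by the base.\<close>

definition append_com :: "nat => nat => nat => nat => nat => nat => nat => nat => nat => com" where
 "append_com cnt rem cur ind len lst ch vg vc =
  (CIf (Rd rem (V vbase +. V vg)) CSkip
   (Wr cur (V vbase +. V vg) (V cnt) ;; Wr ind (V vbase +. V cnt) (V vg) ;;
    cnt ::= V cnt +. N 1 ;; Wr rem (V vbase +. V vg) (V 11)) ;;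
   Wr rem (V vbase +. V vg) (Rd rem (V vbase +. V vg) -. N 1) ;;
   vc ::= Rd cur (V vbase +. V vg) ;;
   21 ::= Rd len (V vbase +. V vc) ;;
   Wr lst (V vbase +. (V vc *. V 11 +. V 21)) (V 16) ;;
   Wr len (V vbase +. V vc) (V 21 +. N 1) ;;
   Wr ch (V 16) (V vc))"

definition chunk_state :: "nat => nat => (nat => nat) => nat => nat => nat => nat => nat => nat => nat => nat => nat => nat => st => bool" where
 "chunk_state S n g b p0 p cnt rem cur ind len lst ch s \<longleftrightarrow>
  chunks S n g p0 p (vs s cnt) (sh b (ar s rem)) (sh b (ar s cur)) (sh b (ar s ind)) (sh b (ar s len))
   (sh b (ar s lst)) (ar s ch)"

text \<open>The clause on new chunk numbers says that a chunk opened here receives \<open>p\<close>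
  at once. So no chunk is ever empty, and every column chunk has a least value.\<close>

lemma wp_append:
 assumes cs: "chunk_state S n g b p0 p cnt rem cur ind len lst ch s"
  and d: "distinct [rem, cur, ind, len, lst, ch]" "distinct [cnt, vg, vc, 7, 11, 16, 21]"
  and v: "vs s vbase = b" "vs s 11 = S" "vs s 16 = p" "vs s vg = g p" "g p < n" "p0 \<le> p" "p < p0 + n * S"
  and B: "2 * n + 1 \<le> B" "S + 1 \<le> B" "p + 1 \<le> B"
 shows "wp B (append_com cnt rem cur ind len lst ch vg vc)
  (\<lambda>s'. chunk_state S n g b p0 (p + 1) cnt rem cur ind len lst ch s' \<and>
   vs s' vc = ar s' ch p \<and> (\<forall>q. q \<noteq> p --> ar s' ch q = ar s ch q) \<and> vs s cnt \<le> vs s' cnt \<and>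
   (\<forall>r. vs s cnt \<le> r --> r < vs s' cnt --> r = ar s' ch p) \<and> ck s' \<le> ck s + 200) s"
proof -
 let ?i = "g p"
 have "distinct [ch, lst, len, ind, cur, rem]" "distinct [21, 16, 11, 7, vc, vg, cnt]" using d by auto
 note ne = d[simplified] this[simplified]
 have S: "0 < S" using v by (cases S) auto
 have gB: "g p \<le> B" using v(5) B(1) by simp
 have c: "chunks S n g p0 p (vs s cnt) (sh b (ar s rem)) (sh b (ar s cur)) (sh b (ar s ind)) (sh b (ar s len))
   (sh b (ar s lst)) (ar s ch)" using cs by (simp add: chunk_state_def)
 have cB: "vs s cnt \<le> 2 * n" by (rule chunks_count[OF c _ S]) (use v in simp)
 \<comment> \<open>The commands after the conditional are treated once, for a state in which the
   group has free space; both branches lead to such a state.\<close>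
 have key: "wp B (Wr rem (V vbase +. V vg) (Rd rem (V vbase +. V vg) -. N 1) ;;
   vc ::= Rd cur (V vbase +. V vg) ;; 21 ::= Rd len (V vbase +. V vc) ;;
   Wr lst (V vbase +. (V vc *. V 11 +. V 21)) (V 16) ;;
   Wr len (V vbase +. V vc) (V 21 +. N 1) ;; Wr ch (V 16) (V vc))
   (\<lambda>s'. chunk_state S n g b p0 (p + 1) cnt rem cur ind len lst ch s' \<and>
   vs s' vc = ar s' ch p \<and> (\<forall>q. q \<noteq> p --> ar s' ch q = ar s1 ch q) \<and> vs s' cnt = vs s1 cnt \<and>
   ar s' ch p = sh b (ar s1 cur) ?i \<and> ck s' \<le> ck s1 + 120) s1"
  if c1: "chunk_state S n g b p0 p cnt rem cur ind len lst ch s1" and r1: "ar s1 rem (b + ?i) \<noteq> 0"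
   and v1: "vs s1 vbase = b" "vs s1 11 = S" "vs s1 16 = p" "vs s1 vg = ?i" for s1
 proof -
  have c': "chunks S n g p0 p (vs s1 cnt) (sh b (ar s1 rem)) (sh b (ar s1 cur)) (sh b (ar s1 ind)) (sh b (ar s1 len))
   (sh b (ar s1 lst)) (ar s1 ch)" using c1 by (simp add: chunk_state_def)
  have r: "sh b (ar s1 rem) ?i \<noteq> 0" using r1 by (simp add: sh_def)
  note push = chunks_push[OF c' refl v(5) r v(6)]
  have "vs s1 cnt \<le> 2 * n" by (rule chunks_count[OF c' _ S]) (use v in simp)
  moreover have "sh b (ar s1 cur) ?i < vs s1 cnt" "sh b (ar s1 rem) ?i \<le> S"
   "sh b (ar s1 len) (sh b (ar s1 cur) ?i) + sh b (ar s1 rem) ?i = S"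
   using c' v(5) r unfolding chunks_def by blast+
  ultimately have "ar s1 cur (b + ?i) \<le> B" "ar s1 rem (b + ?i) - 1 \<le> B" "ar s1 len (b + ar s1 cur (b + ?i)) + 1 \<le> B"
   using B r by (simp_all add: sh_def)
  moreover define r where "r = ar s1 cur (b + ?i)"
  moreover define l where "l = ar s1 len (b + r)"
  ultimately have bb: "r \<le> B" "ar s1 rem (b + ?i) - 1 \<le> B" "l + 1 \<le> B" "l \<le> B" by auto
  have e: "sh b (ar s1 cur) ?i = r" "sh b (ar s1 rem) ?i = ar s1 rem (b + ?i)" "sh b (ar s1 len) r = l"
   by (simp_all add: sh_def r_def l_def)
  have push': "chunks S n g p0 (p + 1) (vs s1 cnt) (sh b ((ar s1 rem)(b + ?i := ar s1 rem (b + ?i) - 1)))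
    (sh b (ar s1 cur)) (sh b (ar s1 ind)) (sh b ((ar s1 len)(b + r := l + 1)))
    (sh b ((ar s1 lst)(b + (r * S + l) := p))) ((ar s1 ch)(p := r))"
   using push unfolding sh_upd e .
  show ?thesis
   using push' bb B by (simp add: ne v1 chunk_state_def e flip: r_def l_def)
 qed
 show ?thesis
 proof (cases "ar s rem (b + ?i) = 0")
  case False
  have "wp B (Wr rem (V vbase +. V vg) (Rd rem (V vbase +. V vg) -. N 1) ;;
   vc ::= Rd cur (V vbase +. V vg) ;; 21 ::= Rd len (V vbase +. V vc) ;;
   Wr lst (V vbase +. (V vc *. V 11 +. V 21)) (V 16) ;;
   Wr len (V vbase +. V vc) (V 21 +. N 1) ;; Wr ch (V 16) (V vc))
   (\<lambda>s'. chunk_state S n g b p0 (p + 1) cnt rem cur ind len lst ch s' \<and>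
   vs s' vc = ar s' ch p \<and> (\<forall>q. q \<noteq> p --> ar s' ch q = ar s ch q) \<and> vs s cnt \<le> vs s' cnt \<and>
   (\<forall>r. vs s cnt \<le> r --> r < vs s' cnt --> r = ar s' ch p) \<and> ck s' \<le> ck s + 200) (tick 1 (tick 11 s))"
   by (rule wp_conseq[OF key]) (use cs False v in \<open>auto simp: chunk_state_def\<close>)
  then show ?thesis unfolding append_com_def using False by (simp add: ne v)
 next
  case True
  have r0: "sh b (ar s rem) ?i = 0" using True by (simp add: sh_def)
  let ?s = "seta 12 rem (b + ?i) S (setv 6 cnt (vs s cnt + 1) (seta 12 ind (b + vs s cnt) ?i
    (seta 12 cur (b + ?i) (vs s cnt) (tick 11 s))))"
  have c2: "chunk_state S n g b p0 p cnt rem cur ind len lst ch ?s"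
   using chunks_alloc[OF c v(5) r0] by (simp add: ne chunk_state_def)
  have "wp B (Wr rem (V vbase +. V vg) (Rd rem (V vbase +. V vg) -. N 1) ;;
   vc ::= Rd cur (V vbase +. V vg) ;; 21 ::= Rd len (V vbase +. V vc) ;;
   Wr lst (V vbase +. (V vc *. V 11 +. V 21)) (V 16) ;;
   Wr len (V vbase +. V vc) (V 21 +. N 1) ;; Wr ch (V 16) (V vc))
   (\<lambda>s'. chunk_state S n g b p0 (p + 1) cnt rem cur ind len lst ch s' \<and>
   vs s' vc = ar s' ch p \<and> (\<forall>q. q \<noteq> p --> ar s' ch q = ar s ch q) \<and> vs s cnt \<le> vs s' cnt \<and>
   (\<forall>r. vs s cnt \<le> r --> r < vs s' cnt --> r = ar s' ch p) \<and> ck s' \<le> ck s + 200) ?s"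
   by (rule wp_conseq[OF key[OF c2]]) (use True v S in \<open>auto simp: ne sh_def\<close>)
  then show ?thesis unfolding append_com_def using True B cB gB by (simp add: ne v)
 qed
qed

lemma wp_Seq_fun [simp]: "wp B (c ;; d) Q = wp B c (wp B d Q)"
 by (simp add: fun_eq_iff)

lemma mv_append [simp]: "mv (append_com cnt rem cur ind len lst ch vg vc) = {cnt, vc, 21}"
 and ma_append [simp]: "ma (append_com cnt rem cur ind len lst ch vg vc) = {rem, cur, ind, len, lst, ch}"
 by (auto simp: append_com_def)

definition row_state :: "nat => nat => (nat => nat) => nat => nat => nat => st => bool" where
 "row_state S n g b p0 p = chunk_state S n g b p0 p 14 17 18 19 20 21 16"

definition col_state :: "nat => nat => (nat => nat) => nat => nat => nat => st => bool" where
 "col_state S n g b p0 p = chunk_state S n g b p0 p 15 22 23 24 25 26 30"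

lemma row_state_same: "row_state S n g b p0 p s ==> same X Y s s' ==> 14 \<notin> X ==> Y \<inter> {16..21} = {} ==>
  row_state S n g b p0 p s'"
proof -
 assume *: "row_state S n g b p0 p s" "same X Y s s'" "14 \<notin> X" "Y \<inter> {16..21} = {}"
 have "ar s' a = ar s a" if "a \<in> {16..21}" for a using * that by (auto intro!: same_ar)
 then show ?thesis using * by (simp add: row_state_def chunk_state_def same_vs[OF *(2)])
qed

lemma col_state_same: "col_state S n g b p0 p s ==> same X Y s s' ==> 15 \<notin> X ==>
  Y \<inter> {22..26} = {} ==> 30 \<notin> Y ==> col_state S n g b p0 p s'"
proof -
 assume *: "col_state S n g b p0 p s" "same X Y s s'" "15 \<notin> X" "Y \<inter> {22..26} = {}" "30 \<notin> Y"
 have "ar s' a = ar s a" if "a \<in> {22..26}" for a using * that by (auto intro!: same_ar)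
 then show ?thesis using * by (simp add: col_state_def chunk_state_def same_vs[OF *(2)] same_ar[OF *(2)])
qed

text \<open>Positions come in descending order of values, so the last value written to array 27 for
  a column chunk is its least one.\<close>

definition build_com :: com where
 "build_com = For 24 (V 13 -. V 12) (
   16 ::= V 12 +. V 24 ;; 17 ::= Rd aOI (V 16) ;; 18 ::= Rd aOK (V 16) ;;
   append_com 14 17 18 19 20 21 16 17 19 ;;
   append_com 15 22 23 24 25 26 30 18 20 ;;
   Wr aPM (V vbase +. (V 19 *. V vN +. V 20)) (N 1) ;;
   Wr 27 (V vbase +. V 20) (Rd aOA (V 16)))"

text \<open>Array 28 starts with the incidence matrix of row chunks and column chunks: a cell is 1
  if the two chunks share a position. The last two conjuncts make array 27 the least value of each
  column chunk.\<close>

definition built :: "nat => nat => nat => (nat => nat) => (nat => nat) => (nat => nat) => nat => nat => st => bool" where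
 "built n S b I K a p0 p s \<longleftrightarrow> row_state S n I b p0 p s \<and> col_state S n K b p0 p s \<and>
  (\<forall>r<2 * n. \<forall>k<2 * n. ar s aPM (b + (r * (2 * n) + k)) =
   (if \<exists>q. p0 \<le> q \<and> q < p \<and> r = ar s 16 q \<and> k = ar s 30 q then 1 else 0)) \<and>
  (\<forall>x\<ge>2 * n * (2 * n). ar s aPM (b + x) = 0) \<and>
  (\<forall>k<vs s 15. \<exists>q. p0 \<le> q \<and> q < p \<and> ar s 30 q = k \<and> ar s 27 (b + k) = a q) \<and>
  (\<forall>q. p0 \<le> q --> q < p --> ar s 27 (b + ar s 30 q) \<le> a q)"

lemma row_state_props:
 assumes "row_state S n g b p0 p s" "p0 \<le> q" "q < p" "p \<le> p0 + n * S" "0 < S"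
 shows "ar s 16 q < vs s 14" "vs s 14 \<le> 2 * n" "ar s 19 (b + ar s 16 q) = g q"
 using assms chunks_count[of S n g p0 p] unfolding row_state_def chunk_state_def
 by (auto simp: chunks_def sh_def)

lemma col_state_props:
 assumes "col_state S n g b p0 p s" "p0 \<le> q" "q < p" "p \<le> p0 + n * S" "0 < S"
 shows "ar s 30 q < vs s 15" "vs s 15 \<le> 2 * n" "ar s 24 (b + ar s 30 q) = g q"
 using assms chunks_count[of S n g p0 p] unfolding col_state_def chunk_state_def
 by (auto simp: chunks_def sh_def)

lemma wp_build:
 assumes v: "vs s vn = n" "vs s vN = 2 * n" "vs s vbase = b" "vs s 11 = S" "vs s 12 = p0" "vs s 13 = p1" "vs s 14 = 0" "vs s 15 = 0"
  and fresh: "\<forall>x. ar s 17 (b + x) = 0" "\<forall>x. ar s 20 (b + x) = 0" "\<forall>x. ar s 22 (b + x) = 0" "\<forall>x. ar s 25 (b + x) = 0"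
   "\<forall>x. ar s aPM (b + x) = 0"
  and se: "sorted_entries n A (ar s aOI) (ar s aOK) (ar s aOA)"
  and p: "p0 \<le> p1" "p1 \<le> p0 + n * S" "p1 \<le> n * n"
  and B: "2 * n + 1 \<le> B" "S + 1 \<le> B" "n * n + 1 \<le> B" "\<forall>q<n * n. ar s aOA q \<le> B"
 shows "wp B build_com (\<lambda>s'. built n S b (ar s aOI) (ar s aOK) (ar s aOA) p0 p1 s' \<and>
  ck s' \<le> ck s + 600 * (p1 - p0) + 20) s"
 unfolding build_com_def
proof (rule wp_For[where I = "\<lambda>k s'. built n S b (ar s aOI) (ar s aOK) (ar s aOA) p0 (p0 + k) s' \<and>
  ck s' \<le> ck s + 600 * k + 3" and b = "p1 - p0"], goal_cases)
 case 1
 then show ?case using fresh v unfolding built_def row_state_def col_state_def chunk_state_def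
  by (auto simp: sh_def intro!: chunks_init)
next
 case (4 k s')
 let ?p = "p0 + k"
 from 4(2) have sm: "same {14, 15, 16, 17, 18, 19, 20, 21, 24} {16, 17, 18, 19, 20, 21, 22, 23, 24, 25, 26, 27, 28, 30} s s'"
  by (rule same_mono) auto
 have bt: "built n S b (ar s aOI) (ar s aOK) (ar s aOA) p0 ?p s'" and ck: "ck s' \<le> ck s + 600 * k + 3" using 4(1) by auto
 have pl: "?p < n * n" "?p < p0 + n * S" "?p < p1" using 4(4) p by auto
 have S: "0 < S" using pl by (cases S) auto
 have IK: "ar s aOI ?p < n" "ar s aOK ?p < n" using se pl by (auto simp: sorted_entries_def)
 let ?s = "setv 9 18 (ar s aOK ?p) (setv 9 17 (ar s aOI ?p) (setv 7 16 ?p (tick 9 s')))"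
 have c1: "row_state S n (ar s aOI) b p0 ?p ?s" "col_state S n (ar s aOK) b p0 ?p ?s"
  using bt by (auto simp: built_def row_state_def col_state_def chunk_state_def)
 have A1: "wp B (append_com 14 17 18 19 20 21 16 17 19)
  (\<lambda>s'. chunk_state S n (ar s aOI) b p0 (?p + 1) 14 17 18 19 20 21 16 s' \<and>
   vs s' 19 = ar s' 16 ?p \<and> (\<forall>q. q \<noteq> ?p --> ar s' 16 q = ar ?s 16 q) \<and> vs ?s 14 \<le> vs s' 14 \<and>
   (\<forall>r. vs ?s 14 \<le> r --> r < vs s' 14 --> r = ar s' 16 ?p) \<and> ck s' \<le> ck ?s + 200) ?s"
  by (rule wp_append) (use c1 IK pl B v in \<open>auto simp: row_state_def same_vs[OF sm]\<close>)
 have "wp B (append_com 14 17 18 19 20 21 16 17 19) (wp B (append_com 15 22 23 24 25 26 30 18 20)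
   (wp B (Wr aPM (V vbase +. (V 19 *. V vN +. V 20)) (N 1)) (wp B (Wr 27 (V vbase +. V 20) (Rd aOA (V 16)))
   (\<lambda>s''. vs s'' 24 = k \<and> built n S b (ar s aOI) (ar s aOK) (ar s aOA) p0 (p0 + (k + 1)) (setv 6 24 (k + 1) s'') \<and>
   ck (setv 6 24 (k + 1) s'') \<le> ck s + 600 * (k + 1) + 3)))) ?s"
 proof (rule wp_conseq[OF A1])
  fix s1 assume s1: "chunk_state S n (ar s aOI) b p0 (?p + 1) 14 17 18 19 20 21 16 s1 \<and>
   vs s1 19 = ar s1 16 ?p \<and> (\<forall>q. q \<noteq> ?p --> ar s1 16 q = ar ?s 16 q) \<and> vs ?s 14 \<le> vs s1 14 \<and>
   (\<forall>r. vs ?s 14 \<le> r --> r < vs s1 14 --> r = ar s1 16 ?p) \<and> ck s1 \<le> ck ?s + 200"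
   and "same (mv (append_com 14 17 18 19 20 21 16 17 19)) (ma (append_com 14 17 18 19 20 21 16 17 19)) ?s s1"
  then have sm1: "same {14, 19, 21} {16, 17, 18, 19, 20, 21} ?s s1" by (simp add: insert_commute)
  have cs1: "col_state S n (ar s aOK) b p0 ?p s1" by (rule col_state_same[OF c1(2) sm1]) auto
  have A2: "wp B (append_com 15 22 23 24 25 26 30 18 20)
   (\<lambda>s'. chunk_state S n (ar s aOK) b p0 (?p + 1) 15 22 23 24 25 26 30 s' \<and>
    vs s' 20 = ar s' 30 ?p \<and> (\<forall>q. q \<noteq> ?p --> ar s' 30 q = ar s1 30 q) \<and> vs s1 15 \<le> vs s' 15 \<and>
    (\<forall>r. vs s1 15 \<le> r --> r < vs s' 15 --> r = ar s' 30 ?p) \<and> ck s' \<le> ck s1 + 200) s1"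
   by (rule wp_append) (use cs1 IK pl B v in \<open>auto simp: col_state_def same_vs[OF sm] same_vs[OF sm1]\<close>)
  show "wp B (append_com 15 22 23 24 25 26 30 18 20)
   (wp B (Wr aPM (V vbase +. (V 19 *. V vN +. V 20)) (N 1)) (wp B (Wr 27 (V vbase +. V 20) (Rd aOA (V 16)))
   (\<lambda>s''. vs s'' 24 = k \<and> built n S b (ar s aOI) (ar s aOK) (ar s aOA) p0 (p0 + (k + 1)) (setv 6 24 (k + 1) s'') \<and>
   ck (setv 6 24 (k + 1) s'') \<le> ck s + 600 * (k + 1) + 3))) s1"
  proof (rule wp_conseq[OF A2])
   fix s2 assume s2: "chunk_state S n (ar s aOK) b p0 (?p + 1) 15 22 23 24 25 26 30 s2 \<and>
    vs s2 20 = ar s2 30 ?p \<and> (\<forall>q. q \<noteq> ?p --> ar s2 30 q = ar s1 30 q) \<and> vs s1 15 \<le> vs s2 15 \<and>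
    (\<forall>r. vs s1 15 \<le> r --> r < vs s2 15 --> r = ar s2 30 ?p) \<and> ck s2 \<le> ck s1 + 200"
    and "same (mv (append_com 15 22 23 24 25 26 30 18 20)) (ma (append_com 15 22 23 24 25 26 30 18 20)) s1 s2"
   then have sm2: "same {15, 20, 21} {22, 23, 24, 25, 26, 30} s1 s2" by (simp add: insert_commute)
   have r2: "row_state S n (ar s aOI) b p0 (?p + 1) s2"
    by (rule row_state_same[OF _ sm2]) (use s1 in \<open>auto simp: row_state_def\<close>)
   have c2: "col_state S n (ar s aOK) b p0 (?p + 1) s2" using s2 by (simp add: col_state_def)
   define r where "r = ar s2 16 ?p"
   define kk where "kk = ar s2 30 ?p"
   have vr: "vs s2 19 = r" "vs s2 20 = kk" using s1 s2 by (auto simp: r_def kk_def same_vs[OF sm2] same_ar[OF sm2])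
   have rk: "r < 2 * n" "kk < 2 * n" "kk < vs s2 15"
    using row_state_props[OF r2, of ?p] col_state_props[OF c2, of ?p] pl S by (auto simp: r_def kk_def)
   have old16: "ar s2 16 q = ar s' 16 q" if "q \<noteq> ?p" for q using s1 that by (auto simp: same_ar[OF sm2])
   have old30: "ar s2 30 q = ar s' 30 q" if "q \<noteq> ?p" for q using s2 that by (auto simp: same_ar[OF sm1])
   have oldc: "vs s1 15 = vs s' 15" by (simp add: same_vs[OF sm1])
   let ?s3 = "seta 17 27 (b + kk) (ar s aOA ?p) (seta 17 28 (b + (r * (2 * n) + kk)) 1 s2)"
   have pm: "ar s2 28 = ar s' 28" "ar s2 27 = ar s' 27" by (simp_all add: same_ar[OF sm2] same_ar[OF sm1])
   have Px: "(ar s' 28)(b + (r * (2 * n) + kk) := 1) = ar ?s3 28" using pm by simp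
   have P1: "ar ?s3 28 (b + (r' * (2 * n) + k')) =
     (if \<exists>q. p0 \<le> q \<and> q < ?p + 1 \<and> r' = ar s2 16 q \<and> k' = ar s2 30 q then 1 else 0)" if "r' < 2 * n" "k' < 2 * n" for r' k'
   proof (cases "r' = r \<and> k' = kk")
    case True
    then have "\<exists>q. p0 \<le> q \<and> q < ?p + 1 \<and> r' = ar s2 16 q \<and> k' = ar s2 30 q"
     by (intro exI[of _ ?p]) (auto simp: r_def kk_def)
    then show ?thesis using True by simp
   next
    case False
    then have "b + (r' * (2 * n) + k') \<noteq> b + (r * (2 * n) + kk)" using cell_eq[of k' "2*n" kk r' r] that rk by auto
    then have "ar ?s3 28 (b + (r' * (2 * n) + k')) = ar s' 28 (b + (r' * (2 * n) + k'))" using pm by simp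
    also have "\<dots> = (if \<exists>q. p0 \<le> q \<and> q < ?p \<and> r' = ar s' 16 q \<and> k' = ar s' 30 q then 1 else 0)"
     using bt that by (simp add: built_def)
    also have "(\<exists>q. p0 \<le> q \<and> q < ?p \<and> r' = ar s' 16 q \<and> k' = ar s' 30 q) \<longleftrightarrow>
      (\<exists>q. p0 \<le> q \<and> q < ?p + 1 \<and> r' = ar s2 16 q \<and> k' = ar s2 30 q)"
     using False by (metis r_def kk_def old16 old30 less_plus1_eq nat_neq_iff)
    finally show ?thesis .
   qed
   have P2: "ar ?s3 28 (b + x) = 0" if "x \<ge> 2 * n * (2 * n)" for x
   proof -
    have "x \<noteq> r * (2 * n) + kk" using cell_less[of r "2*n" kk "2*n"] rk that by auto
    then show ?thesis using bt that pm by (simp add: built_def)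
   qed
   have mono: "ar s aOA ?p \<le> ar s aOA q" if "q \<le> ?p" for q using se pl that unfolding sorted_entries_def by blast
   have L1: "\<exists>q. p0 \<le> q \<and> q < ?p + 1 \<and> ar s2 30 q = k' \<and> ar ?s3 27 (b + k') = ar s aOA q" if "k' < vs s2 15" for k'
   proof (cases "k' = kk")
    case True
    then show ?thesis by (intro exI[of _ ?p]) (auto simp: kk_def)
   next
    case False
    \<comment> \<open>Only the chunk of the current position can be new, so \<open>k'\<close>
      existed before and the invariant applies to it.\<close>
    then have "k' < vs s' 15" using s2 that oldc kk_def by (metis not_less)
    then obtain q where q: "p0 \<le> q" "q < ?p" "ar s' 30 q = k'" "ar s' 27 (b + k') = ar s aOA q"
     using bt unfolding built_def by blast
    then show ?thesis using False pm old30[of q] by (intro exI[of _ q]) auto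
   qed
   have L2: "ar ?s3 27 (b + ar s2 30 q) \<le> ar s aOA q" if "p0 \<le> q" "q < ?p + 1" for q
   proof (cases "q = ?p \<or> ar s2 30 q = kk")
    case True
    then have "ar s2 30 q = kk" by (auto simp: kk_def)
    then show ?thesis using mono[of q] that by simp
   next
    case False
    then have "ar s' 27 (b + ar s' 30 q) \<le> ar s aOA q" using bt that unfolding built_def by auto
    then show ?thesis using False old30[of q] pm by simp
   qed
   have fin: "built n S b (ar s aOI) (ar s aOK) (ar s aOA) p0 (?p + 1) (setv 6 24 (k + 1) ?s3)"
    unfolding built_def
   proof (intro conjI)
    show "row_state S n (ar s aOI) b p0 (?p + 1) (setv 6 24 (k + 1) ?s3)"
     "col_state S n (ar s aOK) b p0 (?p + 1) (setv 6 24 (k + 1) ?s3)"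
     using r2 c2 by (simp_all add: row_state_def col_state_def chunk_state_def)
   qed (use P1 P2 L1 L2 in simp_all)
   have "ar s aOA ?p \<le> B" using B pl by simp
   then show "wp B (Wr aPM (V vbase +. (V 19 *. V vN +. V 20)) (N 1)) (wp B (Wr 27 (V vbase +. V 20) (Rd aOA (V 16)))
    (\<lambda>s''. vs s'' 24 = k \<and> built n S b (ar s aOI) (ar s aOK) (ar s aOA) p0 (p0 + (k + 1)) (setv 6 24 (k + 1) s'') \<and>
    ck (setv 6 24 (k + 1) s'') \<le> ck s + 600 * (k + 1) + 3)) s2"
    using fin B s1 s2 ck 4(3) v
    by (simp add: vr same_vs[OF sm2] same_vs[OF sm1] same_vs[OF sm] same_ar[OF sm2] same_ar[OF sm1] same_ar[OF sm] add.assoc)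
  qed
 qed
 then show ?case using 4(3) v IK pl B by (simp add: same_vs[OF sm] same_ar[OF sm])
next
 case (5 s')
 then show ?case using p by (simp add: built_def row_state_def col_state_def chunk_state_def)
qed (use v p B in \<open>auto simp: same_vs\<close>)

subsection \<open>One part of the sorted entries\<close>

text \<open>The abstract data of one part, free of machine states. \<open>rc\<close> and
  \<open>cc\<close> give the row chunk and the column chunk of a position, \<open>ri\<close> and
  \<open>ci\<close> the row or column to which a chunk belongs, \<open>lo\<close> the least value of
  a column chunk and \<open>Bv\<close> the second operand in row-major order. Monotonicity of
  \<open>rc\<close> and \<open>cc\<close> says that chunks of one row or column follow the
  descending order.\<close>

locale part =
 fixes n S p0 p1 nr nc :: nat and I K a rc cc ri ci lo Bv :: "nat => nat"
 assumes n: "0 < n" and S: "0 < S" and p: "p0 \<le> p1" "p1 \<le> n * n"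
  and I: "q < n * n ==> I q < n" and K: "q < n * n ==> K q < n"
  and anti: "q \<le> q' ==> q' < n * n ==> a q' \<le> a q"
  and rc: "p0 \<le> q ==> q < p1 ==> rc q < nr" "p0 \<le> q ==> q < p1 ==> ri (rc q) = I q"
  and rmono: "p0 \<le> q ==> q < q' ==> q' < p1 ==> I q = I q' ==> rc q \<le> rc q'"
  and cc: "p0 \<le> q ==> q < p1 ==> cc q < nc" "p0 \<le> q ==> q < p1 ==> ci (cc q) = K q"
  and cmono: "p0 \<le> q ==> q < q' ==> q' < p1 ==> K q = K q' ==> cc q \<le> cc q'"
  and ri: "r < nr ==> ri r < n" and ci: "r < nc ==> ci r < n"
  and lo1: "r < nc ==> \<exists>q. p0 \<le> q \<and> q < p1 \<and> cc q = r \<and> lo r = a q"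
  and lo2: "p0 \<le> q ==> q < p1 ==> lo (cc q) \<le> a q"
  and nr: "nr \<le> 2 * n" and nc: "nc \<le> 2 * n"
begin

definition dom :: "nat => nat => bool" where
 "dom q j \<longleftrightarrow> a q \<le> Bv (K q * n + j)"

text \<open>
 Once a chunk with a value at most \<open>Bv (k * n + j)\<close> has been met in column \<open>k\<close>, all later entries of
 this column are dominated; from then on the flag of \<open>(k, j)\<close> stands for the whole chunk.
\<close>

definition flag_inv :: "nat => (nat => nat) => bool" where
 "flag_inv p F \<longleftrightarrow> (\<forall>k<n. \<forall>j<n.
  (F (k * n + j) \<noteq> 0 --> (\<forall>q. p \<le> q --> q < n * n --> K q = k --> a q \<le> Bv (k * n + j))) \<and>
  (F (k * n + j) = 0 --> (\<forall>q<p. K q = k --> Bv (k * n + j) < a q)))"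

text \<open>\<open>D\<close> marks the finished entries of the result \<open>C\<close>. Since values
  descend, the first row chunk containing a dominated entry already contains the maximum, so an
  entry is finished after one scan. The last conjunct keeps \<open>C\<close> attained or 0
  throughout.\<close>

definition done_inv :: "nat => (nat => nat) => (nat => nat) => bool" where
 "done_inv p D C \<longleftrightarrow> (\<forall>i<n. \<forall>j<n.
  (D (i * n + j) \<noteq> 0 --> (\<forall>q<n * n. I q = i --> dom q j --> a q \<le> C (i * n + j))) \<and>
  (D (i * n + j) = 0 --> (\<forall>q<p. I q = i --> \<not> dom q j)) \<and>
  (C (i * n + j) = 0 \<or> (\<exists>q<n * n. I q = i \<and> dom q j \<and> C (i * n + j) = a q)))"

text \<open>\<open>flag_inv\<close> in the middle of a part: \<open>x\<close> counts the pairs of a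
  column chunk and an index \<open>j\<close> already treated, in row-major order, so
  \<open>cc q * n + j < x\<close> says that the pair belonging to \<open>q\<close> and
  \<open>j\<close> has been passed.\<close>

definition fl :: "nat => (nat => nat) => bool" where
 "fl x F \<longleftrightarrow> (\<forall>k<n. \<forall>j<n.
  (F (k * n + j) \<noteq> 0 --> (\<forall>q. p0 \<le> q --> q < n * n --> K q = k --> \<not> (q < p1 \<and> cc q * n + j < x) --> a q \<le> Bv (k * n + j))) \<and>
  (F (k * n + j) = 0 --> (\<forall>q<p1. K q = k --> (q < p0 \<or> cc q * n + j < x) --> Bv (k * n + j) < a q)))"

text \<open>\<open>Y\<close> and \<open>M\<close> are the second factor of the matrix product and the marks made directly.\<close>

definition marks :: "nat => (nat => nat) => (nat => nat) => bool" where
 "marks x Y M \<longleftrightarrow>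
  (\<forall>q j. p0 \<le> q --> q < p1 --> j < n --> cc q * n + j < x --> dom q j -->
   Y (cc q * (2 * n) + j) = 1 \<or> M (rc q * (2 * n) + j) \<noteq> 0) \<and>
  (\<forall>k<2 * n. \<forall>j<2 * n. Y (k * (2 * n) + j) \<le> 1 \<and> (Y (k * (2 * n) + j) \<noteq> 0 -->
   k < nc \<and> j < n \<and> (\<forall>q. p0 \<le> q --> q < p1 --> cc q = k --> dom q j))) \<and>
  (\<forall>r. \<forall>j<2 * n. M (r * (2 * n) + j) \<noteq> 0 --> j < n \<and> (\<exists>q. p0 \<le> q \<and> q < p1 \<and> rc q = r \<and> dom q j))"

lemma flD:
 assumes "fl x F" "k < n" "j < n"
 shows "F (k * n + j) \<noteq> 0 ==> p0 \<le> q ==> q < n * n ==> K q = k ==> \<not> (q < p1 \<and> cc q * n + j < x) ==> a q \<le> Bv (k * n + j)"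
  "F (k * n + j) = 0 ==> q < p1 ==> K q = k ==> q < p0 \<or> cc q * n + j < x ==> Bv (k * n + j) < a q"
 using assms unfolding fl_def by blast+

lemma marksD:
 assumes "marks x Y M"
 shows "p0 \<le> q ==> q < p1 ==> j < n ==> cc q * n + j < x ==> dom q j ==>
   Y (cc q * (2 * n) + j) = 1 \<or> M (rc q * (2 * n) + j) \<noteq> 0"
  "k < 2 * n ==> j < 2 * n ==> Y (k * (2 * n) + j) \<le> 1"
  "k < 2 * n ==> j < 2 * n ==> Y (k * (2 * n) + j) \<noteq> 0 ==>
   k < nc \<and> j < n \<and> (\<forall>q. p0 \<le> q --> q < p1 --> cc q = k --> dom q j)"
  "j < 2 * n ==> M (r * (2 * n) + j) \<noteq> 0 ==> j < n \<and> (\<exists>q. p0 \<le> q \<and> q < p1 \<and> rc q = r \<and> dom q j)"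
 using assms unfolding marks_def by blast+

lemma fl_0: "flag_inv p0 F ==> fl 0 F"
 using p unfolding flag_inv_def fl_def by auto

lemma fl_end: "fl (nc * n) F ==> flag_inv p1 F"
proof -
 assume f: "fl (nc * n) F"
 have "cc q * n + j < nc * n" if "p0 \<le> q" "q < p1" "j < n" for q j
  using cell_less[OF cc(1)] that by auto
 then have *: "q < p0 \<or> cc q * n + j < nc * n" if "q < p1" "j < n" for q j using that by (cases "q < p0") auto
 show ?thesis unfolding flag_inv_def
 proof (intro allI impI conjI)
  fix k j q assume "k < n" "j < n" "F (k * n + j) \<noteq> 0" "p1 \<le> q" "q < n * n" "K q = k"
  then show "a q \<le> Bv (k * n + j)" using flD(1)[OF f, of k j q] p(1) by auto
 next
  fix k j q assume "k < n" "j < n" "F (k * n + j) = 0" "q < p1" "K q = k"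
  then show "Bv (k * n + j) < a q" using flD(2)[OF f, of k j q] * by auto
 qed
qed

lemma cell_idx:
 assumes "k < nc" "j < n" "x = k * n + j"
 shows "p0 \<le> q ==> q < p1 ==> j' < n ==> cc q * n + j' < x + 1 \<longleftrightarrow> cc q * n + j' < x \<or> (cc q = k \<and> j' = j)"
 using assms cell_eq[of j' n j "cc q" k] by (auto simp: less_plus1_eq)

text \<open>The flag stems from an earlier chunk of the same column, so all entries of the present
  one are dominated, and a single 1 in \<open>Y\<close> represents the whole chunk.\<close>

lemma mid_flagged:
 assumes x: "k < nc" "j < n" "x = k * n + j" and F: "F (ci k * n + j) \<noteq> 0" and "fl x F" "marks x Y M"
 shows "fl (x + 1) F" "marks (x + 1) (Y(k * (2 * n) + j := 1)) M"
proof -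
 have kc: "K q = ci k" if "p0 \<le> q" "q < p1" "cc q = k" for q using cc(2)[OF that(1,2)] that by simp
 show "fl (x + 1) F" unfolding fl_def
 proof (intro allI impI conjI)
  fix k' j' q assume *: "k' < n" "j' < n" "F (k' * n + j') \<noteq> 0" "p0 \<le> q" "q < n * n" "K q = k'" "\<not> (q < p1 \<and> cc q * n + j' < x + 1)"
  then show "a q \<le> Bv (k' * n + j')" using flD(1)[OF \<open>fl x F\<close>, of k' j' q] by (auto simp: less_plus1_eq)
 next
  fix k' j' q assume *: "k' < n" "j' < n" "F (k' * n + j') = 0" "q < p1" "K q = k'" "q < p0 \<or> cc q * n + j' < x + 1"
  have "q < p0 \<or> cc q * n + j' < x"
  proof (rule ccontr)
   assume "\<not> ?thesis"
   then have "p0 \<le> q" "cc q = k" "j' = j" using * cell_idx[OF x, of q j'] by auto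
   then show False using kc[of q] * F by auto
  qed
  then show "Bv (k' * n + j') < a q" using flD(2)[OF \<open>fl x F\<close>, of k' j' q] * by auto
 qed
 have dm: "dom q j" if "p0 \<le> q" "q < p1" "cc q = k" for q
  using flD(1)[OF \<open>fl x F\<close> ci[OF x(1)] x(2) F that(1)] that x(3) kc[OF that] p unfolding dom_def by auto
 have k2: "k < 2 * n" "j < 2 * n" using x nc by auto
 show "marks (x + 1) (Y(k * (2 * n) + j := 1)) M" unfolding marks_def
 proof (intro allI impI conjI)
  fix q j' assume *: "p0 \<le> q" "q < p1" "j' < n" "cc q * n + j' < x + 1" "dom q j'"
  show "(Y(k * (2 * n) + j := 1)) (cc q * (2 * n) + j') = 1 \<or> M (rc q * (2 * n) + j') \<noteq> 0"
   using * cell_idx[OF x, of q j'] marksD(1)[OF \<open>marks x Y M\<close>, of q j'] by (auto simp: cell_eq)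
 next
  fix k' j' assume *: "k' < 2 * n" "j' < 2 * n"
  have e: "k' * (2 * n) + j' = k * (2 * n) + j \<longleftrightarrow> k' = k \<and> j' = j" using cell_eq[of j' "2*n" j k' k] * k2 by auto
  show "(Y(k * (2 * n) + j := 1)) (k' * (2 * n) + j') \<le> 1"
   using marksD(2)[OF \<open>marks x Y M\<close> *] by auto
  assume nz: "(Y(k * (2 * n) + j := 1)) (k' * (2 * n) + j') \<noteq> 0"
  have "k' < nc \<and> j' < n \<and> (\<forall>q. p0 \<le> q --> q < p1 --> cc q = k' --> dom q j')"
  proof (cases "k' = k \<and> j' = j")
   case True then show ?thesis using x dm by auto
  next
   case False
   then have "Y (k' * (2 * n) + j') \<noteq> 0" using nz e by auto
   then show ?thesis using marksD(3)[OF \<open>marks x Y M\<close> *] by auto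
  qed
  then show "k' < nc" "j' < n" "\<And>q. p0 \<le> q ==> q < p1 ==> cc q = k' ==> dom q j'" by auto
 qed (use \<open>marks x Y M\<close> in \<open>auto simp: marks_def\<close>)
qed

text \<open>Even the least value of the chunk exceeds the bound. Nothing in it is dominated, and
  there is nothing to record.\<close>

lemma mid_low:
 assumes x: "k < nc" "j < n" "x = k * n + j" and low: "Bv (ci k * n + j) < lo k"
  and F: "F (ci k * n + j) = 0" and "fl x F" "marks x Y M"
 shows "fl (x + 1) F" "marks (x + 1) Y M"
proof -
 have kc: "K q = ci k" if "p0 \<le> q" "q < p1" "cc q = k" for q using cc(2)[OF that(1,2)] that by simp
 have nd: "Bv (ci k * n + j) < a q" if "p0 \<le> q" "q < p1" "cc q = k" for q
  using low lo2[OF that(1,2)] that by simp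
 show "fl (x + 1) F" unfolding fl_def
 proof (intro allI impI conjI)
  fix k' j' q assume *: "k' < n" "j' < n" "F (k' * n + j') \<noteq> 0" "p0 \<le> q" "q < n * n" "K q = k'" "\<not> (q < p1 \<and> cc q * n + j' < x + 1)"
  then show "a q \<le> Bv (k' * n + j')" using flD(1)[OF \<open>fl x F\<close>, of k' j' q] by (auto simp: less_plus1_eq)
 next
  fix k' j' q assume *: "k' < n" "j' < n" "F (k' * n + j') = 0" "q < p1" "K q = k'" "q < p0 \<or> cc q * n + j' < x + 1"
  show "Bv (k' * n + j') < a q"
  proof (cases "q < p0 \<or> cc q * n + j' < x")
   case True then show ?thesis using flD(2)[OF \<open>fl x F\<close>, of k' j' q] * by auto
  next
   case False
   then have "p0 \<le> q" "cc q = k" "j' = j" using * cell_idx[OF x, of q j'] by auto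
   then show ?thesis using kc[of q] nd[of q] * by auto
  qed
 qed
 show "marks (x + 1) Y M" unfolding marks_def
 proof (intro allI impI conjI)
  fix q j' assume *: "p0 \<le> q" "q < p1" "j' < n" "cc q * n + j' < x + 1" "dom q j'"
  have "\<not> (cc q = k \<and> j' = j)" using nd[of q] kc[of q] * by (auto simp: dom_def)
  then show "Y (cc q * (2 * n) + j') = 1 \<or> M (rc q * (2 * n) + j') \<noteq> 0"
   using * cell_idx[OF x, of q j'] marksD(1)[OF \<open>marks x Y M\<close>, of q j'] by auto
 qed (use \<open>marks x Y M\<close> in \<open>auto simp: marks_def\<close>)
qed

text \<open>The least value is dominated while larger values of the chunk may not be, so the
  dominated entries are recorded individually in \<open>M\<close>. All later entries of the column
  are at most this least value, which justifies setting the flag.\<close>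

lemma mid_new:
 assumes x: "k < nc" "j < n" "x = k * n + j" and high: "lo k \<le> Bv (ci k * n + j)" and "fl x F" "marks x Y M"
  and M': "\<And>r j'. j' < 2 * n ==> M' (r * (2 * n) + j') \<noteq> 0 \<longleftrightarrow> M (r * (2 * n) + j') \<noteq> 0 \<or>
   j' = j \<and> (\<exists>q. p0 \<le> q \<and> q < p1 \<and> cc q = k \<and> rc q = r \<and> dom q j)"
 shows "fl (x + 1) (F(ci k * n + j := 1))" "marks (x + 1) Y M'"
proof -
 have kc: "K q = ci k" if "p0 \<le> q" "q < p1" "cc q = k" for q using cc(2)[OF that(1,2)] that by simp
 obtain q1 where q1: "p0 \<le> q1" "q1 < p1" "cc q1 = k" "lo k = a q1" using lo1[OF x(1)] by blast
 show "fl (x + 1) (F(ci k * n + j := 1))" unfolding fl_def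
 proof (intro allI impI conjI)
  fix k' j' q assume *: "k' < n" "j' < n" "(F(ci k * n + j := 1)) (k' * n + j') \<noteq> 0" "p0 \<le> q" "q < n * n" "K q = k'" "\<not> (q < p1 \<and> cc q * n + j' < x + 1)"
  show "a q \<le> Bv (k' * n + j')"
  proof (cases "k' = ci k \<and> j' = j")
   case True
   \<comment> \<open>\<open>q1\<close> attains the least value of chunk \<open>k\<close>. An entry
     of the same column that is still untreated lies in a later chunk or beyond the part, hence
     after \<open>q1\<close>.\<close>
   have "q1 \<le> q"
   proof (cases "q < p1")
    case False then show ?thesis using q1 by simp
   next
    case True'': True
    have "\<not> cc q * n + j < x + 1" using * True True'' by auto
    have "k < cc q"
    proof (rule ccontr)
     assume "\<not> k < cc q"
     then have "cc q * n \<le> k * n" by simp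
     then show False using \<open>\<not> cc q * n + j < x + 1\<close> x(3) by linarith
    qed
    then show ?thesis using cmono[of q q1] q1 kc[of q1] True *(4,6) by (metis not_le leD)
   qed
   then have "a q \<le> a q1" using anti *(5) by simp
   then show ?thesis using True high q1 by simp
  next
   case False
   then have "F (k' * n + j') \<noteq> 0" using * cell_eq[of j' n j k' "ci k"] x by (auto split: if_splits)
   then show ?thesis using flD(1)[OF \<open>fl x F\<close>, of k' j' q] * by (auto simp: less_plus1_eq)
  qed
 next
  fix k' j' q assume *: "k' < n" "j' < n" "(F(ci k * n + j := 1)) (k' * n + j') = 0" "q < p1" "K q = k'" "q < p0 \<or> cc q * n + j' < x + 1"
  then have F: "F (k' * n + j') = 0" "k' * n + j' \<noteq> ci k * n + j" by (auto split: if_splits)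
  have "q < p0 \<or> cc q * n + j' < x"
  proof (rule ccontr)
   assume "\<not> ?thesis"
   then have "p0 \<le> q" "cc q = k" "j' = j" using * cell_idx[OF x, of q j'] by auto
   then show False using kc[of q] * F by auto
  qed
  then show "Bv (k' * n + j') < a q" using flD(2)[OF \<open>fl x F\<close>, of k' j' q] * F by auto
 qed
 show "marks (x + 1) Y M'" unfolding marks_def
 proof (intro allI impI conjI)
  fix q j' assume *: "p0 \<le> q" "q < p1" "j' < n" "cc q * n + j' < x + 1" "dom q j'"
  show "Y (cc q * (2 * n) + j') = 1 \<or> M' (rc q * (2 * n) + j') \<noteq> 0"
  proof (cases "cc q = k \<and> j' = j")
   case True then show ?thesis using M'[of j' "rc q"] * by auto
  next
   case False
   then have "cc q * n + j' < x" using * cell_idx[OF x, of q j'] by auto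
   then have "Y (cc q * (2 * n) + j') = 1 \<or> M (rc q * (2 * n) + j') \<noteq> 0"
    using * marksD(1)[OF \<open>marks x Y M\<close>] by auto
   then show ?thesis using M'[of j' "rc q"] * by auto
  qed
 next
  fix r j' assume *: "j' < 2 * n" "M' (r * (2 * n) + j') \<noteq> 0"
  have "j' < n \<and> (\<exists>q. p0 \<le> q \<and> q < p1 \<and> rc q = r \<and> dom q j')"
   using M'[OF *(1), of r] * marksD(4)[OF \<open>marks x Y M\<close> *(1), of r] x by blast
  then show "j' < n" "\<exists>q. p0 \<le> q \<and> q < p1 \<and> rc q = r \<and> dom q j'" by auto
 qed (use \<open>marks x Y M\<close> in \<open>auto simp: marks_def\<close>)
qed

text \<open>A nonzero summand is a column chunk that shares a position with row chunk
  \<open>r\<close> and is dominated as a whole, so the shared position is dominated. Dominated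
  positions that \<open>Y\<close> does not cover are found in \<open>M\<close>. Numbers are added,
  not Boolean values, which suffices because only being nonzero matters.\<close>

lemma marks_end:
 assumes "marks (nc * n) Y M" "r < nr" "j < n"
  and X: "\<And>r k. r < 2 * n ==> k < 2 * n ==> X (r * (2 * n) + k) \<noteq> 0 \<longleftrightarrow> (\<exists>q. p0 \<le> q \<and> q < p1 \<and> r = rc q \<and> k = cc q)"
 shows "(\<Sum>k<2 * n. X (r * (2 * n) + k) * Y (k * (2 * n) + j)) + M (r * (2 * n) + j) \<noteq> 0 \<longleftrightarrow>
  (\<exists>q. p0 \<le> q \<and> q < p1 \<and> rc q = r \<and> dom q j)" (is "?L \<longleftrightarrow> ?R")
proof
 assume ?L
 then consider k where "k < 2 * n" "X (r * (2 * n) + k) \<noteq> 0" "Y (k * (2 * n) + j) \<noteq> 0" | "M (r * (2 * n) + j) \<noteq> 0"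
  by (auto simp: sum_eq_0_iff)
 then show ?R
 proof cases
  case 1
  then obtain q where "p0 \<le> q" "q < p1" "r = rc q" "k = cc q" using X[of r k] assms(2) nr by auto
  then show ?thesis using 1 marksD(3)[OF assms(1), of k j] assms(3) by auto
 next
  case 2
  then show ?thesis using marksD(4)[OF assms(1), of j r] assms(3) by auto
 qed
next
 assume ?R
 then obtain q where q: "p0 \<le> q" "q < p1" "rc q = r" "dom q j" by blast
 have "cc q * n + j < nc * n" using cell_less[OF cc(1)[OF q(1,2)]] assms(3) by auto
 then consider "Y (cc q * (2 * n) + j) = 1" | "M (r * (2 * n) + j) \<noteq> 0"
  using marksD(1)[OF assms(1), of q j] assms(3) q by auto
 then show ?L
 proof cases
  case 1
  have k: "cc q < 2 * n" using cc(1)[OF q(1,2)] nc by simp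
  moreover have "X (r * (2 * n) + cc q) \<noteq> 0" using X[of r "cc q"] k assms(2) nr q by auto
  ultimately have "(\<Sum>k<2 * n. X (r * (2 * n) + k) * Y (k * (2 * n) + j)) \<noteq> 0"
   using 1 by (auto simp: sum_eq_0_iff)
  then show ?thesis by simp
 qed simp
qed

text \<open>The analogue of \<open>fl\<close> for \<open>done_inv\<close>: \<open>x\<close> counts
  the treated pairs of a row chunk and an index \<open>j\<close>.\<close>

definition dn :: "nat => (nat => nat) => (nat => nat) => bool" where
 "dn x D C \<longleftrightarrow> (\<forall>i<n. \<forall>j<n.
  (D (i * n + j) \<noteq> 0 --> (\<forall>q<n * n. I q = i --> dom q j --> a q \<le> C (i * n + j))) \<and>
  (D (i * n + j) = 0 --> (\<forall>q<p1. I q = i --> q < p0 \<or> rc q * n + j < x --> \<not> dom q j)) \<and>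
  (C (i * n + j) = 0 \<or> (\<exists>q<n * n. I q = i \<and> dom q j \<and> C (i * n + j) = a q)))"

lemma dn_0: "done_inv p0 D C ==> dn 0 D C"
 unfolding done_inv_def dn_def by auto

lemma dn_end: "dn (nr * n) D C ==> done_inv p1 D C"
proof -
 assume f: "dn (nr * n) D C"
 have "rc q * n + j < nr * n" if "p0 \<le> q" "q < p1" "j < n" for q j
  using cell_less[OF rc(1)] that by auto
 then have "q < p0 \<or> rc q * n + j < nr * n" if "q < p1" "j < n" for q j using that by (cases "q < p0") auto
 then show ?thesis using f unfolding done_inv_def dn_def by auto
qed

lemma fin_skip:
 assumes x: "r < nr" "j < n" "x = r * n + j" and "dn x D C"
  and *: "D (ri r * n + j) = 0 ==> \<not> (\<exists>q. p0 \<le> q \<and> q < p1 \<and> rc q = r \<and> dom q j)"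
 shows "dn (x + 1) D C"
proof -
 have "\<not> dom q j'" if "i < n" "j' < n" "D (i * n + j') = 0" "q < p1" "I q = i" "q < p0 \<or> rc q * n + j' < x + 1" for i j' q
 proof (cases "q < p0 \<or> rc q * n + j' < x")
  case True then show ?thesis using \<open>dn x D C\<close> that unfolding dn_def by auto
 next
  case False
  then have q: "p0 \<le> q" "rc q = r" "j' = j" using that x cell_eq[of j' n j "rc q" r] by (auto simp: less_plus1_eq)
  then have "i = ri r" using rc(2)[of q] that by auto
  then show ?thesis using * q that by auto
 qed
 then show ?thesis using \<open>dn x D C\<close> unfolding dn_def by auto
qed

text \<open>As \<open>D y = 0\<close>, no treated chunk of this row has an entry dominated for
  \<open>j\<close>. The entry \<open>q0\<close> in chunk \<open>r\<close> precedes all entries of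
  later chunks and parts in the descending order, so the maximum over the scanned chunk is the
  maximum over the whole row.\<close>

lemma fin_scan:
 assumes x: "r < nr" "j < n" "x = r * n + j" "y = ri r * n + j" and "dn x D C" "D y = 0"
  and ex: "\<exists>q. p0 \<le> q \<and> q < p1 \<and> rc q = r \<and> dom q j"
  and C': "\<And>z. z \<noteq> y ==> C' z = C z" "\<And>q. p0 \<le> q ==> q < p1 ==> rc q = r ==> dom q j ==> a q \<le> C' y"
   "C' y = C y \<or> (\<exists>q. p0 \<le> q \<and> q < p1 \<and> rc q = r \<and> dom q j \<and> C' y = a q)"
 shows "dn (x + 1) (D(y := 1)) C'"
proof -
 have rin: "ri r < n" using ri x by simp
 obtain q0 where q0: "p0 \<le> q0" "q0 < p1" "rc q0 = r" "dom q0 j" using ex by blast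
 have le: "a q \<le> C' y" if q: "q < n * n" "I q = ri r" "dom q j" for q
 proof -
  have nd: "\<not> (q < p1 \<and> (q < p0 \<or> rc q * n + j < x))"
   using \<open>dn x D C\<close> \<open>D y = 0\<close> q x rin unfolding dn_def by auto
  show ?thesis
  proof (cases "q < p1 \<and> rc q = r")
   case True then show ?thesis using C'(2)[of q] nd q by auto
  next
   case False
   have "q0 \<le> q"
   proof (cases "q < p1")
    case True
    then have "p0 \<le> q" "rc q \<noteq> r" "\<not> rc q * n + j < x" using nd False by auto
    have "r < rc q"
    proof (rule ccontr)
     assume "\<not> r < rc q"
     then have "rc q < r" using \<open>rc q \<noteq> r\<close> by simp
     then have "rc q * n < r * n" using n by simp
     then show False using \<open>\<not> rc q * n + j < x\<close> x(3) by linarith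
    qed
    then show ?thesis using rmono[of q q0] q0 rc(2)[of q0] q \<open>p0 \<le> q\<close> by (metis not_le)
   qed (use q0 in simp)
   then have "a q \<le> a q0" using anti q by simp
   also have "\<dots> \<le> C' y" using C'(2) q0 by simp
   finally show ?thesis .
  qed
 qed
 show ?thesis unfolding dn_def
 proof (intro allI impI)
  fix i j' assume ij: "i < n" "j' < n"
  have e: "i * n + j' = y \<longleftrightarrow> i = ri r \<and> j' = j" using cell_eq[of j' n j i "ri r"] x ij by auto
  show "((D(y := 1)) (i * n + j') \<noteq> 0 --> (\<forall>q<n * n. I q = i --> dom q j' --> a q \<le> C' (i * n + j'))) \<and>
  ((D(y := 1)) (i * n + j') = 0 --> (\<forall>q<p1. I q = i --> q < p0 \<or> rc q * n + j' < x + 1 --> \<not> dom q j')) \<and>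
  (C' (i * n + j') = 0 \<or> (\<exists>q<n * n. I q = i \<and> dom q j' \<and> C' (i * n + j') = a q))"
  proof (cases "i = ri r \<and> j' = j")
   case True
   have "C y = 0 \<or> (\<exists>q<n * n. I q = ri r \<and> dom q j \<and> C y = a q)"
    using \<open>dn x D C\<close> x rin unfolding dn_def by auto
   moreover have "I q = ri r \<and> q < n * n" if "p0 \<le> q" "q < p1" "rc q = r" for q using rc(2)[OF that(1,2)] that p by auto
   ultimately have "C' y = 0 \<or> (\<exists>q<n * n. I q = ri r \<and> dom q j \<and> C' y = a q)" using C'(3) by metis
   then show ?thesis using True e le by auto
  next
   case False
   then have ne: "i * n + j' \<noteq> y" using e by simp
   have "\<not> dom q j'" if "D (i * n + j') = 0" "q < p1" "I q = i" "q < p0 \<or> rc q * n + j' < x + 1" for q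
   proof (cases "q < p0 \<or> rc q * n + j' < x")
    case True then show ?thesis using \<open>dn x D C\<close> that ij unfolding dn_def by auto
   next
    case F: False
    then have q: "p0 \<le> q" "rc q = r" "j' = j" using that x ij cell_eq[of j' n j "rc q" r] by (auto simp: less_plus1_eq)
    then have "i = ri r" using rc(2)[of q] that by auto
    then show ?thesis using False q by auto
   qed
   then show ?thesis using \<open>dn x D C\<close> ij ne C'(1) unfolding dn_def by simp
  qed
 qed
qed

end

section \<open>The commands for one part, with the cost of scans charged to the flags they
  set\<close>

definition nnz :: "nat => (nat => nat) => nat" where
 "nnz M F = card {y. y < M \<and> F y \<noteq> 0}"

lemma nnz_le: "nnz M F \<le> M"
 unfolding nnz_def by (rule card_less_bound)

lemma nnz_upd: "y < M ==> F y = 0 ==> nnz M (F(y := 1)) = nnz M F + 1"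
proof -
 assume *: "y < M" "F y = 0"
 have "{z. z < M \<and> (F(y := 1)) z \<noteq> 0} = insert y {z. z < M \<and> F z \<noteq> 0}" using * by auto
 then show ?thesis using * unfolding nnz_def by simp
qed

lemma less_plus1_le: "(i :: nat) < k + 1 \<longleftrightarrow> i \<le> k"
 by auto

lemma ex_less_plus1: "(\<exists>c<k + 1. P c) \<longleftrightarrow> (\<exists>c<k. P c) \<or> P (k :: nat)"
 by (auto simp: less_plus1_eq)

lemma chunksD:
 assumes "chunks S n g p0 p cnt rem cur ind len lst ch"
 shows "p0 \<le> q ==> q < p ==> ch q < cnt" "p0 \<le> q ==> q < p ==> ind (ch q) = g q"
  "p0 \<le> q ==> q < p ==> \<exists>c<len (ch q). lst (ch q * S + c) = q"
  "p0 \<le> q ==> q < q' ==> q' < p ==> g q = g q' ==> ch q \<le> ch q'"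
  "r < cnt ==> len r \<le> S" "r < cnt ==> ind r < n" "r < cnt ==> c < len r ==> p0 \<le> lst (r * S + c)"
  "r < cnt ==> c < len r ==> lst (r * S + c) < p" "r < cnt ==> c < len r ==> ch (lst (r * S + c)) = r"
  "x \<ge> cnt ==> len x = 0" "x \<ge> n ==> rem x = 0"
 using assms unfolding chunks_def by blast+

lemma chunk_list:
 assumes "chunks S n g p0 p cnt rem cur ind len lst ch" "r < cnt"
 shows "(\<exists>c<len r. P (lst (r * S + c))) \<longleftrightarrow> (\<exists>q. p0 \<le> q \<and> q < p \<and> ch q = r \<and> P q)"
proof
 assume "\<exists>c<len r. P (lst (r * S + c))"
 then show "\<exists>q. p0 \<le> q \<and> q < p \<and> ch q = r \<and> P q" using chunksD(7-9)[OF assms(1,2)] by blast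
next
 assume "\<exists>q. p0 \<le> q \<and> q < p \<and> ch q = r \<and> P q"
 then obtain q where q: "p0 \<le> q" "q < p" "ch q = r" "P q" by blast
 then obtain c where "c < len r" "lst (r * S + c) = q" using chunksD(3)[OF assms(1) q(1,2)] by blast
 then show "\<exists>c<len r. P (lst (r * S + c))" using q by blast
qed

lemma built_part:
 assumes bt: "built n S b (ar s aOI) (ar s aOK) (ar s aOA) p0 p1 s"
  and se: "sorted_entries n A (ar s aOI) (ar s aOK) (ar s aOA)"
  and p: "0 < n" "0 < S" "p0 \<le> p1" "p1 \<le> p0 + n * S" "p1 \<le> n * n"
 shows "part n S p0 p1 (vs s 14) (vs s 15) (ar s aOI) (ar s aOK) (ar s aOA) (ar s 16) (ar s 30)
  (sh b (ar s 19)) (sh b (ar s 24)) (sh b (ar s 27))"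
proof -
 have r: "chunks S n (ar s aOI) p0 p1 (vs s 14) (sh b (ar s 17)) (sh b (ar s 18)) (sh b (ar s 19)) (sh b (ar s 20)) (sh b (ar s 21)) (ar s 16)"
  and c: "chunks S n (ar s aOK) p0 p1 (vs s 15) (sh b (ar s 22)) (sh b (ar s 23)) (sh b (ar s 24)) (sh b (ar s 25)) (sh b (ar s 26)) (ar s 30)"
  using bt by (auto simp: built_def row_state_def col_state_def chunk_state_def)
 have lo: "\<forall>k<vs s 15. \<exists>q. p0 \<le> q \<and> q < p1 \<and> ar s 30 q = k \<and> sh b (ar s 27) k = ar s aOA q"
  "\<forall>q. p0 \<le> q --> q < p1 --> sh b (ar s 27) (ar s 30 q) \<le> ar s aOA q"
  using bt by (auto simp: built_def sh_def)
 have cn: "vs s 14 \<le> 2 * n" "vs s 15 \<le> 2 * n" using chunks_count[OF r p(4,2)] chunks_count[OF c p(4,2)] by auto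
 show ?thesis
 proof unfold_locales
  show "ar s aOI q < n" "ar s aOK q < n" if "q < n * n" for q using se that by (auto simp: sorted_entries_def)
  show "ar s aOA q' \<le> ar s aOA q" if "q \<le> q'" "q' < n * n" for q q'
   using se that unfolding sorted_entries_def by blast
  show "ar s 16 q < vs s 14" "sh b (ar s 19) (ar s 16 q) = ar s aOI q"
   "ar s 30 q < vs s 15" "sh b (ar s 24) (ar s 30 q) = ar s aOK q" if "p0 \<le> q" "q < p1" for q
   using chunksD(1,2)[OF r that] chunksD(1,2)[OF c that] by auto
  show "ar s 16 q \<le> ar s 16 q'" if "p0 \<le> q" "q < q'" "q' < p1" "ar s aOI q = ar s aOI q'" for q q'
   using chunksD(4)[OF r that] .
  show "ar s 30 q \<le> ar s 30 q'" if "p0 \<le> q" "q < q'" "q' < p1" "ar s aOK q = ar s aOK q'" for q q'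
   using chunksD(4)[OF c that] .
  show "sh b (ar s 19) x < n" if "x < vs s 14" for x using chunksD(6)[OF r that] .
  show "sh b (ar s 24) x < n" if "x < vs s 15" for x using chunksD(6)[OF c that] .
 qed (use lo cn p in simp_all)
qed

definition mark_com :: com where
 "mark_com = For 21 (Rd 25 (V vbase +. V 20)) (
   26 ::= Rd 26 (V vbase +. (V 20 *. V 11 +. V 21)) ;;
   CIf (Rd aOA (V 26) <. Rd aBV (V 23) +. N 1)
    (Wr 29 (V vbase +. (Rd 16 (V 26) *. V vN +. V 22)) (N 1)) CSkip)"

lemma mv_mark [simp]: "mv mark_com = {21, 26}" and ma_mark [simp]: "ma mark_com = {29}"
 by (auto simp: mark_com_def)

lemma wp_mark:
 fixes s :: st
 defines "q \<equiv> \<lambda>c. ar s 26 (vs s vbase + (vs s 20 * vs s 11 + c))"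
 assumes L: "ar s 25 (vs s vbase + vs s 20) = L" "L \<le> B" "1 \<le> B" "\<And>c. c < L ==> q c \<le> B"
 shows "wp B mark_com (\<lambda>s'. (\<forall>z. ar s' 29 z = (if \<exists>c<L. ar s aOA (q c) \<le> ar s aBV (vs s 23) \<and>
   z = vs s vbase + (ar s 16 (q c) * vs s vN + vs s 22) then 1 else ar s 29 z)) \<and> ck s' \<le> ck s + 120 * L + 20) s"
 unfolding mark_com_def
proof (rule wp_For[where I = "\<lambda>k s'. (\<forall>z. ar s' 29 z = (if \<exists>c<k. ar s aOA (q c) \<le> ar s aBV (vs s 23) \<and>
   z = vs s vbase + (ar s 16 (q c) * vs s vN + vs s 22) then 1 else ar s 29 z)) \<and> ck s' \<le> ck s + 120 * k + 3" and b = L], goal_cases)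
 case (4 k s')
 from 4(2) have sm: "same {21, 26} {29} s s'" by (simp add: insert_commute)
 have qk: "ar s 26 (vs s vbase + (vs s 20 * vs s 11 + k)) = q k" by (simp add: q_def)
 show ?case using 4(1,3,4) L
  by (auto simp: same_vs[OF sm] same_ar[OF sm] qk less_plus1_le ex_less_plus1)
qed (use L in \<open>auto simp: same_vs same_ar\<close>)

text \<open>Array 15 holds the flags, array 29 the marks \<open>M\<close>, and array 28 has the
  factor \<open>Y\<close> after its first \<open>vN * vN\<close> cells. A comparison
  \<open>x <. y +. N 1\<close> encodes \<open>x \<le> y\<close>.\<close>

definition mid_if :: com where
 "mid_if = CIf (Rd 15 (V 23)) (Wr aPM (V vbase +. (V vN *. V vN +. (V 20 *. V vN +. V 22))) (N 1))
    (CIf (Rd 27 (V vbase +. V 20) <. Rd aBV (V 23) +. N 1) (Wr 15 (V 23) (N 1) ;; mark_com) CSkip)"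

definition mid_com :: com where
 "mid_com = For 24 (V 15 *. V vn) (
   20 ::= V 24 /. V vn ;; 22 ::= V 24 -. V 20 *. V vn ;; 18 ::= Rd 24 (V vbase +. V 20) ;;
   23 ::= V 18 *. V vn +. V 22 ;;
   mid_if)"

lemma mv_mid_if [simp]: "mv mid_if = {21, 26}" and ma_mid_if [simp]: "ma mid_if = {15, 28, 29}"
 by (auto simp: mid_if_def)

lemma shift_upd: "(\<lambda>z. (f(b + (m + z0) := v)) (b + (m + z :: nat))) = (\<lambda>z. f (b + (m + z)))(z0 := (v :: nat))"
 by (auto simp: fun_eq_iff)

text \<open>Every execution of \<open>mark_com\<close> sets a flag that was 0, so
  \<open>300 * S * nnz\<close> is a potential whose growth pays for the scan of up to
  \<open>S\<close> positions. It stands on both sides of the bound to avoid subtraction of natural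
  numbers.\<close>

lemma wp_mid:
 fixes s0 :: st and n S p0 p1 b :: nat
 defines "D \<equiv> 2 * n" and "Bv \<equiv> ar s0 aBV"
 assumes P: "part n S p0 p1 (vs s0 14) (vs s0 15) (ar s0 aOI) (ar s0 aOK) (ar s0 aOA) (ar s0 16) (ar s0 30)
   (sh b (ar s0 19)) (sh b (ar s0 24)) (sh b (ar s0 27))"
  and cs: "chunks S n (ar s0 aOK) p0 p1 (vs s0 15) (sh b (ar s0 22)) (sh b (ar s0 23)) (sh b (ar s0 24)) (sh b (ar s0 25)) (sh b (ar s0 26)) (ar s0 30)"
  and v: "vs s0 vn = n" "vs s0 vN = D" "vs s0 vbase = b" "vs s0 11 = S"
  and F: "part.flag_inv n (ar s0 aOK) (ar s0 aOA) Bv p0 (ar s0 15)"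
  and z: "\<forall>x\<ge>D * D. ar s0 aPM (b + x) = 0" "\<forall>x. ar s0 29 (b + x) = 0"
  and B: "D * n \<le> B" "n * n \<le> B" "S \<le> B" "1 \<le> B" "2 * n \<le> B"
 shows "wp B mid_com (\<lambda>s. part.flag_inv n (ar s0 aOK) (ar s0 aOA) Bv p1 (ar s 15) \<and>
   part.marks n p0 p1 (vs s0 15) (ar s0 aOK) (ar s0 aOA) (ar s0 16) (ar s0 30) Bv (vs s0 15 * n)
    (\<lambda>z. ar s aPM (b + (D * D + z))) (\<lambda>z. ar s 29 (b + z)) \<and>
   (\<forall>x<D * D. ar s aPM (b + x) = ar s0 aPM (b + x)) \<and> (\<forall>x\<ge>2 * (D * D). ar s aPM (b + x) = 0) \<and>
   (\<forall>x\<ge>D * D. ar s 29 (b + x) = 0) \<and>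
   ck s + 300 * S * nnz (n * n) (ar s0 15) \<le> ck s0 + 200 * (D * n) + 20 + 300 * S * nnz (n * n) (ar s 15)) s0"
proof -
 interpret part n S p0 p1 "vs s0 14" "vs s0 15" "ar s0 aOI" "ar s0 aOK" "ar s0 aOA" "ar s0 16" "ar s0 30"
   "sh b (ar s0 19)" "sh b (ar s0 24)" "sh b (ar s0 27)" Bv by (rule P)
 let ?nc = "vs s0 15" and ?a = "ar s0 aOA" and ?cc = "ar s0 30" and ?rc = "ar s0 16" and ?ci = "sh b (ar s0 24)"
 define J where "J x s \<longleftrightarrow> fl x (ar s 15) \<and> marks x (\<lambda>z. ar s aPM (b + (D * D + z))) (\<lambda>z. ar s 29 (b + z)) \<and>
   (\<forall>x<D * D. ar s aPM (b + x) = ar s0 aPM (b + x)) \<and> (\<forall>x\<ge>2 * (D * D). ar s aPM (b + x) = 0) \<and>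
   (\<forall>x\<ge>D * D. ar s 29 (b + x) = 0) \<and>
   ck s + 300 * S * nnz (n * n) (ar s0 15) \<le> ck s0 + 200 * x + 3 + 300 * S * nnz (n * n) (ar s 15)" for x :: nat and s :: st
 have ncn: "?nc * n \<le> D * n" using nc by (simp add: D_def)
 have ncB: "?nc * n \<le> B" using ncn B(1) by (rule le_trans)
 show ?thesis unfolding mid_com_def
 proof (rule wp_For[where I = J and b = "?nc * n"], goal_cases)
  case 1
  have "marks 0 (\<lambda>z. ar s0 aPM (b + (D * D + z))) (\<lambda>z. ar s0 29 (b + z))" using z by (simp add: marks_def)
  then show ?case unfolding J_def using fl_0 F z by simp
 next
  case (4 x s)
  from 4(2) have sm: "same {18, 20, 21, 22, 23, 24, 26} {15, 28, 29} s0 s" by (rule same_mono) auto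
  define k where "k = x div n"
  define j where "j = x mod n"
  have x: "k < ?nc" "j < n" "x = k * n + j"
   using 4(4) n by (auto simp: k_def j_def less_mult_imp_div_less)
  have cin: "?ci k < n" using ci x by simp
  have nB: "n \<le> B" "2 * n \<le> B" using B(5) by auto
  have xj: "x div n = k" "x - k * n = j" using x(3) by (simp_all add: k_def)
  have kB: "k \<le> B" "j \<le> B" using x(1,2) nc nB by auto
  define y where "y = ?ci k * n + j"
  have y: "y < n * n" unfolding y_def using cell_less[OF cin x(2)] .
  have cB: "?ci k \<le> B" using cin nB by simp
  have Jx: "fl x (ar s 15)" "marks x (\<lambda>z. ar s aPM (b + (D * D + z))) (\<lambda>z. ar s 29 (b + z))"
   "\<forall>x<D * D. ar s aPM (b + x) = ar s0 aPM (b + x)" "\<forall>x\<ge>2 * (D * D). ar s aPM (b + x) = 0"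
   "\<forall>x\<ge>D * D. ar s 29 (b + x) = 0"
   "ck s + 300 * S * nnz (n * n) (ar s0 15) \<le> ck s0 + 200 * x + 3 + 300 * S * nnz (n * n) (ar s 15)"
   using 4(1) unfolding J_def by auto
  let ?s = "setv 10 23 y (setv 12 18 (?ci k) (setv 10 22 j (setv 7 20 k (tick 9 s))))"
  have kj: "k * D + j < D * D" using cell_less[of k D j D] x nc by (auto simp: D_def)
  have v': "vs s vn = n" "vs s vN = D" "vs s vbase = b" "vs s 11 = S" using v by (simp_all add: same_vs[OF sm])
  have e: "ar s0 24 (b + k) = ?ci k" "ar s0 27 (b + k) = sh b (ar s0 27) k" "ar s0 aBV = Bv" by (simp_all add: sh_def Bv_def)
  have "wp B mid_if (\<lambda>s''. vs s'' 24 = x \<and> J (x + 1) (setv 6 24 (x + 1) s'')) ?s"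
  proof (cases "ar s 15 y = 0")
   case False
   let ?s2 = "setv 6 24 (x + 1) (seta 99 aPM (b + (D * D + (k * D + j))) 1 (tick 8 ?s))"
   note f = mid_flagged[OF x _ Jx(1,2)]
   have "marks (x + 1) (\<lambda>z. ((ar s aPM)(b + (D * D + (k * D + j)) := 1)) (b + (D * D + z))) (\<lambda>z. ar s 29 (b + z))"
    unfolding shift_upd using f(2) False by (simp add: y_def D_def)
   moreover have "fl (x + 1) (ar s 15)" using f(1) False by (simp add: y_def)
   moreover have "(k * D + j) + D * D < 2 * (D * D)" using kj by simp
   ultimately show ?thesis unfolding mid_if_def using Jx False 4(3) B kj
    by (simp add: J_def v')
  next
   case True
   show ?thesis
   proof (cases "Bv y < sh b (ar s0 27) k")
    case low: True
    note f = mid_low[OF x _ _ Jx(1,2)]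
    have "fl (x + 1) (ar s 15)" "marks (x + 1) (\<lambda>z. ar s aPM (b + (D * D + z))) (\<lambda>z. ar s 29 (b + z))"
     using f low True by (simp_all add: y_def)
    then show ?thesis unfolding mid_if_def using Jx True low 4(3)
     by (simp add: J_def v' same_ar[OF sm] e less_plus1_le)
   next
    case high: False
    let ?L = "sh b (ar s0 25) k"
    let ?q = "\<lambda>c. sh b (ar s0 26) (k * S + c)"
    let ?s1 = "seta 8 15 y 1 (tick 21 (tick 8 ?s))"
    have LS: "?L \<le> S" by (rule chunksD(5)[OF cs x(1)])
    have qB: "?q c \<le> B" if "c < ?L" for c
     using chunksD(8)[OF cs x(1) that] p(2) B(2) by linarith
    have kc: "ar s0 aOK q = ?ci k" if "p0 \<le> q" "q < p1" "?cc q = k" for q using cc(2)[OF that(1,2)] that by simp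
    have "wp B mark_com (\<lambda>s'. (\<forall>z. ar s' 29 z = (if \<exists>c<?L. ?a (?q c) \<le> Bv y \<and>
      z = b + (?rc (?q c) * D + j) then 1 else ar s 29 z)) \<and> ck s' \<le> ck ?s1 + 120 * ?L + 20) ?s1"
     using wp_mark[of ?s1 ?L B] LS qB B v
     by (simp add: same_vs[OF sm] same_ar[OF sm] sh_def Bv_def cong: if_cong split del: if_split)
    then have "wp B mark_com (\<lambda>s''. vs s'' 24 = x \<and> J (x + 1) (setv 6 24 (x + 1) s'')) ?s1"
    proof (rule wp_conseq)
     fix s' assume s': "(\<forall>z. ar s' 29 z = (if \<exists>c<?L. ?a (?q c) \<le> Bv y \<and>
      z = b + (?rc (?q c) * D + j) then 1 else ar s 29 z)) \<and> ck s' \<le> ck ?s1 + 120 * ?L + 20"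
      and "same (mv mark_com) (ma mark_com) ?s1 s'"
     then have sm': "same {21, 26} {29} ?s1 s'" by simp
     have cl: "(\<exists>c<?L. ?a (?q c) \<le> Bv y \<and> b + z = b + (?rc (?q c) * D + j)) \<longleftrightarrow>
       (\<exists>q. p0 \<le> q \<and> q < p1 \<and> ?cc q = k \<and> dom q j \<and> z = ?rc q * D + j)" for z
      using chunk_list[OF cs x(1), of "\<lambda>q. ?a q \<le> Bv y \<and> b + z = b + (?rc q * D + j)"] kc
      unfolding dom_def y_def by auto
     have s29: "ar s' 29 (b + z) = (if \<exists>q. p0 \<le> q \<and> q < p1 \<and> ?cc q = k \<and> dom q j \<and> z = ?rc q * D + j
       then 1 else ar s 29 (b + z))" for z
      using conjunct1[OF s', rule_format, of "b + z"] unfolding cl .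
     have M': "ar s' 29 (b + (r * D + j')) \<noteq> 0 \<longleftrightarrow> ar s 29 (b + (r * D + j')) \<noteq> 0 \<or>
       j' = j \<and> (\<exists>q. p0 \<le> q \<and> q < p1 \<and> ?cc q = k \<and> ?rc q = r \<and> dom q j)" if "j' < 2 * n" for r j'
     proof -
      have e: "r * D + j' = ?rc q * D + j \<longleftrightarrow> ?rc q = r \<and> j' = j" for q
       using cell_eq[of j' D j r "?rc q"] that x(2) by (auto simp: D_def)
      show ?thesis unfolding s29 e by auto
     qed
     have zz: "ar s' 29 (b + z) = 0" if "z \<ge> D * D" for z
     proof -
      have "z \<noteq> ?rc q * D + j" if "p0 \<le> q" "q < p1" for q
       using cell_less[of "?rc q" D j D] rc(1)[OF that] nr x(2) \<open>z \<ge> D * D\<close> by (auto simp: D_def)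
      then show ?thesis using Jx(5) that unfolding s29 by auto
     qed
     have f: "fl (x + 1) ((ar s 15)(y := 1))" "marks (x + 1) (\<lambda>z. ar s aPM (b + (D * D + z))) (\<lambda>z. ar s' 29 (b + z))"
      using mid_new[OF x _ Jx(1,2), of "\<lambda>z. ar s' 29 (b + z)"] high M' by (simp_all add: y_def D_def)
     have "120 * ?L + 20 + 50 \<le> 300 * S + 50" using LS S by simp
     then have "ck s' + 6 + 300 * S * nnz (n * n) (ar s0 15) \<le>
       ck s0 + 200 * (x + 1) + 3 + 300 * S * nnz (n * n) ((ar s 15)(y := 1))"
      using s' Jx(6) nnz_upd[of y "n * n" "ar s 15", OF y True] by (simp add: algebra_simps)
     then show "vs s' 24 = x \<and> J (x + 1) (setv 6 24 (x + 1) s')"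
      using f zz Jx 4(3) by (simp add: J_def same_vs[OF sm'] same_ar[OF sm'])
    qed
    then show ?thesis unfolding mid_if_def using True high B
     by (simp add: v' same_ar[OF sm] e less_plus1_le)
   qed
  qed
  moreover have "?ci k * n + j \<le> B" using y B unfolding y_def by simp
  ultimately show ?case using 4(3) kB cB
   by (simp add: v' same_ar[OF sm] xj e y_def)
 next
  case (5 s)
  then have J: "J (?nc * n) s" by simp
  then have "ck s + 9 + 300 * S * nnz (n * n) (ar s0 15) \<le> ck s0 + 200 * (D * n) + 20 + 300 * S * nnz (n * n) (ar s 15)"
   using ncn unfolding J_def by linarith
  then show ?case using fl_end J unfolding J_def by simp
 qed (use v ncB in \<open>auto simp: same_vs\<close>)
qed

definition scan_com :: com where
 "scan_com = For 21 (Rd 20 (V vbase +. V 19)) (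
   26 ::= Rd 21 (V vbase +. (V 19 *. V 11 +. V 21)) ;;
   CIf (Rd aOA (V 26) <. Rd aBV (Rd aOK (V 26) *. V vn +. V 22) +. N 1)
    (CIf (Rd aCV (V 23) <. Rd aOA (V 26)) (Wr aCV (V 23) (Rd aOA (V 26))) CSkip) CSkip)"

lemma mv_scan [simp]: "mv scan_com = {21, 26}" and ma_scan [simp]: "ma scan_com = {9}"
 by (auto simp: scan_com_def)

lemma wp_scan:
 fixes s :: st
 defines "q \<equiv> \<lambda>c. ar s 21 (vs s vbase + (vs s 19 * vs s 11 + c))"
 defines "P \<equiv> \<lambda>c. ar s aOA (q c) \<le> ar s aBV (ar s aOK (q c) * vs s vn + vs s 22)"
 assumes L: "ar s 20 (vs s vbase + vs s 19) = L" "L \<le> B" "\<And>c. c < L ==> q c \<le> B" "\<And>c. c < L ==> ar s aOA (q c) \<le> B"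
 shows "wp B scan_com (\<lambda>s'. (\<forall>z. z \<noteq> vs s 23 --> ar s' aCV z = ar s aCV z) \<and>
   (\<forall>c<L. P c --> ar s aOA (q c) \<le> ar s' aCV (vs s 23)) \<and>
   (ar s' aCV (vs s 23) = ar s aCV (vs s 23) \<or> (\<exists>c<L. P c \<and> ar s' aCV (vs s 23) = ar s aOA (q c))) \<and>
   ck s' \<le> ck s + 150 * L + 20) s"
 unfolding scan_com_def
proof (rule wp_For[where I = "\<lambda>k s'. (\<forall>z. z \<noteq> vs s 23 --> ar s' aCV z = ar s aCV z) \<and>
   (\<forall>c<k. P c --> ar s aOA (q c) \<le> ar s' aCV (vs s 23)) \<and>
   (ar s' aCV (vs s 23) = ar s aCV (vs s 23) \<or> (\<exists>c<k. P c \<and> ar s' aCV (vs s 23) = ar s aOA (q c))) \<and>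
   ck s' \<le> ck s + 150 * k + 3" and b = L], goal_cases)
 case (4 k s')
 from 4(2) have sm: "same {21, 26} {9} s s'" by (simp add: insert_commute)
 have qk: "ar s 21 (vs s vbase + (vs s 19 * vs s 11 + k)) = q k" by (simp add: q_def)
 have Pk: "ar s aOA (q k) \<le> ar s aBV (ar s aOK (q k) * vs s vn + vs s 22) \<longleftrightarrow> P k" by (simp add: P_def)
 have B: "q k \<le> B" "ar s aOA (q k) \<le> B" using L 4(4) by auto
 have le: "ar s aOA (q c) \<le> ar s aOA (q k)" if "c < k" "P c" "ar s' aCV (vs s 23) < ar s aOA (q k)" for c
  using 4(1) that by (meson le_less_trans less_imp_le)
 show ?case using 4(1,3) B le
  by (auto simp: same_vs[OF sm] same_ar[OF sm] qk less_plus1_le[of "ar s aOA (q k)"] Pk all_less_plus1 ex_less_plus1 not_less)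
qed (use L in \<open>auto simp: same_vs same_ar\<close>)

definition fin_if :: com where
 "fin_if = CIf (Rd 14 (V 23)) CSkip
   (CIf (Rd aPM (V vbase +. (N 2 *. (V vN *. V vN) +. (V 19 *. V vN +. V 22))) +.
      Rd 29 (V vbase +. (V 19 *. V vN +. V 22)))
    (Wr 14 (V 23) (N 1) ;; scan_com) CSkip)"

definition fin_com :: com where
 "fin_com = For 24 (V 14 *. V vn) (
   19 ::= V 24 /. V vn ;; 22 ::= V 24 -. V 19 *. V vn ;; 17 ::= Rd 19 (V vbase +. V 19) ;;
   23 ::= V 17 *. V vn +. V 22 ;; fin_if)"

lemma mv_fin_if [simp]: "mv fin_if = {21, 26}" and ma_fin_if [simp]: "ma fin_if = {9, 14}"
 by (auto simp: fin_if_def)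

text \<open>The same potential argument with array 14, which marks the finished result entries: each
  of them is scanned for at most once over all parts. The hypothesis on array 28 is stated on sums
  because a hit may come from the product or from a mark.\<close>

lemma wp_fin:
 fixes s0 :: st and n S p0 p1 b :: nat
 defines "D \<equiv> 2 * n" and "Bv \<equiv> ar s0 aBV"
 assumes P: "part n S p0 p1 (vs s0 14) (vs s0 15) (ar s0 aOI) (ar s0 aOK) (ar s0 aOA) (ar s0 16) (ar s0 30)
   (sh b (ar s0 19)) (sh b (ar s0 24)) (sh b (ar s0 27))"
  and cs: "chunks S n (ar s0 aOI) p0 p1 (vs s0 14) (sh b (ar s0 17)) (sh b (ar s0 18)) (sh b (ar s0 19)) (sh b (ar s0 20)) (sh b (ar s0 21)) (ar s0 16)"
  and v: "vs s0 vn = n" "vs s0 vN = D" "vs s0 vbase = b" "vs s0 11 = S"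
  and F: "part.done_inv n (ar s0 aOI) (ar s0 aOK) (ar s0 aOA) Bv p0 (ar s0 14) (ar s0 aCV)"
  and marked: "\<And>r j. r < vs s0 14 ==> j < n ==>
    ar s0 aPM (b + (2 * (D * D) + (r * D + j))) + ar s0 29 (b + (r * D + j)) \<noteq> 0 \<longleftrightarrow>
    (\<exists>q. p0 \<le> q \<and> q < p1 \<and> ar s0 16 q = r \<and> part.dom n (ar s0 aOK) (ar s0 aOA) Bv q j)"
  and B: "D * n \<le> B" "n * n \<le> B" "S \<le> B" "1 \<le> B" "2 * n \<le> B" "\<forall>q<n * n. ar s0 aOA q \<le> B"
 shows "wp B fin_com (\<lambda>s. part.done_inv n (ar s0 aOI) (ar s0 aOK) (ar s0 aOA) Bv p1 (ar s 14) (ar s aCV) \<and>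
   ck s + 300 * S * nnz (n * n) (ar s0 14) \<le> ck s0 + 300 * (D * n) + 20 + 300 * S * nnz (n * n) (ar s 14)) s0"
proof -
 interpret part n S p0 p1 "vs s0 14" "vs s0 15" "ar s0 aOI" "ar s0 aOK" "ar s0 aOA" "ar s0 16" "ar s0 30"
   "sh b (ar s0 19)" "sh b (ar s0 24)" "sh b (ar s0 27)" Bv by (rule P)
 let ?nr = "vs s0 14" and ?a = "ar s0 aOA" and ?rc = "ar s0 16" and ?ri = "sh b (ar s0 19)"
 define J where "J x s \<longleftrightarrow> dn x (ar s 14) (ar s aCV) \<and>
   ck s + 300 * S * nnz (n * n) (ar s0 14) \<le> ck s0 + 300 * x + 3 + 300 * S * nnz (n * n) (ar s 14)" for x :: nat and s :: st
 have nrn: "?nr * n \<le> D * n" using nr by (simp add: D_def)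
 have nrB: "?nr * n \<le> B" using nrn B(1) by (rule le_trans)
 show ?thesis unfolding fin_com_def
 proof (rule wp_For[where I = J and b = "?nr * n"], goal_cases)
  case 1
  show ?case unfolding J_def using dn_0 F by simp
 next
  case (4 x s)
  from 4(2) have sm: "same {17, 19, 21, 22, 23, 24, 26} {9, 14} s0 s" by (rule same_mono) auto
  define r where "r = x div n"
  define j where "j = x mod n"
  have x: "r < ?nr" "j < n" "x = r * n + j"
   using 4(4) n by (auto simp: r_def j_def less_mult_imp_div_less)
  have xj: "x div n = r" "x - r * n = j" using x(3) by (simp_all add: r_def)
  have kB: "r \<le> B" "j \<le> B" using x(1,2) nr B(5) by auto
  have rin: "?ri r < n" using ri x by simp
  define y where "y = ?ri r * n + j"
  have y: "y < n * n" unfolding y_def using cell_less[OF rin x(2)] .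
  have cB: "?ri r \<le> B" using rin B(5) by simp
  have Jx: "dn x (ar s 14) (ar s aCV)"
   "ck s + 300 * S * nnz (n * n) (ar s0 14) \<le> ck s0 + 300 * x + 3 + 300 * S * nnz (n * n) (ar s 14)"
   using 4(1) unfolding J_def by auto
  let ?s = "setv 10 23 y (setv 12 17 (?ri r) (setv 10 22 j (setv 7 19 r (tick 9 s))))"
  have v': "vs s vn = n" "vs s vN = D" "vs s vbase = b" "vs s 11 = S" using v by (simp_all add: same_vs[OF sm])
  have e: "ar s0 19 (b + r) = ?ri r" "ar s0 aBV = Bv" by (simp_all add: sh_def Bv_def)
  have "wp B fin_if (\<lambda>s''. vs s'' 24 = x \<and> J (x + 1) (setv 6 24 (x + 1) s'')) ?s"
  proof (cases "ar s 14 y = 0 \<and> ar s0 aPM (b + (2 * (D * D) + (r * D + j))) + ar s0 29 (b + (r * D + j)) \<noteq> 0")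
   case False
   have "dn (x + 1) (ar s 14) (ar s aCV)"
    by (rule fin_skip[OF x Jx(1)]) (use False marked[OF x(1,2)] in \<open>auto simp: y_def\<close>)
   then show ?thesis unfolding fin_if_def using Jx False 4(3)
    by (auto simp: J_def v' same_ar[OF sm])
  next
   case True
   have ex: "\<exists>q. p0 \<le> q \<and> q < p1 \<and> ?rc q = r \<and> dom q j" using marked[OF x(1,2)] True by simp
   let ?L = "sh b (ar s0 20) r"
   let ?q = "\<lambda>c. sh b (ar s0 21) (r * S + c)"
   let ?s1 = "seta 8 14 y 1 (tick 42 (tick 8 ?s))"
   have LS: "?L \<le> S" by (rule chunksD(5)[OF cs x(1)])
   have qn: "?q c < n * n" if "c < ?L" for c using chunksD(8)[OF cs x(1) that] p(2) by linarith
   have qB: "?q c \<le> B" "?a (?q c) \<le> B" if "c < ?L" for c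
    using qn[OF that] B(2,6) by auto
   have "wp B scan_com (\<lambda>s'. (\<forall>z. z \<noteq> y --> ar s' aCV z = ar s aCV z) \<and>
     (\<forall>c<?L. dom (?q c) j --> ?a (?q c) \<le> ar s' aCV y) \<and>
     (ar s' aCV y = ar s aCV y \<or> (\<exists>c<?L. dom (?q c) j \<and> ar s' aCV y = ?a (?q c))) \<and>
     ck s' \<le> ck ?s1 + 150 * ?L + 20) ?s1"
    using wp_scan[of ?s1 ?L B] LS qB B
    by (simp add: v' same_ar[OF sm] sh_def e(2) dom_def)
   then have "wp B scan_com (\<lambda>s''. vs s'' 24 = x \<and> J (x + 1) (setv 6 24 (x + 1) s'')) ?s1"
   proof (rule wp_conseq)
    fix s' assume s': "(\<forall>z. z \<noteq> y --> ar s' aCV z = ar s aCV z) \<and>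
     (\<forall>c<?L. dom (?q c) j --> ?a (?q c) \<le> ar s' aCV y) \<and>
     (ar s' aCV y = ar s aCV y \<or> (\<exists>c<?L. dom (?q c) j \<and> ar s' aCV y = ?a (?q c))) \<and>
     ck s' \<le> ck ?s1 + 150 * ?L + 20"
     and "same (mv scan_com) (ma scan_com) ?s1 s'"
    then have sm': "same {21, 26} {9} ?s1 s'" by simp
    have f: "dn (x + 1) ((ar s 14)(y := 1)) (ar s' aCV)"
    proof (rule fin_scan[OF x y_def Jx(1) _ ex])
     show "ar s 14 y = 0" using True by simp
     show "ar s' aCV z = ar s aCV z" if "z \<noteq> y" for z using s' that by simp
     show "?a q \<le> ar s' aCV y" if "p0 \<le> q" "q < p1" "?rc q = r" "dom q j" for q
      using chunk_list[OF cs x(1), of "\<lambda>q'. q' = q"] that s' by auto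
     show "ar s' aCV y = ar s aCV y \<or> (\<exists>q. p0 \<le> q \<and> q < p1 \<and> ?rc q = r \<and> dom q j \<and> ar s' aCV y = ?a q)"
      using chunk_list[OF cs x(1), of "\<lambda>q. dom q j \<and> ar s' aCV y = ?a q"] s' by auto
    qed
    have "150 * ?L + 20 + 50 \<le> 300 * S + 50" using LS S by simp
    then have "ck s' + 6 + 300 * S * nnz (n * n) (ar s0 14) \<le>
      ck s0 + 300 * (x + 1) + 3 + 300 * S * nnz (n * n) ((ar s 14)(y := 1))"
     using s' Jx(2) nnz_upd[OF y, of "ar s 14"] True by (simp add: algebra_simps)
    then show "vs s' 24 = x \<and> J (x + 1) (setv 6 24 (x + 1) s')"
     using f Jx 4(3) by (simp add: J_def same_vs[OF sm'] same_ar[OF sm'])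
   qed
   then show ?thesis unfolding fin_if_def using True B
    by (simp add: v' same_ar[OF sm])
  qed
  moreover have "?ri r * n + j \<le> B" using y B unfolding y_def by simp
  ultimately show ?case using 4(3) kB cB
   by (simp add: v' same_ar[OF sm] xj e y_def)
 next
  case (5 s)
  then have J: "J (?nr * n) s" by simp
  then have "ck s + 9 + 300 * S * nnz (n * n) (ar s0 14) \<le> ck s0 + 300 * (D * n) + 20 + 300 * S * nnz (n * n) (ar s 14)"
   using nrn unfolding J_def by linarith
  then show ?case using dn_end J unfolding J_def by simp
 qed (use v nrB in \<open>auto simp: same_vs\<close>)
qed

lemma mv_build [simp]: "mv build_com = {14, 15, 16, 17, 18, 19, 20, 21, 24}"
 and ma_build [simp]: "ma build_com = {16, 17, 18, 19, 20, 21, 22, 23, 24, 25, 26, 27, 28, 30}"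
 by (auto simp: build_com_def)

lemma mv_mid [simp]: "mv mid_com = {18, 20, 21, 22, 23, 24, 26}" and ma_mid [simp]: "ma mid_com = {15, 28, 29}"
 by (auto simp: mid_com_def)

lemma mv_fin [simp]: "mv fin_com = {17, 19, 21, 22, 23, 24, 26}" and ma_fin [simp]: "ma fin_com = {9, 14}"
 by (auto simp: fin_com_def)

definition part_com :: "com => com" where
 "part_com mm =
  (13 ::= V 12 +. V vn *. V 11 ;; CIf (V vnn <. V 13) (13 ::= V vnn) CSkip ;; 14 ::= N 0 ;; 15 ::= N 0 ;;
   build_com ;; mid_com ;; mm ;; fin_com)"

text \<open>The arrays that a part expects to be zero from its base on: free space and lengths of
  the row chunks (17 and 20) and of the column chunks (22 and 25), the memory of the multiplier (28)
  and the marks (29).\<close>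

definition fresh :: "nat => st => bool" where
 "fresh b s \<longleftrightarrow> (\<forall>a\<in>{17, 20, 22, 25, 28, 29}. \<forall>x\<ge>b. ar s a x = 0)"

definition flagi :: "nat => st => nat => st => bool" where
 "flagi n s0 p s = part.flag_inv n (ar s0 aOK) (ar s0 aOA) (ar s0 aBV) p (ar s 15)"

definition donei :: "nat => st => nat => st => bool" where
 "donei n s0 p s = part.done_inv n (ar s0 aOI) (ar s0 aOK) (ar s0 aOA) (ar s0 aBV) p (ar s 14) (ar s aCV)"

lemma fresh_shift: "fresh b s ==> a \<in> {17, 20, 22, 25, 28, 29} ==> ar s a (b + x) = 0"
 unfolding fresh_def by (metis le_add1)

text \<open>The next base is \<open>b + Q\<close>: group and chunk numbers are at most
  \<open>2 * n\<close>, marks stay below \<open>D * D\<close>, and the multiplication leaves nothing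
  from \<open>Q\<close> on, so all scratch arrays are still zero there.\<close>

lemma wp_part:
 fixes s :: st and n S p0 b C B Q \<tau> :: nat and mm :: com
 defines "p1 \<equiv> min (p0 + n * S) (n * n)" and "D \<equiv> 2 * n"
 assumes v: "vs s vn = n" "vs s vnn = n * n" "vs s vN = 2 * n" "vs s vbase = b" "vs s 11 = S" "vs s 12 = p0"
  and pos: "0 < n" "0 < S" "p0 < n * n"
  and se: "sorted_entries n A (ar s aOI) (ar s aOK) (ar s aOA)"
  and inv: "flagi n s p0 s" "donei n s p0 s" and fr: "fresh b s"
  and mm: "mm_spec C mm (2 * n) B Q \<tau>" and X: "vs s vX + \<tau> \<le> B"
  and Q: "2 * (D * D) \<le> Q" "D \<le> Q"
  and B: "p0 + n * S \<le> B" "2 * n + 1 \<le> B" "S + 1 \<le> B" "n * n + 1 \<le> B" "D * n \<le> B" "\<forall>q<n * n. ar s aOA q \<le> B"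
 shows "wp B (part_com mm) (\<lambda>s'. flagi n s p1 s' \<and> donei n s p1 s' \<and> fresh (b + Q) s' \<and>
  vs s vX \<le> vs s' vX \<and> vs s' vX \<le> vs s vX + \<tau> \<and>
  ck s' + 300 * S * (nnz (n * n) (ar s 14) + nnz (n * n) (ar s 15)) \<le>
   ck s + 600 * (p1 - p0) + 500 * (D * n) + C * (vs s' vX - vs s vX) + C + 200 +
   300 * S * (nnz (n * n) (ar s' 14) + nnz (n * n) (ar s' 15))) s"
proof -
 have D0: "0 < D" using pos by (simp add: D_def)
 have p: "p0 \<le> p1" "p1 \<le> p0 + n * S" "p1 \<le> n * n" using pos by (auto simp: p1_def)
 define s1 where "s1 = (if n * n < p0 + n * S then setv 3 15 0 (setv 3 14 0 (setv 4 13 (n * n) (tick 6 (setv 10 13 (p0 + n * S) s))))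
   else setv 3 15 0 (setv 3 14 0 (tick 1 (tick 6 (setv 10 13 (p0 + n * S) s)))))"
 have s1: "vs s1 vn = n" "vs s1 vN = 2 * n" "vs s1 vbase = b" "vs s1 11 = S" "vs s1 12 = p0" "vs s1 13 = p1" "vs s1 14 = 0" "vs s1 15 = 0"
  "vs s1 vX = vs s vX" "ar s1 = ar s" "ck s1 \<le> ck s + 30"
  using v by (auto simp: s1_def p1_def)
 have b1: "wp B build_com (\<lambda>s'. built n S b (ar s1 aOI) (ar s1 aOK) (ar s1 aOA) p0 p1 s' \<and>
  ck s' \<le> ck s1 + 600 * (p1 - p0) + 20) s1"
  by (rule wp_build[OF s1(1-8)]) (use fr p B se s1(10) in \<open>auto simp: fresh_shift\<close>)
 have "wp B build_com (wp B (mid_com ;; mm ;; fin_com) (\<lambda>s'. flagi n s p1 s' \<and> donei n s p1 s' \<and> fresh (b + Q) s' \<and>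
  vs s vX \<le> vs s' vX \<and> vs s' vX \<le> vs s vX + \<tau> \<and>
  ck s' + 300 * S * (nnz (n * n) (ar s 14) + nnz (n * n) (ar s 15)) \<le>
   ck s + 600 * (p1 - p0) + 500 * (D * n) + C * (vs s' vX - vs s vX) + C + 200 +
   300 * S * (nnz (n * n) (ar s' 14) + nnz (n * n) (ar s' 15)))) s1" (is "wp _ _ (wp _ _ ?Q) _")
 proof (rule wp_conseq[OF b1])
  fix s2 assume s2: "built n S b (ar s1 aOI) (ar s1 aOK) (ar s1 aOA) p0 p1 s2 \<and> ck s2 \<le> ck s1 + 600 * (p1 - p0) + 20"
   and "same (mv build_com) (ma build_com) s1 s2"
  then have sm2: "same {14, 15, 16, 17, 18, 19, 20, 21, 24} {16, 17, 18, 19, 20, 21, 22, 23, 24, 25, 26, 27, 28, 30} s1 s2" by simp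
  have arr: "ar s2 aOI = ar s aOI" "ar s2 aOK = ar s aOK" "ar s2 aOA = ar s aOA" "ar s2 aBV = ar s aBV" "ar s2 15 = ar s 15"
   "ar s2 14 = ar s 14" "ar s2 aCV = ar s aCV" "ar s2 29 = ar s 29"
   by (simp_all add: same_ar[OF sm2] s1)
  have bt: "built n S b (ar s2 aOI) (ar s2 aOK) (ar s2 aOA) p0 p1 s2" using s2 s1(10) by (simp add: arr)
  have P: "part n S p0 p1 (vs s2 14) (vs s2 15) (ar s2 aOI) (ar s2 aOK) (ar s2 aOA) (ar s2 16) (ar s2 30)
   (sh b (ar s2 19)) (sh b (ar s2 24)) (sh b (ar s2 27))"
   by (rule built_part[OF bt]) (use se arr pos p in auto)
  then interpret part n S p0 p1 "vs s2 14" "vs s2 15" "ar s2 aOI" "ar s2 aOK" "ar s2 aOA" "ar s2 16" "ar s2 30"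
   "sh b (ar s2 19)" "sh b (ar s2 24)" "sh b (ar s2 27)" "ar s2 aBV" .
  have rs: "chunks S n (ar s2 aOI) p0 p1 (vs s2 14) (sh b (ar s2 17)) (sh b (ar s2 18)) (sh b (ar s2 19)) (sh b (ar s2 20)) (sh b (ar s2 21)) (ar s2 16)"
   and cs: "chunks S n (ar s2 aOK) p0 p1 (vs s2 15) (sh b (ar s2 22)) (sh b (ar s2 23)) (sh b (ar s2 24)) (sh b (ar s2 25)) (sh b (ar s2 26)) (ar s2 30)"
   using bt by (auto simp: built_def row_state_def col_state_def chunk_state_def)
  have v2: "vs s2 vn = n" "vs s2 vN = D" "vs s2 vbase = b" "vs s2 11 = S" "vs s2 vX = vs s vX"
   using s1 by (simp_all add: same_vs[OF sm2] D_def)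
  have X01: "ar s2 aPM (b + (r * D + k)) = (if \<exists>q. p0 \<le> q \<and> q < p1 \<and> r = ar s2 16 q \<and> k = ar s2 30 q then 1 else 0)"
   if "r < D" "k < D" for r k
   using bt that unfolding built_def D_def by blast
  have Xz: "\<forall>x\<ge>D * D. ar s2 aPM (b + x) = 0" using bt unfolding built_def D_def by blast
  have b2: "wp B mid_com (\<lambda>s. flag_inv p1 (ar s 15) \<and>
   marks (vs s2 15 * n) (\<lambda>z. ar s aPM (b + (D * D + z))) (\<lambda>z. ar s 29 (b + z)) \<and>
   (\<forall>x<D * D. ar s aPM (b + x) = ar s2 aPM (b + x)) \<and> (\<forall>x\<ge>2 * (D * D). ar s aPM (b + x) = 0) \<and>
   (\<forall>x\<ge>D * D. ar s 29 (b + x) = 0) \<and>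
   ck s + 300 * S * nnz (n * n) (ar s2 15) \<le> ck s2 + 200 * (D * n) + 20 + 300 * S * nnz (n * n) (ar s 15)) s2"
   unfolding D_def
  proof (rule wp_mid[OF P cs])
   show "flag_inv p0 (ar s2 15)" using inv(1) unfolding flagi_def arr .
  qed (use v2 Xz fr B pos in \<open>auto simp: D_def arr fresh_shift\<close>)
  show "wp B (mid_com ;; mm ;; fin_com) ?Q s2" unfolding wp_Seq
  proof (rule wp_conseq[OF b2])
   fix s3 assume s3: "flag_inv p1 (ar s3 15) \<and>
     marks (vs s2 15 * n) (\<lambda>z. ar s3 aPM (b + (D * D + z))) (\<lambda>z. ar s3 29 (b + z)) \<and>
     (\<forall>x<D * D. ar s3 aPM (b + x) = ar s2 aPM (b + x)) \<and> (\<forall>x\<ge>2 * (D * D). ar s3 aPM (b + x) = 0) \<and>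
     (\<forall>x\<ge>D * D. ar s3 29 (b + x) = 0) \<and>
     ck s3 + 300 * S * nnz (n * n) (ar s2 15) \<le> ck s2 + 200 * (D * n) + 20 + 300 * S * nnz (n * n) (ar s3 15)"
    and "same (mv mid_com) (ma mid_com) s2 s3"
   then have sm3: "same {18, 20, 21, 22, 23, 24, 26} {15, 28, 29} s2 s3" by simp
   have mk: "marks (vs s2 15 * n) (\<lambda>z. ar s3 aPM (b + (D * D + z))) (\<lambda>z. ar s3 29 (b + z))" using s3 by simp
   have cell: "x div D < D" "x mod D < D" "x div D * D + x mod D = x" if "x < D * D" for x
    using that D0 by (auto simp: less_mult_imp_div_less)
   \<comment> \<open>The multiplier is specified for 0/1 matrices: the first block is the incidence
     matrix, the second is \<open>Y\<close>, and the rest is zero.\<close>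
   have le1: "ar s3 aPM (b + x) \<le> 1" for x
   proof (cases "x < D * D")
    case True
    then show ?thesis using s3 X01[OF cell(1,2)[OF True]] cell(3)[OF True] by auto
   next
    case False
    show ?thesis
    proof (cases "x < 2 * (D * D)")
     case True
     define y where "y = x - D * D"
     have y: "y < D * D" "x = D * D + y" using True False by (auto simp: y_def)
     show ?thesis using marksD(2)[OF mk, of "y div D" "y mod D"] cell[OF y(1)] unfolding y(2) D_def[symmetric] by simp
    qed (use s3 in auto)
   qed
   have b3: "wp B mm (\<lambda>s'. (\<forall>i<D. \<forall>j<D. ar s' aPM (b + (2 * (D * D) + i * D + j)) =
     (\<Sum>l<D. ar s3 aPM (b + (i * D + l)) * ar s3 aPM (b + (D * D + l * D + j)))) \<and>
    (\<forall>x\<ge>Q. ar s' aPM (b + x) = 0) \<and> vs s vX \<le> vs s' vX \<and> vs s' vX \<le> vs s vX + \<tau> \<and>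
    ck s' \<le> ck s3 + C * (vs s' vX - vs s vX) + C) s3"
   proof -
    have "mm_spec C mm D B Q \<tau>" using mm by (simp add: D_def)
    note mm' = this[unfolded mm_spec_def, THEN conjunct2, THEN conjunct2, rule_format, of s3]
    have v3: "vs s3 vN = D" "vs s3 vbase = b" "vs s3 vX = vs s vX" using v2 by (simp_all add: same_vs[OF sm3])
    show ?thesis using mm'[OF v3(1)] le1 s3 X unfolding v3 by simp
   qed
   have mmv: "mv mm \<subseteq> insert vX {100..}" "ma mm \<subseteq> {aPM}" using mm by (auto simp: mm_spec_def)
   show "wp B mm (wp B fin_com ?Q) s3"
   proof (rule wp_conseq[OF b3])
    fix s4 assume s4: "(\<forall>i<D. \<forall>j<D. ar s4 aPM (b + (2 * (D * D) + i * D + j)) =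
     (\<Sum>l<D. ar s3 aPM (b + (i * D + l)) * ar s3 aPM (b + (D * D + l * D + j)))) \<and>
     (\<forall>x\<ge>Q. ar s4 aPM (b + x) = 0) \<and> vs s vX \<le> vs s4 vX \<and> vs s4 vX \<le> vs s vX + \<tau> \<and>
     ck s4 \<le> ck s3 + C * (vs s4 vX - vs s vX) + C"
     and "same (mv mm) (ma mm) s3 s4"
    then have sm4: "same (insert vX {100..}) {28} s3 s4" using mmv by (auto intro: same_mono)
    have ar4: "ar s4 a = ar s2 a" if "a \<notin> {15, 28, 29}" for a
     using that by (simp add: same_ar[OF sm4] same_ar[OF sm3])
    have vs4: "vs s4 14 = vs s2 14" "vs s4 15 = vs s2 15" "vs s4 vn = n" "vs s4 vN = D" "vs s4 vbase = b" "vs s4 11 = S"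
     using v2 by (simp_all add: same_vs[OF sm4] same_vs[OF sm3])
    have marked: "ar s4 aPM (b + (2 * (D * D) + (r * D + j))) + ar s4 29 (b + (r * D + j)) \<noteq> 0 \<longleftrightarrow>
      (\<exists>q. p0 \<le> q \<and> q < p1 \<and> ar s2 16 q = r \<and> dom q j)" if rj: "r < vs s2 14" "j < n" for r j
    proof -
     have "r < D" "j < D" using rj nr by (auto simp: D_def)
     then have "ar s4 aPM (b + (2 * (D * D) + (r * D + j))) =
       (\<Sum>l<D. ar s3 aPM (b + (r * D + l)) * ar s3 aPM (b + (D * D + (l * D + j))))"
      using s4 by (simp add: add.assoc)
     also have "\<dots> = (\<Sum>l<D. ar s2 aPM (b + (r * D + l)) * ar s3 aPM (b + (D * D + (l * D + j))))"
      using s3 cell_less[OF \<open>r < D\<close>, of _ D] by (intro sum.cong) auto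
     finally have e: "ar s4 aPM (b + (2 * (D * D) + (r * D + j))) =
       (\<Sum>l<2 * n. ar s2 aPM (b + (r * (2 * n) + l)) * ar s3 aPM (b + (D * D + (l * (2 * n) + j))))" by (simp add: D_def)
     have e29: "ar s4 29 = ar s3 29" by (simp add: same_ar[OF sm4])
     show ?thesis unfolding e e29
      using marks_end[OF mk rj, of "\<lambda>z. ar s2 aPM (b + z)"] X01 by (simp add: D_def)
    qed
    have b4: "wp B fin_com (\<lambda>s. done_inv p1 (ar s 14) (ar s aCV) \<and>
     ck s + 300 * S * nnz (n * n) (ar s4 14) \<le> ck s4 + 300 * (D * n) + 20 + 300 * S * nnz (n * n) (ar s 14)) s4"
    proof -
     have "wp B fin_com (\<lambda>s. part.done_inv n (ar s4 aOI) (ar s4 aOK) (ar s4 aOA) (ar s4 aBV) p1 (ar s 14) (ar s aCV) \<and>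
      ck s + 300 * S * nnz (n * n) (ar s4 14) \<le> ck s4 + 300 * (2 * n * n) + 20 + 300 * S * nnz (n * n) (ar s 14)) s4"
     proof (rule wp_fin)
      show "part n S p0 p1 (vs s4 14) (vs s4 15) (ar s4 aOI) (ar s4 aOK) (ar s4 aOA) (ar s4 16) (ar s4 30)
       (sh b (ar s4 19)) (sh b (ar s4 24)) (sh b (ar s4 27))" using P by (simp add: ar4 vs4)
      show "chunks S n (ar s4 aOI) p0 p1 (vs s4 14) (sh b (ar s4 17)) (sh b (ar s4 18)) (sh b (ar s4 19)) (sh b (ar s4 20)) (sh b (ar s4 21)) (ar s4 16)"
       using rs by (simp add: ar4 vs4)
      show "part.done_inv n (ar s4 aOI) (ar s4 aOK) (ar s4 aOA) (ar s4 aBV) p0 (ar s4 14) (ar s4 aCV)"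
       using inv(2) by (simp add: donei_def ar4 arr)
      show "ar s4 aPM (b + (2 * (2 * n * (2 * n)) + (r * (2 * n) + j))) + ar s4 29 (b + (r * (2 * n) + j)) \<noteq> 0 \<longleftrightarrow>
       (\<exists>q. p0 \<le> q \<and> q < p1 \<and> ar s4 16 q = r \<and> part.dom n (ar s4 aOK) (ar s4 aOA) (ar s4 aBV) q j)"
       if "r < vs s4 14" "j < n" for r j using marked[of r j] that by (simp add: ar4 vs4 D_def)
     qed (use vs4 B in \<open>auto simp: D_def ar4 arr\<close>)
     then show ?thesis by (simp add: ar4 D_def)
    qed
    show "wp B fin_com ?Q s4"
    proof (rule wp_conseq[OF b4])
     fix s5 assume s5: "done_inv p1 (ar s5 14) (ar s5 aCV) \<and>
      ck s5 + 300 * S * nnz (n * n) (ar s4 14) \<le> ck s4 + 300 * (D * n) + 20 + 300 * S * nnz (n * n) (ar s5 14)"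
      and "same (mv fin_com) (ma fin_com) s4 s5"
     then have sm5: "same {17, 19, 21, 22, 23, 24, 26} {9, 14} s4 s5" by simp
     have f15: "ar s5 15 = ar s3 15" by (simp add: same_ar[OF sm5] same_ar[OF sm4])
     have "flagi n s p1 s5" using s3 by (simp add: flagi_def f15 arr)
     moreover have "donei n s p1 s5" using s5 by (simp add: donei_def arr)
     moreover have "fresh (b + Q) s5"
     proof -
      have c: "vs s2 14 \<le> Q" "vs s2 15 \<le> Q" "n \<le> Q" using nr nc Q(2) by (auto simp: D_def)
      have "ar s5 a x = 0" if a: "a \<in> {17, 20, 22, 25, 28, 29}" and x: "x \<ge> b + Q" for a x
      proof -
       define y where "y = x - b"
       have y: "x = b + y" "y \<ge> Q" using x by (auto simp: y_def)
       have e: "ar s5 a = ar s4 a" using a by (auto simp: same_ar[OF sm5])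
       have "ar s2 17 (b + y) = 0" "ar s2 20 (b + y) = 0" "ar s2 22 (b + y) = 0" "ar s2 25 (b + y) = 0"
        using chunksD(10,11)[OF rs, of y] chunksD(10,11)[OF cs, of y] c y(2) by (auto simp: sh_def)
       moreover have "ar s4 29 (b + y) = 0" using s3 y(2) Q(1) by (simp add: same_ar[OF sm4])
       moreover have "ar s4 28 (b + y) = 0" using s4 y(2) by simp
       ultimately show ?thesis using a unfolding e y(1) by (auto simp: ar4)
      qed
      then show ?thesis by (auto simp: fresh_def)
     qed
     moreover have "vs s5 vX = vs s4 vX" by (simp add: same_vs[OF sm5])
     moreover have "ck s5 + 300 * S * (nnz (n * n) (ar s 14) + nnz (n * n) (ar s 15)) \<le>
       ck s + 600 * (p1 - p0) + 500 * (D * n) + C * (vs s5 vX - vs s vX) + C + 200 +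
       300 * S * (nnz (n * n) (ar s5 14) + nnz (n * n) (ar s5 15))"
     proof -
      have "ck s3 + 300 * S * nnz (n * n) (ar s2 15) \<le> ck s2 + 200 * (D * n) + 20 + 300 * S * nnz (n * n) (ar s3 15)"
       using s3 by simp
      then show ?thesis
       using s2 s4 s5 s1(11) \<open>vs s5 vX = vs s4 vX\<close> by (simp add: f15 ar4 arr distrib_left)
     qed
     ultimately show "?Q s5" using s4 by simp
    qed
   qed
  qed
 qed
 then show ?thesis unfolding part_com_def using B v by (simp add: s1_def split: if_splits)
qed

section \<open>The adaptive loop over all parts, computing one one-sided maximum\<close>

definition core_step :: "com => com" where
 "core_step mm = (part_com mm ;; vX ::= V vX +. V vnn ;; 12 ::= V 12 +. V vn *. V 11 ;;
   CIf (V vnn *. V 11 <. V vX) (11 ::= N 2 *. V 11) CSkip ;; vbase ::= V vbase +. V vQ)"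

text \<open>
 Variable \<open>11\<close> is the chunk size. It is doubled as soon as the measured cost of the matrix products
 exceeds the cost of scanning one chunk for each of the \<open>n\<^sup>2\<close> pairs; so the two costs are balanced
 without knowing the exponent \<open>\<omega>\<close>.
\<close>

definition core_com :: "com => com" where
 "core_com mm = (sort_com ;; memset 14 (V vnn) ;; memset 15 (V vnn) ;; memset aCV (V vnn) ;;
   12 ::= N 0 ;; 11 ::= N 1 ;; vX ::= N 0 ;; CWhile (V 12 <. V vnn) (core_step mm))"

lemma mv_sort [simp]: "mv sort_com = {16, 17, 23, 24, 25, 27}" and ma_sort [simp]: "ma sort_com = {10, 11, 12, 13}"
 by (auto simp: sort_com_def count_com_def prefix_com_def place_com_def)

lemma mv_part: "mv mm \<subseteq> insert vX {100..} ==> mv (part_com mm) \<subseteq> insert vX ({13..26} \<union> {100..})"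
 and ma_part: "ma mm \<subseteq> {aPM} ==> ma (part_com mm) \<subseteq> insert 9 {14..30}"
 by (auto simp: part_com_def)

text \<open>The equations that define the invariants are theorems under the locale assumptions. An
  empty part satisfies these and makes the equations available before any part has been
  built.\<close>

lemma part_trivial:
 assumes "0 < n" "sorted_entries n A I K a"
 shows "part n 1 0 0 0 0 I K a rc cc ri ci lo"
proof unfold_locales
 show "a q' \<le> a q" if "q \<le> q'" "q' < n * n" for q q' using assms(2) that unfolding sorted_entries_def by blast
qed (use assms in \<open>auto simp: sorted_entries_def\<close>)

text \<open>\<open>vX\<close> sums the measured multiplication costs plus \<open>n * n\<close> per
  part, at most \<open>\<tau>'\<close> for each of the \<open>t\<close> parts. In the last
  existential, \<open>a\<close> counts the doublings of the chunk size \<open>S\<close>, and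
  \<open>q\<close> counts parts processed with \<open>\<sigma> \<le> S\<close>. A part with smaller
  \<open>S\<close> either causes a doubling or leaves \<open>vX\<close> at most
  \<open>n * n * S\<close>; so \<open>vX\<close> stays below
  \<open>n * n * \<sigma> + \<tau>' * (a + q)\<close>. Conversely, \<open>n * n * S\<close> stays
  within a constant factor of the costs, because \<open>S\<close> doubles only after
  \<open>vX\<close> has exceeded it.\<close>

definition core_inv :: "nat => nat => nat => nat => nat => nat => st => st => bool" where
 "core_inv n C Q \<tau>' \<sigma> b s0 s \<longleftrightarrow>
  flagi n s0 (min (vs s 12) (n * n)) s \<and> donei n s0 (min (vs s 12) (n * n)) s \<and> fresh (vs s vbase) s \<and>
  1 \<le> vs s 11 \<and> vs s 11 \<le> 4 * n \<and> n * vs s 11 \<le> 2 * vs s 12 + n \<and>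
  n * n * vs s 11 \<le> 2 * (n * n * \<sigma>) + 2 * vs s vX \<and>
  (\<exists>t. vs s vbase = b + Q * t \<and> t * n \<le> vs s 12 \<and> t \<le> n \<and> vs s vX \<le> t * \<tau>') \<and>
  (\<exists>a q. vs s 11 = 2 ^ a \<and> q * (n * \<sigma>) \<le> vs s 12 \<and> q * \<sigma> \<le> n + \<sigma> \<and> vs s vX \<le> n * n * \<sigma> + \<tau>' * (a + q)) \<and>
  ck s \<le> ck s0 + (C + 1600) * vs s vX + 600 * min (vs s 12) (n * n) +
   300 * vs s 11 * (nnz (n * n) (ar s 14) + nnz (n * n) (ar s 15))"

lemma wp_core_step:
 assumes inv: "core_inv n C Q \<tau>' \<sigma> b s0 s" and lt: "vs s 12 < n * n"
  and v: "vs s vn = n" "vs s vnn = n * n" "vs s vN = 2 * n" "vs s vQ = Q"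
  and ar: "ar s aOI = ar s0 aOI" "ar s aOK = ar s0 aOK" "ar s aOA = ar s0 aOA" "ar s aBV = ar s0 aBV"
  and pos: "0 < n" "0 < \<sigma>"
  and se: "sorted_entries n A (ar s0 aOI) (ar s0 aOK) (ar s0 aOA)"
  and mm: "mm_spec C mm (2 * n) B Q \<tau>" and \<tau>': "\<tau>' = \<tau> + n * n"
  and Q: "8 * (n * n) \<le> Q" "2 * n \<le> Q"
  and B: "(n + 1) * \<tau>' \<le> B" "b + Q * (n + 1) \<le> B" "5 * (n * n) \<le> B" "4 * n + 1 \<le> B" "n * n + 1 \<le> B"
   "\<forall>q<n * n. ar s0 aOA q \<le> B"
 shows "wp B (core_step mm) (\<lambda>s'. core_inv n C Q \<tau>' \<sigma> b s0 s' \<and> n * n - vs s' 12 < n * n - vs s 12) (tick 6 s)"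
proof -
 define p0 where "p0 = vs s 12"
 define S where "S = vs s 11"
 define X where "X = vs s vX"
 define p1 where "p1 = min (p0 + n * S) (n * n)"
 obtain t where t: "vs s vbase = b + Q * t" "t * n \<le> p0" "t \<le> n" "X \<le> t * \<tau>'"
  using inv unfolding core_inv_def p0_def X_def by blast
 obtain a q where aq: "S = 2 ^ a" "q * (n * \<sigma>) \<le> p0" "q * \<sigma> \<le> n + \<sigma>" "X \<le> n * n * \<sigma> + \<tau>' * (a + q)"
  using inv unfolding core_inv_def p0_def S_def X_def by blast
 have i: "flagi n s0 p0 s" "donei n s0 p0 s" "fresh (vs s vbase) s" "1 \<le> S" "S \<le> 4 * n" "n * S \<le> 2 * p0 + n"
  "n * n * S \<le> 2 * (n * n * \<sigma>) + 2 * X"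
  "ck s \<le> ck s0 + (C + 1600) * X + 600 * p0 + 300 * S * (nnz (n * n) (ar s 14) + nnz (n * n) (ar s 15))"
  using inv lt unfolding core_inv_def p0_def S_def X_def by (auto simp: min_def)
 have tn: "t < n" using t(2) lt pos(1) unfolding p0_def[symmetric] by (metis le_less_trans mult_less_cancel2)
 \<comment> \<open>Each doubling follows a part of \<open>n * S\<close> positions, hence
   \<open>n * S \<le> 2 * p0 + n\<close>; and \<open>p0 < n * n\<close> as long as the loop
   runs.\<close>
 have S2: "S \<le> 2 * n"
 proof -
  have "n * S < n * (2 * n + 1)" using i(6) lt unfolding p0_def[symmetric] by (simp add: algebra_simps)
  then show ?thesis by simp
 qed
 have nS: "n * S \<le> 2 * (n * n)" using mult_le_mono2[OF S2, of n] by simp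
 have XB: "X + \<tau>' \<le> B"
 proof -
  have "t * \<tau>' + \<tau>' \<le> (n + 1) * \<tau>'" using tn by (simp add: algebra_simps)
  then show ?thesis using t(4) B(1) by linarith
 qed
 have bB: "b + Q * t + Q \<le> B"
 proof -
  have "Q * t + Q \<le> Q * (n + 1)" using tn mult_le_mono2[of "t + 1" "n + 1" Q] by (simp add: algebra_simps)
  then show ?thesis using B(2) by linarith
 qed
 \<comment> \<open>Fewer than \<open>n * n\<close> positions have been treated, so
   \<open>q * \<sigma> < n\<close>, and one more part respects the bound.\<close>
 have qn: "(q + 1) * \<sigma> \<le> n + \<sigma>"
 proof -
  have "q * (n * \<sigma>) = n * (q * \<sigma>)" by (simp add: mult_ac)
  then have "n * (q * \<sigma>) < n * n" using aq(2) lt unfolding p0_def[symmetric] by linarith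
  then show ?thesis by (simp add: add_mult_distrib)
 qed
 have part: "wp B (part_com mm) (\<lambda>s'. flagi n (tick 6 s) p1 s' \<and> donei n (tick 6 s) p1 s' \<and> fresh (vs s vbase + Q) s' \<and>
  vs (tick 6 s) vX \<le> vs s' vX \<and> vs s' vX \<le> vs (tick 6 s) vX + \<tau> \<and>
  ck s' + 300 * S * (nnz (n * n) (ar (tick 6 s) 14) + nnz (n * n) (ar (tick 6 s) 15)) \<le>
   ck (tick 6 s) + 600 * (p1 - p0) + 500 * (2 * n * n) + C * (vs s' vX - vs (tick 6 s) vX) + C + 200 +
   300 * S * (nnz (n * n) (ar s' 14) + nnz (n * n) (ar s' 15))) (tick 6 s)"
  unfolding p1_def
 proof (rule wp_part)
  show "sorted_entries n A (ar (tick 6 s) aOI) (ar (tick 6 s) aOK) (ar (tick 6 s) aOA)" using se ar by simp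
  show "flagi n (tick 6 s) p0 (tick 6 s)" "donei n (tick 6 s) p0 (tick 6 s)"
   using i(1,2) ar by (simp_all add: flagi_def donei_def)
  show "fresh (vs s vbase) (tick 6 s)" using i(3) by (simp add: fresh_def)
  show "p0 + n * S \<le> B" using nS lt B(3) unfolding p0_def by linarith
  show "vs (tick 6 s) vX + \<tau> \<le> B" using XB \<tau>' by (simp add: X_def)
  show "p0 < n * n" using lt by (simp add: p0_def)
 qed (use v pos mm Q B S2 i ar in \<open>auto simp: p0_def S_def\<close>)
 show ?thesis unfolding core_step_def wp_Seq
 proof (rule wp_conseq[OF part])
  fix s1 assume s1: "flagi n (tick 6 s) p1 s1 \<and> donei n (tick 6 s) p1 s1 \<and> fresh (vs s vbase + Q) s1 \<and>
   vs (tick 6 s) vX \<le> vs s1 vX \<and> vs s1 vX \<le> vs (tick 6 s) vX + \<tau> \<and>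
   ck s1 + 300 * S * (nnz (n * n) (ar (tick 6 s) 14) + nnz (n * n) (ar (tick 6 s) 15)) \<le>
   ck (tick 6 s) + 600 * (p1 - p0) + 500 * (2 * n * n) + C * (vs s1 vX - vs (tick 6 s) vX) + C + 200 +
   300 * S * (nnz (n * n) (ar s1 14) + nnz (n * n) (ar s1 15))"
   and "same (mv (part_com mm)) (ma (part_com mm)) (tick 6 s) s1"
  then have sm: "same (insert vX ({13..26} \<union> {100..})) (insert 9 {14..30}) (tick 6 s) s1"
   using mm mv_part[of mm] ma_part[of mm] by (auto simp: mm_spec_def intro: same_mono)
  have v1: "vs s1 vn = n" "vs s1 vnn = n * n" "vs s1 vQ = Q" "vs s1 11 = S" "vs s1 12 = p0" "vs s1 vbase = b + Q * t"
   using v t(1) by (simp_all add: same_vs[OF sm] S_def p0_def)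
  define X' where "X' = vs s1 vX + n * n"
  define S' where "S' = (if n * n * S < X' then 2 * S else S)"
  have X': "X + n * n \<le> X'" "X' \<le> X + \<tau>'" using s1 \<tau>' by (auto simp: X'_def X_def)
  have nn1: "1 \<le> n * n" using pos(1) by (simp add: One_nat_def Suc_le_eq)
  have S0: "0 < S" using i(4) by linarith
  have p0nn: "p0 < n * n" using lt by (simp add: p0_def)
  \<comment> \<open>The overhead \<open>1000 * (n * n) + C + 200\<close> of a part is covered by
    \<open>C + 1600\<close> times the \<open>n * n\<close> added to \<open>vX\<close>. Passing from
    \<open>S\<close> to \<open>S'\<close> only raises the potential.\<close>
  have time: "ck s1 + 60 \<le> ck s0 + (C + 1600) * X' + 600 * p1 + 300 * S' * (nnz (n * n) (ar s1 14) + nnz (n * n) (ar s1 15))"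
  proof -
   define d where "d = vs s1 vX - X"
   have d: "vs s1 vX = X + d" using s1 by (auto simp: d_def X_def)
   have "300 * S * (nnz (n * n) (ar s1 14) + nnz (n * n) (ar s1 15)) \<le> 300 * S' * (nnz (n * n) (ar s1 14) + nnz (n * n) (ar s1 15))"
    by (intro mult_le_mono1) (simp add: S'_def)
   moreover have "(C + 1600) * X' = (C + 1600) * X + C * d + 1600 * d + C * (n * n) + 1600 * (n * n)"
    unfolding X'_def d by (simp add: algebra_simps)
   moreover have "C \<le> C * (n * n)" using mult_le_mono2[OF nn1, of C] by simp
   moreover have "ck s1 + 300 * S * (nnz (n * n) (ar s 14) + nnz (n * n) (ar s 15)) \<le>
    ck s + 6 + 600 * (p1 - p0) + 1000 * (n * n) + C * d + C + 200 +
    300 * S * (nnz (n * n) (ar s1 14) + nnz (n * n) (ar s1 15))"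
    using s1 d by (simp add: X_def algebra_simps)
   moreover have "p0 \<le> p1" using p0nn by (simp add: p1_def)
   ultimately show ?thesis using i(8) nn1 by linarith
  qed
  have main: "core_inv n C Q \<tau>' \<sigma> b s0 f \<and> n * n - vs f 12 < n * n - vs s 12"
   if f: "vs f 12 = p0 + n * S" "vs f vX = X'" "vs f 11 = S'" "vs f vbase = b + Q * t + Q" "ar f = ar s1" "ck f \<le> ck s1 + 60" for f
  proof
   show "n * n - vs f 12 < n * n - vs s 12" using p0nn mult_pos_pos[OF pos(1) S0] unfolding f p0_def[symmetric] by linarith
   show "core_inv n C Q \<tau>' \<sigma> b s0 f" unfolding core_inv_def f
   proof (intro conjI)
    show "flagi n s0 (min (p0 + n * S) (n * n)) f" "donei n s0 (min (p0 + n * S) (n * n)) f"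
     using s1 ar f(5) unfolding p1_def by (auto simp: flagi_def donei_def)
    show "fresh (b + Q * t + Q) f" using s1 t(1) f(5) by (simp add: fresh_def)
    show "1 \<le> S'" using i(4) by (simp add: S'_def)
    show "S' \<le> 4 * n" using S2 by (simp add: S'_def)
    show "n * S' \<le> 2 * (p0 + n * S) + n" by (simp add: S'_def)
    show "n * n * S' \<le> 2 * (n * n * \<sigma>) + 2 * X'" using i(7) X'(1) by (auto simp: S'_def)
    show "\<exists>t'. b + Q * t + Q = b + Q * t' \<and> t' * n \<le> p0 + n * S \<and> t' \<le> n \<and> X' \<le> t' * \<tau>'"
    proof (intro exI[of _ "t + 1"] conjI)
     show "(t + 1) * n \<le> p0 + n * S" unfolding add_mult_distrib using t(2) mult_le_mono2[OF i(4), of n] by linarith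
     show "X' \<le> (t + 1) * \<tau>'" using t(4) X'(2) by (simp add: add_mult_distrib)
    qed (use tn in \<open>auto simp: algebra_simps\<close>)
    show "\<exists>a' q'. S' = 2 ^ a' \<and> q' * (n * \<sigma>) \<le> p0 + n * S \<and> q' * \<sigma> \<le> n + \<sigma> \<and> X' \<le> n * n * \<sigma> + \<tau>' * (a' + q')"
    \<comment> \<open>A part with \<open>\<sigma> \<le> S\<close> is charged to \<open>q\<close>,
      otherwise a doubling is charged to \<open>a\<close>. If neither happens, then
      \<open>X' \<le> n * n * S \<le> n * n * \<sigma>\<close> holds outright.\<close>
    proof (cases "\<sigma> \<le> S")
     case True
     have "(q + 1) * (n * \<sigma>) \<le> p0 + n * S" unfolding add_mult_distrib using aq(2) mult_le_mono2[OF True, of n] by linarith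
     moreover have "X' \<le> n * n * \<sigma> + \<tau>' * (a' + (q + 1))" if "a \<le> a'" for a'
     proof -
      have "\<tau>' * (a + q) + \<tau>' \<le> \<tau>' * (a' + (q + 1))" using that mult_le_mono2[of "a + q + 1" "a' + (q + 1)" \<tau>'] by (simp add: algebra_simps)
      then show ?thesis using aq(4) X'(2) by linarith
     qed
     moreover have "S' = 2 ^ (if n * n * S < X' then a + 1 else a)" using aq(1) by (simp add: S'_def power_add)
     ultimately show ?thesis using qn by (metis le_add1 order_refl)
    next
     case False
     show ?thesis
     proof (cases "n * n * S < X'")
      case True
      have "X' \<le> n * n * \<sigma> + \<tau>' * (a + 1 + q)"
       using aq(4) X'(2) by (simp add: algebra_simps)
      moreover have "S' = 2 ^ (a + 1)" using aq(1) True by (simp add: S'_def power_add)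
      ultimately show ?thesis using aq(2,3) trans_le_add1[OF aq(2)] by blast
     next
      case F: False
      have "n * n * S \<le> n * n * \<sigma>" using False by simp
      then have "X' \<le> n * n * \<sigma>" using F by linarith
      moreover have "S' = 2 ^ a" using aq(1) F by (simp add: S'_def)
      ultimately show ?thesis using aq(2,3) trans_le_add1[OF aq(2)] trans_le_add1 by blast
     qed
    qed
    show "ck f \<le> ck s0 + (C + 1600) * X' + 600 * min (p0 + n * S) (n * n) +
     300 * S' * (nnz (n * n) (ar s1 14) + nnz (n * n) (ar s1 15))"
     using time f(6) unfolding p1_def by linarith
   qed
  qed
  have bnds: "X' \<le> B" "p0 + n * S \<le> B" "2 * S \<le> B" "b + Q * t + Q \<le> B"
   using X'(2) XB nS p0nn B(3,4) S2 bB by linarith+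
  show "wp B (vX ::= V vX +. V vnn) (wp B (12 ::= V 12 +. V vn *. V 11)
   (wp B (CIf (V vnn *. V 11 <. V vX) (11 ::= N 2 *. V 11) CSkip)
    (wp B (vbase ::= V vbase +. V vQ) (\<lambda>s'. core_inv n C Q \<tau>' \<sigma> b s0 s' \<and> n * n - vs s' 12 < n * n - vs s 12)))) s1"
  proof (cases "n * n * S < X'")
   case True
   let ?f = "setv 7 7 (b + Q * t + Q) (setv 6 11 (2 * S) (tick 9 (setv 10 12 (p0 + n * S) (setv 7 10 X' s1))))"
   have "core_inv n C Q \<tau>' \<sigma> b s0 ?f \<and> n * n - vs ?f 12 < n * n - vs s 12"
    by (rule main) (use True in \<open>auto simp: S'_def\<close>)
   then show ?thesis using bnds True by (simp add: v1 X'_def[symmetric])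
  next
   case False
   let ?f = "setv 7 7 (b + Q * t + Q) (tick 1 (tick 9 (setv 10 12 (p0 + n * S) (setv 7 10 X' s1))))"
   have "core_inv n C Q \<tau>' \<sigma> b s0 ?f \<and> n * n - vs ?f 12 < n * n - vs s 12"
    by (rule main) (use False v1 in \<open>auto simp: S'_def\<close>)
   then show ?thesis using bnds False by (simp add: v1 X'_def[symmetric])
  qed
 qed
qed

text \<open>The program does not know \<open>\<sigma>\<close>, so the bound holds for every positive
  \<open>\<sigma>\<close> and is optimised afterwards. \<open>L\<close> bounds the number of
  doublings, because \<open>S\<close> is a power of 2 and at most \<open>4 * n\<close>.\<close>

lemma wp_core:
 fixes s :: st and n m b C B Q \<tau> \<sigma> L :: nat and mm :: com
 defines "A \<equiv> ar s aAV" and "Bv \<equiv> ar s aBV" and "\<tau>' \<equiv> \<tau> + n * n"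
 assumes v: "vs s vn = n" "vs s vnn = n * n" "vs s vm = m" "vs s vN = 2 * n" "vs s vQ = Q" "vs s vbase = b"
  and pos: "0 < n" "0 < \<sigma>" "4 * n < 2 ^ (L + 1)"
  and A: "\<forall>e<n * n. A e \<le> m + 1" and m: "m \<le> n * n"
  and fr: "fresh b s"
  and mm: "mm_spec C mm (2 * n) B Q \<tau>"
  and Q: "8 * (n * n) \<le> Q" "2 * n \<le> Q"
  and B: "(n + 1) * \<tau>' \<le> B" "b + Q * (n + 1) \<le> B" "5 * (n * n) \<le> B" "4 * n + 1 \<le> B" "2 * (n * n) + 4 \<le> B"
 shows "wp B (core_com mm) (\<lambda>s'. (\<forall>i<n. \<forall>j<n.
   (\<forall>k<n. A (i * n + k) \<le> Bv (k * n + j) --> A (i * n + k) \<le> ar s' aCV (i * n + j)) \<and>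
   (ar s' aCV (i * n + j) = 0 \<or> (\<exists>k<n. A (i * n + k) \<le> Bv (k * n + j) \<and> ar s' aCV (i * n + j) = A (i * n + k)))) \<and>
   (\<exists>t\<le>n. vs s' vbase = b + Q * t) \<and> fresh (vs s' vbase) s' \<and>
   ck s' \<le> ck s + (C + 9000) * (n * n * \<sigma> + \<tau>' * (L + n div \<sigma> + 1))) s"
proof -
 have nn1: "1 \<le> n * n" using pos(1) by (simp add: One_nat_def Suc_le_eq)
 have AB: "\<forall>e<n * n. A e \<le> B" using A m B(5) by (auto intro: order_trans[of _ "m + 1"])
 have b1: "wp B sort_com (\<lambda>s'. (\<forall>e<n * n. placed n (keyf m A) (n * n) (ar s') A e) \<and>
  ck s' \<le> ck s + 400 * (n * n + m + 4)) s"
  unfolding A_def by (rule wp_sort) (use v m B AB in \<open>auto simp: A_def\<close>)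
 show ?thesis unfolding core_com_def wp_Seq
 proof (rule wp_conseq[OF b1])
  fix s1 assume s1: "(\<forall>e<n * n. placed n (keyf m A) (n * n) (ar s1) A e) \<and> ck s1 \<le> ck s + 400 * (n * n + m + 4)"
   and "same (mv sort_com) (ma sort_com) s s1"
  then have sm1: "same {16, 17, 23, 24, 25, 27} {10, 11, 12, 13} s s1" by simp
  have se: "sorted_entries n A (ar s1 aOI) (ar s1 aOK) (ar s1 aOA)" using sorted_entries_placed s1 A by blast
  have ms: "wp B (memset 14 (V vnn) ;; memset 15 (V vnn) ;; memset aCV (V vnn)) (\<lambda>s'.
    (\<forall>i<n * n. ar s' 14 i = 0) \<and> (\<forall>i<n * n. ar s' 15 i = 0) \<and> (\<forall>i<n * n. ar s' aCV i = 0) \<and>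
    ck s' \<le> ck s1 + 66 * (n * n + 1)) s1"
   unfolding wp_Seq
  proof (rule wp_conseq[OF wp_memset[of "n * n"]], goal_cases)
   case (3 s2)
   then have sm2: "same {27} {14} s1 s2" by simp
   show ?case
   proof (rule wp_conseq[OF wp_memset[of "n * n"]], goal_cases)
    case (3 s3)
    then have sm3: "same {27} {15} s2 s3" by simp
    show ?case
    proof (rule wp_conseq[OF wp_memset[of "n * n"]], goal_cases)
     case (3 s4)
     then have sm4: "same {27} {9} s3 s4" by simp
     show ?case using 3(1) \<open>(\<forall>i<n * n. ar s3 15 i = 0) \<and> _\<close> \<open>(\<forall>i<n * n. ar s2 14 i = 0) \<and> _\<close>
      by (simp add: same_ar[OF sm4] same_ar[OF sm3])
    qed (use v B in \<open>auto simp: same_vs same_vs[OF sm1] same_vs[OF sm2] same_vs[OF sm3]\<close>)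
   qed (use v B in \<open>auto simp: same_vs same_vs[OF sm1] same_vs[OF sm2]\<close>)
  qed (use v B in \<open>auto simp: same_vs same_vs[OF sm1]\<close>)
  have "wp B (memset 14 (V vnn) ;; memset 15 (V vnn) ;; memset aCV (V vnn))
    (wp B (12 ::= N 0 ;; 11 ::= N 1 ;; vX ::= N 0 ;; CWhile (V 12 <. V vnn) (core_step mm)) (\<lambda>s'. (\<forall>i<n. \<forall>j<n.
   (\<forall>k<n. A (i * n + k) \<le> Bv (k * n + j) --> A (i * n + k) \<le> ar s' aCV (i * n + j)) \<and>
   (ar s' aCV (i * n + j) = 0 \<or> (\<exists>k<n. A (i * n + k) \<le> Bv (k * n + j) \<and> ar s' aCV (i * n + j) = A (i * n + k)))) \<and>
   (\<exists>t\<le>n. vs s' vbase = b + Q * t) \<and> fresh (vs s' vbase) s' \<and>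
   ck s' \<le> ck s + (C + 9000) * (n * n * \<sigma> + \<tau>' * (L + n div \<sigma> + 1)))) s1" (is "wp _ _ (wp _ _ ?Q) _")
  proof (rule wp_conseq[OF ms])
   fix s2 assume s2: "(\<forall>i<n * n. ar s2 14 i = 0) \<and> (\<forall>i<n * n. ar s2 15 i = 0) \<and> (\<forall>i<n * n. ar s2 aCV i = 0) \<and>
    ck s2 \<le> ck s1 + 66 * (n * n + 1)"
    and "same (mv (memset 14 (V vnn) ;; memset 15 (V vnn) ;; memset aCV (V vnn)))
     (ma (memset 14 (V vnn) ;; memset 15 (V vnn) ;; memset aCV (V vnn))) s1 s2"
   then have sm2: "same {27} {9, 14, 15} s1 s2" by (simp add: insert_commute)
   let ?s0 = "setv 3 vX 0 (setv 3 11 1 (setv 3 12 0 s2))"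
   have ar0: "ar ?s0 aOI = ar s1 aOI" "ar ?s0 aOK = ar s1 aOK" "ar ?s0 aOA = ar s1 aOA" "ar ?s0 aBV = Bv"
    by (simp_all add: same_ar[OF sm2] same_ar[OF sm1] Bv_def)
   have v0: "vs ?s0 vn = n" "vs ?s0 vnn = n * n" "vs ?s0 vN = 2 * n" "vs ?s0 vQ = Q" "vs ?s0 vbase = b"
    using v by (simp_all add: same_vs[OF sm2] same_vs[OF sm1])
   have P: "part n 1 0 0 0 0 (ar ?s0 aOI) (ar ?s0 aOK) (ar ?s0 aOA) id id id id id"
    by (rule part_trivial[OF pos(1)]) (use se ar0 in simp)
   have mmv: "mv (part_com mm) \<subseteq> insert vX ({13..26} \<union> {100..})" "ma (part_com mm) \<subseteq> insert 9 {14..30}"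
    using mm mv_part[of mm] ma_part[of mm] by (simp_all add: mm_spec_def)
   have OAB: "\<forall>q<n * n. ar ?s0 aOA q \<le> B"
    using se AB cell_less unfolding ar0 sorted_entries_def by metis
   have init: "core_inv n C Q \<tau>' \<sigma> b ?s0 ?s0"
    unfolding core_inv_def flagi_def donei_def part.flag_inv_def[OF P] part.done_inv_def[OF P]
   proof (intro conjI)
    show "fresh (vs ?s0 vbase) ?s0" using fr unfolding fresh_def v0(5) by (simp add: same_ar[OF sm2] same_ar[OF sm1])
    show "\<exists>t. vs ?s0 vbase = b + Q * t \<and> t * n \<le> vs ?s0 12 \<and> t \<le> n \<and> vs ?s0 vX \<le> t * \<tau>'"
     by (rule exI[of _ 0]) (use v0 in simp)
    show "\<exists>a q. vs ?s0 11 = 2 ^ a \<and> q * (n * \<sigma>) \<le> vs ?s0 12 \<and> q * \<sigma> \<le> n + \<sigma> \<and> vs ?s0 vX \<le> n * n * \<sigma> + \<tau>' * (a + q)"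
     by (rule exI[of _ 0], rule exI[of _ 0]) simp
    show "n * n * vs ?s0 11 \<le> 2 * (n * n * \<sigma>) + 2 * vs ?s0 vX"
     using mult_le_mono2[of 1 \<sigma> "n * n"] pos(2) by (simp add: One_nat_def Suc_le_eq)
    show "1 \<le> vs ?s0 11" "vs ?s0 11 \<le> 4 * n" using pos(1) by auto
   qed (use s2 cell_less in auto)
   have "wp B (CWhile (V 12 <. V vnn) (core_step mm)) ?Q ?s0"
   proof (rule wp_While[where I = "core_inv n C Q \<tau>' \<sigma> b ?s0" and f = "\<lambda>s. n * n - vs s 12"])
    show "core_inv n C Q \<tau>' \<sigma> b ?s0 ?s0" by (rule init)
   next
    fix s' assume I: "core_inv n C Q \<tau>' \<sigma> b ?s0 s'"
     and "same (mv (core_step mm)) (ma (core_step mm)) ?s0 s'" and nz: "aval (V 12 <. V vnn) s' \<noteq> 0"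
    then have sm: "same ({7, 10, 11, 12} \<union> {13..26} \<union> {100..}) (insert 9 {14..30}) ?s0 s'"
     by (elim same_mono) (use mmv in \<open>auto simp: core_step_def\<close>)
    have v': "vs s' vn = n" "vs s' vnn = n * n" "vs s' vN = 2 * n" "vs s' vQ = Q"
     using v0 by (simp_all add: same_vs[OF sm])
    have "ecost (V 12 <. V vnn) + 1 = 6" by simp
    then show "wp B (core_step mm) (\<lambda>s''. core_inv n C Q \<tau>' \<sigma> b ?s0 s'' \<and> n * n - vs s'' 12 < n * n - vs s' 12)
      (tick (ecost (V 12 <. V vnn) + 1) s')"
     using wp_core_step[OF I _ v' _ _ _ _ pos(1,2) _ mm] nz v' se ar0 OAB Q B
     by (auto simp: same_ar[OF sm] \<tau>'_def split: if_splits)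
   next
    fix s' assume I: "core_inv n C Q \<tau>' \<sigma> b ?s0 s'"
     and "same (mv (core_step mm)) (ma (core_step mm)) ?s0 s'" and z: "aval (V 12 <. V vnn) s' = 0"
    then have sm: "same ({7, 10, 11, 12} \<union> {13..26} \<union> {100..}) (insert 9 {14..30}) ?s0 s'"
     by (elim same_mono) (use mmv in \<open>auto simp: core_step_def\<close>)
    have "vs s' vnn = n * n" using v0 by (simp add: same_vs[OF sm])
    then have p: "min (vs s' 12) (n * n) = n * n" using z by (simp split: if_splits)
    have D: "part.done_inv n (ar ?s0 aOI) (ar ?s0 aOK) (ar ?s0 aOA) (ar ?s0 aBV) (n * n) (ar s' 14) (ar s' aCV)"
     using I p unfolding core_inv_def donei_def by simp
    have res: "(\<forall>k<n. A (i * n + k) \<le> Bv (k * n + j) --> A (i * n + k) \<le> ar s' aCV (i * n + j)) \<and>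
     (ar s' aCV (i * n + j) = 0 \<or> (\<exists>k<n. A (i * n + k) \<le> Bv (k * n + j) \<and> ar s' aCV (i * n + j) = A (i * n + k)))"
     if ij: "i < n" "j < n" for i j
    proof -
     note D' = D[unfolded part.done_inv_def[OF P], rule_format, OF ij, unfolded part.dom_def[OF P], unfolded ar0]
     have se1: "ar s1 aOI q < n" "ar s1 aOK q < n" "ar s1 aOA q = A (ar s1 aOI q * n + ar s1 aOK q)" if "q < n * n" for q
      using se that unfolding sorted_entries_def by auto
     have ex: "\<exists>q<n * n. ar s1 aOI q = i \<and> ar s1 aOK q = k" if "k < n" for k
      using se ij that unfolding sorted_entries_def by auto
     show ?thesis
     proof (intro conjI allI impI)
      fix k assume k: "k < n" "A (i * n + k) \<le> Bv (k * n + j)"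
      obtain q where q: "q < n * n" "ar s1 aOI q = i" "ar s1 aOK q = k" using ex[OF k(1)] by blast
      then have "ar s1 aOA q = A (i * n + k)" using se1 by auto
      then show "A (i * n + k) \<le> ar s' aCV (i * n + j)" using D' q k by (cases "ar s' 14 (i * n + j) = 0") auto
     next
      show "ar s' aCV (i * n + j) = 0 \<or> (\<exists>k<n. A (i * n + k) \<le> Bv (k * n + j) \<and> ar s' aCV (i * n + j) = A (i * n + k))"
       using D' se1 by metis
     qed
    qed
    obtain t where t: "vs s' vbase = b + Q * t" "t \<le> n" using I unfolding core_inv_def by blast
    obtain a q where aq: "vs s' 11 = 2 ^ a" "q * \<sigma> \<le> n + \<sigma>" "vs s' vX \<le> n * n * \<sigma> + \<tau>' * (a + q)"
     using I unfolding core_inv_def by blast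
    have "(2::nat) ^ a < 2 ^ (L + 1)" using I aq(1) pos(3) unfolding core_inv_def by linarith
    then have aL: "a \<le> L" by simp
    have "q = (q * \<sigma>) div \<sigma>" using pos(2) by simp
    also have "\<dots> \<le> (n + \<sigma>) div \<sigma>" using aq(2) by (rule div_le_mono)
    also have "\<dots> = n div \<sigma> + 1" using pos(2) by (simp add: div_add_self2)
    finally have qL: "q \<le> n div \<sigma> + 1" .
    define H where "H = n * n * \<sigma> + \<tau>' * (L + n div \<sigma> + 1)"
    have XH: "vs s' vX \<le> H"
    proof -
     have "\<tau>' * (a + q) \<le> \<tau>' * (L + n div \<sigma> + 1)" using aL qL by (intro mult_le_mono2) simp
     then show ?thesis using aq(3) unfolding H_def by linarith
    qed
    have nnH: "n * n \<le> H"
    proof -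
     have "n * n * 1 \<le> n * n * \<sigma>" using pos(2) by (intro mult_le_mono2) simp
     then show ?thesis unfolding H_def by linarith
    qed
    have "ck s' + 6 \<le> ck s + (C + 9000) * H"
    proof -
     have "n * n * vs s' 11 \<le> 2 * (n * n * \<sigma>) + 2 * vs s' vX" using I unfolding core_inv_def by blast
     then have SH: "n * n * vs s' 11 \<le> 4 * H" using XH unfolding H_def by simp
     have "nnz (n * n) (ar s' 14) + nnz (n * n) (ar s' 15) \<le> 2 * (n * n)"
      using nnz_le[of "n * n" "ar s' 14"] nnz_le[of "n * n" "ar s' 15"] by simp
     then have "300 * vs s' 11 * (nnz (n * n) (ar s' 14) + nnz (n * n) (ar s' 15)) \<le> 300 * vs s' 11 * (2 * (n * n))"
      by (intro mult_le_mono2)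
     also have "\<dots> = 600 * (n * n * vs s' 11)" by simp
     also have "\<dots> \<le> 2400 * H" using SH by simp
     finally have "ck s' \<le> ck ?s0 + (C + 1600) * vs s' vX + 600 * (n * n) + 2400 * H"
      using I p unfolding core_inv_def by linarith
     moreover have "(C + 1600) * vs s' vX \<le> (C + 1600) * H" using XH by (rule mult_le_mono2)
     moreover have "(C + 9000) * H = (C + 1600) * H + 7400 * H" by (simp add: algebra_simps)
     moreover have "ck ?s0 \<le> ck s + 1000 * (n * n) + 2000" using s1 s2 m by simp
     ultimately show ?thesis using nnH nn1 by linarith
    qed
    moreover have "ecost (V 12 <. V vnn) + 1 = 6" by simp
    moreover have "fresh (vs s' vbase) (tick 6 s')" using I unfolding core_inv_def fresh_def by simp
    ultimately show "?Q (tick (ecost (V 12 <. V vnn) + 1) s')"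
     using res t unfolding H_def by auto
   qed
   then show "wp B (12 ::= N 0 ;; 11 ::= N 1 ;; vX ::= N 0 ;; CWhile (V 12 <. V vnn) (core_step mm)) ?Q s2"
    using B(4) by simp
  qed
  then show "wp B (memset 14 (V vnn)) (wp B (memset 15 (V vnn)) (wp B (memset aCV (V vnn)) (wp B (12 ::= N 0)
   (wp B (11 ::= N 1) (wp B (vX ::= N 0) (wp B (CWhile (V 12 <. V vnn) (core_step mm)) ?Q)))))) s1" by (simp only: wp_Seq_fun)
 qed
qed

subsection \<open>The (max,min)-product\<close>

text \<open>Variables 33, 34 and 35 are the offsets of the operands and the result in array 6.
  Variables 36 and 37 are the strides of the row and the column index: \<open>n\<close> and 1 give a
  matrix as stored, 1 and \<open>n\<close> its transpose.\<close>

definition copyin_com :: com where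
 "copyin_com = For 24 (V vnn) (17 ::= V 24 /. V vn ;; 18 ::= V 24 -. V 17 *. V vn ;;
   Wr aAV (V 24) (Rd 6 (V 33 +. (V 17 *. V 36 +. V 18 *. V 37))) ;;
   Wr aBV (V 24) (Rd 6 (V 34 +. (V 17 *. V 36 +. V 18 *. V 37))))"

definition copyout_com :: com where
 "copyout_com = For 24 (V vnn) (17 ::= V 24 /. V vn ;; 18 ::= V 24 -. V 17 *. V vn ;;
   23 ::= V 35 +. (V 17 *. V 36 +. V 18 *. V 37) ;;
   CIf (Rd 6 (V 23) <. Rd aCV (V 24)) (Wr 6 (V 23) (Rd aCV (V 24))) CSkip)"

definition half_com :: "com => com" where
 "half_com mm = (copyin_com ;; core_com mm ;; copyout_com)"

text \<open>The second half exchanges the operands and transposes all three matrices. It thereby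
  merges into the same result those candidates in which the entry of the second operand is the
  smaller one.\<close>

definition prod_com :: "com => com" where
 "prod_com mm = (36 ::= V vn ;; 37 ::= N 1 ;; half_com mm ;;
   23 ::= V 33 ;; 33 ::= V 34 ;; 34 ::= V 23 ;; 36 ::= N 1 ;; 37 ::= V vn ;; half_com mm)"

lemma mv_copyin [simp]: "mv copyin_com = {17, 18, 24}" and ma_copyin [simp]: "ma copyin_com = {7, 8}"
 by (auto simp: copyin_com_def)
lemma mv_copyout [simp]: "mv copyout_com = {17, 18, 23, 24}" and ma_copyout [simp]: "ma copyout_com = {6}"
 by (auto simp: copyout_com_def)

lemma mv_core: "mv mm \<subseteq> insert vX {100..} ==> mv (core_com mm) \<subseteq> {7} \<union> {10..27} \<union> {100..}"
 and ma_core: "ma mm \<subseteq> {aPM} ==> ma (core_com mm) \<subseteq> {9..30}"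
 using mv_part[of mm] ma_part[of mm] by (auto simp: core_com_def core_step_def)

lemma mv_half: "mv mm \<subseteq> insert vX {100..} ==> mv (half_com mm) \<subseteq> {7} \<union> {10..27} \<union> {100..}"
 and ma_half: "ma mm \<subseteq> {aPM} ==> ma (half_com mm) \<subseteq> {6..30}"
 using mv_core[of mm] ma_core[of mm] by (auto simp: half_com_def)

lemma mv_prod: "mv mm \<subseteq> insert vX {100..} ==> mv (prod_com mm) \<subseteq> {7} \<union> {10..27} \<union> {33, 34, 36, 37} \<union> {100..}"
 and ma_prod: "ma mm \<subseteq> {aPM} ==> ma (prod_com mm) \<subseteq> {6..30}"
 using mv_half[of mm] ma_half[of mm] by (auto simp: prod_com_def)

definition index_map :: "nat => nat => nat => bool" where
 "index_map n \<alpha> \<beta> \<longleftrightarrow> \<alpha> = n \<and> \<beta> = 1 \<or> \<alpha> = 1 \<and> \<beta> = n"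

lemma index_map_less: "index_map n \<alpha> \<beta> ==> i < n ==> k < n ==> i * \<alpha> + k * \<beta> < n * n"
 using cell_less[of i n k n] cell_less[of k n i n] by (auto simp: index_map_def add.commute)

lemma index_map_eq: "index_map n \<alpha> \<beta> ==> i < n ==> k < n ==> i' < n ==> k' < n ==>
  i * \<alpha> + k * \<beta> = i' * \<alpha> + k' * \<beta> \<longleftrightarrow> i = i' \<and> k = k'"
 using cell_eq[of k n k' i i'] cell_eq[of i n i' k k'] by (auto simp: index_map_def add.commute)

lemma wp_copyin:
 assumes v: "vs s vn = n" "vs s vnn = n * n" "vs s 33 = oa" "vs s 34 = ob" "vs s 36 = \<alpha>" "vs s 37 = \<beta>"
  and B: "n * n \<le> B" "\<forall>x. ar s 6 x \<le> B"
 shows "wp B copyin_com (\<lambda>s'. (\<forall>i<n. \<forall>k<n. ar s' aAV (i * n + k) = ar s 6 (oa + (i * \<alpha> + k * \<beta>)) \<and>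
   ar s' aBV (i * n + k) = ar s 6 (ob + (i * \<alpha> + k * \<beta>))) \<and> ck s' \<le> ck s + 120 * (n * n + 1)) s"
 unfolding copyin_com_def
proof (rule wp_For[where I = "\<lambda>x s'. (\<forall>y<x. ar s' aAV y = ar s 6 (oa + (y div n * \<alpha> + y mod n * \<beta>)) \<and>
   ar s' aBV y = ar s 6 (ob + (y div n * \<alpha> + y mod n * \<beta>))) \<and> ck s' \<le> ck s + 120 * x + 3" and b = "n * n"], goal_cases)
 case (4 x s')
 from 4(2) have sm: "same {17, 18, 24} {7, 8} s s'" by (simp add: insert_commute)
 have "x div n \<le> B" "x mod n \<le> B" using div_le_dividend[of x n] mod_less_eq_dividend[of x n] 4(4) B by linarith+
 then show ?case using 4(1,3) B v by (auto simp: same_vs[OF sm] same_ar[OF sm] sub_div_mult all_less_plus1)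
next
 case (5 s')
 then show ?case using cell_less by auto
qed (use v B in \<open>auto simp: same_vs\<close>)

lemma wp_copyout:
 fixes s :: st
 assumes v: "vs s vn = n" "vs s vnn = n * n" "vs s 35 = oc" "vs s 36 = \<alpha>" "vs s 37 = \<beta>"
  and im: "index_map n \<alpha> \<beta>"
  and B: "oc + n * n \<le> B" "\<forall>x<n * n. ar s aCV x \<le> B"
 shows "wp B copyout_com (\<lambda>s'. (\<forall>i<n. \<forall>k<n. ar s' 6 (oc + (i * \<alpha> + k * \<beta>)) =
   max (ar s 6 (oc + (i * \<alpha> + k * \<beta>))) (ar s aCV (i * n + k))) \<and>
   (\<forall>y. y < oc \<or> oc + n * n \<le> y --> ar s' 6 y = ar s 6 y) \<and> ck s' \<le> ck s + 120 * (n * n + 1)) s"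
 unfolding copyout_com_def
proof (rule wp_For[where I = "\<lambda>x s'. (\<forall>i<n. \<forall>k<n. ar s' 6 (oc + (i * \<alpha> + k * \<beta>)) =
   (if i * n + k < x then max (ar s 6 (oc + (i * \<alpha> + k * \<beta>))) (ar s aCV (i * n + k)) else ar s 6 (oc + (i * \<alpha> + k * \<beta>)))) \<and>
   (\<forall>y. y < oc \<or> oc + n * n \<le> y --> ar s' 6 y = ar s 6 y) \<and> ck s' \<le> ck s + 120 * x + 3" and b = "n * n"], goal_cases)
 case (4 x s')
 from 4(2) have sm: "same {17, 18, 23, 24} {6} s s'" by (simp add: insert_commute)
 define i0 where "i0 = x div n"
 define k0 where "k0 = x mod n"
 have n: "0 < n" using 4(4) by (cases n) auto
 have ik: "i0 < n" "k0 < n" "x = i0 * n + k0" using 4(4) n by (auto simp: i0_def k0_def less_mult_imp_div_less)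
 define y where "y = i0 * \<alpha> + k0 * \<beta>"
 have y: "y < n * n" unfolding y_def by (rule index_map_less[OF im ik(1,2)])
 have xe: "x div n = i0" "x - i0 * n = k0" using ik(3) by (simp_all add: i0_def)
 have nB: "i0 \<le> B" "k0 \<le> B" "oc + y \<le> B" using ik y B(1) le_square[of n] by linarith+
 have e1: "oc + (i * \<alpha> + k * \<beta>) = oc + y \<longleftrightarrow> i = i0 \<and> k = k0" if "i < n" "k < n" for i k
  unfolding y_def using index_map_eq[OF im that ik(1,2)] by simp
 have e2: "i * n + k = x \<longleftrightarrow> i = i0 \<and> k = k0" if "i < n" "k < n" for i k
  unfolding ik(3) using cell_eq[of k n k0 i i0] that ik by simp
 have old: "ar s' 6 (oc + y) = ar s 6 (oc + y)" using 4(1) ik e2 by (auto simp: y_def)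
 let ?Mx = "(ar s' 6)(oc + y := max (ar s 6 (oc + y)) (ar s aCV x))"
 have new: "?Mx (oc + (i * \<alpha> + k * \<beta>)) =
   (if i * n + k < x + 1 then max (ar s 6 (oc + (i * \<alpha> + k * \<beta>))) (ar s aCV (i * n + k)) else ar s 6 (oc + (i * \<alpha> + k * \<beta>)))"
  if "i < n" "k < n" for i k
 proof (cases "i = i0 \<and> k = k0")
  case True then show ?thesis using e1[OF that] by (simp add: ik(3) y_def)
 next
  case False
  then have "i * n + k < x + 1 \<longleftrightarrow> i * n + k < x" using e2[OF that] by auto
  moreover have "?Mx (oc + (i * \<alpha> + k * \<beta>)) = ar s' 6 (oc + (i * \<alpha> + k * \<beta>))" using e1[OF that] False by auto
  moreover have "ar s' 6 (oc + (i * \<alpha> + k * \<beta>)) =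
   (if i * n + k < x then max (ar s 6 (oc + (i * \<alpha> + k * \<beta>))) (ar s aCV (i * n + k)) else ar s 6 (oc + (i * \<alpha> + k * \<beta>)))"
   using 4(1) that by blast
  ultimately show ?thesis by presburger
 qed
 have new2: "?Mx z = ar s 6 z" if "z < oc \<or> oc + n * n \<le> z" for z using that 4(1) y by auto
 show ?case
 proof (cases "ar s 6 (oc + y) < ar s aCV x")
  case True
  then have "max (ar s 6 (oc + y)) (ar s aCV x) = ar s aCV x" by simp
  then show ?thesis using 4(1,3,4) nB B True new new2 old
   by (simp add: v same_vs[OF sm] same_ar[OF sm] xe y_def[symmetric])
 next
  case False
  then have "?Mx = ar s' 6" using old by (auto simp: fun_eq_iff)
  then show ?thesis using 4(1,3,4) nB B False new new2 old
   by (simp add: v same_vs[OF sm] same_ar[OF sm] xe y_def[symmetric])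
 qed
next
 case (5 s')
 then show ?case using cell_less[of _ n _ n] by auto
qed (use v B in \<open>auto simp: same_vs\<close>)

lemma wp_half:
 fixes s :: st and n m b C B Q \<tau> \<sigma> L oa ob oc \<alpha> \<beta> :: nat and mm :: com
 defines "\<tau>' \<equiv> \<tau> + n * n" and "A \<equiv> \<lambda>i k. ar s 6 (oa + (i * \<alpha> + k * \<beta>))" and "A' \<equiv> \<lambda>k j. ar s 6 (ob + (k * \<alpha> + j * \<beta>))"
 assumes v: "vs s vn = n" "vs s vnn = n * n" "vs s vm = m" "vs s vN = 2 * n" "vs s vQ = Q" "vs s vbase = b"
   "vs s 33 = oa" "vs s 34 = ob" "vs s 35 = oc" "vs s 36 = \<alpha>" "vs s 37 = \<beta>"
  and im: "index_map n \<alpha> \<beta>" and pos: "0 < n" "0 < \<sigma>" "4 * n < 2 ^ (L + 1)"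
  and A: "\<forall>i<n. \<forall>k<n. A i k \<le> m + 1" and m: "m \<le> n * n" and fr: "fresh b s"
  and mm: "mm_spec C mm (2 * n) B Q \<tau>"
  and Q: "8 * (n * n) \<le> Q" "2 * n \<le> Q"
  and B: "(n + 1) * \<tau>' \<le> B" "b + Q * (n + 1) \<le> B" "5 * (n * n) \<le> B" "4 * n + 1 \<le> B" "2 * (n * n) + 4 \<le> B"
   "oc + n * n \<le> B" "\<forall>x. ar s 6 x \<le> B"
 shows "wp B (half_com mm) (\<lambda>s'. (\<forall>i<n. \<forall>j<n.
   (\<forall>k<n. A i k \<le> A' k j --> A i k \<le> ar s' 6 (oc + (i * \<alpha> + j * \<beta>))) \<and>
   ar s 6 (oc + (i * \<alpha> + j * \<beta>)) \<le> ar s' 6 (oc + (i * \<alpha> + j * \<beta>)) \<and>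
   (ar s' 6 (oc + (i * \<alpha> + j * \<beta>)) = ar s 6 (oc + (i * \<alpha> + j * \<beta>)) \<or>
    (\<exists>k<n. A i k \<le> A' k j \<and> ar s' 6 (oc + (i * \<alpha> + j * \<beta>)) = A i k))) \<and>
   (\<forall>y. y < oc \<or> oc + n * n \<le> y --> ar s' 6 y = ar s 6 y) \<and>
   (\<exists>t\<le>n. vs s' vbase = b + Q * t) \<and> fresh (vs s' vbase) s' \<and>
   ck s' \<le> ck s + (C + 9600) * (n * n * \<sigma> + \<tau>' * (L + n div \<sigma> + 1))) s"
proof -
 have b1: "wp B copyin_com (\<lambda>s'. (\<forall>i<n. \<forall>k<n. ar s' aAV (i * n + k) = A i k \<and> ar s' aBV (i * n + k) = A' i k) \<and>
   ck s' \<le> ck s + 120 * (n * n + 1)) s"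
  unfolding A_def A'_def by (rule wp_copyin) (use v B in auto)
 show ?thesis unfolding half_com_def wp_Seq
 proof (rule wp_conseq[OF b1])
  fix s1 assume s1: "(\<forall>i<n. \<forall>k<n. ar s1 aAV (i * n + k) = A i k \<and> ar s1 aBV (i * n + k) = A' i k) \<and>
   ck s1 \<le> ck s + 120 * (n * n + 1)" and "same (mv copyin_com) (ma copyin_com) s s1"
  then have sm1: "same {17, 18, 24} {7, 8} s s1" by simp
  have v1: "vs s1 vn = n" "vs s1 vnn = n * n" "vs s1 vm = m" "vs s1 vN = 2 * n" "vs s1 vQ = Q" "vs s1 vbase = b"
   "vs s1 35 = oc" "vs s1 36 = \<alpha>" "vs s1 37 = \<beta>" using v by (simp_all add: same_vs[OF sm1])
  have AV: "\<forall>e<n * n. ar s1 aAV e \<le> m + 1"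
  proof (intro allI impI)
   fix e assume e: "e < n * n"
   have "e div n < n" "e mod n < n" "e = e div n * n + e mod n" using e pos(1) by (auto simp: less_mult_imp_div_less)
   then show "ar s1 aAV e \<le> m + 1" using s1 A by metis
  qed
  have fr1: "fresh b s1" using fr by (simp add: fresh_def same_ar[OF sm1])
  note core = wp_core[OF v1(1-6) pos AV m fr1 mm Q B(1)[unfolded \<tau>'_def] B(2-5), folded \<tau>'_def]
  show "wp B (core_com mm) (wp B copyout_com (\<lambda>s'. (\<forall>i<n. \<forall>j<n.
   (\<forall>k<n. A i k \<le> A' k j --> A i k \<le> ar s' 6 (oc + (i * \<alpha> + j * \<beta>))) \<and>
   ar s 6 (oc + (i * \<alpha> + j * \<beta>)) \<le> ar s' 6 (oc + (i * \<alpha> + j * \<beta>)) \<and>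
   (ar s' 6 (oc + (i * \<alpha> + j * \<beta>)) = ar s 6 (oc + (i * \<alpha> + j * \<beta>)) \<or>
    (\<exists>k<n. A i k \<le> A' k j \<and> ar s' 6 (oc + (i * \<alpha> + j * \<beta>)) = A i k))) \<and>
   (\<forall>y. y < oc \<or> oc + n * n \<le> y --> ar s' 6 y = ar s 6 y) \<and>
   (\<exists>t\<le>n. vs s' vbase = b + Q * t) \<and> fresh (vs s' vbase) s' \<and>
   ck s' \<le> ck s + (C + 9600) * (n * n * \<sigma> + \<tau>' * (L + n div \<sigma> + 1)))) s1" (is "wp _ _ (wp _ _ ?Q) _")
  proof (rule wp_conseq[OF core])
   fix s2 assume s2: "(\<forall>i<n. \<forall>j<n.
     (\<forall>k<n. ar s1 aAV (i * n + k) \<le> ar s1 aBV (k * n + j) --> ar s1 aAV (i * n + k) \<le> ar s2 aCV (i * n + j)) \<and>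
     (ar s2 aCV (i * n + j) = 0 \<or> (\<exists>k<n. ar s1 aAV (i * n + k) \<le> ar s1 aBV (k * n + j) \<and> ar s2 aCV (i * n + j) = ar s1 aAV (i * n + k)))) \<and>
    (\<exists>t\<le>n. vs s2 vbase = b + Q * t) \<and> fresh (vs s2 vbase) s2 \<and>
    ck s2 \<le> ck s1 + (C + 9000) * (n * n * \<sigma> + \<tau>' * (L + n div \<sigma> + 1))"
    and "same (mv (core_com mm)) (ma (core_com mm)) s1 s2"
   then have sm2: "same ({7} \<union> {10..27} \<union> {100..}) {9..30} s1 s2"
    using mm mv_core[of mm] ma_core[of mm] by (elim same_mono) (simp_all add: mm_spec_def)
   have cv: "\<forall>k<n. A i k \<le> A' k j --> A i k \<le> ar s2 aCV (i * n + j)"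
    "ar s2 aCV (i * n + j) = 0 \<or> (\<exists>k<n. A i k \<le> A' k j \<and> ar s2 aCV (i * n + j) = A i k)" if "i < n" "j < n" for i j
   proof -
    have "ar s1 aAV (i * n + k) = A i k" "ar s1 aBV (k * n + j) = A' k j" if "k < n" for k using s1 that \<open>i < n\<close> \<open>j < n\<close> by auto
    then show "\<forall>k<n. A i k \<le> A' k j --> A i k \<le> ar s2 aCV (i * n + j)"
     "ar s2 aCV (i * n + j) = 0 \<or> (\<exists>k<n. A i k \<le> A' k j \<and> ar s2 aCV (i * n + j) = A i k)"
     using s2[THEN conjunct1, rule_format, OF that] by auto
   qed
   have CB: "\<forall>x<n * n. ar s2 aCV x \<le> B"
   proof (intro allI impI)
    fix e assume e: "e < n * n"
    have d: "e div n < n" "e mod n < n" "e div n * n + e mod n = e" using e pos(1) by (auto simp: less_mult_imp_div_less)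
    have "ar s2 aCV e \<le> m + 1" using cv(2)[OF d(1,2)] A d unfolding d(3) by auto
    then show "ar s2 aCV e \<le> B" using m B(5) by linarith
   qed
   have M2: "ar s2 6 = ar s 6" by (simp add: same_ar[OF sm2] same_ar[OF sm1])
   have v2: "vs s2 vn = n" "vs s2 vnn = n * n" "vs s2 35 = oc" "vs s2 36 = \<alpha>" "vs s2 37 = \<beta>"
    using v1 by (simp_all add: same_vs[OF sm2])
   note out = wp_copyout[OF v2 im B(6) CB]
   show "wp B copyout_com ?Q s2"
   proof (rule wp_conseq[OF out])
    fix s3 assume s3: "(\<forall>i<n. \<forall>k<n. ar s3 6 (oc + (i * \<alpha> + k * \<beta>)) =
      max (ar s2 6 (oc + (i * \<alpha> + k * \<beta>))) (ar s2 aCV (i * n + k))) \<and>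
     (\<forall>y. y < oc \<or> oc + n * n \<le> y --> ar s3 6 y = ar s2 6 y) \<and> ck s3 \<le> ck s2 + 120 * (n * n + 1)"
     and "same (mv copyout_com) (ma copyout_com) s2 s3"
    then have sm3: "same {17, 18, 23, 24} {6} s2 s3" by simp
    have r: "(\<forall>k<n. A i k \<le> A' k j --> A i k \<le> ar s3 6 (oc + (i * \<alpha> + j * \<beta>))) \<and>
     ar s 6 (oc + (i * \<alpha> + j * \<beta>)) \<le> ar s3 6 (oc + (i * \<alpha> + j * \<beta>)) \<and>
     (ar s3 6 (oc + (i * \<alpha> + j * \<beta>)) = ar s 6 (oc + (i * \<alpha> + j * \<beta>)) \<or>
     (\<exists>k<n. A i k \<le> A' k j \<and> ar s3 6 (oc + (i * \<alpha> + j * \<beta>)) = A i k))" if ij: "i < n" "j < n" for i j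
    proof -
     have e: "ar s3 6 (oc + (i * \<alpha> + j * \<beta>)) = max (ar s 6 (oc + (i * \<alpha> + j * \<beta>))) (ar s2 aCV (i * n + j))"
      using s3 ij by (simp add: M2)
     show ?thesis unfolding e using cv[OF ij] by (auto simp: max_def)
    qed
    have vb: "vs s3 vbase = vs s2 vbase" by (simp add: same_vs[OF sm3])
    have fr3: "fresh (vs s2 vbase) s3" using s2 by (simp add: fresh_def same_ar[OF sm3])
    define H where "H = n * n * \<sigma> + \<tau>' * (L + n div \<sigma> + 1)"
    have nn1: "1 \<le> n * n" using pos(1) by (simp add: One_nat_def Suc_le_eq)
    have nnH: "n * n \<le> H"
    proof -
     have "n * n * 1 \<le> n * n * \<sigma>" using pos(2) by (intro mult_le_mono2) simp
     then show ?thesis unfolding H_def by linarith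
    qed
    have "(C + 9600) * H = (C + 9000) * H + 600 * H" by (simp add: algebra_simps)
    moreover have "ck s3 \<le> ck s + 240 * (n * n + 1) + (C + 9000) * H" using s3 s2 s1 unfolding H_def by linarith
    moreover have "240 * (n * n + 1) \<le> 600 * H" using nnH nn1 by simp
    ultimately have "ck s3 \<le> ck s + (C + 9600) * H" by linarith
    then show "?Q s3" using r s2 s3 vb fr3 M2 unfolding H_def by auto
   qed
  qed
 qed
qed

text \<open>The minimum of two entries is the one that does not exceed the other, and each half
  accounts for one of these cases. The target must start at zero because both halves can only raise
  its cells.\<close>

lemma wp_prod:
 fixes s :: st and n m b C B Q \<tau> \<sigma> L oa ob oc :: nat and mm :: com
 defines "\<tau>' \<equiv> \<tau> + n * n" and "A \<equiv> \<lambda>i k. ar s 6 (oa + (i * n + k))" and "A' \<equiv> \<lambda>k j. ar s 6 (ob + (k * n + j))"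
 assumes v: "vs s vn = n" "vs s vnn = n * n" "vs s vm = m" "vs s vN = 2 * n" "vs s vQ = Q" "vs s vbase = b"
   "vs s 33 = oa" "vs s 34 = ob" "vs s 35 = oc"
  and pos: "0 < n" "0 < \<sigma>" "4 * n < 2 ^ (L + 1)"
  and A: "\<forall>i<n. \<forall>k<n. A i k \<le> m + 1" "\<forall>i<n. \<forall>k<n. A' i k \<le> m + 1" and m: "m \<le> n * n" and fr: "fresh b s"
  and dj: "oa + n * n \<le> oc" "ob + n * n \<le> oc" and z: "\<forall>x<n * n. ar s 6 (oc + x) = 0"
  and mm: "mm_spec C mm (2 * n) B Q \<tau>"
  and Q: "8 * (n * n) \<le> Q" "2 * n \<le> Q"
  and B: "(n + 1) * \<tau>' \<le> B" "b + Q * (2 * n + 1) \<le> B" "5 * (n * n) \<le> B" "4 * n + 1 \<le> B" "2 * (n * n) + 4 \<le> B"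
   "oc + n * n \<le> B" "\<forall>x. ar s 6 x \<le> B"
 shows "wp B (prod_com mm) (\<lambda>s'. (\<forall>i<n. \<forall>j<n.
   (\<forall>k<n. min (A i k) (A' k j) \<le> ar s' 6 (oc + (i * n + j))) \<and>
   (ar s' 6 (oc + (i * n + j)) = 0 \<or> (\<exists>k<n. ar s' 6 (oc + (i * n + j)) = min (A i k) (A' k j)))) \<and>
   (\<forall>y. y < oc \<or> oc + n * n \<le> y --> ar s' 6 y = ar s 6 y) \<and>
   (\<exists>t\<le>2 * n. vs s' vbase = b + Q * t) \<and> fresh (vs s' vbase) s' \<and>
   ck s' \<le> ck s + (2 * C + 20000) * (n * n * \<sigma> + \<tau>' * (L + n div \<sigma> + 1))) s"
proof -
 define H where "H = n * n * \<sigma> + \<tau>' * (L + n div \<sigma> + 1)"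
 have nn1: "1 \<le> n * n" using pos(1) by (simp add: One_nat_def Suc_le_eq)
 have nnH: "n * n \<le> H"
 proof -
  have "n * n * 1 \<le> n * n * \<sigma>" using pos(2) by (intro mult_le_mono2) simp
  then show ?thesis unfolding H_def by linarith
 qed
 have mmv: "mv (half_com mm) \<subseteq> {7} \<union> {10..27} \<union> {100..}" "ma (half_com mm) \<subseteq> {6..30}"
  using mm mv_half[of mm] ma_half[of mm] by (simp_all add: mm_spec_def)
 let ?s = "setv 3 37 1 (setv 4 36 n s)"
 have im: "index_map n n 1" "index_map n 1 n" by (simp_all add: index_map_def)
 have bq: "b + Q * (n + 1) \<le> B" "b + Q * n + Q * (n + 1) \<le> B"
  using B(2) by (simp_all add: algebra_simps)
 have eq: "i * n + j * 1 = i * n + j" for i j by simp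
 have h1: "wp B (half_com mm) (\<lambda>s'. (\<forall>i<n. \<forall>j<n.
   (\<forall>k<n. A i k \<le> A' k j --> A i k \<le> ar s' 6 (oc + (i * n + j))) \<and>
   (ar s' 6 (oc + (i * n + j)) = 0 \<or> (\<exists>k<n. A i k \<le> A' k j \<and> ar s' 6 (oc + (i * n + j)) = A i k))) \<and>
   (\<forall>y. y < oc \<or> oc + n * n \<le> y --> ar s' 6 y = ar s 6 y) \<and>
   (\<exists>t\<le>n. vs s' vbase = b + Q * t) \<and> fresh (vs s' vbase) s' \<and>
   ck s' \<le> ck ?s + (C + 9600) * H) ?s"
 proof -
  have fr': "fresh b ?s" using fr by (simp add: fresh_def)
  have w: "wp B (half_com mm) (\<lambda>s'. (\<forall>i<n. \<forall>j<n.
   (\<forall>k<n. A i k \<le> A' k j --> A i k \<le> ar s' 6 (oc + (i * n + j * 1))) \<and>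
   ar s 6 (oc + (i * n + j * 1)) \<le> ar s' 6 (oc + (i * n + j * 1)) \<and>
   (ar s' 6 (oc + (i * n + j * 1)) = ar s 6 (oc + (i * n + j * 1)) \<or>
    (\<exists>k<n. A i k \<le> A' k j \<and> ar s' 6 (oc + (i * n + j * 1)) = A i k))) \<and>
   (\<forall>y. y < oc \<or> oc + n * n \<le> y --> ar s' 6 y = ar s 6 y) \<and>
   (\<exists>t\<le>n. vs s' vbase = b + Q * t) \<and> fresh (vs s' vbase) s' \<and>
   ck s' \<le> ck ?s + (C + 9600) * H) ?s"
   using wp_half[of ?s n m Q b oa ob oc n 1 \<sigma> L C mm B \<tau>] v im(1) pos A m fr' mm Q B bq
   by (simp add: A_def A'_def H_def \<tau>'_def)
  show ?thesis by (rule wp_conseq[OF w]) (use z cell_less[of _ n _ n] in \<open>simp add: eq\<close>)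
 qed
 show ?thesis unfolding prod_com_def
 proof -
  have "wp B (half_com mm) (wp B (23 ::= V 33 ;; 33 ::= V 34 ;; 34 ::= V 23 ;; 36 ::= N 1 ;; 37 ::= V vn ;; half_com mm)
   (\<lambda>s'. (\<forall>i<n. \<forall>j<n.
   (\<forall>k<n. min (A i k) (A' k j) \<le> ar s' 6 (oc + (i * n + j))) \<and>
   (ar s' 6 (oc + (i * n + j)) = 0 \<or> (\<exists>k<n. ar s' 6 (oc + (i * n + j)) = min (A i k) (A' k j)))) \<and>
   (\<forall>y. y < oc \<or> oc + n * n \<le> y --> ar s' 6 y = ar s 6 y) \<and>
   (\<exists>t\<le>2 * n. vs s' vbase = b + Q * t) \<and> fresh (vs s' vbase) s' \<and>
   ck s' \<le> ck s + (2 * C + 20000) * H)) ?s" (is "wp _ _ (wp _ _ ?Q) _")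
  proof (rule wp_conseq[OF h1])
   fix s1 assume s1: "(\<forall>i<n. \<forall>j<n.
    (\<forall>k<n. A i k \<le> A' k j --> A i k \<le> ar s1 6 (oc + (i * n + j))) \<and>
    (ar s1 6 (oc + (i * n + j)) = 0 \<or> (\<exists>k<n. A i k \<le> A' k j \<and> ar s1 6 (oc + (i * n + j)) = A i k))) \<and>
    (\<forall>y. y < oc \<or> oc + n * n \<le> y --> ar s1 6 y = ar s 6 y) \<and>
    (\<exists>t\<le>n. vs s1 vbase = b + Q * t) \<and> fresh (vs s1 vbase) s1 \<and>
    ck s1 \<le> ck ?s + (C + 9600) * H" and "same (mv (half_com mm)) (ma (half_com mm)) ?s s1"
   then have sm1: "same ({7} \<union> {10..27} \<union> {100..}) {6..30} ?s s1" using mmv by (elim same_mono)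
   obtain t where t: "t \<le> n" "vs s1 vbase = b + Q * t" using s1 by blast
   let ?s2 = "setv 4 37 n (setv 3 36 1 (setv 4 34 oa (setv 4 33 ob (setv 4 23 oa s1))))"
   have v2: "vs ?s2 vn = n" "vs ?s2 vnn = n * n" "vs ?s2 vm = m" "vs ?s2 vN = 2 * n" "vs ?s2 vQ = Q" "vs ?s2 vbase = b + Q * t"
    "vs ?s2 33 = ob" "vs ?s2 34 = oa" "vs ?s2 35 = oc" "vs ?s2 36 = 1" "vs ?s2 37 = n"
    using v t by (simp_all add: same_vs[OF sm1])
   have out: "ar s1 6 y = ar s 6 y" if "y < oc" for y using s1 that by blast
   have a1: "ar s1 6 (oa + (k * n + i)) = A k i" "ar s1 6 (ob + (k * n + i)) = A' k i" if "i < n" "k < n" for i k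
    using out dj cell_less[OF that(2,1)] by (auto simp: A_def A'_def)
   have le: "A i k \<le> B" "A' i k \<le> B" for i k using B(7) by (auto simp: A_def A'_def)
   have tq: "b + Q * t + Q * (n + 1) \<le> B" using bq(2) mult_le_mono2[OF t(1), of Q] by linarith
   have M1: "\<forall>x. ar s1 6 x \<le> B"
   proof
    fix x show "ar s1 6 x \<le> B"
    proof (cases "x < oc \<or> oc + n * n \<le> x")
     case True then show ?thesis using s1 B(7) by auto
    next
     case False
     define y where "y = x - oc"
     have y: "x = oc + y" "y < n * n" using False by (auto simp: y_def)
     have d: "y div n < n" "y mod n < n" "y div n * n + y mod n = y" using y(2) pos(1) by (auto simp: less_mult_imp_div_less)
     then show ?thesis using s1 le unfolding y(1) by (metis le0)
    qed
   qed
   have AA: "\<forall>i<n. \<forall>k<n. ar ?s2 6 (ob + (i * 1 + k * n)) \<le> m + 1" using a1 A(2) by (simp add: add.commute)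
   have fr2: "fresh (b + Q * t) ?s2" using s1 t by (simp add: fresh_def)
   note h2 = wp_half[OF v2 im(2) pos AA m fr2 mm Q B(1)[unfolded \<tau>'_def] tq B(3-6), folded \<tau>'_def, folded H_def]
   have "wp B (half_com mm) ?Q ?s2"
   proof (rule wp_conseq[OF h2])
    show "\<forall>x. ar ?s2 6 x \<le> B" using M1 by simp
    fix s3 assume s3: "(\<forall>i<n. \<forall>j<n.
     (\<forall>k<n. ar ?s2 6 (ob + (i * 1 + k * n)) \<le> ar ?s2 6 (oa + (k * 1 + j * n)) -->
       ar ?s2 6 (ob + (i * 1 + k * n)) \<le> ar s3 6 (oc + (i * 1 + j * n))) \<and>
     ar ?s2 6 (oc + (i * 1 + j * n)) \<le> ar s3 6 (oc + (i * 1 + j * n)) \<and>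
     (ar s3 6 (oc + (i * 1 + j * n)) = ar ?s2 6 (oc + (i * 1 + j * n)) \<or>
     (\<exists>k<n. ar ?s2 6 (ob + (i * 1 + k * n)) \<le> ar ?s2 6 (oa + (k * 1 + j * n)) \<and>
      ar s3 6 (oc + (i * 1 + j * n)) = ar ?s2 6 (ob + (i * 1 + k * n))))) \<and>
     (\<forall>y. y < oc \<or> oc + n * n \<le> y --> ar s3 6 y = ar ?s2 6 y) \<and>
     (\<exists>t'\<le>n. vs s3 vbase = b + Q * t + Q * t') \<and> fresh (vs s3 vbase) s3 \<and>
     ck s3 \<le> ck ?s2 + (C + 9600) * H"
    have s3': "(\<forall>k<n. A' k i \<le> A j k --> A' k i \<le> ar s3 6 (oc + (j * n + i))) \<and>
     ar s1 6 (oc + (j * n + i)) \<le> ar s3 6 (oc + (j * n + i)) \<and>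
     (ar s3 6 (oc + (j * n + i)) = ar s1 6 (oc + (j * n + i)) \<or>
     (\<exists>k<n. A' k i \<le> A j k \<and> ar s3 6 (oc + (j * n + i)) = A' k i))" if "i < n" "j < n" for i j
    proof -
     have e: "i * 1 + k * n = k * n + i" for i k by simp
     show ?thesis using s3[THEN conjunct1, rule_format, OF that] that unfolding e by (auto simp: a1)
    qed
    have r: "(\<forall>k<n. min (A i k) (A' k j) \<le> ar s3 6 (oc + (i * n + j))) \<and>
     (ar s3 6 (oc + (i * n + j)) = 0 \<or> (\<exists>k<n. ar s3 6 (oc + (i * n + j)) = min (A i k) (A' k j)))"
     if ij: "i < n" "j < n" for i j
    proof -
     note p1 = s1[THEN conjunct1, rule_format, OF ij] and p3 = s3'[OF ij(2,1)]
     show ?thesis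
     proof (intro conjI allI impI)
      fix k assume k: "k < n"
      show "min (A i k) (A' k j) \<le> ar s3 6 (oc + (i * n + j))"
      proof (cases "A i k \<le> A' k j")
       case True then show ?thesis using p1 p3 k by (metis le_trans min.coboundedI1)
      next
       case False then show ?thesis using p3 k by (metis min.coboundedI2 nat_le_linear)
      qed
     next
      show "ar s3 6 (oc + (i * n + j)) = 0 \<or> (\<exists>k<n. ar s3 6 (oc + (i * n + j)) = min (A i k) (A' k j))"
       using p1 p3 by (metis min.absorb1 min.absorb2)
     qed
    qed
    obtain t' where t': "t' \<le> n" "vs s3 vbase = b + Q * t + Q * t'" using s3 by blast
    have "vs s3 vbase = b + Q * (t + t')" "t + t' \<le> 2 * n" using t t' by (simp_all add: algebra_simps)
    then have bb: "\<exists>t\<le>2 * n. vs s3 vbase = b + Q * t" by blast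
    have "(2 * C + 20000) * H = 2 * ((C + 9600) * H) + 800 * H" by (simp add: algebra_simps)
    then have "ck s3 \<le> ck s + (2 * C + 20000) * H" using s1 s3 nnH nn1 by simp
    then show "?Q s3" using r s1 s3 bb by auto
   qed
   moreover have "oa \<le> B" "ob \<le> B" "n \<le> B" using dj B(4,6) by linarith+
   ultimately show "wp B (23 ::= V 33 ;; 33 ::= V 34 ;; 34 ::= V 23 ;; 36 ::= N 1 ;; 37 ::= V vn ;; half_com mm) ?Q s1"
    using v B(4) by (simp add: same_vs[OF sm1])
  qed
  then show "wp B (36 ::= V vn ;; 37 ::= N 1 ;; half_com mm ;;
   23 ::= V 33 ;; 33 ::= V 34 ;; 34 ::= V 23 ;; 36 ::= N 1 ;; 37 ::= V vn ;; half_com mm) (\<lambda>s'. (\<forall>i<n. \<forall>j<n.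
   (\<forall>k<n. min (A i k) (A' k j) \<le> ar s' 6 (oc + (i * n + j))) \<and>
   (ar s' 6 (oc + (i * n + j)) = 0 \<or> (\<exists>k<n. ar s' 6 (oc + (i * n + j)) = min (A i k) (A' k j)))) \<and>
   (\<forall>y. y < oc \<or> oc + n * n \<le> y --> ar s' 6 y = ar s 6 y) \<and>
   (\<exists>t\<le>2 * n. vs s' vbase = b + Q * t) \<and> fresh (vs s' vbase) s' \<and>
   ck s' \<le> ck s + (2 * C + 20000) * (n * n * \<sigma> + \<tau>' * (L + n div \<sigma> + 1))) s"
   using v B(4) unfolding H_def by simp
 qed
qed

subsection \<open>Length scales and bottleneck matrices\<close>

text \<open>The lengths are \<open>1, ..., 2 * h\<close>, followed by the doubles of
  \<open>h + 1, ..., 2 * h\<close>, the doubles of these, and so on. So every length above 1 is a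
  sum of two earlier ones, and each block of \<open>h\<close> indices doubles it. The case
  \<open>h = 0\<close> only serves termination.\<close>

fun slen :: "nat => nat => nat" where
 "slen h k = (if h = 0 \<or> k < 2 * h then k + 1 else 2 * slen h (k - h))"

declare slen.simps [simp del]

lemma slen_small: "k < 2 * h ==> slen h k = k + 1"
 by (simp add: slen.simps)

lemma slen_large: "0 < h ==> 2 * h \<le> k ==> slen h k = 2 * slen h (k - h)"
 by (subst slen.simps) auto

lemma slen_pos: "1 \<le> slen h k"
proof (induction k rule: less_induct)
 case (less k)
 show ?case
 proof (cases "h = 0 \<or> k < 2 * h")
  case False
  then have "1 \<le> slen h (k - h)" using less.IH[of "k - h"] by simp
  then show ?thesis using slen_large[of h k] False by simp
 qed (simp add: slen.simps)
qed

lemma slen_less: "0 < h ==> slen h k < slen h (k + 1)"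
proof (induction k rule: less_induct)
 case (less k)
 show ?case
 proof (cases "k + 1 < 2 * h")
  case True
  then show ?thesis by (simp add: slen_small)
 next
  case False
  show ?thesis
  proof (cases "k < 2 * h")
   case True
   then have "k + 1 - h = h" using False by simp
   then have "slen h (k + 1) = 2 * (h + 1)" using False less.prems slen_large[of h "k + 1"] by (simp add: slen_small)
   then show ?thesis using True by (simp add: slen_small)
  next
   case F: False
   have "slen h (k - h) < slen h (k - h + 1)" using less.IH[of "k - h"] less.prems F by simp
   moreover have "k - h + 1 = k + 1 - h" using F by simp
   ultimately show ?thesis using F False less.prems slen_large[of h k] slen_large[of h "k + 1"] by simp
  qed
 qed
qed

lemma slen_mono: "0 < h ==> j \<le> k ==> slen h j \<le> slen h k"
 by (rule lift_Suc_mono_le[of "slen h"]) (use slen_less[of h] in \<open>simp_all add: less_imp_le Suc_eq_plus1 del: add_Suc_right\<close>)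

lemma slen_ge: "0 < h ==> k + 1 \<le> slen h k"
proof (induction k)
 case 0
 then show ?case using slen_pos by simp
next
 case (Suc k)
 then show ?case using slen_less[of h k] by (simp add: Suc_eq_plus1 del: add_Suc_right)
qed

text \<open>Going \<open>h\<close> indices further doubles the length; hence about
  \<open>h * log 2 n\<close> scales suffice to reach \<open>n\<close>.\<close>

lemma slen_exp: "0 < h ==> 2 ^ (k div h) \<le> 2 * slen h k"
proof (induction k rule: less_induct)
 case (less k)
 show ?case
 proof (cases "k < 2 * h")
  case True
  then have "k div h \<le> 1" using less.prems by (simp add: less_mult_imp_div_less less_Suc_eq_le[symmetric] One_nat_def numeral_2_eq_2)
  then have "(2::nat) ^ (k div h) \<le> 2 ^ 1" by (intro power_increasing) auto
  then show ?thesis using True slen_pos[of h k] by simp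
 next
  case False
  have "k div h = (k - h) div h + 1" using False less.prems by (simp add: le_div_geq)
  then have "(2::nat) ^ (k div h) = 2 * 2 ^ ((k - h) div h)" by (simp only: power_add) simp
  also have "\<dots> \<le> 2 * (2 * slen h (k - h))" using less.IH[of "k - h"] False less.prems by simp
  finally show ?thesis using slen_large[of h k] False less.prems by simp
 qed
qed

text \<open>Within the initial list the ratio is \<open>(l + 1) / l\<close> with
  \<open>h \<le> l\<close>, and doubling preserves ratios. The seam between the initial list and the
  doubled ones is the step from \<open>2 * h\<close> to \<open>2 * (h + 1)\<close>.\<close>

lemma slen_ratio: "0 < h ==> h \<le> k + 1 ==> h * slen h (k + 1) \<le> (h + 1) * slen h k"
proof (induction k rule: less_induct)
 case (less k)
 show ?case
 proof (cases "k + 1 < 2 * h")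
  case True
  then show ?thesis using less.prems by (simp add: slen_small algebra_simps)
 next
  case False
  show ?thesis
  proof (cases "k < 2 * h")
   case True
   then have k: "k + 1 = 2 * h" "k + 1 - h = h" using False by simp_all
   have "slen h (k + 1) = 2 * (h + 1)" using k less.prems slen_large[of h "k + 1"] by (simp add: slen_small)
   moreover have "slen h k = 2 * h" using True k by (simp add: slen_small)
   ultimately show ?thesis by (simp add: algebra_simps)
  next
   case F: False
   have "h * slen h (k - h + 1) \<le> (h + 1) * slen h (k - h)" using less.IH[of "k - h"] less.prems F by simp
   moreover have "k - h + 1 = k + 1 - h" using F by simp
   ultimately show ?thesis using F False less.prems slen_large[of h k] slen_large[of h "k + 1"] by simp
  qed
 qed
qed

section \<open>Bottleneck matrices of walks of bounded length\<close>

definition eset :: "edge list => nat => edge set" where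
 "eset es t = {es ! i | i. i < length es \<and> t \<le> i + 1}"

text \<open>Thresholds are predicted deletion times, counted from 1. The entry is 0 if no threshold
  admits a walk. The threshold \<open>length es + 1\<close> belongs to the graph without edges and
  is reached only for \<open>u = v\<close>, by the empty walk.\<close>

definition level :: "nat => edge list => nat => (nat => nat) => nat => bool" where
 "level n es l M o' \<longleftrightarrow> (\<forall>u<n. \<forall>v<n. M (o' + (u * n + v)) \<le> length es + 1 \<and>
  (\<forall>t. 1 \<le> t --> t \<le> length es + 1 --> (t \<le> M (o' + (u * n + v)) \<longleftrightarrow> (\<exists>j\<le>l. (u, v) \<in> eset es t ^^ j))))"

lemma level_bound: "level n es l M o' ==> u < n ==> v < n ==> M (o' + (u * n + v)) \<le> length es + 1"
 by (simp add: level_def)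

lemma levelD: "level n es l M o' ==> u < n ==> v < n ==> 1 \<le> t ==> t \<le> length es + 1 ==>
  t \<le> M (o' + (u * n + v)) \<longleftrightarrow> (\<exists>j\<le>l. (u, v) \<in> eset es t ^^ j)"
 by (simp add: level_def)

lemma relpow_less:
 assumes "E \<subseteq> {..<n} \<times> {..<n}" "(u, w) \<in> E ^^ l" "u < n"
 shows "w < (n::nat)"
 using assms(2,3) by (induction l arbitrary: w) (use assms(1) in auto)

lemma eset_sub: "set es \<subseteq> {..<n} \<times> {..<n} ==> eset es t \<subseteq> {..<n} \<times> {..<n}"
 unfolding eset_def using nth_mem by blast

text \<open>A walk of length \<open>j \<le> la + lb\<close> is cut after \<open>min j la\<close>
  steps. Both pieces exist above the threshold \<open>t\<close> iff \<open>t\<close> is at most the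
  minimum of the two entries, and the maximum ranges over the vertex at the cut.\<close>

lemma level_prod:
 assumes es: "set es \<subseteq> {..<n} \<times> {..<n}"
  and A: "level n es la M oa" and A': "level n es lb M ob"
  and C: "\<And>i j k. i < n ==> j < n ==> k < n ==> min (M (oa + (i * n + k))) (M (ob + (k * n + j))) \<le> M' (oc + (i * n + j))"
  and C': "\<And>i j. i < n ==> j < n ==> M' (oc + (i * n + j)) = 0 \<or>
   (\<exists>k<n. M' (oc + (i * n + j)) = min (M (oa + (i * n + k))) (M (ob + (k * n + j))))"
 shows "level n es (la + lb) M' oc"
 unfolding level_def
proof (intro allI impI conjI)
 fix u v assume uv: "u < n" "v < n"
 show "M' (oc + (u * n + v)) \<le> length es + 1"
 proof (cases "M' (oc + (u * n + v)) = 0")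
  case False
  then obtain k where k: "k < n" "M' (oc + (u * n + v)) = min (M (oa + (u * n + k))) (M (ob + (k * n + v)))"
   using C'[OF uv] by auto
  then show ?thesis using k(2) level_bound[OF A uv(1) k(1)] by simp
 qed simp
 fix t assume t: "1 \<le> t" "t \<le> length es + 1"
 have "t \<le> M' (oc + (u * n + v)) \<longleftrightarrow> (\<exists>w<n. t \<le> M (oa + (u * n + w)) \<and> t \<le> M (ob + (w * n + v)))"
 proof
  assume "t \<le> M' (oc + (u * n + v))"
  then have "M' (oc + (u * n + v)) \<noteq> 0" using t by simp
  then obtain k where "k < n" "M' (oc + (u * n + v)) = min (M (oa + (u * n + k))) (M (ob + (k * n + v)))"
   using C'[OF uv] by auto
  then show "\<exists>w<n. t \<le> M (oa + (u * n + w)) \<and> t \<le> M (ob + (w * n + v))"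
   using \<open>t \<le> M' (oc + (u * n + v))\<close> by auto
 next
  assume "\<exists>w<n. t \<le> M (oa + (u * n + w)) \<and> t \<le> M (ob + (w * n + v))"
  then obtain w where "w < n" "t \<le> min (M (oa + (u * n + w))) (M (ob + (w * n + v)))" by auto
  then show "t \<le> M' (oc + (u * n + v))" using C[OF uv, of w] by (simp add: min_def split: if_splits)
 qed
 also have "\<dots> \<longleftrightarrow> (\<exists>w<n. (\<exists>j\<le>la. (u, w) \<in> eset es t ^^ j) \<and> (\<exists>j\<le>lb. (w, v) \<in> eset es t ^^ j))"
 proof (intro ex_cong1 conj_cong refl)
  fix w assume "w < n"
  then show "(t \<le> M (oa + (u * n + w))) = (\<exists>j\<le>la. (u, w) \<in> eset es t ^^ j)"
   "(t \<le> M (ob + (w * n + v))) = (\<exists>j\<le>lb. (w, v) \<in> eset es t ^^ j)"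
   using levelD[OF A uv(1) _ t] levelD[OF A' _ uv(2) t] by simp_all
 qed
 also have "\<dots> \<longleftrightarrow> (\<exists>j\<le>la + lb. (u, v) \<in> eset es t ^^ j)"
 proof
  assume "\<exists>w<n. (\<exists>j\<le>la. (u, w) \<in> eset es t ^^ j) \<and> (\<exists>j\<le>lb. (w, v) \<in> eset es t ^^ j)"
  then obtain w i j where "i \<le> la" "(u, w) \<in> eset es t ^^ i" "j \<le> lb" "(w, v) \<in> eset es t ^^ j" by blast
  then have "(u, v) \<in> eset es t ^^ (i + j)" "i + j \<le> la + lb" by (auto simp: relpow_add)
  then show "\<exists>j\<le>la + lb. (u, v) \<in> eset es t ^^ j" by blast
 next
  assume "\<exists>j\<le>la + lb. (u, v) \<in> eset es t ^^ j"
  then obtain j where j: "j \<le> la + lb" "(u, v) \<in> eset es t ^^ j" by blast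
  have "j = min j la + (j - min j la)" by simp
  then have "(u, v) \<in> eset es t ^^ min j la O eset es t ^^ (j - min j la)"
   using j(2) by (metis relpow_add)
  then obtain w where w: "(u, w) \<in> eset es t ^^ min j la" "(w, v) \<in> eset es t ^^ (j - min j la)" by blast
  have "w < n" using relpow_less[OF eset_sub[OF es] w(1) uv(1)] .
  moreover have "min j la \<le> la" "j - min j la \<le> lb" using j(1) by auto
  ultimately show "\<exists>w<n. (\<exists>j\<le>la. (u, w) \<in> eset es t ^^ j) \<and> (\<exists>j\<le>lb. (w, v) \<in> eset es t ^^ j)" using w by blast
 qed
 finally show "t \<le> M' (oc + (u * n + v)) \<longleftrightarrow> (\<exists>j\<le>la + lb. (u, v) \<in> eset es t ^^ j)" .
qed

lemma level_cong: "level n es l M o' ==> (\<And>x. o' \<le> x ==> x < o' + n * n ==> M' x = M x) ==> level n es l M' o'"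
 unfolding level_def using cell_less[of _ n _ n] by simp

text \<open>Variables 30 and 31 are the indices of the two scales whose lengths add up to the new
  one, variable 32. Matrix \<open>k\<close> is stored in array 6 from
  \<open>(k + 1) * (n * n)\<close> on; the block before the first matrix overlaps the input.\<close>

definition levels_step :: "com => nat => com" where
 "levels_step mm h = (
   CIf (V vK <. N (2 * h)) (30 ::= V vK -. N 1 ;; 31 ::= N 0 ;; 32 ::= V 32 +. N 1)
    (30 ::= V vK -. N h ;; 31 ::= V 30 ;; 32 ::= N 2 *. Rd 5 (V 30)) ;;
   Wr 5 (V vK) (V 32) ;;
   33 ::= (V 30 +. N 1) *. V vnn ;; 34 ::= (V 31 +. N 1) *. V vnn ;; 35 ::= (V vK +. N 1) *. V vnn ;;
   prod_com mm ;; vK ::= V vK +. N 1)"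

definition levels_com :: "com => nat => com" where
 "levels_com mm h = (Wr 5 (N 0) (N 1) ;; vK ::= N 1 ;; 32 ::= N 1 ;;
   CWhile (V 32 <. V vn) (levels_step mm h))"

text \<open>The last conjunct says that only the final scale may reach \<open>n\<close>; it bounds
  the number of scales.\<close>

definition levels_ok :: "nat => edge list => nat => nat => st => bool" where
 "levels_ok n es h K s \<longleftrightarrow> 1 \<le> K \<and> (\<forall>k<K. ar s 5 k = slen h k \<and> level n es (slen h k) (ar s 6) ((k + 1) * (n * n))) \<and>
  (\<forall>k. k + 1 < K --> slen h k < n)"

lemma mv_levels_step: "mv mm \<subseteq> insert vX {100..} ==>
  mv (levels_step mm h) \<subseteq> {5, 7} \<union> {10..27} \<union> {30..37} \<union> {100..}"
 and ma_levels_step: "ma mm \<subseteq> {aPM} ==> ma (levels_step mm h) \<subseteq> {5..30}"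
 using mv_prod[of mm] ma_prod[of mm] by (auto simp: levels_step_def)

definition linv :: "nat => edge list => nat => nat => nat => nat => nat => st => st => bool" where
 "linv n es h B Q b T s0 s \<longleftrightarrow> levels_ok n es h (vs s vK) s \<and> vs s 32 = slen h (vs s vK - 1) \<and>
  (\<forall>x\<ge>(vs s vK + 1) * (n * n). ar s 6 x = 0) \<and> (\<forall>x. ar s 6 x \<le> B) \<and> fresh (vs s vbase) s \<and>
  (\<exists>t\<le>2 * n * (vs s vK - 1). vs s vbase = b + Q * t) \<and> ck s \<le> ck s0 + T * (vs s vK - 1)"

lemma wp_levels_step:
 fixes s :: st and n m b C B Q \<tau> \<sigma> L h :: nat and mm :: com
 defines "\<tau>' \<equiv> \<tau> + n * n"
 defines "T \<equiv> (2 * C + 20200) * (n * n * \<sigma> + \<tau>' * (L + n div \<sigma> + 1))"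
 assumes inv: "linv n es h B Q b T s0 s" and lt: "vs s 32 < n"
  and v: "vs s vn = n" "vs s vnn = n * n" "vs s vm = length es" "vs s vN = 2 * n" "vs s vQ = Q"
  and pos: "0 < \<sigma>" "4 * n < 2 ^ (L + 1)" "0 < h"
  and m: "length es \<le> n * n" and es: "set es \<subseteq> {..<n} \<times> {..<n}"
  and mm: "mm_spec C mm (2 * n) B Q \<tau>"
  and Q: "8 * (n * n) \<le> Q" "2 * n \<le> Q"
  and B: "(n + 1) * \<tau>' \<le> B" "b + Q * (2 * n * n + 2 * n + 1) \<le> B" "4 * n + 1 \<le> B" "5 * (n * n) + 4 \<le> B" "(n + 2) * (n * n) \<le> B"
 shows "wp B (levels_step mm h) (\<lambda>s'. linv n es h B Q b T s0 s' \<and> n - vs s' 32 < n - vs s 32) (tick 6 s)"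
proof -
 define K where "K = vs s vK"
 define H where "H = n * n * \<sigma> + \<tau>' * (L + n div \<sigma> + 1)"
 have lo: "levels_ok n es h K s" and l32: "vs s 32 = slen h (K - 1)" and z6: "\<forall>x\<ge>(K + 1) * (n * n). ar s 6 x = 0"
  and B6: "\<forall>x. ar s 6 x \<le> B" and fr: "fresh (vs s vbase) s" and ck: "ck s \<le> ck s0 + T * (K - 1)"
  using inv unfolding linv_def K_def by blast+
 obtain t where t: "t \<le> 2 * n * (K - 1)" "vs s vbase = b + Q * t" using inv unfolding linv_def K_def by blast
 have K1: "1 \<le> K" using lo by (simp add: levels_ok_def)
 have n: "0 < n" using lt by simp
 have Kn: "K < n" using slen_ge[OF pos(3), of "K - 1"] lt l32 K1 by simp
 define a where "a = (if K < 2 * h then K - 1 else K - h)"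
 define b' where "b' = (if K < 2 * h then 0 else K - h)"
 \<comment> \<open>Either the previous scale plus the scale of length 1, or twice the scale
   \<open>h\<close> places back.\<close>
 have ab: "a < K" "b' < K" "slen h K = slen h a + slen h b'"
 proof -
  show "a < K" "b' < K" using K1 pos(3) by (auto simp: a_def b'_def)
  show "slen h K = slen h a + slen h b'"
   using slen_large[of h K] pos(3) K1 by (auto simp: a_def b'_def slen_small)
 qed
 have lev: "level n es (slen h k) (ar s 6) ((k + 1) * (n * n))" "ar s 5 k = slen h k" if "k < K" for k
  using lo that by (auto simp: levels_ok_def)
 have step: "slen h (K - 1) < slen h K" using slen_less[OF pos(3), of "K - 1"] K1 by simp
 have K2: "slen h K \<le> 2 * n"
 proof -
  have "slen h K \<le> 2 * slen h (K - 1)" unfolding ab(3) using slen_mono[OF pos(3), of a "K - 1"] slen_mono[OF pos(3), of b' "K - 1"] ab(1,2) by linarith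
  then show ?thesis using lt l32 by simp
 qed
 define oa where "oa = (a + 1) * (n * n)"
 define ob where "ob = (b' + 1) * (n * n)"
 define oc where "oc = (K + 1) * (n * n)"
 have "oc + n * n \<le> B"
 proof -
  have "oc + n * n = (K + 2) * (n * n)" by (simp add: oc_def algebra_simps)
  also have "\<dots> \<le> (n + 2) * (n * n)" using Kn by (intro mult_le_mono1) simp
  finally show ?thesis using B(5) by linarith
 qed
 note ocB = this
 have dj: "oa + n * n \<le> oc" "ob + n * n \<le> oc"
 proof -
  have "oa + n * n = (a + 2) * (n * n)" "ob + n * n = (b' + 2) * (n * n)" by (simp_all add: oa_def ob_def add_mult_distrib)
  moreover have "(a + 2) * (n * n) \<le> oc" "(b' + 2) * (n * n) \<le> oc" unfolding oc_def using ab(1,2) by (intro mult_le_mono1; simp)+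
  ultimately show "oa + n * n \<le> oc" "ob + n * n \<le> oc" by linarith+
 qed
 have main: "wp B (33 ::= (V 30 +. N 1) *. V vnn ;; 34 ::= (V 31 +. N 1) *. V vnn ;; 35 ::= (V vK +. N 1) *. V vnn ;;
   prod_com mm ;; vK ::= V vK +. N 1) (\<lambda>s'. linv n es h B Q b T s0 s' \<and> n - vs s' 32 < n - vs s 32) s1"
  if s1: "vs s1 30 = a" "vs s1 31 = b'" "vs s1 32 = slen h K" "ar s1 5 = (ar s 5)(K := slen h K)"
   "same {30, 31, 32} {5} s s1" "ck s1 \<le> ck s + 60" for s1
 proof -
  have v1: "vs s1 vn = n" "vs s1 vnn = n * n" "vs s1 vm = length es" "vs s1 vN = 2 * n" "vs s1 vQ = Q" "vs s1 vK = K" "vs s1 vbase = b + Q * t"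
   using v t by (simp_all add: same_vs[OF s1(5)] K_def)
  let ?s2 = "setv 9 35 oc (setv 9 34 ob (setv 9 33 oa s1))"
  have m61: "ar s1 6 = ar s 6" by (simp add: same_ar[OF s1(5)])
  then have m6: "ar ?s2 6 = ar s 6" by simp
  have "b + Q * t + Q * (2 * n + 1) \<le> B"
  proof -
   have "t \<le> 2 * n * n" using t(1) Kn mult_le_mono2[of "K - 1" n "2 * n"] by linarith
   then have "Q * t \<le> Q * (2 * n * n)" by (rule mult_le_mono2)
   then have "b + Q * t + Q * (2 * n + 1) \<le> b + Q * (2 * n * n + 2 * n + 1)" by (simp add: algebra_simps)
   then show ?thesis using B(2) by linarith
  qed
  note bq = this
  have p: "wp B (prod_com mm) (\<lambda>s'. (\<forall>i<n. \<forall>j<n.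
   (\<forall>k<n. min (ar ?s2 6 (oa + (i * n + k))) (ar ?s2 6 (ob + (k * n + j))) \<le> ar s' 6 (oc + (i * n + j))) \<and>
   (ar s' 6 (oc + (i * n + j)) = 0 \<or> (\<exists>k<n. ar s' 6 (oc + (i * n + j)) = min (ar ?s2 6 (oa + (i * n + k))) (ar ?s2 6 (ob + (k * n + j)))))) \<and>
   (\<forall>y. y < oc \<or> oc + n * n \<le> y --> ar s' 6 y = ar ?s2 6 y) \<and>
   (\<exists>t'\<le>2 * n. vs s' vbase = b + Q * t + Q * t') \<and> fresh (vs s' vbase) s' \<and>
   ck s' \<le> ck ?s2 + (2 * C + 20000) * (n * n * \<sigma> + (\<tau> + n * n) * (L + n div \<sigma> + 1))) ?s2"
  proof (rule wp_prod[where m = "length es" and s = ?s2 and n = n and oa = oa and ob = ob and oc = oc and b = "b + Q * t"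
    and Q = Q and B = B and C = C and \<tau> = \<tau> and \<sigma> = \<sigma> and L = L and mm = mm])
   show "\<forall>i<n. \<forall>k<n. ar ?s2 6 (oa + (i * n + k)) \<le> length es + 1" "\<forall>i<n. \<forall>k<n. ar ?s2 6 (ob + (i * n + k)) \<le> length es + 1"
    using level_bound[OF lev(1)[OF ab(1)]] level_bound[OF lev(1)[OF ab(2)]] by (simp_all add: m61 oa_def ob_def)
   show "fresh (b + Q * t) ?s2" using fr t by (simp add: fresh_def same_ar[OF s1(5)])
   show "\<forall>x<n * n. ar ?s2 6 (oc + x) = 0" using z6 by (simp add: m61 oc_def)
   show "\<forall>x. ar ?s2 6 x \<le> B" using B6 by (simp add: m61)
   show "(n + 1) * (\<tau> + n * n) \<le> B" using B(1) unfolding \<tau>'_def .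
   show "5 * (n * n) \<le> B" "2 * (n * n) + 4 \<le> B" using B(4) by linarith+
  qed ((simp add: v1; fail) | fact n pos m dj mm Q B bq ocB)+
  have "wp B (prod_com mm) (wp B (vK ::= V vK +. N 1) (\<lambda>s'. linv n es h B Q b T s0 s' \<and> n - vs s' 32 < n - vs s 32)) ?s2"
  proof (rule wp_conseq[OF p])
   fix s3 assume s3: "(\<forall>i<n. \<forall>j<n.
    (\<forall>k<n. min (ar ?s2 6 (oa + (i * n + k))) (ar ?s2 6 (ob + (k * n + j))) \<le> ar s3 6 (oc + (i * n + j))) \<and>
    (ar s3 6 (oc + (i * n + j)) = 0 \<or> (\<exists>k<n. ar s3 6 (oc + (i * n + j)) = min (ar ?s2 6 (oa + (i * n + k))) (ar ?s2 6 (ob + (k * n + j)))))) \<and>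
    (\<forall>y. y < oc \<or> oc + n * n \<le> y --> ar s3 6 y = ar ?s2 6 y) \<and>
    (\<exists>t'\<le>2 * n. vs s3 vbase = b + Q * t + Q * t') \<and> fresh (vs s3 vbase) s3 \<and>
    ck s3 \<le> ck ?s2 + (2 * C + 20000) * (n * n * \<sigma> + (\<tau> + n * n) * (L + n div \<sigma> + 1))"
    and "same (mv (prod_com mm)) (ma (prod_com mm)) ?s2 s3"
   then have sm3: "same ({7} \<union> {10..27} \<union> {33, 34, 36, 37} \<union> {100..}) {6..30} ?s2 s3"
    using mm mv_prod[of mm] ma_prod[of mm] by (elim same_mono) (simp_all add: mm_spec_def)
   have v3: "vs s3 vK = K" "vs s3 32 = slen h K" "ar s3 5 = (ar s 5)(K := slen h K)"
    using v1 s1 by (simp_all add: same_vs[OF sm3] same_ar[OF sm3])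
   have out: "ar s3 6 y = ar s 6 y" if "y < oc \<or> oc + n * n \<le> y" for y using s3 that m6 by auto
   have newl: "level n es (slen h K) (ar s3 6) oc" unfolding ab(3)
    by (rule level_prod[OF es lev(1)[OF ab(1)] lev(1)[OF ab(2)]]) (use s3 m61 in \<open>simp_all add: oa_def ob_def\<close>)
   have oldl: "level n es (slen h k) (ar s3 6) ((k + 1) * (n * n))" if "k < K" for k
   proof (rule level_cong[OF lev(1)[OF that]])
    fix x assume "x < (k + 1) * (n * n) + n * n"
    also have "\<dots> = (k + 2) * (n * n)" by (simp add: algebra_simps)
    also have "\<dots> \<le> oc" unfolding oc_def using that by (intro mult_le_mono1) simp
    finally show "ar s3 6 x = ar s 6 x" using out by simp
   qed
   have B3: "ar s3 6 x \<le> B" for x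
   proof (cases "x < oc \<or> oc + n * n \<le> x")
    case True then show ?thesis using out B6 by simp
   next
    case False
    define y where "y = x - oc"
    have y: "x = oc + y" "y < n * n" using False by (auto simp: y_def)
    have d: "y div n < n" "y mod n < n" "y div n * n + y mod n = y" using y(2) n by (auto simp: less_mult_imp_div_less)
    have "ar s3 6 (oc + y) \<le> length es + 1" using level_bound[OF newl d(1,2)] unfolding d(3) .
    then show ?thesis unfolding y(1) using m B(4) by linarith
   qed
   obtain t' where t': "t' \<le> 2 * n" "vs s3 vbase = b + Q * t + Q * t'" using s3 by blast
   have tt: "vs s3 vbase = b + Q * (t + t')" "t + t' \<le> 2 * n * K"
   proof -
    show "vs s3 vbase = b + Q * (t + t')" using t' by (simp add: algebra_simps)
    have "2 * n * K = 2 * n * (K - 1) + 2 * n" using K1 by (cases K) (simp_all add: algebra_simps)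
    then show "t + t' \<le> 2 * n * K" using t t' by linarith
   qed
   have ckk: "ck s3 + 6 \<le> ck s0 + T * K"
   proof -
    have "T * K = T * (K - 1) + T" using K1 by (cases K) (simp_all add: algebra_simps)
    moreover have "T = (2 * C + 20000) * H + 200 * H" unfolding T_def H_def by (simp add: algebra_simps)
    moreover have "1 \<le> H"
    proof -
     have "1 * 1 * 1 \<le> n * n * \<sigma>" using n pos by (intro mult_le_mono) auto
     then show ?thesis unfolding H_def by simp
    qed
    moreover have "ck s3 \<le> ck s + 100 + (2 * C + 20000) * H" using s3 s1(6) unfolding H_def \<tau>'_def by simp
    ultimately show ?thesis using ck by linarith
   qed
   have "linv n es h B Q b T s0 (setv 6 vK (K + 1) s3)" unfolding linv_def levels_ok_def
   proof (intro conjI)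
    show "\<forall>k<vs (setv 6 vK (K + 1) s3) vK. ar (setv 6 vK (K + 1) s3) 5 k = slen h k \<and>
     level n es (slen h k) (ar (setv 6 vK (K + 1) s3) 6) ((k + 1) * (n * n))"
     using oldl newl lev(2) v3(3) by (auto simp: less_plus1_eq oc_def)
    show "\<forall>k. k + 1 < vs (setv 6 vK (K + 1) s3) vK --> slen h k < n"
    proof (intro allI impI)
     fix k assume "k + 1 < vs (setv 6 vK (K + 1) s3) vK"
     then have "k \<le> K - 1" by simp
     then show "slen h k < n" using slen_mono[OF pos(3), of k "K - 1"] lt l32 by simp
    qed
    show "\<forall>x\<ge>(vs (setv 6 vK (K + 1) s3) vK + 1) * (n * n). ar (setv 6 vK (K + 1) s3) 6 x = 0"
    proof (intro allI impI)
     fix x assume "x \<ge> (vs (setv 6 vK (K + 1) s3) vK + 1) * (n * n)"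
     then have "x \<ge> oc + n * n" by (simp add: oc_def algebra_simps)
     moreover have "oc \<ge> (K + 1) * (n * n)" by (simp add: oc_def)
     ultimately show "ar (setv 6 vK (K + 1) s3) 6 x = 0" using out[of x] z6 by simp
    qed
   qed (use v3 B3 s3 tt ckk in \<open>auto simp: fresh_def\<close>)
   then show "wp B (vK ::= V vK +. N 1) (\<lambda>s'. linv n es h B Q b T s0 s' \<and> n - vs s' 32 < n - vs s 32) s3"
    using v3 Kn B(3) step lt l32 by simp
  qed
  then show ?thesis using s1 v1 dj ocB by (simp add: oa_def[symmetric] ob_def[symmetric] oc_def[symmetric])
 qed
 have aB: "K - 1 \<le> B" "K - h \<le> B" "slen h K \<le> B" using Kn K2 B(3) by auto
 show ?thesis unfolding levels_step_def
 proof (cases "K < 2 * h")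
  case True
  let ?s1 = "seta 9 5 K (slen h K) (setv 6 32 (slen h K) (setv 3 31 0 (setv 6 30 (K - 1) (tick 5 (tick 6 s)))))"
  have e: "slen h (K - 1) + 1 = slen h K" using True K1 by (simp add: slen_small)
  show "wp B (CIf (V vK <. N (2 * h)) (30 ::= V vK -. N 1 ;; 31 ::= N 0 ;; 32 ::= V 32 +. N 1)
    (30 ::= V vK -. N h ;; 31 ::= V 30 ;; 32 ::= N 2 *. Rd 5 (V 30)) ;; Wr 5 (V vK) (V 32) ;;
   33 ::= (V 30 +. N 1) *. V vnn ;; 34 ::= (V 31 +. N 1) *. V vnn ;; 35 ::= (V vK +. N 1) *. V vnn ;;
   prod_com mm ;; vK ::= V vK +. N 1) (\<lambda>s'. linv n es h B Q b T s0 s' \<and> n - vs s' 32 < n - vs s 32) (tick 6 s)"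
   using main[of ?s1] True aB e by (simp add: a_def b'_def K_def[symmetric] l32 same_def)
 next
  case False
  let ?s1 = "seta 9 5 K (slen h K) (setv 11 32 (slen h K) (setv 4 31 (K - h) (setv 6 30 (K - h) (tick 5 (tick 6 s)))))"
  have "ar s 5 (K - h) = slen h (K - h)" using lev(2)[of "K - h"] pos(3) K1 by simp
  then have e: "2 * ar s 5 (K - h) = slen h K" using slen_large[of h K] False pos(3) by simp
  show "wp B (CIf (V vK <. N (2 * h)) (30 ::= V vK -. N 1 ;; 31 ::= N 0 ;; 32 ::= V 32 +. N 1)
    (30 ::= V vK -. N h ;; 31 ::= V 30 ;; 32 ::= N 2 *. Rd 5 (V 30)) ;; Wr 5 (V vK) (V 32) ;;
   33 ::= (V 30 +. N 1) *. V vnn ;; 34 ::= (V 31 +. N 1) *. V vnn ;; 35 ::= (V vK +. N 1) *. V vnn ;;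
   prod_com mm ;; vK ::= V vK +. N 1) (\<lambda>s'. linv n es h B Q b T s0 s' \<and> n - vs s' 32 < n - vs s 32) (tick 6 s)"
   using main[of ?s1] False aB e by (simp add: a_def b'_def K_def[symmetric] same_def)
 qed
qed

lemma wp_levels:
 fixes s :: st and n m b C B Q \<tau> \<sigma> L h :: nat and mm :: com
 defines "\<tau>' \<equiv> \<tau> + n * n"
 defines "T \<equiv> (2 * C + 20200) * (n * n * \<sigma> + \<tau>' * (L + n div \<sigma> + 1))"
 assumes l0: "level n es 1 (ar s 6) (n * n)" and z: "\<forall>x\<ge>2 * (n * n). ar s 6 x = 0" and B6: "\<forall>x. ar s 6 x \<le> B"
  and fr: "fresh b s" and vb: "vs s vbase = b"
  and v: "vs s vn = n" "vs s vnn = n * n" "vs s vm = length es" "vs s vN = 2 * n" "vs s vQ = Q"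
  and pos: "0 < \<sigma>" "4 * n < 2 ^ (L + 1)" "0 < h"
  and m: "length es \<le> n * n" and es: "set es \<subseteq> {..<n} \<times> {..<n}"
  and mm: "mm_spec C mm (2 * n) B Q \<tau>"
  and Q: "8 * (n * n) \<le> Q" "2 * n \<le> Q"
  and B: "(n + 1) * \<tau>' \<le> B" "b + Q * (2 * n * n + 2 * n + 1) \<le> B" "4 * n + 1 \<le> B" "5 * (n * n) + 4 \<le> B" "(n + 2) * (n * n) \<le> B"
 shows "wp B (levels_com mm h) (\<lambda>s'. levels_ok n es h (vs s' vK) s' \<and> n \<le> slen h (vs s' vK - 1) \<and>
  ck s' \<le> ck s + 20 + T * (vs s' vK - 1)) s"
proof -
 let ?s = "setv 3 32 1 (setv 3 vK 1 (seta 7 5 0 1 s))"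
 have s1: "slen h 0 = 1" using pos(3) by (simp add: slen_small)
 have "wp B (CWhile (V 32 <. V vn) (levels_step mm h)) (\<lambda>s'. levels_ok n es h (vs s' vK) s' \<and> n \<le> slen h (vs s' vK - 1) \<and>
  ck s' \<le> ck s + 20 + T * (vs s' vK - 1)) ?s"
 proof (rule wp_While[where I = "linv n es h B Q b T ?s" and f = "\<lambda>s. n - vs s 32"])
  show "linv n es h B Q b T ?s ?s"
   unfolding linv_def levels_ok_def using l0 z B6 fr vb by (simp add: s1 fresh_def)
 next
  fix s' assume I: "linv n es h B Q b T ?s s'" and sm: "same (mv (levels_step mm h)) (ma (levels_step mm h)) ?s s'"
   and e: "aval (V 32 <. V vn) s' \<noteq> 0"
  have sm': "same ({5, 7} \<union> {10..27} \<union> {30..37} \<union> {100..}) {5..30} ?s s'"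
   using mm by (intro same_mono[OF sm mv_levels_step ma_levels_step]) (simp_all add: mm_spec_def)
  have v': "vs s' vn = n" "vs s' vnn = n * n" "vs s' vm = length es" "vs s' vN = 2 * n" "vs s' vQ = Q"
   using v by (simp_all add: same_vs[OF sm'])
  have lt: "vs s' 32 < n" using e v' by (simp split: if_splits)
  have "wp B (levels_step mm h) (\<lambda>s''. linv n es h B Q b T ?s s'' \<and> n - vs s'' 32 < n - vs s' 32) (tick 6 s')"
   unfolding T_def \<tau>'_def
   by (rule wp_levels_step) (fact lt v' pos m es mm Q B I[unfolded T_def \<tau>'_def] B[unfolded \<tau>'_def])+
  then show "wp B (levels_step mm h) (\<lambda>s''. linv n es h B Q b T ?s s'' \<and> n - vs s'' 32 < n - vs s' 32)
   (tick (ecost (V 32 <. V vn) + 1) s')" by simp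
 next
  fix s' assume I: "linv n es h B Q b T ?s s'" and sm: "same (mv (levels_step mm h)) (ma (levels_step mm h)) ?s s'"
   and e: "aval (V 32 <. V vn) s' = 0"
  have sm': "same ({5, 7} \<union> {10..27} \<union> {30..37} \<union> {100..}) {5..30} ?s s'"
   using mm by (intro same_mono[OF sm mv_levels_step ma_levels_step]) (simp_all add: mm_spec_def)
  have v': "vs s' vn = n" using v by (simp add: same_vs[OF sm'])
  then have "n \<le> vs s' 32" using e by (simp split: if_splits)
  then show "levels_ok n es h (vs (tick (ecost (V 32 <. V vn) + 1) s') vK) (tick (ecost (V 32 <. V vn) + 1) s') \<and>
   n \<le> slen h (vs (tick (ecost (V 32 <. V vn) + 1) s') vK - 1) \<and>
   ck (tick (ecost (V 32 <. V vn) + 1) s') \<le> ck s + 20 + T * (vs (tick (ecost (V 32 <. V vn) + 1) s') vK - 1)"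
   using I unfolding linv_def levels_ok_def by simp
 qed
 then show ?thesis unfolding levels_com_def using B(3) by simp
qed

subsection \<open>Preprocessing\<close>

text \<open>All data start at cell \<open>n * n\<close> because the input may occupy lower cells of
  any array. Array 2 is a direct-address table from an edge to its predicted position, counted from
  1.\<close>

definition edges_ok :: "nat => edge list => nat => st => bool" where
 "edges_ok n es k s \<longleftrightarrow> (\<forall>i<k. ar s 0 (n * n + i) = fst (es ! i) \<and> ar s 1 (n * n + i) = snd (es ! i) \<and>
  ar s 2 (n * n + (fst (es ! i) * n + snd (es ! i))) = i + 1)"

text \<open>Physical address \<open>x\<close> is cell \<open>x div 32\<close> of array
  \<open>x mod 32\<close>, so the contiguous input appears scattered over the arrays.\<close>

definition raw_input :: "edge list => st => bool" where
 "raw_input es s \<longleftrightarrow> (\<forall>i<length es. ar s (2 * i mod 32) (2 * i div 32) = fst (es ! i) \<and>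
  ar s ((2 * i + 1) mod 32) ((2 * i + 1) div 32) = snd (es ! i))"

text \<open>Position \<open>0\<close> and position \<open>m + 1\<close> are sentinels of the doubly linked list.\<close>

definition links :: "nat => nat set => (nat => nat) => (nat => nat) => bool" where
 "links m D nx pv \<longleftrightarrow> D \<subseteq> {1..m} \<and> (\<forall>x\<le>m. x \<notin> D --> x < nx x \<and> nx x \<le> m + 1 \<and> nx x \<notin> D \<and>
  (\<forall>z. x < z --> z < nx x --> z \<in> D) \<and> pv (nx x) = x)"

definition read_com :: com where
 "read_com = For 16 (V vm) (
   17 ::= Raw (N 2 *. V 16) ;; 18 ::= Raw (N 2 *. V 16 +. N 1) ;; 19 ::= V vnn +. (V 17 *. V vn +. V 18) ;;
   Wr 0 (V vnn +. V 16) (V 17) ;; Wr 1 (V vnn +. V 16) (V 18) ;;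
   Wr 2 (V 19) (V 16 +. N 1) ;; Wr 6 (V 19) (V 16 +. N 1))"

definition diag_com :: com where
 "diag_com = For 16 (V vn) (Wr 6 (V vnn +. (V 16 *. V vn +. V 16)) (V vm +. N 1))"

definition links_com :: com where
 "links_com = For 16 (V vm +. N 1) (Wr 3 (V 16) (V 16 +. N 1) ;; Wr 4 (V 16 +. N 1) (V 16))"

text \<open>The region size \<open>(2 * n + 2) ^ q\<close> is the address range of one
  multiplication. The exponent is a constant of the program, so the power is unrolled.\<close>

fun qpow_com :: "nat => com" where
 "qpow_com 0 = vQ ::= N 1"
| "qpow_com (Suc q) = (qpow_com q ;; vQ ::= V vQ *. (N 2 *. V vn +. N 2))"

definition pre_com :: "com => nat => nat => com" where
 "pre_com mm h q = (vn ::= V 0 ;; vm ::= V 1 ;; vnn ::= V vn *. V vn ;; vN ::= N 2 *. V vn ;; vJ ::= N 0 ;; vbase ::= V vnn ;;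
   read_com ;; diag_com ;; links_com ;; qpow_com q ;; levels_com mm h)"

definition entry :: "nat => edge list => nat => st => bool" where
 "entry n es k s \<longleftrightarrow> (\<forall>u<n. \<forall>v<n. (\<forall>i<k. es ! i = (u, v) --> ar s 6 (n * n + (u * n + v)) = i + 1) \<and>
   ((\<forall>i<k. es ! i \<noteq> (u, v)) --> ar s 6 (n * n + (u * n + v)) = 0))"

lemma wp_read:
 fixes s :: st
 assumes v: "vs s vn = n" "vs s vnn = n * n" "vs s vm = length es"
  and m: "length es \<le> n * n" and es: "set es \<subseteq> {..<n} \<times> {..<n}" and d: "distinct es"
  and raw: "raw_input es s" and z: "\<forall>x\<ge>n * n. ar s 6 x = 0" and B6: "\<forall>x. ar s 6 x \<le> B"
  and B: "2 * (n * n) + 4 \<le> B" "n \<le> B"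
 shows "wp B read_com (\<lambda>s'. edges_ok n es (length es) s' \<and> entry n es (length es) s' \<and>
  (\<forall>x\<ge>2 * (n * n). ar s' 6 x = 0) \<and> (\<forall>x. ar s' 6 x \<le> B) \<and> ck s' \<le> ck s + 200 * length es + 20) s"
 unfolding read_com_def
proof (rule wp_For[where b = "length es" and I = "\<lambda>k s'. edges_ok n es k s' \<and> entry n es k s' \<and>
  (\<forall>a x. x < n * n --> ar s' a x = ar s a x) \<and> (\<forall>x\<ge>2 * (n * n). ar s' 6 x = 0) \<and> (\<forall>x. ar s' 6 x \<le> B) \<and>
  ck s' \<le> ck s + 200 * k + 3"], goal_cases)
 case 1
 then show ?case using z B6 by (auto simp: edges_ok_def entry_def)
next
 case (4 k s')
 let ?X = "insert 16 {17, 18, 19}" and ?Y = "{0, 1, 2, 6}"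
 have sm: "same ?X ?Y s s'" using 4(2) by (elim same_mono) auto
 have v': "vs s' vn = n" "vs s' vnn = n * n" "vs s' vm = length es" "vs s' 16 = k"
  using v 4(3) by (simp_all add: same_vs[OF sm])
 obtain u w where uw: "es ! k = (u, w)" by force
 have "es ! k \<in> {..<n} \<times> {..<n}" using es 4(4) nth_mem by blast
 then have uwn: "u < n" "w < n" using uw by auto
 have c: "u * n + w < n * n" using cell_less[OF uwn] .
 have rd: "ar s' (2 * k mod 32) (2 * k div 32) = u" "ar s' ((2 * k + 1) mod 32) ((2 * k + 1) div 32) = w"
 proof -
  \<comment> \<open>The input lies in cells below \<open>n * n\<close>, while all writes go to cells
    from \<open>n * n\<close> on; so the input is intact while it is being read.\<close>
  have "2 * k div 32 < n * n" "(2 * k + 1) div 32 < n * n" using 4(4) m by linarith+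
  then show "ar s' (2 * k mod 32) (2 * k div 32) = u" "ar s' ((2 * k + 1) mod 32) ((2 * k + 1) div 32) = w"
   using 4(1,4) raw uw unfolding raw_input_def by auto
 qed
 have ne: "es ! i \<noteq> (u, w)" if "i < k" for i
  using d that 4(4) uw by (metis less_trans nth_eq_iff_index_eq order_less_irrefl)
 have old: "ar s' 0 (n * n + i) = fst (es ! i)" "ar s' 1 (n * n + i) = snd (es ! i)"
   "ar s' 2 (n * n + (fst (es ! i) * n + snd (es ! i))) = i + 1" "fst (es ! i) * n + snd (es ! i) \<noteq> u * n + w" if "i < k" for i
 proof -
  show "ar s' 0 (n * n + i) = fst (es ! i)" "ar s' 1 (n * n + i) = snd (es ! i)"
   "ar s' 2 (n * n + (fst (es ! i) * n + snd (es ! i))) = i + 1" using 4(1) that by (simp_all add: edges_ok_def)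
  have "es ! i \<in> {..<n} \<times> {..<n}" using es 4(4) that nth_mem less_trans by blast
  then show "fst (es ! i) * n + snd (es ! i) \<noteq> u * n + w" using ne[OF that] uwn cell_eq[of "snd (es ! i)" n w] by (cases "es ! i") auto
 qed
 have e: "entry n es (k + 1) s''" if s'': "ar s'' 6 = (ar s' 6)(n * n + (u * n + w) := k + 1)" for s'' unfolding entry_def
 proof (intro allI impI conjI)
  fix u' v' assume uv: "u' < n" "v' < n"
  have eq: "u' * n + v' = u * n + w \<longleftrightarrow> u' = u \<and> v' = w" using cell_eq[OF uv(2) uwn(2)] .
  have I: "(\<forall>i<k. es ! i = (u', v') --> ar s' 6 (n * n + (u' * n + v')) = i + 1) \<and>
   ((\<forall>i<k. es ! i \<noteq> (u', v')) --> ar s' 6 (n * n + (u' * n + v')) = 0)" using 4(1) uv unfolding entry_def by simp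
  show "ar s'' 6 (n * n + (u' * n + v')) = i + 1" if "i < k + 1" "es ! i = (u', v')" for i
   using I that eq ne uw by (auto simp: less_plus1_eq s'')
  show "ar s'' 6 (n * n + (u' * n + v')) = 0" if "\<forall>i<k + 1. es ! i \<noteq> (u', v')"
   using I that eq uw by (auto simp: less_plus1_eq s'')
 qed
 have e': "edges_ok n es (k + 1) s''" if s'': "ar s'' 0 = (ar s' 0)(n * n + k := u)" "ar s'' 1 = (ar s' 1)(n * n + k := w)"
   "ar s'' 2 = (ar s' 2)(n * n + (u * n + w) := k + 1)" for s''
  unfolding edges_ok_def
 proof (intro allI impI)
  fix i assume "i < k + 1"
  then consider "i < k" | "i = k" by linarith
  then show "ar s'' 0 (n * n + i) = fst (es ! i) \<and> ar s'' 1 (n * n + i) = snd (es ! i) \<and>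
   ar s'' 2 (n * n + (fst (es ! i) * n + snd (es ! i))) = i + 1"
   by cases (use old in \<open>simp_all add: s'' uw\<close>)
 qed
 have b: "u \<le> B" "w \<le> B" "n * n + (u * n + w) \<le> B" "k + 1 \<le> B" using uwn B c 4(4) m by linarith+
 have z': "ar s' 6 x = 0" if "2 * (n * n) \<le> x" for x using 4(1) that by simp
 have B6': "ar s' 6 x \<le> B" for x using 4(1) by simp
 have lo: "ar s' a x = ar s a x" if "x < n * n" for a x using 4(1) that by simp
 have "ck s' \<le> ck s + 200 * k + 3" using 4(1) by simp
 moreover have "ar s' (2 * k mod 32) (k div 16) = u" using rd(1) by simp
 ultimately show ?case using b c by (simp add: v' rd e e' z' B6' lo)
next
 case (5 s')
 then show ?case by (simp add: edges_ok_def entry_def)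
qed (use v m B in \<open>auto simp: same_vs\<close>)

text \<open>By distinctness, the edge at list index \<open>i\<close> belongs to the graph with
  threshold \<open>t\<close> exactly for \<open>t \<le> i + 1\<close>. The diagonal is overwritten,
  also at a loop, since the empty walk beats every edge.\<close>

lemma level_0:
 assumes e: "entry n es (length es) s" and d: "distinct es"
  and M: "\<forall>u<n. \<forall>v<n. ar s' 6 (n * n + (u * n + v)) = (if u = v then length es + 1 else ar s 6 (n * n + (u * n + v)))"
 shows "level n es 1 (ar s' 6) (n * n)"
 unfolding level_def
proof (intro allI impI)
 fix u v assume uv: "u < n" "v < n"
 have l1: "(\<exists>j\<le>1. (u, v) \<in> eset es t ^^ j) \<longleftrightarrow> u = v \<or> (u, v) \<in> eset es t" for t
  by (auto simp: le_Suc_eq One_nat_def)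
 show "ar s' 6 (n * n + (u * n + v)) \<le> length es + 1 \<and> (\<forall>t\<ge>1. t \<le> length es + 1 -->
  (t \<le> ar s' 6 (n * n + (u * n + v))) = (\<exists>j\<le>1. (u, v) \<in> eset es t ^^ j))"
 proof (cases "u = v")
  case True
  then show ?thesis unfolding l1 using M uv by simp
 next
  case False
  then have eq: "ar s' 6 (n * n + (u * n + v)) = ar s 6 (n * n + (u * n + v))" using M uv by simp
  have I: "(\<forall>i<length es. es ! i = (u, v) --> ar s 6 (n * n + (u * n + v)) = i + 1) \<and>
   ((\<forall>i<length es. es ! i \<noteq> (u, v)) --> ar s 6 (n * n + (u * n + v)) = 0)" using e uv unfolding entry_def by simp
  show ?thesis
  proof (cases "\<exists>i<length es. es ! i = (u, v)")
   case True
   then obtain i where i: "i < length es" "es ! i = (u, v)" by blast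
   have "(u, v) \<in> eset es t \<longleftrightarrow> t \<le> i + 1" for t
   proof
    assume "(u, v) \<in> eset es t"
    then obtain i' where i': "i' < length es" "es ! i' = (u, v)" "t \<le> i' + 1" unfolding eset_def by auto
    then have "i' = i" using d i nth_eq_iff_index_eq by metis
    then show "t \<le> i + 1" using i' by simp
   qed (use i in \<open>auto simp: eset_def intro!: exI[of _ i]\<close>)
   then show ?thesis unfolding l1 eq using I i False by simp
  next
   case F: False
   then have "(u, v) \<notin> eset es t" for t unfolding eset_def by auto
   moreover have "ar s 6 (n * n + (u * n + v)) = 0" using I F by blast
   ultimately show ?thesis unfolding l1 eq using False by simp
  qed
 qed
qed

lemma wp_diag:
 fixes s :: st
 assumes v: "vs s vn = n" "vs s vnn = n * n" "vs s vm = m" and B: "m + 1 \<le> B" "n \<le> B"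
  and z: "\<forall>x\<ge>2 * (n * n). ar s 6 x = 0" and B6: "\<forall>x. ar s 6 x \<le> B"
 shows "wp B diag_com (\<lambda>s'. (\<forall>u<n. \<forall>v<n. ar s' 6 (n * n + (u * n + v)) = (if u = v then m + 1 else ar s 6 (n * n + (u * n + v)))) \<and>
  (\<forall>x\<ge>2 * (n * n). ar s' 6 x = 0) \<and> (\<forall>x. ar s' 6 x \<le> B) \<and> ck s' \<le> ck s + 100 * n + 20) s"
 unfolding diag_com_def
proof (rule wp_For[where b = n and I = "\<lambda>k s'. (\<forall>u<n. \<forall>v<n. ar s' 6 (n * n + (u * n + v)) = (if u = v \<and> u < k then m + 1 else ar s 6 (n * n + (u * n + v)))) \<and>
  (\<forall>x\<ge>2 * (n * n). ar s' 6 x = 0) \<and> (\<forall>x. ar s' 6 x \<le> B) \<and> ck s' \<le> ck s + 100 * k + 3"], goal_cases)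
 case (4 k s')
 have v': "vs s' vn = n" "vs s' vnn = n * n" "vs s' vm = m" "vs s' 16 = k"
  using v 4(3) by (simp_all add: same_vs[OF 4(2)])
 have c: "k * n + k < n * n" using cell_less[OF 4(4,4)] .
 have eq: "(u * n + v = k * n + k) = (u = k \<and> v = k)" if "v < n" for u v using cell_eq[OF that 4(4)] .
 show ?case using 4(1) B c by (simp add: v' eq)
qed (use v B z B6 in \<open>auto simp: same_vs\<close>)

lemma wp_links:
 fixes s :: st
 assumes v: "vs s vm = m" and B: "m + 2 \<le> B"
 shows "wp B links_com (\<lambda>s'. links m {} (ar s' 3) (ar s' 4) \<and> ck s' \<le> ck s + 100 * m + 120) s"
 unfolding links_com_def
proof (rule wp_For[where b = "m + 1" and I = "\<lambda>k s'. (\<forall>x<k. ar s' 3 x = x + 1 \<and> ar s' 4 (x + 1) = x) \<and> ck s' \<le> ck s + 100 * k + 3"], goal_cases)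
 case (4 k s')
 then show ?case using B by (auto simp: less_plus1_eq)
next
 case (5 s')
 then show ?case by (simp add: links_def less_plus1_le)
qed (use v B in \<open>auto simp: same_vs\<close>)

lemma wp_qpow: "vs s vn = n ==> (2 * n + 2) ^ q \<le> B ==>
  wp B (qpow_com q) (\<lambda>s'. vs s' vQ = (2 * n + 2) ^ q \<and> ck s' \<le> ck s + 20 * q + 10) s"
proof (induction q)
 case (Suc q)
 have "(2 * n + 2) ^ q \<le> (2 * n + 2) ^ Suc q" by (intro power_increasing) auto
 then have le: "(2 * n + 2) ^ q \<le> B" using Suc.prems(2) by linarith
 have "wp B (qpow_com q) (wp B (vQ ::= V vQ *. (N 2 *. V vn +. N 2)) (\<lambda>s'. vs s' vQ = (2 * n + 2) ^ Suc q \<and> ck s' \<le> ck s + 20 * Suc q + 10)) s"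
 proof (rule wp_conseq[OF Suc.IH[OF Suc.prems(1) le]], goal_cases)
  case (1 s')
  have "mv (qpow_com q) \<subseteq> {vQ}" "ma (qpow_com q) \<subseteq> {}" by (induction q) auto
  then have "vs s' vn = n" using same_vs[OF same_mono[OF 1(2)], of "{vQ}" "{}" vn] Suc.prems(1) by simp
  then show ?case using 1(1) Suc.prems(2) by (simp add: mult.commute)
 qed
 then show ?case by simp
qed simp

text \<open>What holds between two requests, with \<open>D\<close> the predicted positions of the
  deleted edges. The matrices are never updated; only the linked list and \<open>vJ\<close> follow
  the deletions.\<close>

definition online :: "nat => edge list => nat => nat => nat set => st => bool" where
 "online n es h K D s \<longleftrightarrow> vs s vn = n \<and> vs s vnn = n * n \<and> vs s vm = length es \<and> vs s vK = K \<and> vs s vJ = Max (insert 0 D) \<and>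
  levels_ok n es h K s \<and> n \<le> slen h (K - 1) \<and> edges_ok n es (length es) s \<and> links (length es) D (ar s 3) (ar s 4)"

lemma wp_pre:
 fixes s :: st and n m C B Q \<tau> \<sigma> L h q :: nat and mm :: com
 defines "\<tau>' \<equiv> \<tau> + n * n" and "Q \<equiv> (2 * n + 2) ^ q"
 defines "T \<equiv> (2 * C + 20200) * (n * n * \<sigma> + \<tau>' * (L + n div \<sigma> + 1))"
 assumes v: "vs s 0 = n" "vs s 1 = length es" and raw: "raw_input es s" and z: "\<forall>a<32. \<forall>x\<ge>n * n. ar s a x = 0"
  and B6: "\<forall>x. ar s 6 x \<le> B" and d: "distinct es"
  and pos: "0 < \<sigma>" "4 * n < 2 ^ (L + 1)" "0 < h"
  and m: "length es \<le> n * n" and es: "set es \<subseteq> {..<n} \<times> {..<n}"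
  and mm: "mm_spec C mm (2 * n) B Q \<tau>" and q: "4 \<le> q"
  and B: "(n + 1) * \<tau>' \<le> B" "n * n + Q * (2 * n * n + 2 * n + 1) \<le> B" "4 * n + 1 \<le> B" "5 * (n * n) + 4 \<le> B" "(n + 2) * (n * n) \<le> B"
 shows "wp B (pre_com mm h q) (\<lambda>s'. \<exists>K. online n es h K {} s' \<and> ck s' \<le> ck s + 20 * q + 500 * (n * n + 1) + T * (K - 1)) s"
proof -
 let ?s = "setv 4 vbase (n * n) (setv 3 vJ 0 (setv 6 vN (2 * n) (setv 7 vnn (n * n) (setv 4 vm (length es) (setv 4 vn n s)))))"
 \<comment> \<open>\<open>4 \<le> q\<close> gives \<open>16 * (n + 1) ^ 4 \<le> Q\<close>, which
   leaves room for two factors of dimension \<open>2 * n\<close> with \<open>8 * (n * n)\<close>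
   cells in all.\<close>
 have Qge: "8 * (n * n) \<le> Q" "2 * n \<le> Q" "Q \<le> B"
 proof -
  have "(2 * n + 2) ^ 4 \<le> Q" unfolding Q_def using q by (intro power_increasing) auto
  moreover have "(2 * n + 2) ^ 4 = 16 * (n + 1) ^ 4" using power_mult_distrib[of 2 "n + 1" 4] by (simp add: algebra_simps)
  moreover have "(n + 1) ^ 2 \<le> (n + 1) ^ 4" by (intro power_increasing) auto
  moreover have "(n + 1) ^ 2 = n * n + 2 * n + 1" by (simp add: power2_eq_square algebra_simps)
  ultimately show "8 * (n * n) \<le> Q" "2 * n \<le> Q" by linarith+
  have "Q * 1 \<le> Q * (2 * n * n + 2 * n + 1)" by (intro mult_le_mono2) simp
  then show "Q \<le> B" using B(2) by linarith
 qed
 have nn: "n \<le> n * n" by (cases n) auto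
 have zz: "ar s a x = 0" if "a \<in> {6, 17, 20, 22, 25, 28, 29}" "n * n \<le> x" for a x using z that by auto
 define P where "P = (\<lambda>s'. \<exists>K. online n es h K {} s' \<and> ck s' \<le> ck s + 20 * q + 500 * (n * n + 1) + T * (K - 1))"
 have "wp B read_com (wp B (diag_com ;; links_com ;; qpow_com q ;; levels_com mm h) P) ?s"
 proof (rule wp_conseq[OF wp_read[where n = n and es = es and B = B]], goal_cases)
  case (12 s1)
  have sm: "same {16, 17, 18, 19} {0, 1, 2, 6} ?s s1" using 12(2) by (elim same_mono) (auto simp: read_com_def)
  have v1: "vs s1 vn = n" "vs s1 vnn = n * n" "vs s1 vm = length es" "vs s1 vN = 2 * n" "vs s1 vJ = 0" "vs s1 vbase = n * n"
   by (simp_all add: same_vs[OF sm])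
  have f1: "ar s1 a x = 0" if "a \<in> {17, 20, 22, 25, 28, 29}" "n * n \<le> x" for a x using zz[of a x] that same_ar[OF sm, of a] by auto
  have "wp B diag_com (wp B (links_com ;; qpow_com q ;; levels_com mm h) P) s1"
  proof (rule wp_conseq[OF wp_diag[where n = n and m = "length es" and B = B]], goal_cases)
   case (8 s2)
   have sm2: "same {16} {6} s1 s2" using 8(2) by (elim same_mono) (auto simp: diag_com_def)
   have v2: "vs s2 vn = n" "vs s2 vnn = n * n" "vs s2 vm = length es" "vs s2 vN = 2 * n" "vs s2 vJ = 0" "vs s2 vbase = n * n"
    using v1 by (simp_all add: same_vs[OF sm2])
   have f2: "ar s2 a x = 0" if "a \<in> {17, 20, 22, 25, 28, 29}" "n * n \<le> x" for a x using f1[of a x] that same_ar[OF sm2, of a] by auto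
   have l2: "level n es 1 (ar s2 6) (n * n)" by (rule level_0[of n es s1]) (use 12(1) 8(1) d in simp_all)
   have e2: "edges_ok n es (length es) s2" using 12(1) same_ar[OF sm2] by (simp add: edges_ok_def)
   have "wp B links_com (wp B (qpow_com q ;; levels_com mm h) P) s2"
   proof (rule wp_conseq[OF wp_links[where m = "length es" and B = B]], goal_cases)
    case (3 s3)
    have sm3: "same {16} {3, 4} s2 s3" using 3(2) by (elim same_mono) (auto simp: links_com_def)
    have v3: "vs s3 vn = n" "vs s3 vnn = n * n" "vs s3 vm = length es" "vs s3 vN = 2 * n" "vs s3 vJ = 0" "vs s3 vbase = n * n"
     using v2 by (simp_all add: same_vs[OF sm3])
    have "wp B (qpow_com q) (wp B (levels_com mm h) P) s3"
    proof (rule wp_conseq[OF wp_qpow[where n = n and B = B]], goal_cases)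
     case (3 s4)
     have mq: "mv (qpow_com q) \<subseteq> {vQ}" "ma (qpow_com q) \<subseteq> {}" by (induction q) auto
     have sm4: "same {vQ} {} s3 s4" using 3(2) by (elim same_mono) (use mq in auto)
     have v4: "vs s4 vn = n" "vs s4 vnn = n * n" "vs s4 vm = length es" "vs s4 vN = 2 * n" "vs s4 vJ = 0" "vs s4 vbase = n * n"
      "vs s4 vQ = Q" using v3 3(1) by (simp_all add: same_vs[OF sm4] Q_def)
     have a4: "ar s4 6 = ar s2 6" "ar s4 3 = ar s3 3" "ar s4 4 = ar s3 4" "ar s4 0 = ar s2 0" "ar s4 1 = ar s2 1" "ar s4 2 = ar s2 2"
      by (simp_all add: same_ar[OF sm4] same_ar[OF sm3])
     have ck4: "ck s4 + 20 \<le> ck s + 20 * q + 500 * (n * n + 1)"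
     proof -
      have "ck s4 \<le> ck s3 + 20 * q + 10" "ck s3 \<le> ck s2 + 100 * length es + 120" "ck s2 \<le> ck s1 + 100 * n + 20"
       "ck s1 \<le> 48 + (ck s + 200 * length es)" using 3(1) \<open>links _ _ _ _ \<and> _\<close> 8(1) 12(1) by simp_all
      moreover have "500 * (n * n + 1) = 500 * (n * n) + 500" by simp
      ultimately show ?thesis using m nn by linarith
     qed
     have fr: "fresh (n * n) s4" unfolding fresh_def
     proof (intro ballI allI impI)
      fix a x assume a: "a \<in> {17, 20, 22, 25, 28, 29 :: nat}" and "n * n \<le> x"
      then show "ar s4 a x = 0" using f2[of a x] same_ar[OF sm4, of a] same_ar[OF sm3, of a] by auto
     qed
     show ?case
     proof (rule wp_conseq[OF wp_levels[where n = n and es = es and b = "n * n" and C = C and B = B and Q = Q and \<tau> = \<tau> and \<sigma> = \<sigma> and L = L and h = h and mm = mm and s = s4]])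
      fix s5 assume s5: "levels_ok n es h (vs s5 vK) s5 \<and> n \<le> slen h (vs s5 vK - 1) \<and>
       ck s5 \<le> ck s4 + 20 + (2 * C + 20200) * (n * n * \<sigma> + (\<tau> + n * n) * (L + n div \<sigma> + 1)) * (vs s5 vK - 1)"
       and "same (mv (levels_com mm h)) (ma (levels_com mm h)) s4 s5"
      moreover have "mv (levels_com mm h) \<subseteq> {5, 7} \<union> {10..27} \<union> {30..37} \<union> {100..}" "ma (levels_com mm h) \<subseteq> {5..30}"
       using mv_levels_step[of mm h] ma_levels_step[of mm h] mm by (auto simp: levels_com_def mm_spec_def)
      ultimately have sm5: "same ({5, 7} \<union> {10..27} \<union> {30..37} \<union> {100..}) {5..30} s4 s5" using same_mono by blast
      have v5: "vs s5 vn = n" "vs s5 vnn = n * n" "vs s5 vm = length es" "vs s5 vJ = 0"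
       using v4 by (simp_all add: same_vs[OF sm5])
      have a5: "ar s5 0 = ar s2 0" "ar s5 1 = ar s2 1" "ar s5 2 = ar s2 2" "ar s5 3 = ar s3 3" "ar s5 4 = ar s3 4"
       by (simp_all add: same_ar[OF sm5] a4)
      have "online n es h (vs s5 vK) {} s5"
       using s5 e2 \<open>links _ _ _ _ \<and> _\<close> unfolding online_def by (simp add: v5 a5 edges_ok_def)
      then show "P s5" unfolding P_def T_def \<tau>'_def using s5 ck4 by (intro exI[of _ "vs s5 vK"]) linarith
     next
      show "(n + 1) * (\<tau> + n * n) \<le> B" using B(1) unfolding \<tau>'_def .
      show "level n es 1 (ar s4 6) (n * n)" using l2 a4 by simp
      show "\<forall>x\<ge>2 * (n * n). ar s4 6 x = 0" "\<forall>x. ar s4 6 x \<le> B" using 8(1) a4 by simp_all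
     qed (fact v4 pos m es mm Qge B fr)+
    next
     case 1 show ?case by (fact v3)
    next
     case 2 show ?case using Qge by (simp add: Q_def)
    qed
    then show ?case by simp
   qed (use v2 m B in auto)
   then show ?case by simp
  qed (use v1 m B 12(1) in auto)
  then show ?case by simp
 next
  case 7
  then show ?case using raw by (simp add: raw_input_def)
 qed (use m es d zz B6 B in auto)
 moreover have "n \<le> B" "2 * n \<le> B" "n * n \<le> B" "length es \<le> B" using B(3,4) m by linarith+
 ultimately show ?thesis unfolding pre_com_def P_def[symmetric] using v by simp
qed

subsection \<open>Deletions\<close>

text \<open>Let \<open>x\<close> be the largest undeleted position below \<open>e\<close>. Its
  successor is undeleted, so it is not below \<open>e\<close>; and it is not above \<open>e\<close>,
  since everything between \<open>x\<close> and its successor is deleted. So it equals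
  \<open>e\<close>.\<close>

lemma links_prev:
 assumes "links m D nx pv" "1 \<le> e" "e \<le> m + 1" "e \<notin> D"
 shows "pv e \<notin> D" "pv e < e" "nx (pv e) = e"
proof -
 let ?S = "{z. z < e \<and> z \<notin> D}"
 have "0 \<in> ?S" using assms by (auto simp: links_def)
 then have x: "Max ?S \<in> ?S" by (intro Max_in) auto
 define x where "x = Max ?S"
 have mx: "z \<le> x" if "z < e" "z \<notin> D" for z unfolding x_def using that by (intro Max_ge) auto
 have xm: "x < e" "x \<notin> D" using x unfolding x_def by auto
 have n: "x < nx x" "nx x \<notin> D" "\<And>z. x < z ==> z < nx x ==> z \<in> D" "pv (nx x) = x"
 proof -
  have "x \<le> m" using assms(3) xm by simp
  then show "x < nx x" "nx x \<notin> D" "\<And>z. x < z ==> z < nx x ==> z \<in> D" "pv (nx x) = x"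
   using assms(1) xm(2) unfolding links_def by simp_all
 qed
 have "\<not> nx x < e" using mx[of "nx x"] n(1,2) by auto
 moreover have "\<not> e < nx x" using n(3)[of e] xm assms(4) by auto
 ultimately have "nx x = e" by simp
 then show "pv e \<notin> D" "pv e < e" "nx (pv e) = e" using n xm by auto
qed

text \<open>\<open>pv\<close> recovers an undeleted position from its successor, so no position
  other than \<open>pv e\<close> leads to \<open>e\<close>, and none other than \<open>e\<close>
  leads to \<open>nx e\<close>. Two assignments thus repair the list in constant time.\<close>

lemma links_delete:
 assumes l: "links m D nx pv" and e: "1 \<le> e" "e \<le> m" "e \<notin> D"
 shows "links m (insert e D) (nx(pv e := nx e)) (pv(nx e := pv e))"
proof -
 have p: "pv e \<notin> D" "pv e < e" "nx (pv e) = e" using links_prev[OF l e(1) _ e(3)] e(2) by auto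
 have I: "x < nx x" "nx x \<le> m + 1" "nx x \<notin> D" "\<And>z. x < z ==> z < nx x ==> z \<in> D" "pv (nx x) = x" if "x \<le> m" "x \<notin> D" for x
  using l that unfolding links_def by auto
 note y = I[OF e(2,3)]
 have pe: "z \<in> D" if "pv e < z" "z < e" for z using I(4)[of "pv e" z] p e that by simp
 have "x < (nx(pv e := nx e)) x \<and> (nx(pv e := nx e)) x \<le> m + 1 \<and> (nx(pv e := nx e)) x \<notin> insert e D \<and>
  (\<forall>z. x < z --> z < (nx(pv e := nx e)) x --> z \<in> insert e D) \<and> (pv(nx e := pv e)) ((nx(pv e := nx e)) x) = x"
  if x: "x \<le> m" "x \<notin> insert e D" for x
 proof (cases "x = pv e")
  case True
  have "z \<in> insert e D" if "pv e < z" "z < nx e" for z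
   using pe[of z] y(4)[of z] that by (cases "z < e"; cases "z = e") auto
  then show ?thesis using True y p by auto
 next
  case False
  note ix = I[OF x(1)]
  have "nx x \<noteq> e" using False ix(5) x by auto
  moreover have "nx x \<noteq> nx e" using ix(5) y(5) x by auto
  ultimately show ?thesis using False ix x by auto
 qed
 moreover have "insert e D \<subseteq> {1..m}" using l e by (simp add: links_def)
 ultimately show ?thesis unfolding links_def by blast
qed

definition delete_com :: com where
 "delete_com = (23 ::= V vnn +. (V 0 *. V vn +. V 1) ;; 12 ::= Rd 2 (V 23) ;;
   CIf (V vJ <. V 12) (vJ ::= V 12) CSkip ;;
   13 ::= Rd 4 (V 12) ;; 14 ::= Rd 3 (V 12) ;; Wr 3 (V 13) (V 14) ;; Wr 4 (V 14) (V 13))"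

lemma online_cong:
 assumes "online n es h K D s" "\<And>x. x \<in> {2, 3, 4, 5, 6} ==> vs s' x = vs s x" "\<And>a. a \<in> {0, 1, 2, 3, 4, 5, 6} ==> ar s' a = ar s a"
 shows "online n es h K D s'"
 using assms(1) unfolding online_def levels_ok_def edges_ok_def by (simp add: assms(2,3))

lemma online_same:
 assumes "online n es h K D s" "same X Y s s'" "X \<inter> {2, 3, 4, 5, 6} = {}" "Y \<inter> {0, 1, 2, 3, 4, 5, 6} = {}"
 shows "online n es h K D s'"
 by (rule online_cong[OF assms(1)]) (use same_vs[OF assms(2)] same_ar[OF assms(2)] assms(3,4) in blast)+

lemma wp_delete:
 assumes o: "online n es h K D s" and v: "vs s 0 = fst (es ! i)" "vs s 1 = snd (es ! i)"
  and i: "i < length es" "i + 1 \<notin> D" and es: "set es \<subseteq> {..<n} \<times> {..<n}" and B: "2 * (n * n) + 4 \<le> B" and m: "length es \<le> n * n"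
 shows "wp B delete_com (\<lambda>s'. online n es h K (insert (i + 1) D) s' \<and> ck s' \<le> ck s + 200) s"
proof -
 have v': "vs s vn = n" "vs s vnn = n * n" "vs s vm = length es" "vs s vK = K" "vs s vJ = Max (insert 0 D)"
  and l: "links (length es) D (ar s 3) (ar s 4)" and ed: "edges_ok n es (length es) s"
  using o by (simp_all add: online_def)
 define c where "c = n * n + (fst (es ! i) * n + snd (es ! i))"
 have a2: "ar s 2 c = i + 1" using ed i(1) by (simp add: edges_ok_def c_def)
 have "es ! i \<in> {..<n} \<times> {..<n}" using es i nth_mem by blast
 then have cB: "c \<le> B" using cell_less[of "fst (es ! i)" n "snd (es ! i)" n] B unfolding c_def by (auto simp: mem_Times_iff)
 have fin: "finite D" using l finite_subset[of D "{1..length es}"] by (auto simp: links_def)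
 have mx: "Max (insert 0 (insert (i + 1) D)) = max (i + 1) (Max (insert 0 D))"
  using fin by (simp add: insert_commute[of 0])
 have p: "ar s 4 (i + 1) < i + 1" using links_prev[OF l _ _ i(2)] i(1) by simp
 have y: "ar s 3 (i + 1) \<le> length es + 1" using l i by (simp add: links_def)
 have l': "links (length es) (insert (i + 1) D) ((ar s 3)(ar s 4 (i + 1) := ar s 3 (i + 1))) ((ar s 4)(ar s 3 (i + 1) := ar s 4 (i + 1)))"
  by (rule links_delete[OF l]) (use i in auto)
 have b: "i + 1 \<le> B" "ar s 4 (i + 1) \<le> B" "ar s 3 (i + 1) \<le> B" using i(1) m B p y by linarith+
 have fin': "online n es h K (insert (i + 1) D) s'"
  if "vs s' vn = n" "vs s' vnn = n * n" "vs s' vm = length es" "vs s' vK = K" "vs s' vJ = max (i + 1) (Max (insert 0 D))"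
   "ar s' 3 = (ar s 3)(ar s 4 (i + 1) := ar s 3 (i + 1))" "ar s' 4 = (ar s 4)(ar s 3 (i + 1) := ar s 4 (i + 1))"
   "ar s' 0 = ar s 0" "ar s' 1 = ar s 1" "ar s' 2 = ar s 2" "ar s' 5 = ar s 5" "ar s' 6 = ar s 6" for s'
  using o l' unfolding online_def mx levels_ok_def edges_ok_def that by auto
 show ?thesis unfolding delete_com_def
  using cB b by (simp add: v v' c_def[symmetric] a2 fin' max_def)
qed

subsection \<open>Walks and the distance estimate\<close>

definition cur :: "edge list => nat set => edge set" where
 "cur es D = {es ! i | i. i < length es \<and> i + 1 \<notin> D}"

definition extra :: "edge list => nat set => nat => edge set" where
 "extra es D x = {es ! i | i. i < length es \<and> i + 1 \<notin> D \<and> i + 1 < x}"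

text \<open>Nothing predicted after \<open>J\<close> has been deleted, so the predicted graph from
  \<open>J + 1\<close> on is fully present, and only edges predicted up to \<open>J\<close> have to
  be added.\<close>

lemma cur_split:
 assumes "\<And>d. d \<in> D ==> d \<le> J"
 shows "cur es D = eset es (J + 1) \<union> extra es D (J + 1)"
proof -
 have "J + 1 \<le> i + 1 \<or> i + 1 < J + 1" for i :: nat by linarith
 moreover have "i + 1 \<notin> D" if "J + 1 \<le> i + 1" for i using assms[of "i + 1"] that by auto
 ultimately show ?thesis unfolding cur_def eset_def extra_def by blast
qed

lemma relpow_mono': "E \<subseteq> E' ==> (a, b) \<in> E ^^ l ==> (a, b) \<in> E' ^^ l" for E E' :: "('a \<times> 'a) set"
 by (induction l arbitrary: b) auto

text \<open>A shortest walk repeats no vertex, since the piece between two occurrences could be cut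
  out; it therefore has at most \<open>n\<close> vertices.\<close>

lemma walk_short:
 assumes E: "E \<subseteq> {..<n} \<times> {..<n}" and u: "u < n" and w: "(u, v) \<in> E ^^ l"
 shows "\<exists>l<n. (u, v) \<in> E ^^ l"
proof -
 define k where "k = (LEAST l. (u, v) \<in> E ^^ l)"
 have k: "(u, v) \<in> E ^^ k" unfolding k_def by (rule LeastI[of _ l]) (rule w)
 have least: "k \<le> j" if "(u, v) \<in> E ^^ j" for j unfolding k_def using that by (rule Least_le)
 obtain f where f: "f 0 = u" "f k = v" "\<forall>i<k. (f i, f (Suc i)) \<in> E" using k unfolding relpow_fun_conv by blast
 have seg: "(f i, f (i + d)) \<in> E ^^ d" if "i + d \<le> k" for i d
  using that by (induction d) (use f(3) in \<open>auto intro!: relcompI\<close>)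
 have "inj_on f {..k}"
 proof (rule linorder_inj_onI')
  fix i j assume ij: "i \<in> {..k}" "j \<in> {..k}" "i < j"
  show "f i \<noteq> f j"
  proof
   assume eq: "f i = f j"
   have "(u, f i) \<in> E ^^ i" using seg[of 0 i] ij f(1) by simp
   moreover have "(f i, v) \<in> E ^^ (k - j)" using seg[of j "k - j"] ij f(2) eq by simp
   ultimately have "(u, v) \<in> E ^^ (i + (k - j))" by (auto simp: relpow_add)
   from least[OF this] show False using ij by simp
  qed
 qed
 moreover have "f ` {..k} \<subseteq> {..<n}"
 proof
  fix x assume "x \<in> f ` {..k}"
  then obtain i where "i \<le> k" "x = f i" by auto
  then show "x \<in> {..<n}" using seg[of 0 i] f(1) relpow_less[OF E _ u, of "f i" i] by simp
 qed
 ultimately have "card {..k} \<le> card {..<n}" by (intro card_inj_on_le[of f]) auto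
 then show ?thesis using k by (intro exI[of _ k]) simp
qed

lemma slen_double: "0 < h ==> slen h (k + 1) \<le> 2 * slen h k"
proof (cases "k + 1 < 2 * h")
 case False
 assume "0 < h"
 then show ?thesis using False slen_large[of h "k + 1"] slen_mono[of h "k + 1 - h" k] by simp
qed (simp add: slen_small)

text \<open>A binary search for the first scale with a walk in the graph of threshold
  \<open>vJ + 1\<close>. Equal end points are treated apart, as their distance 0 lies below every
  scale; the value \<open>2 * n + 1\<close> stands for an unreachable vertex.\<close>

definition find_com :: com where
 "find_com = CIf ((V 18 <. V 19) +. (V 19 <. V 18))
   (20 ::= N 0 ;; 21 ::= V vK ;;
   CWhile (V 20 <. V 21) (22 ::= (V 20 +. V 21) /. N 2 ;;
    CIf (V vJ <. Rd 6 ((V 22 +. N 1) *. V vnn +. (V 18 *. V vn +. V 19))) (21 ::= V 22) (20 ::= V 22 +. N 1)) ;;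
   CIf (V 20 <. V vK) (17 ::= Rd 5 (V 20)) (17 ::= N 2 *. V vn +. N 1))
   (17 ::= N 0)"

text \<open>If scale \<open>k\<close> is the first to succeed, every walk is longer than the scale
  before. For large scales the ratio bound then gives the factor \<open>(h + 1) / h\<close>; small
  scales are consecutive integers and hence exact. If all scales fail, no walk exists: a walk could
  be shortened to fewer than \<open>n\<close> steps, and the last scale is at least
  \<open>n\<close>.\<close>

lemma wp_find:
 assumes o: "online n es h K D s" and es: "set es \<subseteq> {..<n} \<times> {..<n}" and h: "0 < h"
  and u: "vs s 18 = u" "u < n" and w: "vs s 19 = w" "w < n" and R: "K < 2 ^ R" and B: "2 * n + 1 \<le> B" "K + 1 \<le> B"
 defines "E \<equiv> eset es (Max (insert 0 D) + 1)"
 shows "wp B find_com (\<lambda>s'. (vs s' 17 \<le> 2 * n --> (\<exists>j\<le>vs s' 17. (u, w) \<in> E ^^ j)) \<and>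
  (\<forall>a. (u, w) \<in> E ^^ a --> h * vs s' 17 \<le> (h + 1) * a) \<and> vs s' 17 \<le> 2 * n + 1 \<and> ck s' \<le> ck s + 100 * R + 100) s"
proof -
 define J where "J = Max (insert 0 D)"
 define Post where "Post = (\<lambda>x. (x \<le> 2 * n --> (\<exists>j\<le>x. (u, w) \<in> E ^^ j)) \<and>
  (\<forall>a. (u, w) \<in> E ^^ a --> h * x \<le> (h + 1) * a) \<and> x \<le> 2 * n + 1)"
 have v': "vs s vn = n" "vs s vnn = n * n" "vs s vK = K" "vs s vJ = J"
  and l: "links (length es) D (ar s 3) (ar s 4)" and lo: "levels_ok n es h K s" and nK: "n \<le> slen h (K - 1)"
  using o by (simp_all add: online_def J_def)
 have K1: "1 \<le> K" using lo by (simp add: levels_ok_def)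
 have "J \<le> length es"
 proof -
  have D: "D \<subseteq> {1..length es}" using l by (simp add: links_def)
  then have "finite D" by (rule finite_subset) simp
  then show ?thesis unfolding J_def using D by (subst Max_le_iff) auto
 qed
 define P where "P = (\<lambda>k. J < ar s 6 ((k + 1) * (n * n) + (u * n + w)))"
 have P: "P k \<longleftrightarrow> (\<exists>j\<le>slen h k. (u, w) \<in> E ^^ j)" if "k < K" for k
 proof -
  have "level n es (slen h k) (ar s 6) ((k + 1) * (n * n))" using lo that by (simp add: levels_ok_def)
  from levelD[OF this u(2) w(2), of "J + 1"] show ?thesis using \<open>J \<le> length es\<close> unfolding P_def E_def J_def by auto
 qed
 have Pm: "P k'" if "P k" "k \<le> k'" "k' < K" for k k'
  using that P slen_mono[OF h that(2)] by (meson le_less_trans le_trans)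
 have E: "E \<subseteq> {..<n} \<times> {..<n}" unfolding E_def by (rule eset_sub[OF es])
 have sK: "slen h k \<le> 2 * n" if "k < K" for k
 proof (cases k)
  case 0
  then show ?thesis using h u(2) by (simp add: slen_small)
 next
  case (Suc j')
  then obtain j where Suc: "k = j + 1" by simp
  then have "slen h j < n" using lo that by (simp add: levels_ok_def)
  then show ?thesis using slen_double[OF h, of j] Suc by simp
 qed
 have found: "Post (slen h k)" if k: "k < K" "P k" "\<And>k'. k' < k ==> \<not> P k'" and ne: "u \<noteq> w" for k
  unfolding Post_def
 proof (intro conjI allI impI)
  show "\<exists>j\<le>slen h k. (u, w) \<in> E ^^ j" using P[OF k(1)] k(2) by simp
  show "slen h k \<le> 2 * n + 1" using sK[OF k(1)] by simp
  fix a assume a: "(u, w) \<in> E ^^ a"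
  have a0: "1 \<le> a" using a ne by (cases a) (auto simp: One_nat_def)
  show "h * slen h k \<le> (h + 1) * a"
  proof (cases k)
   case 0
   then have "slen h k = 1" using h by (simp add: slen_small)
   then show ?thesis using a0 mult_le_mono[of h "h + 1" 1 a] by simp
  next
   case (Suc j')
   then obtain j where Suc: "k = j + 1" by simp
   then have "\<not> P j" "j < K" using k by auto
   then have ja: "slen h j < a" using P[of j] a by (meson not_less)
   show ?thesis
   proof (cases "h \<le> j + 1")
    case True
    have "h * slen h (j + 1) \<le> (h + 1) * slen h j" by (rule slen_ratio[OF h True])
    also have "\<dots> \<le> (h + 1) * a" using ja by (intro mult_le_mono2) simp
    finally show ?thesis using Suc by simp
   next
    case False
    then have "slen h k = slen h j + 1" using Suc by (simp add: slen_small)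
    then have "slen h k \<le> a" using ja by simp
    then show ?thesis by (intro mult_le_mono) auto
   qed
  qed
 qed
 have none: "Post (2 * n + 1)" if "\<And>k'. k' < K ==> \<not> P k'"
  unfolding Post_def
 proof (intro conjI allI impI)
  fix a assume "(u, w) \<in> E ^^ a"
  from walk_short[OF E u(2) this] obtain l where "l < n" "(u, w) \<in> E ^^ l" by blast
  then have "P (K - 1)" using P[of "K - 1"] nK K1 by (auto intro!: exI[of _ l])
  then show "h * (2 * n + 1) \<le> (h + 1) * a" using that[of "K - 1"] K1 by simp
 qed auto
 have same0: "Post 0" if "u = w" unfolding Post_def using that by auto
 let ?s = "setv 4 21 K (setv 3 20 0 (tick 12 s))"
 let ?c = "22 ::= (V 20 +. V 21) /. N 2 ;;
    CIf (V vJ <. Rd 6 ((V 22 +. N 1) *. V vnn +. (V 18 *. V vn +. V 19))) (21 ::= V 22) (20 ::= V 22 +. N 1)"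
 \<comment> \<open>The number \<open>r\<close> bounds the remaining iterations: each one at least
   halves the search interval and may spend 100 ticks.\<close>
 define I where "I = (\<lambda>s' :: st. vs s' 20 \<le> vs s' 21 \<and> vs s' 21 \<le> K \<and> (\<forall>k<vs s' 20. \<not> P k) \<and> (\<forall>k. vs s' 21 \<le> k --> k < K --> P k) \<and>
  (\<exists>r\<le>R. vs s' 21 - vs s' 20 < 2 ^ r \<and> ck s' + 100 * r \<le> ck s + 19 + 100 * R))"
 have main: "wp B (CWhile (V 20 <. V 21) ?c) (\<lambda>s'. vs s' 20 \<le> K \<and> (\<forall>k<vs s' 20. \<not> P k) \<and> (vs s' 20 < K --> P (vs s' 20)) \<and>
   ck s' \<le> ck s + 25 + 100 * R) ?s"
 proof (rule wp_While[where I = I and f = "\<lambda>s'. vs s' 21 - vs s' 20"], goal_cases)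
  case 1
  show ?case unfolding I_def using R by (auto intro!: exI[of _ R])
 next
  case (2 s')
  have sm: "same {20, 21, 22} {} ?s s'" using 2(2) by (elim same_mono) auto
  have v2: "vs s' vn = n" "vs s' vnn = n * n" "vs s' vK = K" "vs s' vJ = J" "vs s' 18 = u" "vs s' 19 = w" "ar s' 6 = ar s 6"
   using v' u w by (simp_all add: same_vs[OF sm] same_ar[OF sm])
  define lo' hi mid where "lo' = vs s' 20" and "hi = vs s' 21" and "mid = (lo' + hi) div 2"
  have lt: "lo' < hi" using 2(3) by (simp add: lo'_def hi_def split: if_splits)
  have I: "hi \<le> K" "\<And>k. k < lo' ==> \<not> P k" "\<And>k. hi \<le> k ==> k < K ==> P k" using 2(1) unfolding I_def lo'_def hi_def by auto
  obtain r where r: "r \<le> R" "hi - lo' < 2 ^ r" "ck s' + 100 * r \<le> ck s + 19 + 100 * R" using 2(1) unfolding I_def lo'_def hi_def by blast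
  have r0: "r \<noteq> 0" using r(2) lt by (cases r) auto
  then obtain r' where r': "r = r' + 1" by (metis Suc_eq_plus1 not0_implies_Suc)
  have mid: "lo' \<le> mid" "mid < hi" "mid \<le> B" "mid + 1 \<le> B" unfolding mid_def using lt I(1) B(2) by linarith+
  have half: "mid - lo' < 2 ^ r'" "hi - (mid + 1) < 2 ^ r'" using r(2) lt unfolding r' mid_def by (simp_all add: power_add)
  have Pmid: "J < ar s 6 ((mid + 1) * (n * n) + (u * n + w)) \<longleftrightarrow> P mid" by (simp add: P_def)
  have lo2: "\<not> P k" if "\<not> P mid" "k < mid + 1" for k using Pm[of k mid] that mid(2) I(1) by auto
  have hi2: "P k" if "P mid" "mid \<le> k" "k < K" for k using Pm[of mid k] that by auto
  have fin: "I s'' \<and> vs s'' 21 - vs s'' 20 < hi - lo'"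
   if "P mid \<and> vs s'' 20 = lo' \<and> vs s'' 21 = mid \<or> \<not> P mid \<and> vs s'' 20 = mid + 1 \<and> vs s'' 21 = hi" "ck s'' \<le> ck s' + 60" for s''
  proof -
   have "ck s'' + 100 * r' \<le> ck s + 19 + 100 * R" using that(2) r(3) r' by simp
   then show ?thesis unfolding I_def using that(1) half mid r(1) r' I lo2 hi2 lt
    by (elim disjE conjE) (auto intro!: exI[of _ r'])
  qed
  show ?case
   using mid by (auto simp: v2 lo'_def[symmetric] hi_def[symmetric] mid_def[symmetric] Pmid intro!: fin[THEN conjunct1])
 next
  case (3 s')
  have "vs s' 20 = vs s' 21" using 3(1,3) unfolding I_def by (simp split: if_splits)
  then show ?case using 3(1) unfolding I_def by auto
 qed
 show ?thesis
 proof (cases "u = w")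
  case True
  then show ?thesis using same0 unfolding find_com_def Post_def by (simp add: u w)
 next
  case False
  have "wp B (CWhile (V 20 <. V 21) ?c) (wp B (CIf (V 20 <. V vK) (17 ::= Rd 5 (V 20)) (17 ::= N 2 *. V vn +. N 1))
   (\<lambda>s'. Post (vs s' 17) \<and> ck s' \<le> ck s + 100 * R + 100)) ?s"
  proof (rule wp_conseq[OF main], goal_cases)
   case (1 s')
   have sm: "same {20, 21, 22} {} ?s s'" using 1(2) by (elim same_mono) auto
   have v2: "vs s' vn = n" "vs s' vK = K" "ar s' 5 = ar s 5"
    using v' by (simp_all add: same_vs[OF sm] same_ar[OF sm])
   show ?case
   proof (cases "vs s' 20 < K")
    case True
    have a5: "ar s 5 (vs s' 20) = slen h (vs s' 20)" using lo True by (simp add: levels_ok_def)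
    have "Post (slen h (vs s' 20))" by (rule found[OF True]) (use 1(1) True False in auto)
    then show ?thesis using True 1(1) sK[OF True] B(1) by (simp add: v2 a5)
   next
    case F: False
    then have "vs s' 20 = K" using 1(1) by simp
    moreover have "Post (2 * n + 1)" by (rule none) (use 1(1) calculation in auto)
    ultimately show ?thesis using 1(1) B(1) by (simp add: v2)
   qed
  qed
  moreover have "(if u < w then 1 else 0) + (if w < u then 1 else 0) = (1::nat)" using False by simp
  ultimately show ?thesis using B(2) unfolding find_com_def Post_def by (simp add: u w v' conj_assoc)
 qed
qed

subsection \<open>Queries\<close>

text \<open>The nodes of the auxiliary graph: \<open>(x, x)\<close>, the undeleted edges up to the last deleted predicted
 position, and \<open>(y, y)\<close>; \<open>TL\<close> and \<open>HD\<close> are the tails and heads.\<close>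

definition nodes :: "edge set => nat => nat => nat => (nat => nat) => (nat => nat) => bool" where
 "nodes X x y c TL HD \<longleftrightarrow> 2 \<le> c \<and> TL 0 = x \<and> HD 0 = x \<and> TL (c - 1) = y \<and> HD (c - 1) = y \<and>
  (\<lambda>j. (TL j, HD j)) ` {1..<c - 1} = X"

lemma nodes_cases:
 assumes "nodes X x y c TL HD" "g < c"
 obtains "g = 0" "TL g = x" "HD g = x" | "1 \<le> g" "(TL g, HD g) \<in> X" | "1 \<le> g" "TL g = y" "HD g = y"
proof -
 consider "g = 0" | "1 \<le> g" "g < c - 1" | "1 \<le> g" "g = c - 1" using assms(2) by linarith
 then show thesis
 proof cases
  case 2
  then have "(TL g, HD g) \<in> (\<lambda>j. (TL j, HD j)) ` {1..<c - 1}" by auto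
  then show thesis using that(2) 2 assms(1) unfolding nodes_def by blast
 qed (use assms(1) that in \<open>auto simp: nodes_def\<close>)
qed

text \<open>Arrays 30 and 31 receive the tails and heads, array 7 the tentative distances, with
  \<open>2 * n + 2\<close> for infinity, and array 8 the visited flags. The linked list is followed
  from its sentinel 0.\<close>

definition collect_com :: com where
 "collect_com = (Wr 30 (N 0) (V 0) ;; Wr 31 (N 0) (V 0) ;; Wr 7 (N 0) (N 0) ;; Wr 8 (N 0) (N 0) ;; 11 ::= N 1 ;; 12 ::= Rd 3 (N 0) ;;
   CWhile (V 12 <. V vJ +. N 1)
    (Wr 30 (V 11) (Rd 0 (V vnn +. V 12 -. N 1)) ;; Wr 31 (V 11) (Rd 1 (V vnn +. V 12 -. N 1)) ;;
    Wr 7 (V 11) (N 2 *. V vn +. N 2) ;; Wr 8 (V 11) (N 0) ;; 11 ::= V 11 +. N 1 ;; 12 ::= Rd 3 (V 12)) ;;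
   Wr 30 (V 11) (V 1) ;; Wr 31 (V 11) (V 1) ;; Wr 7 (V 11) (N 2 *. V vn +. N 2) ;; Wr 8 (V 11) (N 0) ;; 11 ::= V 11 +. N 1)"

lemma wp_collect:
 fixes s :: st
 assumes o: "online n es h K D s" and es: "set es \<subseteq> {..<n} \<times> {..<n}" and m: "length es \<le> n * n"
  and v: "vs s 0 = x" "vs s 1 = y" and xy: "x < n" "y < n" and B: "2 * (n * n) + 4 \<le> B" "2 * n + 2 \<le> B"
 defines "J \<equiv> Max (insert 0 D)"
 shows "wp B collect_com (\<lambda>s'. nodes (extra es D (J + 1)) x y (vs s' 11) (ar s' 30) (ar s' 31) \<and>
  vs s' 11 = card ({1..<J + 1} - D) + 2 \<and> ar s' 7 0 = 0 \<and> (\<forall>j. 0 < j --> j < vs s' 11 --> ar s' 7 j = 2 * n + 2) \<and>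
  (\<forall>j<vs s' 11. ar s' 8 j = 0) \<and> ck s' \<le> ck s + 300 * vs s' 11) s"
proof -
 have v': "vs s vn = n" "vs s vnn = n * n" "vs s vJ = J"
  and l: "links (length es) D (ar s 3) (ar s 4)" and ed: "edges_ok n es (length es) s"
  using o by (simp_all add: online_def J_def)
 have D: "D \<subseteq> {1..length es}" using l by (simp add: links_def)
 then have fD: "finite D" by (rule finite_subset) simp
 have Jm: "J \<le> length es" unfolding J_def using D fD by (subst Max_le_iff) auto
 have JD: "d \<le> J" if "d \<in> D" for d unfolding J_def using fD that by simp
 \<comment> \<open>\<open>J\<close> is the largest deleted position, so \<open>J + 1\<close> is
   undeleted and no successor of a position up to \<open>J\<close> jumps over it; the traversal ends
   exactly there.\<close>
 have nx: "p < ar s 3 p" "ar s 3 p \<le> J + 1" "ar s 3 p \<notin> D" "\<And>z. p < z ==> z < ar s 3 p ==> z \<in> D" if "p \<le> J" "p \<notin> D" for p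
 proof -
  have "p \<le> length es" using that Jm by simp
  then show *: "p < ar s 3 p" "ar s 3 p \<notin> D" "\<And>z. p < z ==> z < ar s 3 p ==> z \<in> D" using l that(2) by (simp_all add: links_def)
  show "ar s 3 p \<le> J + 1"
  proof (rule ccontr)
   assume "\<not> ar s 3 p \<le> J + 1"
   then have "J + 1 \<in> D" using *(3)[of "J + 1"] that(1) by simp
   then show False using JD[of "J + 1"] by simp
  qed
 qed
 have "0 \<notin> D" using D by auto
 have rg: "{1..<ar s 3 p} - D = insert p ({1..<p} - D)" "extra es D (ar s 3 p) = insert (es ! (p - 1)) (extra es D p)"
  if p: "1 \<le> p" "p \<le> J" "p \<notin> D" for p
 proof -
  note q = nx[OF p(2,3)]
  have zz: "z < ar s 3 p \<and> z \<notin> D \<longleftrightarrow> z = p \<or> z < p \<and> z \<notin> D" for z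
  proof -
   have "\<not> (p < z \<and> z < ar s 3 p \<and> z \<notin> D)" using q(4)[of z] by blast
   then show ?thesis using q(1) p(3) by (metis less_trans linorder_neqE_nat)
  qed
  show "{1..<ar s 3 p} - D = insert p ({1..<p} - D)"
  proof (intro set_eqI)
   fix z show "z \<in> {1..<ar s 3 p} - D \<longleftrightarrow> z \<in> insert p ({1..<p} - D)" using zz[of z] p(1) by auto
  qed
  show "extra es D (ar s 3 p) = insert (es ! (p - 1)) (extra es D p)" (is "?L = ?R")
  proof (intro equalityI subsetI)
   fix e assume "e \<in> ?L"
   then obtain i where i: "e = es ! i" "i < length es" "i + 1 \<notin> D" "i + 1 < ar s 3 p" unfolding extra_def by blast
   then have "i + 1 = p \<or> i + 1 < p" using zz[of "i + 1"] by blast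
   then show "e \<in> ?R" using i unfolding extra_def by auto
  next
   fix e assume "e \<in> ?R"
   then consider "e = es ! (p - 1)" | i where "e = es ! i" "i < length es" "i + 1 \<notin> D" "i + 1 < p" unfolding extra_def by blast
   then show "e \<in> ?L"
   proof cases
    case 1
    have "p - 1 < length es" "p - 1 + 1 = p" using p Jm by auto
    then show ?thesis using 1 p q unfolding extra_def by (intro CollectI exI[of _ "p - 1"]) auto
   next
    case (2 i)
    then show ?thesis using q(1) unfolding extra_def by (intro CollectI exI[of _ i]) auto
   qed
  qed
 qed
 let ?s = "setv 8 12 (ar s 3 0) (setv 3 11 1 (seta 7 8 0 0 (seta 7 7 0 0 (seta 8 31 0 x (seta 8 30 0 x s)))))"
 let ?c = "Wr 30 (V 11) (Rd 0 (V vnn +. V 12 -. N 1)) ;; Wr 31 (V 11) (Rd 1 (V vnn +. V 12 -. N 1)) ;;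
    Wr 7 (V 11) (N 2 *. V vn +. N 2) ;; Wr 8 (V 11) (N 0) ;; 11 ::= V 11 +. N 1 ;; 12 ::= Rd 3 (V 12)"
 define I where "I = (\<lambda>s' :: st. 1 \<le> vs s' 12 \<and> vs s' 12 \<le> J + 1 \<and> vs s' 12 \<notin> D \<and> vs s' 11 = card ({1..<vs s' 12} - D) + 1 \<and>
  ar s' 30 0 = x \<and> ar s' 31 0 = x \<and> (\<lambda>j. (ar s' 30 j, ar s' 31 j)) ` {1..<vs s' 11} = extra es D (vs s' 12) \<and> ar s' 7 0 = 0 \<and>
  (\<forall>j. 0 < j --> j < vs s' 11 --> ar s' 7 j = 2 * n + 2) \<and> (\<forall>j<vs s' 11. ar s' 8 j = 0) \<and> ck s' \<le> ck s + 100 + 150 * vs s' 11)"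
 have main: "wp B (CWhile (V 12 <. V vJ +. N 1) ?c) (\<lambda>s'. I s' \<and> vs s' 12 = J + 1) ?s"
 proof (rule wp_While[where I = "\<lambda>s'. I s' \<and> ck s' + 8 \<le> ck s + 100 + 150 * vs s' 11" and f = "\<lambda>s'. J + 1 - vs s' 12"], goal_cases)
  case 1
  note q = nx[of 0, OF _ \<open>0 \<notin> D\<close>]
  have "{1..<ar s 3 0} - D = {}" using q(4) by fastforce
  moreover have "extra es D (ar s 3 0) = {}" unfolding extra_def using q(4) by fastforce
  ultimately show ?case unfolding I_def using q(1-3) by (simp add: One_nat_def Suc_le_eq)
 next
  case (2 s')
  have sm: "same {11, 12} {30, 31, 7, 8} ?s s'" using 2(2) by (elim same_mono) auto
  have v2: "vs s' vn = n" "vs s' vnn = n * n" "vs s' vJ = J" "ar s' 0 = ar s 0" "ar s' 1 = ar s 1" "ar s' 3 = ar s 3"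
   using v' by (simp_all add: same_vs[OF sm] same_ar[OF sm])
  define p c where "p = vs s' 12" and "c = vs s' 11"
  have I: "1 \<le> p" "p \<notin> D" "c = card ({1..<p} - D) + 1" "ar s' 30 0 = x" "ar s' 31 0 = x" "(\<lambda>j. (ar s' 30 j, ar s' 31 j)) ` {1..<c} = extra es D p"
   "ar s' 7 0 = 0" "\<And>j. 0 < j ==> j < c ==> ar s' 7 j = 2 * n + 2" "\<And>j. j < c ==> ar s' 8 j = 0" "ck s' + 8 \<le> ck s + 100 + 150 * c"
   using 2(1) unfolding I_def p_def c_def by auto
  have pJ: "p \<le> J" using 2(3) v2 by (simp add: p_def split: if_splits)
  have c1: "1 \<le> c" using I(3) by simp
  have cm: "c \<le> length es"
  proof -
   have "card ({1..<p} - D) \<le> card {1..<p}" by (intro card_mono) auto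
   then show ?thesis using I(3) pJ Jm \<open>1 \<le> p\<close> by simp
  qed
  obtain i where i: "p = i + 1" using I(1) by (metis le_add_diff_inverse2)
  have il: "i < length es" using i pJ Jm by simp
  have e: "ar s 0 (n * n + i) = fst (es ! i)" "ar s 1 (n * n + i) = snd (es ! i)" using ed il by (simp_all add: edges_ok_def)
  have "es ! i \<in> {..<n} \<times> {..<n}" using es il nth_mem by blast
  then have eB: "fst (es ! i) \<le> B" "snd (es ! i) \<le> B" using B(2) by (auto simp: mem_Times_iff)
  note q = nx[OF pJ I(2)] and r = rg[OF I(1) pJ I(2)]
  have fin: "(I s'' \<and> ck s'' + 8 \<le> ck s + 100 + 150 * vs s'' 11) \<and> J + 1 - vs s'' 12 < J + 1 - p"
   if s'': "vs s'' 12 = ar s 3 p" "vs s'' 11 = c + 1" "ar s'' 30 = (ar s' 30)(c := fst (es ! i))" "ar s'' 31 = (ar s' 31)(c := snd (es ! i))"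
    "ar s'' 7 = (ar s' 7)(c := 2 * n + 2)" "ar s'' 8 = (ar s' 8)(c := 0)" "ck s'' \<le> ck s' + 150" for s''
  proof -
   have "card ({1..<ar s 3 p} - D) = card ({1..<p} - D) + 1" unfolding r(1) by (subst card_insert_disjoint) auto
   moreover have "(\<lambda>j. (ar s'' 30 j, ar s'' 31 j)) ` {1..<c + 1} = extra es D (ar s 3 p)"
   proof -
    have "{1..<c + 1} = insert c {1..<c}" using c1 by auto
    moreover have "(\<lambda>j. (ar s'' 30 j, ar s'' 31 j)) ` {1..<c} = (\<lambda>j. (ar s' 30 j, ar s' 31 j)) ` {1..<c}" by (intro image_cong) (auto simp: s'')
    moreover have "es ! (p - 1) = es ! i" using i by simp
    ultimately show ?thesis unfolding r(2) using I(6) by (simp add: s'')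
   qed
   ultimately show ?thesis unfolding I_def s''(1,2) using I q s''(7) pJ c1
    by (simp add: s''(3-6) less_plus1_eq all_less_plus1)
  qed
  have "c \<le> B" "c + 1 \<le> B" "ar s 3 p \<le> B" "2 * n + 2 \<le> B" using cm m B q(2) Jm by linarith+
  moreover have "ar s 0 (n * n + p - 1) = fst (es ! i)" "ar s 1 (n * n + p - 1) = snd (es ! i)" using e i by simp_all
  moreover have "J + 1 - ar s 3 p < J + 1 - p" using q(1) pJ by simp
  ultimately show ?case using eB I(10)
   by (auto simp: v2 p_def[symmetric] c_def[symmetric] intro!: fin[THEN conjunct1, THEN conjunct1])
 next
  case (3 s')
  have sm: "same {11, 12} {30, 31, 7, 8} ?s s'" using 3(2) by (elim same_mono) auto
  have "vs s' vJ = J" using v' by (simp add: same_vs[OF sm])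
  then have "vs s' 12 = J + 1" using 3(1,3) unfolding I_def by (simp split: if_splits)
  moreover have "I (tick 8 s')" using 3(1) unfolding I_def st_sel by blast
  ultimately show ?case by simp
 qed
 have "wp B (CWhile (V 12 <. V vJ +. N 1) ?c) (wp B (Wr 30 (V 11) (V 1) ;; Wr 31 (V 11) (V 1) ;; Wr 7 (V 11) (N 2 *. V vn +. N 2) ;; Wr 8 (V 11) (N 0) ;; 11 ::= V 11 +. N 1)
  (\<lambda>s'. nodes (extra es D (J + 1)) x y (vs s' 11) (ar s' 30) (ar s' 31) \<and>
  vs s' 11 = card ({1..<J + 1} - D) + 2 \<and> ar s' 7 0 = 0 \<and> (\<forall>j. 0 < j --> j < vs s' 11 --> ar s' 7 j = 2 * n + 2) \<and>
  (\<forall>j<vs s' 11. ar s' 8 j = 0) \<and> ck s' \<le> ck s + 300 * vs s' 11)) ?s"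
 proof (rule wp_conseq[OF main], goal_cases)
  case (1 s')
  have sm: "same {11, 12} {30, 31, 7, 8} ?s s'" using 1(2) by (elim same_mono) auto
  have v2: "vs s' vn = n" "vs s' 1 = y" using v' v by (simp_all add: same_vs[OF sm])
  define c where "c = vs s' 11"
  have I: "c = card ({1..<J + 1} - D) + 1" "ar s' 30 0 = x" "ar s' 31 0 = x" "(\<lambda>j. (ar s' 30 j, ar s' 31 j)) ` {1..<c} = extra es D (J + 1)"
   "ar s' 7 0 = 0" "\<And>j. 0 < j ==> j < c ==> ar s' 7 j = 2 * n + 2" "\<And>j. j < c ==> ar s' 8 j = 0" "ck s' \<le> ck s + 100 + 150 * c"
   using 1(1) unfolding I_def c_def by auto
  have c1: "1 \<le> c" using I(1) by simp
  have cm: "c \<le> length es + 1"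
  proof -
   have "card ({1..<J + 1} - D) \<le> card {1..<J + 1}" by (intro card_mono) auto
   then show ?thesis using I(1) Jm by simp
  qed
  have im: "(\<lambda>j. (if j = c then y else ar s' 30 j, if j = c then y else ar s' 31 j)) ` {1..<c} = extra es D (J + 1)"
   unfolding I(4)[symmetric] by (intro image_cong) auto
  have "c + 1 \<le> B" "y \<le> B" "2 * n + 2 \<le> B" using cm m B xy by linarith+
  then show ?case using I(1-3,5-8) c1 im
   by (simp add: v2 c_def[symmetric] nodes_def fun_upd_def less_plus1_eq all_less_plus1 cong: if_cong)
 qed
 moreover have "ar s 3 0 \<le> B" using nx(2)[of 0, OF _ \<open>0 \<notin> D\<close>] Jm m B(1) by simp
 ultimately show ?thesis unfolding collect_com_def using xy B by (simp add: v v')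
qed

text \<open>The distance of a node includes one unit for its own edge, hence \<open>l + 1\<close>
  for a walk to the tail. The last node pays this unit for its artificial loop, and only node 0 is
  exempt.\<close>

definition sound :: "edge set => nat => nat => nat => (nat => nat) => (nat => nat) => bool" where
 "sound F n x c TL d \<longleftrightarrow> (\<forall>g<c. d g \<le> 2 * n + 1 --> g = 0 \<or> (\<exists>l. (x, TL g) \<in> F ^^ l \<and> l + 1 \<le> d g))"

text \<open>What relaxing the arc from \<open>f\<close> to \<open>g\<close> achieves, in terms of
  the true length \<open>a\<close> of a walk between them instead of the estimate. Multiplying by
  \<open>h\<close> avoids fractions; the final \<open>h\<close> is the unit for the edge of
  \<open>g\<close>.\<close>

definition feas :: "edge set => nat => (nat => nat) => (nat => nat) => nat => nat => nat => nat => bool" where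
 "feas E h TL HD df dg f g \<longleftrightarrow> (\<forall>a. (HD f, TL g) \<in> E ^^ a --> h * dg \<le> h * df + (h + 1) * a + h)"

text \<open>Dijkstra's invariant in terms of inequalities: instead of optimality it records
  soundness of the distances, and feasibility of all arcs out of visited nodes.\<close>

definition dinv :: "edge set => edge set => nat => nat => nat => nat => (nat => nat) => (nat => nat) => (nat => nat) => (nat => nat) => bool" where
 "dinv F E h n x c TL HD d vis \<longleftrightarrow> d 0 = 0 \<and> (\<forall>g<c. d g \<le> 2 * n + 2) \<and> sound F n x c TL d \<and>
  (\<forall>f<c. \<forall>g<c. vis f \<noteq> 0 --> vis g = 0 --> d f \<le> d g) \<and>
  (\<forall>f<c. \<forall>g<c. vis f \<noteq> 0 --> feas E h TL HD (d f) (d g) f g)"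

text \<open>\<open>d f\<close> already pays for the edge of \<open>f\<close>, so the head of
  \<open>f\<close> is reached within \<open>d f\<close> steps and \<open>v\<close> within
  \<open>d f + q\<close>; the remaining unit belongs to the edge entered at
  \<open>v\<close>.\<close>

lemma sound_step:
 assumes nd: "nodes X x y c TL HD" and sub: "X \<subseteq> F" "E \<subseteq> F" and so: "sound F n x c TL d" and d0: "d 0 = 0" and f: "f < c"
  and q: "q \<le> 2 * n ==> \<exists>j\<le>q. (HD f, v) \<in> E ^^ j" and le: "d f + q + 1 \<le> 2 * n + 1"
 shows "\<exists>l. (x, v) \<in> F ^^ l \<and> l + 1 \<le> d f + q + 1"
proof -
 obtain j where j: "j \<le> q" "(HD f, v) \<in> E ^^ j" using q le by auto
 have "\<exists>l\<le>d f. (x, HD f) \<in> F ^^ l"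
  using nd f
 proof (cases rule: nodes_cases)
  case 1
  then show ?thesis using d0 by auto
 next
  case 2
  then obtain l where "(x, TL f) \<in> F ^^ l" "l + 1 \<le> d f" using so f le unfolding sound_def by fastforce
  moreover have "(x, HD f) \<in> F ^^ (Suc l)" using calculation(1) 2 sub(1) by auto
  ultimately show ?thesis by (intro exI[of _ "Suc l"]) auto
 next
  case 3
  then obtain l where "(x, TL f) \<in> F ^^ l" "l + 1 \<le> d f" using so f le unfolding sound_def by fastforce
  then show ?thesis using 3 by (intro exI[of _ l]) auto
 qed
 then obtain l where l: "l \<le> d f" "(x, HD f) \<in> F ^^ l" by blast
 have "(HD f, v) \<in> F ^^ j" using relpow_mono'[OF sub(2) j(2)] .
 then have "(x, v) \<in> F ^^ (l + j)" using l(2) by (auto simp: relpow_add)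
 then show ?thesis using l(1) j(1) by (intro exI[of _ "l + j"]) auto
qed

text \<open>A changed distance exceeds \<open>d f\<close>, while visited nodes lie at or below
  \<open>d f\<close>, and distances never increase. So visited distances are final, and their arcs
  stay feasible.\<close>

lemma dinv_round:
 assumes di: "dinv F E h n x c TL HD d vis" and f: "f < c" "vis f = 0" and mn: "\<And>g. g < c ==> vis g = 0 ==> d f \<le> d g"
  and d': "\<And>g. g < c ==> d' g \<le> d g \<and> (d' g = d g \<or> d f < d' g)" and so: "sound F n x c TL d'"
  and fe: "\<And>g. g < c ==> feas E h TL HD (d f) (d' g) f g"
 shows "dinv F E h n x c TL HD d' (vis(f := 1))"
proof -
 have D: "d 0 = 0" "\<And>g. g < c ==> d g \<le> 2 * n + 2" "\<And>f g. f < c ==> g < c ==> vis f \<noteq> 0 ==> vis g = 0 ==> d f \<le> d g"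
  "\<And>f g. f < c ==> g < c ==> vis f \<noteq> 0 ==> feas E h TL HD (d f) (d g) f g"
  using di unfolding dinv_def by auto
 have old: "d' g = d g" if "g < c" "vis g \<noteq> 0 \<or> g = f" for g
  using d'[OF that(1)] D(3)[OF that(1) f(1)] f(2) that(2) by fastforce
 show ?thesis unfolding dinv_def
 proof (intro conjI allI impI)
  show "d' 0 = 0" using d'[of 0] f(1) D(1) by auto
  show "d' g \<le> 2 * n + 2" if "g < c" for g using d'[OF that] D(2)[OF that] by linarith
  show "d' e \<le> d' g" if "e < c" "g < c" "(vis(f := 1)) e \<noteq> 0" "(vis(f := 1)) g = 0" for e g
  proof -
   have g: "vis g = 0" "g \<noteq> f" using that(4) by (auto split: if_splits)
   have e: "vis e \<noteq> 0 \<or> e = f" using that(3) by (auto split: if_splits)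
   have "d e \<le> d g" "d e \<le> d f" using e D(3)[of e g] D(3)[of e f] that g f mn[of g] by auto
   then show ?thesis using old[OF that(1) e] d'[OF that(2)] by auto
  qed
  show "feas E h TL HD (d' e) (d' g) e g" if "e < c" "g < c" "(vis(f := 1)) e \<noteq> 0" for e g
  proof (cases "e = f")
   case True
   then show ?thesis using fe[OF that(2)] old[of f] f(1) by simp
  next
   case False
   then have "feas E h TL HD (d e) (d g) e g" "d' e = d e" using D(4)[of e g] old[of e] that by auto
   moreover have "h * d' g \<le> h * d g" using d'[OF that(2)] by simp
   ultimately show ?thesis unfolding feas_def using le_trans by metis
  qed
 qed (rule so)
qed

text \<open>Induction along the walk: after \<open>k\<close> steps there are a node \<open>f\<close>
  and an \<open>E\<close>-walk of length \<open>a\<close> from its head with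
  \<open>h * d f + (h + 1) * a \<le> (h + 1) * k\<close>. A step outside \<open>E\<close> moves on
  to the node of that edge and costs \<open>h\<close> where \<open>h + 1\<close> is allowed. The
  \<open>h\<close> left over in the conclusion is the artificial edge at the target.\<close>

lemma dijkstra_complete:
 assumes nd: "nodes X x y c TL HD" and F: "F = E \<union> X" and d0: "d 0 = 0"
  and fe: "\<And>f g. f < c ==> g < c ==> feas E h TL HD (d f) (d g) f g"
  and w: "(x, y) \<in> F ^^ l"
 shows "h * d (c - 1) \<le> (h + 1) * l + h"
proof -
 have "\<exists>f<c. \<exists>a. (HD f, v) \<in> E ^^ a \<and> h * d f + (h + 1) * a \<le> (h + 1) * k" if "(x, v) \<in> F ^^ k" for v k
  using that
 proof (induction k arbitrary: v)
  case 0
  then show ?case using nd d0 by (intro exI[of _ 0]) (auto simp: nodes_def intro!: exI[of _ 0])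
 next
  case (Suc k)
  then obtain u where u: "(x, u) \<in> F ^^ k" "(u, v) \<in> F" by auto
  from Suc.IH[OF u(1)] obtain f a where f: "f < c" "(HD f, u) \<in> E ^^ a" "h * d f + (h + 1) * a \<le> (h + 1) * k" by blast
  show ?case
  proof (cases "(u, v) \<in> E")
   case True
   then have "(HD f, v) \<in> E ^^ (Suc a)" using f(2) by auto
   then show ?thesis using f(1,3) by (intro exI[of _ f] conjI exI[of _ "Suc a"]) (simp_all add: algebra_simps)
  next
   case False
   then have "(u, v) \<in> (\<lambda>j. (TL j, HD j)) ` {1..<c - 1}" using u(2) F nd by (auto simp: nodes_def)
   then obtain g where "g \<in> {1..<c - 1}" and g': "TL g = u" "HD g = v" by blast
   then have g: "g < c" "TL g = u" "HD g = v" by auto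
   have "h * d g \<le> h * d f + (h + 1) * a + h" using fe[OF f(1) g(1)] f(2) g(2) unfolding feas_def by blast
   then have "h * d g \<le> (h + 1) * Suc k" using f(3) by (simp add: algebra_simps)
   then show ?thesis using g by (intro exI[of _ g] conjI exI[of _ 0]) auto
  qed
 qed
 from this[OF w] obtain f a where f: "f < c" "(HD f, y) \<in> E ^^ a" "h * d f + (h + 1) * a \<le> (h + 1) * l" by blast
 have "c - 1 < c" "TL (c - 1) = y" using nd by (auto simp: nodes_def)
 then have "h * d (c - 1) \<le> h * d f + (h + 1) * a + h" using fe[OF f(1), of "c - 1"] f(2) unfolding feas_def by auto
 then show ?thesis using f(3) by linarith
qed

text \<open>The start value \<open>2 * n + 3\<close> exceeds every distance, including the value for
  infinity, so an unvisited node is always found.\<close>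

definition select_com :: com where
 "select_com = (14 ::= N 0 ;; 15 ::= N 2 *. V vn +. N 3 ;;
   For 16 (V 11) (CIf (Rd 8 (V 16)) CSkip (CIf (Rd 7 (V 16) <. V 15) (14 ::= V 16 ;; 15 ::= Rd 7 (V 16)) CSkip)))"

lemma wp_select:
 fixes s :: st
 assumes v: "vs s vn = n" "vs s 11 = c" and c: "c \<le> B" and d: "\<And>g. g < c ==> ar s 7 g \<le> 2 * n + 2"
  and ex: "\<exists>g<c. ar s 8 g = 0" and B: "2 * n + 3 \<le> B"
 shows "wp B select_com (\<lambda>s'. vs s' 14 < c \<and> ar s 8 (vs s' 14) = 0 \<and> (\<forall>g<c. ar s 8 g = 0 --> ar s 7 (vs s' 14) \<le> ar s 7 g) \<and>
  ck s' \<le> ck s + 100 * c + 50) s"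
proof -
 let ?s = "setv 8 15 (2 * n + 3) (setv 3 14 0 s)"
 let ?c = "CIf (Rd 8 (V 16)) CSkip (CIf (Rd 7 (V 16) <. V 15) (14 ::= V 16 ;; 15 ::= Rd 7 (V 16)) CSkip)"
 define I where "I = (\<lambda>k (s' :: st). (\<forall>g<k. ar s 8 g = 0 --> vs s' 15 \<le> ar s 7 g) \<and>
  (vs s' 15 = 2 * n + 3 \<or> vs s' 14 < k \<and> ar s 8 (vs s' 14) = 0 \<and> vs s' 15 = ar s 7 (vs s' 14)) \<and> ck s' \<le> ck s + 100 * k + 20)"
 have "wp B (For 16 (V 11) ?c) (\<lambda>s'. vs s' 14 < c \<and> ar s 8 (vs s' 14) = 0 \<and> (\<forall>g<c. ar s 8 g = 0 --> ar s 7 (vs s' 14) \<le> ar s 7 g) \<and>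
  ck s' \<le> ck s + 100 * c + 50) ?s"
 proof (rule wp_For[where b = c and I = I], goal_cases)
  case 1
  show ?case unfolding I_def by simp
 next
  case 2
  show ?case by (rule c)
 next
  case (3 s')
  then show ?case using v by (simp add: same_def)
 next
  case (4 k s')
  have a: "ar s' 7 = ar s 7" "ar s' 8 = ar s 8" by (simp_all add: same_ar[OF 4(2)])
  have I: "\<forall>g<k. ar s 8 g = 0 --> vs s' 15 \<le> ar s 7 g"
   "vs s' 15 = 2 * n + 3 \<or> vs s' 14 < k \<and> ar s 8 (vs s' 14) = 0 \<and> vs s' 15 = ar s 7 (vs s' 14)"
   "ck s' \<le> ck s + 100 * k + 20" using 4(1) unfolding I_def by blast+
  have dk: "ar s 7 k \<le> 2 * n + 2" "k \<le> B" "ar s 7 k \<le> B" using d[OF 4(4)] 4(4) c B by linarith+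
  consider "ar s 8 k \<noteq> 0" | "ar s 8 k = 0" "ar s 7 k < vs s' 15" | "ar s 8 k = 0" "\<not> ar s 7 k < vs s' 15" by blast
  then show ?case
  proof cases
   case 1
   have "I (k + 1) s''" if "vs s'' 14 = vs s' 14" "vs s'' 15 = vs s' 15" "ck s'' \<le> ck s' + 100" for s''
    using I 1 that unfolding I_def all_less_plus1 by (simp add: less_plus1_eq) blast
   then show ?thesis using 1 by (simp add: a 4(3))
  next
   case 2
   have "\<forall>g<k. ar s 8 g = 0 --> ar s 7 k \<le> ar s 7 g" using I(1) 2(2) by fastforce
   then have "I (k + 1) s''" if "vs s'' 14 = k" "vs s'' 15 = ar s 7 k" "ck s'' \<le> ck s' + 100" for s''
    using I(3) 2 that unfolding I_def all_less_plus1 by simp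
   then show ?thesis using 2 dk by (simp add: a 4(3))
  next
   case 3
   have "I (k + 1) s''" if "vs s'' 14 = vs s' 14" "vs s'' 15 = vs s' 15" "ck s'' \<le> ck s' + 100" for s''
    using I 3 that unfolding I_def all_less_plus1 by (simp add: less_plus1_eq) blast
   then show ?thesis using 3 by (simp add: a 4(3))
  qed
 next
  case (5 s')
  obtain g where "g < c" "ar s 8 g = 0" using ex by blast
  then have "vs s' 15 \<noteq> 2 * n + 3" using 5(1) d[of g] unfolding I_def by fastforce
  then have e: "vs s' 14 < c" "ar s 8 (vs s' 14) = 0" "vs s' 15 = ar s 7 (vs s' 14)" using 5(1) unfolding I_def by blast+
  have "\<forall>g<c. ar s 8 g = 0 --> ar s 7 (vs s' 14) \<le> ar s 7 g" "ck s' \<le> ck s + 100 * c + 20"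
   using 5(1) unfolding I_def e(3)[symmetric] by blast+
  then show ?case using e by simp
 qed
 then show ?thesis unfolding select_com_def using v B by simp
qed

definition relax_com :: com where
 "relax_com = For 16 (V 11) (18 ::= Rd 31 (V 14) ;; 19 ::= Rd 30 (V 16) ;; find_com ;; 23 ::= Rd 7 (V 14) +. V 17 +. N 1 ;;
   CIf (V 23 <. Rd 7 (V 16)) (Wr 7 (V 16) (V 23)) CSkip)"

lemma mv_find: "mv find_com = {17, 20, 21, 22}" and ma_find: "ma find_com = {}"
 by (auto simp: find_com_def)

lemma wp_relax:
 fixes s :: st and es :: "edge list" and D :: "nat set"
 defines "E \<equiv> eset es (Max (insert 0 D) + 1)"
 assumes o: "online n es h K D s" and es: "set es \<subseteq> {..<n} \<times> {..<n}" and h: "0 < h"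
  and nd: "nodes X x y c (ar s 30) (ar s 31)" and X: "X \<subseteq> {..<n} \<times> {..<n}" and xy: "x < n" "y < n"
  and v: "vs s 11 = c" "vs s 14 = f" and f: "f < c"
  and d: "\<And>g. g < c ==> ar s 7 g \<le> 2 * n + 2" and d0: "ar s 7 0 = 0"
  and so: "sound F n x c (ar s 30) (ar s 7)" and sub: "X \<subseteq> F" "E \<subseteq> F"
  and R: "K < 2 ^ R" and B: "4 * n + 4 \<le> B" "K + 1 \<le> B" "c \<le> B"
 shows "wp B relax_com (\<lambda>s'. (\<forall>g<c. ar s' 7 g \<le> ar s 7 g \<and> (ar s' 7 g = ar s 7 g \<or> ar s 7 f < ar s' 7 g)) \<and> sound F n x c (ar s 30) (ar s' 7) \<and>
  (\<forall>g<c. feas E h (ar s 30) (ar s 31) (ar s 7 f) (ar s' 7 g) f g) \<and> ck s' \<le> ck s + (100 * R + 300) * c + 20) s"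
 unfolding relax_com_def
proof (rule wp_For[where b = c and I = "\<lambda>k s'. (\<forall>g<c. ar s' 7 g \<le> ar s 7 g \<and> (ar s' 7 g = ar s 7 g \<or> ar s 7 f < ar s' 7 g)) \<and> sound F n x c (ar s 30) (ar s' 7) \<and>
  (\<forall>g<k. feas E h (ar s 30) (ar s 31) (ar s 7 f) (ar s' 7 g) f g) \<and> ck s' \<le> ck s + (100 * R + 300) * k + 3"], goal_cases)
 case 1
 then show ?case using so by simp
next
 case 2
 then show ?case by (rule B(3))
next
 case (3 s')
 then show ?case using v by (simp add: same_def mv_find ma_find)
next
 case (4 k s')
 have sm: "same {16, 17, 18, 19, 20, 21, 22, 23} {7} s s'" using 4(2) by (elim same_mono) (auto simp: mv_find ma_find)
 have v2: "vs s' 11 = c" "vs s' 14 = f" "ar s' 30 = ar s 30" "ar s' 31 = ar s 31" using v by (simp_all add: same_vs[OF sm] same_ar[OF sm])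
 have I: "\<And>g. g < c ==> ar s' 7 g \<le> ar s 7 g" "\<And>g. g < c ==> ar s' 7 g = ar s 7 g \<or> ar s 7 f < ar s' 7 g" "sound F n x c (ar s 30) (ar s' 7)"
  "\<And>g. g < k ==> feas E h (ar s 30) (ar s 31) (ar s 7 f) (ar s' 7 g) f g" "ck s' \<le> ck s + (100 * R + 300) * k + 3"
  using 4(1) by blast+
 have df: "ar s' 7 f = ar s 7 f" using I(1,2)[OF f] by simp
 have d0': "ar s' 7 0 = 0" using I(1)[of 0] d0 f by simp
 define u w where "u = ar s 31 f" and "w = ar s 30 k"
 have uw: "u < n" "w < n"
 proof -
  have "ar s 31 g < n \<and> ar s 30 g < n" if "g < c" for g
   using nd that by (cases rule: nodes_cases) (use X xy in auto)
  then show "u < n" "w < n" using f 4(4) by (auto simp: u_def w_def)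
 qed
 let ?s = "setv 9 19 w (setv 9 18 u (tick (ecost (V 11) + 4) s'))"
 have o1: "online n es h K D s'" by (rule online_same[OF o sm]) auto
 have o2: "online n es h K D ?s" by (rule online_cong[OF o1]) auto
 have "wp B find_com (wp B (23 ::= Rd 7 (V 14) +. V 17 +. N 1 ;; CIf (V 23 <. Rd 7 (V 16)) (Wr 7 (V 16) (V 23)) CSkip)
   (\<lambda>s''. vs s'' 16 = k \<and> (\<lambda>s'. (\<forall>g<c. ar s' 7 g \<le> ar s 7 g \<and> (ar s' 7 g = ar s 7 g \<or> ar s 7 f < ar s' 7 g)) \<and> sound F n x c (ar s 30) (ar s' 7) \<and>
   (\<forall>g<k + 1. feas E h (ar s 30) (ar s 31) (ar s 7 f) (ar s' 7 g) f g) \<and> ck s' \<le> ck s + (100 * R + 300) * (k + 1) + 3) (setv 6 16 (k + 1) s''))) ?s"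
 proof (rule wp_conseq[OF wp_find[OF o2 es h, where u = u and w = w and R = R]], goal_cases)
  case (8 s3)
  have sm3: "same {17, 20, 21, 22} {} ?s s3" using 8(2) by (simp add: mv_find ma_find)
  have v3: "vs s3 14 = f" "vs s3 16 = k" "ar s3 7 = ar s' 7" using v2 4(3) by (simp_all add: same_vs[OF sm3] same_ar[OF sm3])
  define q where "q = vs s3 17"
  have q: "q \<le> 2 * n ==> \<exists>j\<le>q. (u, w) \<in> E ^^ j" "\<And>a. (u, w) \<in> E ^^ a ==> h * q \<le> (h + 1) * a" "q \<le> 2 * n + 1"
   "ck s3 \<le> ck s' + 24 + 100 * R + 100" using 8(1) unfolding q_def E_def by auto
  define z where "z = ar s 7 f + q + 1"
  have zB: "z \<le> B" using d[OF f] q(3) B(1) unfolding z_def by linarith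
  have fk: "feas E h (ar s 30) (ar s 31) (ar s 7 f) t f k" if "t \<le> z" for t unfolding feas_def
  proof (intro allI impI)
   fix a assume "(ar s 31 f, ar s 30 k) \<in> E ^^ a"
   then have "h * q \<le> (h + 1) * a" using q(2) by (simp add: u_def w_def)
   moreover have "h * t \<le> h * z" using that by simp
   moreover have "h * z = h * ar s 7 f + h * q + h" by (simp add: z_def algebra_simps)
   ultimately show "h * t \<le> h * ar s 7 f + (h + 1) * a + h" by linarith
  qed
  have ckk: "ck s3 + 60 \<le> ck s + (100 * R + 300) * (k + 1) + 3" using q(4) I(5) by (simp add: algebra_simps)
  have upd: "sound F n x c (ar s 30) ((ar s' 7)(k := z))" unfolding sound_def
  proof (intro allI impI)
   fix g assume g: "g < c" "((ar s' 7)(k := z)) g \<le> 2 * n + 1"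
   show "g = 0 \<or> (\<exists>l. (x, ar s 30 g) \<in> F ^^ l \<and> l + 1 \<le> ((ar s' 7)(k := z)) g)"
   proof (cases "g = k")
    case True
    have "\<exists>l. (x, w) \<in> F ^^ l \<and> l + 1 \<le> ar s 7 f + q + 1"
     by (rule sound_step[OF nd sub so d0 f]) (use q(1) g True in \<open>auto simp: u_def z_def\<close>)
    then show ?thesis using True by (simp add: w_def z_def)
   next
    case False
    then show ?thesis using I(3) g unfolding sound_def by simp
   qed
  qed
  show ?case
  proof (cases "z < ar s' 7 k")
   case True
   define dd where "dd = (ar s' 7)(k := z)"
   have "dd g \<le> ar s 7 g \<and> (dd g = ar s 7 g \<or> ar s 7 f < dd g)" if "g < c" for g
    using I(1,2)[OF that] True by (auto simp: z_def dd_def)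
   moreover have "feas E h (ar s 30) (ar s 31) (ar s 7 f) (dd g) f g" if "g < k + 1" for g
    using fk[of z] I(4)[of g] that by (cases "g = k") (auto simp: dd_def)
   ultimately show ?thesis using True zB upd[folded dd_def] ckk
    by (simp add: v3 df q_def[symmetric] z_def[symmetric] dd_def[symmetric])
  next
   case False
   have "feas E h (ar s 30) (ar s 31) (ar s 7 f) (ar s' 7 g) f g" if "g < k + 1" for g
    using fk[of "ar s' 7 k"] False I(4)[of g] that by (cases "g = k") auto
   then show ?thesis using False zB I(1-3) ckk by (simp add: v3 df q_def[symmetric] z_def[symmetric])
  qed
 qed (use uw R B in auto)
 moreover have "u \<le> B" "w \<le> B" using uw B(1) by linarith+
 ultimately show ?case by (simp add: v2 4(3) u_def w_def)
next
 case (5 s')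
 then show ?case by simp
qed

definition query_com :: com where
 "query_com = (collect_com ;;
   For 13 (V 11) (select_com ;; Wr 8 (V 14) (N 1) ;; relax_com) ;;
   23 ::= Rd 7 (V 11 -. N 1) -. N 1 ;;
   CIf (V 23 <. N 2 *. V vn +. N 1) (0 ::= V 23 ;; 1 ::= N 1) (0 ::= N 0 ;; 1 ::= N 0))"

lemma mv_query: "mv query_com \<subseteq> {0, 1} \<union> {11..23}" and ma_query: "ma query_com \<subseteq> {7, 8, 30, 31}"
 by (auto simp: query_com_def collect_com_def select_com_def relax_com_def find_com_def)

text \<open>Each of the \<open>c\<close> rounds relaxes \<open>c\<close> arcs with a binary search
  of \<open>R\<close> steps. Every round visits a new node, so after \<open>c\<close> rounds all
  nodes are visited and all arcs feasible.\<close>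

lemma wp_rounds:
 fixes s :: st and es :: "edge list" and D :: "nat set"
 defines "E \<equiv> eset es (Max (insert 0 D) + 1)"
 assumes o: "online n es h K D s" and es: "set es \<subseteq> {..<n} \<times> {..<n}" and h: "0 < h"
  and nd: "nodes X x y c (ar s 30) (ar s 31)" and X: "X \<subseteq> {..<n} \<times> {..<n}" and xy: "x < n" "y < n"
  and v: "vs s 11 = c" and d0: "ar s 7 0 = 0" and d: "\<And>g. 0 < g ==> g < c ==> ar s 7 g = 2 * n + 2"
  and vis: "\<And>g. g < c ==> ar s 8 g = 0" and sub: "X \<subseteq> F" "E \<subseteq> F"
  and R: "K < 2 ^ R" and B: "4 * n + 4 \<le> B" "K + 1 \<le> B" "c \<le> B"
 shows "wp B (For 13 (V 11) (select_com ;; Wr 8 (V 14) (N 1) ;; relax_com)) (\<lambda>s'. ar s' 7 0 = 0 \<and> sound F n x c (ar s 30) (ar s' 7) \<and>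
  (\<forall>f<c. \<forall>g<c. feas E h (ar s 30) (ar s 31) (ar s' 7 f) (ar s' 7 g) f g) \<and> (\<forall>g<c. ar s' 7 g \<le> 2 * n + 2) \<and>
  ck s' \<le> ck s + ((100 * R + 500) * c + 100) * c + 20) s"
proof (rule wp_For[where b = c and I = "\<lambda>k s'. dinv F E h n x c (ar s 30) (ar s 31) (ar s' 7) (ar s' 8) \<and>
  card {g. g < c \<and> ar s' 8 g \<noteq> 0} = k \<and> ck s' \<le> ck s + ((100 * R + 500) * c + 100) * k + 3"], goal_cases)
 case 1
 have "{g. g < c \<and> ar s 8 g \<noteq> 0} = {}" using vis by auto
 moreover have "dinv F E h n x c (ar s 30) (ar s 31) (ar s 7) (ar s 8)"
  unfolding dinv_def sound_def using d0 d vis by (auto simp: le_less) (metis le0 not_gr_zero le_refl)+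
 ultimately show ?case by simp
next
 case 2
 then show ?case by (rule B(3))
next
 case (3 s')
 then show ?case using v by (simp add: same_def select_com_def relax_com_def mv_find ma_find)
next
 case (4 k s')
 have sm: "same ({13..23} \<union> {13}) {7, 8} s s'" using 4(2) by (elim same_mono) (auto simp: select_com_def relax_com_def mv_find ma_find)
 have o1: "online n es h K D s'" by (rule online_same[OF o sm]) auto
 have v2: "vs s' vn = n" "vs s' 11 = c" "ar s' 30 = ar s 30" "ar s' 31 = ar s 31"
  using v o by (simp_all add: same_vs[OF sm] same_ar[OF sm] online_def)
 have di: "dinv F E h n x c (ar s 30) (ar s 31) (ar s' 7) (ar s' 8)" and ca: "card {g. g < c \<and> ar s' 8 g \<noteq> 0} = k"
  and ck: "ck s' \<le> ck s + ((100 * R + 500) * c + 100) * k + 3" using 4(1) by blast+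
 have dd: "\<And>g. g < c ==> ar s' 7 g \<le> 2 * n + 2" "ar s' 7 0 = 0" "sound F n x c (ar s 30) (ar s' 7)" using di unfolding dinv_def by auto
 have ex: "\<exists>g<c. ar s' 8 g = 0"
 proof (rule ccontr)
  assume "\<not> (\<exists>g<c. ar s' 8 g = 0)"
  then have "{g. g < c \<and> ar s' 8 g \<noteq> 0} = {..<c}" by auto
  then show False using ca 4(4) by simp
 qed
 let ?s = "tick (ecost (V 11) + 4) s'"
 let ?Q = "\<lambda>s''. vs s'' 13 = k \<and> (\<lambda>s'. dinv F E h n x c (ar s 30) (ar s 31) (ar s' 7) (ar s' 8) \<and>
  card {g. g < c \<and> ar s' 8 g \<noteq> 0} = k + 1 \<and> ck s' \<le> ck s + ((100 * R + 500) * c + 100) * (k + 1) + 3) (setv 6 13 (k + 1) s'')"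
 have "wp B select_com (wp B (Wr 8 (V 14) (N 1) ;; relax_com) ?Q) ?s"
 proof (rule wp_conseq[OF wp_select[where n = n and c = c]], goal_cases)
  case (7 s3)
  have sm3: "same {14, 15, 16} {} ?s s3" using 7(2) by (elim same_mono) (auto simp: select_com_def)
  have a3: "ar s3 = ar s'" by (rule ext) (simp add: same_ar[OF sm3])
  define f where "f = vs s3 14"
  have f: "f < c" "ar s' 8 f = 0" "\<And>g. g < c ==> ar s' 8 g = 0 ==> ar s' 7 f \<le> ar s' 7 g" "ck s3 \<le> ck s' + 6 + 100 * c + 50"
   using 7(1) unfolding f_def by auto
  let ?s4 = "seta 8 8 f 1 s3"
  have o3: "online n es h K D s3" by (rule online_same[OF online_cong[OF o1] sm3]) auto
  have o4: "online n es h K D ?s4" by (rule online_cong[OF o3]) auto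
  have "wp B relax_com ?Q ?s4"
  proof (rule wp_conseq[OF wp_relax[OF o4 es h, where X = X and x = x and y = y and c = c and f = f and F = F and R = R]], goal_cases)
   case (17 s5)
   have sm5: "same {16, 17, 18, 19, 20, 21, 22, 23} {7} ?s4 s5" using 17(2) by (elim same_mono) (auto simp: relax_com_def mv_find ma_find)
   have v5: "vs s5 13 = k" "ar s5 8 = (ar s' 8)(f := 1)" using 4(3) by (simp_all add: same_vs[OF sm5] same_ar[OF sm5] same_vs[OF sm3] a3)
   have P: "\<And>g. g < c ==> ar s5 7 g \<le> ar s' 7 g \<and> (ar s5 7 g = ar s' 7 g \<or> ar s' 7 f < ar s5 7 g)" "sound F n x c (ar s 30) (ar s5 7)"
    "\<And>g. g < c ==> feas E h (ar s 30) (ar s 31) (ar s' 7 f) (ar s5 7 g) f g" "ck s5 \<le> ck s3 + 8 + (100 * R + 300) * c + 20"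
    using 17(1) by (simp_all add: a3 v2 E_def)
   have "dinv F E h n x c (ar s 30) (ar s 31) (ar s5 7) ((ar s' 8)(f := 1))"
    by (rule dinv_round[OF di f(1,2)]) (use f(3) P in auto)
   moreover have "card {g. g < c \<and> ((ar s' 8)(f := 1)) g \<noteq> 0} = k + 1"
   proof -
    have "{g. g < c \<and> ((ar s' 8)(f := 1)) g \<noteq> 0} = insert f {g. g < c \<and> ar s' 8 g \<noteq> 0}" using f(1) by auto
    then show ?thesis using ca f(2) by simp
   qed
   moreover have "ck s5 + 6 \<le> ck s + ((100 * R + 500) * c + 100) * (k + 1) + 3" using P(4) f(4) ck by (simp add: algebra_simps)
   ultimately show ?case using v5 by simp
  qed (use nd X xy f dd sub R B v2 in \<open>auto simp: a3 f_def same_vs[OF sm3] E_def\<close>)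
  then show ?case using B(1) by (simp add: f_def)
 qed (use v2 B dd ex in auto)
 then show ?case by simp
next
 case (5 s')
 have di: "dinv F E h n x c (ar s 30) (ar s 31) (ar s' 7) (ar s' 8)" and ca: "card {g. g < c \<and> ar s' 8 g \<noteq> 0} = c" using 5(1) by blast+
 have "{g. g < c \<and> ar s' 8 g \<noteq> 0} = {..<c}"
  by (rule card_subset_eq) (use ca in auto)
 then have all: "ar s' 8 g \<noteq> 0" if "g < c" for g using that by blast
 have "feas E h (ar s 30) (ar s 31) (ar s' 7 f) (ar s' 7 g) f g" if "f < c" "g < c" for f g
  using di all[OF that(1)] that unfolding dinv_def by blast
 moreover have "ar s' 7 0 = 0" "sound F n x c (ar s 30) (ar s' 7)" "\<forall>g<c. ar s' 7 g \<le> 2 * n + 2" using di unfolding dinv_def by blast+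
 ultimately show ?case using 5(1) by simp
qed

text \<open>Correctness combines soundness and completeness at the last node, after removing the
  unit for its artificial edge. The quadratic time in the number \<open>c\<close> of nodes comes
  from Dijkstra's algorithm, the factor \<open>R\<close> from the binary searches.\<close>

lemma wp_query:
 fixes s :: st
 assumes o: "online n es h K D s" and es: "set es \<subseteq> {..<n} \<times> {..<n}" and m: "length es \<le> n * n" and h: "0 < h"
  and v: "vs s 0 = x" "vs s 1 = y" and xy: "x < n" "y < n"
  and R: "K < 2 ^ R" and B: "2 * (n * n) + 4 \<le> B" "4 * n + 4 \<le> B" "K + 1 \<le> B"
 defines "c \<equiv> card ({1..<Max (insert 0 D) + 1} - D) + 2" and "F \<equiv> cur es D"
 shows "wp B query_com (\<lambda>s'. online n es h K D s' \<and>
  (vs s' 1 = 0 \<and> (\<forall>l. (x, y) \<notin> F ^^ l) \<or>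
   vs s' 1 = 1 \<and> (\<exists>l\<le>vs s' 0. (x, y) \<in> F ^^ l) \<and> (\<forall>l. (x, y) \<in> F ^^ l --> h * vs s' 0 \<le> (h + 1) * l)) \<and>
  ck s' \<le> ck s + (100 * R + 1000) * (c * c)) s"
proof -
 define J where "J = Max (insert 0 D)"
 define E where "E = eset es (J + 1)"
 define X where "X = extra es D (J + 1)"
 have l: "links (length es) D (ar s 3) (ar s 4)" using o by (simp add: online_def)
 have D: "D \<subseteq> {1..length es}" using l by (simp add: links_def)
 then have fD: "finite D" by (rule finite_subset) simp
 have Jm: "J \<le> length es" unfolding J_def using D fD by (subst Max_le_iff) auto
 have JD: "d \<le> J" if "d \<in> D" for d unfolding J_def using fD that by simp
 have F: "F = E \<union> X" unfolding F_def E_def X_def by (rule cur_split) (rule JD)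
 have Fn: "F \<subseteq> {..<n} \<times> {..<n}" unfolding F_def cur_def using es nth_mem by blast
 have Xn: "X \<subseteq> {..<n} \<times> {..<n}" using F Fn by blast
 have c2: "2 \<le> c" by (simp add: c_def)
 have cm: "c \<le> length es + 2"
 proof -
  have "card ({1..<J + 1} - D) \<le> card {1..<J + 1}" by (intro card_mono) auto
  then show ?thesis using Jm by (simp add: c_def J_def)
 qed
 let ?P = "\<lambda>s' :: st. (vs s' 1 = 0 \<and> (\<forall>l. (x, y) \<notin> F ^^ l) \<or>
   vs s' 1 = 1 \<and> (\<exists>l\<le>vs s' 0. (x, y) \<in> F ^^ l) \<and> (\<forall>l. (x, y) \<in> F ^^ l --> h * vs s' 0 \<le> (h + 1) * l)) \<and>
  ck s' \<le> ck s + (100 * R + 1000) * (c * c)"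
 let ?fin = "23 ::= Rd 7 (V 11 -. N 1) -. N 1 ;;
   CIf (V 23 <. N 2 *. V vn +. N 1) (0 ::= V 23 ;; 1 ::= N 1) (0 ::= N 0 ;; 1 ::= N 0)"
 let ?rounds = "For 13 (V 11) (select_com ;; Wr 8 (V 14) (N 1) ;; relax_com)"
 have "wp B collect_com (wp B (?rounds ;; ?fin) ?P) s"
 proof (rule wp_conseq[OF wp_collect[OF o es m v xy]], goal_cases)
  case (3 s1)
  have sm1: "same {11, 12} {30, 31, 7, 8} s s1" using 3(2) by (elim same_mono) (auto simp: collect_com_def)
  have o1: "online n es h K D s1" by (rule online_same[OF o sm1]) auto
  have q: "nodes X x y c (ar s1 30) (ar s1 31)" "vs s1 11 = c" "ar s1 7 0 = 0" "\<And>j. 0 < j ==> j < c ==> ar s1 7 j = 2 * n + 2"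
   "\<And>j. j < c ==> ar s1 8 j = 0" "ck s1 \<le> ck s + 300 * c"
   using 3(1) unfolding X_def c_def J_def by auto
  have "wp B ?rounds (wp B ?fin ?P) s1"
  proof (rule wp_conseq[OF wp_rounds[OF o1 es h q(1) Xn xy q(2,3), where F = F and R = R]], goal_cases)
   case (9 s2)
   have sm2: "same ({13..23} \<union> {13}) {7, 8} s1 s2" using 9(2) by (elim same_mono) (auto simp: select_com_def relax_com_def mv_find ma_find)
   have v2: "vs s2 11 = c" "vs s2 vn = n" using q(2) o1 by (simp_all add: same_vs[OF sm2] online_def)
   have dd: "ar s2 7 0 = 0" "sound F n x c (ar s1 30) (ar s2 7)"
    "\<And>f g. f < c ==> g < c ==> feas E h (ar s1 30) (ar s1 31) (ar s2 7 f) (ar s2 7 g) f g" "\<And>g. g < c ==> ar s2 7 g \<le> 2 * n + 2"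
    "ck s2 \<le> ck s1 + ((100 * R + 500) * c + 100) * c + 20" using 9(1) unfolding E_def J_def by blast+
   define z where "z = ar s2 7 (c - 1)"
   have cc: "c - 1 < c" "c - 1 \<noteq> 0" "ar s1 30 (c - 1) = y" using c2 q(1) by (auto simp: nodes_def)
   have comp: "h * (z - 1) \<le> (h + 1) * l" if "(x, y) \<in> F ^^ l" for l
   proof -
    have "h * z \<le> (h + 1) * l + h" unfolding z_def by (rule dijkstra_complete[OF q(1) F dd(1) dd(3) that])
    moreover have "h * (z - 1) = h * z - h" by (simp add: diff_mult_distrib2)
    ultimately show ?thesis by simp
   qed
   have ckk: "ck s2 + 60 \<le> ck s + (100 * R + 1000) * (c * c)"
   proof -
    have "ck s2 \<le> ck s + ((100 * R + 500) * (c * c) + 400 * c + 20)" using dd(5) q(6) by (simp add: algebra_simps)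
    moreover have "c * 2 \<le> c * c" using c2 by (rule mult_le_mono2)
    moreover have "(100 * R + 1000) * (c * c) = (100 * R + 500) * (c * c) + 500 * (c * c)" by (simp add: algebra_simps)
    ultimately show ?thesis using c2 by linarith
   qed
   have zB: "z - 1 \<le> B" using dd(4)[OF cc(1)] B(2) unfolding z_def by linarith
   show ?case
   proof (cases "z - 1 < 2 * n + 1")
    case True
    have "\<exists>l\<le>z - 1. (x, y) \<in> F ^^ l"
    proof (cases "z \<le> 2 * n + 1")
     case True
     then obtain l where "(x, y) \<in> F ^^ l" "l + 1 \<le> z" using dd(2) cc unfolding sound_def z_def by (metis (no_types, lifting))
     then show ?thesis by (intro exI[of _ l]) auto
    qed (use True in auto)
    then show ?thesis using True comp zB ckk B by (simp add: v2 z_def[symmetric])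
   next
    case False
    have "(x, y) \<notin> F ^^ l" for l
    proof
     assume "(x, y) \<in> F ^^ l"
     from walk_short[OF Fn xy(1) this] obtain l where l: "l < n" "(x, y) \<in> F ^^ l" by blast
     \<comment> \<open>A reachable target has a walk of length \<open>l < n\<close>, and
       \<open>h + 1 \<le> 2 * h\<close> then forces a value of at most \<open>2 * n\<close>. A
       larger value therefore proves unreachability.\<close>
     have "h * (2 * n + 1) \<le> h * (z - 1)" using False by simp
     also have "\<dots> \<le> (h + 1) * l" by (rule comp[OF l(2)])
     also have "\<dots> \<le> (2 * h) * n" using h l(1) by (intro mult_le_mono) auto
     finally show False using h by simp
    qed
    then show ?thesis using False comp zB ckk B by (simp add: v2 z_def[symmetric])
   qed
  qed (use q F R B cm m in \<open>auto simp: E_def J_def\<close>)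
  then show ?case by simp
 qed (use B in auto)
 then have "wp B query_com ?P s" unfolding query_com_def by simp
 then show ?thesis
 proof (rule wp_conseq)
  fix s' assume P: "?P s'" and "same (mv query_com) (ma query_com) s s'"
  then have "online n es h K D s'" by (intro online_same[OF o]) (use mv_query ma_query in auto)
  then show "online n es h K D s' \<and> ?P s'" using P by blast
 qed
qed

section \<open>Assembling the algorithm\<close>

subsection \<open>From verified commands to RAM programs\<close>

text \<open>The array numbers are the part of \<open>esyn\<close> that cannot be met by choosing the
  number of variables and the bound on constants large enough.\<close>

fun earr :: "exp => bool" where
 "earr (N k) = True"
| "earr (V x) = True"
| "earr (Bin f a b) = (earr a \<and> earr b)"
| "earr (Rd a e) = (a < 32 \<and> earr e)"
| "earr (Raw e) = earr e"

fun carr :: "com => bool" where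
 "carr CSkip = True"
| "carr (x ::= e) = earr e"
| "carr (Wr a e e') = (a < 32 \<and> earr e \<and> earr e')"
| "carr (c ;; c') = (carr c \<and> carr c')"
| "carr (CIf e c c') = (earr e \<and> carr c \<and> carr c')"
| "carr (CWhile e c) = (earr e \<and> carr c)"

lemma carr_For [simp]: "carr (For x e c) \<longleftrightarrow> earr e \<and> carr c"
 by (auto simp: For_def)

lemma ex_esyn: "earr e ==> \<exists>d. esyn d d e"
proof (induction e)
 case (Bin f a b)
 then obtain d d' where "esyn d d a" "esyn d' d' b" by auto
 then have "esyn (max d d') (max d d') (Bin f a b)" by (auto intro: esyn_mono)
 then show ?case ..
next
 case (V x)
 then show ?case by (intro exI[of _ "x + 1"]) simp
qed auto

lemma ex_csyn: "carr c ==> \<exists>d. csyn d d c"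
proof (induction c)
 case (Assign x e)
 then obtain d where "esyn d d e" using ex_esyn by auto
 then have "csyn (max d (x + 1)) (max d (x + 1)) (x ::= e)" by (auto intro: esyn_mono)
 then show ?case ..
next
 case (Wr a e e')
 then obtain d d' where "esyn d d e" "esyn d' d' e'" using ex_esyn by (meson carr.simps(3))
 then have "csyn (max d d') (max d d') (Wr a e e')" using Wr by (auto intro: esyn_mono)
 then show ?case ..
next
 case (CSeq c c')
 then obtain d d' where "csyn d d c" "csyn d' d' c'" by auto
 then have "csyn (max d d') (max d d') (c ;; c')" by (auto intro: csyn_mono)
 then show ?case ..
next
 case (CIf e c c')
 then obtain d d' d'' where "csyn d d c" "csyn d' d' c'" "esyn d'' d'' e" using ex_esyn by (meson carr.simps(5))
 then have "csyn (max d'' (max d d')) (max d'' (max d d')) (CIf e c c')" by (auto intro: csyn_mono esyn_mono)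
 then show ?case ..
next
 case (CWhile e c)
 then obtain d d'' where "csyn d d c" "esyn d'' d'' e" using ex_esyn by (meson carr.simps(6))
 then have "csyn (max d'' d) (max d'' d) (CWhile e c)" by (auto intro: csyn_mono esyn_mono)
 then show ?case ..
qed auto

lemma carr_simulate: "carr (simulate P)"
 by (induction P) (auto simp: One_nat_def)

lemma carr_matmul: "carr (matmul_com P)"
proof -
 have "carr (clear_regs r)" for r by (induction r) auto
 then show ?thesis by (simp add: matmul_com_def carr_simulate)
qed

lemma carr_naive: "carr naive_com"
 by (simp add: naive_com_def)

lemma carr_pre: "carr mm ==> carr (pre_com mm h q)"
proof -
 assume mm: "carr mm"
 have "carr (qpow_com q)" by (induction q) auto
 then show ?thesis using mm by (simp add: matmul_com_def naive_com_def memset_def count_com_def prefix_com_def place_com_def sort_com_def append_com_def build_com_def mark_com_def mid_if_def mid_com_def scan_com_def fin_if_def fin_com_def part_com_def core_step_def core_com_def copyin_com_def copyout_com_def half_com_def prod_com_def levels_step_def levels_com_def read_com_def diag_com_def links_com_def pre_com_def delete_com_def find_com_def collect_com_def select_com_def relax_com_def query_com_def)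
qed

lemma carr_online: "carr delete_com" "carr query_com"
 by (simp_all add: delete_com_def query_com_def collect_com_def select_com_def relax_com_def find_com_def)

lemma run_wp:
 assumes "wp B c Q s" "csyn d B c" "rel d s \<sigma>" "bnd d B s" "64 \<le> B" "B ^ width c < W"
 obtains s' t \<sigma>' where "Q s'" "run W (compc d c) \<sigma> t \<sigma>'" "rel d s' \<sigma>'" "bnd d B s'" "ck s' = ck s + t"
proof -
 obtain s' where s': "bs B c s s'" "Q s'" using assms(1) unfolding wp_def by blast
 from run_comp[OF s'(1) assms(2-6)] obtain \<sigma>' where
  "ck s \<le> ck s'" "run W (compc d c) \<sigma> (ck s' - ck s) \<sigma>'" "rel d s' \<sigma>'" "bnd d B s'" by blast
 then show thesis using that[of s' "ck s' - ck s" \<sigma>'] s'(2) by simp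
qed

subsection \<open>Distances\<close>

lemma awalk_relpow:
 assumes "set p \<subseteq> E" "wf_digraph (with_proj \<lparr>pverts = {..<n}, parcs = E\<rparr>)"
 shows "pre_digraph.cas (with_proj \<lparr>pverts = {..<n}, parcs = E\<rparr>) s p t ==> (s, t) \<in> E ^^ length p"
 using assms(1)
proof (induction p arbitrary: s)
 case Nil
 then show ?case by (simp add: pre_digraph.cas.simps)
next
 case (Cons e p)
 then have e: "fst e = s" "pre_digraph.cas (with_proj \<lparr>pverts = {..<n}, parcs = E\<rparr>) (snd e) p t" by (simp_all add: pre_digraph.cas.simps)
 then have "(snd e, t) \<in> E ^^ length p" using Cons by simp
 moreover have "(s, snd e) \<in> E" using Cons.prems(2) e(1) by (cases e) auto
 ultimately show ?case by (simp add: relpow_commute) (metis relcomp.relcompI relpow_commute)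
qed

lemma relpow_awalk:
 "(s, t) \<in> E ^^ l ==> \<exists>p. length p = l \<and> set p \<subseteq> E \<and> pre_digraph.cas (with_proj \<lparr>pverts = {..<n}, parcs = E\<rparr>) s p t"
proof (induction l arbitrary: s)
 case 0
 then show ?case by (intro exI[of _ "[]"]) (simp add: pre_digraph.cas.simps)
next
 case (Suc l)
 then obtain u where u: "(s, u) \<in> E" "(u, t) \<in> E ^^ l" by (meson relpow_Suc_D2)
 from Suc.IH[OF u(2)] obtain p where "length p = l" "set p \<subseteq> E" "pre_digraph.cas (with_proj \<lparr>pverts = {..<n}, parcs = E\<rparr>) u p t" by blast
 then show ?case using u(1) by (intro exI[of _ "(s, u) # p"]) (simp add: pre_digraph.cas.simps)
qed

lemma wf_pair: "E \<subseteq> {..<n} \<times> {..<n} ==> wf_digraph (with_proj \<lparr>pverts = {..<n}, parcs = E\<rparr>)"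
 by unfold_locales auto

lemma cost_one:
 fixes G :: "('a, 'b) pre_digraph" and p :: "'b list"
 assumes "wf_digraph G"
 shows "wf_digraph.awalk_cost (\<lambda>_. 1) p = real (length p)"
 by (induction p) (simp_all add: wf_digraph.awalk_cost_Nil[OF assms] wf_digraph.awalk_cost_Cons[OF assms])

lemma dist_in_ge:
 assumes E: "E \<subseteq> {..<n} \<times> {..<n}" and x: "\<And>l. (s, t) \<in> E ^^ l ==> x \<le> ereal (real l)"
 shows "x \<le> dist_in n E s t"
 unfolding dist_in_def wf_digraph.\<mu>_def[OF wf_pair[OF E]]
proof (rule INF_greatest)
 fix p assume "p \<in> {p. pre_digraph.awalk (with_proj \<lparr>pverts = {..<n}, parcs = E\<rparr>) s p t}"
 then have "(s, t) \<in> E ^^ length p"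
  by (intro awalk_relpow[OF _ wf_pair[OF E]]) (auto simp: pre_digraph.awalk_def)
 then show "x \<le> ereal (wf_digraph.awalk_cost (\<lambda>_. 1) p)" using x cost_one[OF wf_pair[OF E], of p] by simp
qed

lemma dist_in_le:
 assumes E: "E \<subseteq> {..<n} \<times> {..<n}" and s: "s < n" and w: "(s, t) \<in> E ^^ l"
 shows "dist_in n E s t \<le> ereal (real l)"
proof -
 obtain p where p: "length p = l" "set p \<subseteq> E" "pre_digraph.cas (with_proj \<lparr>pverts = {..<n}, parcs = E\<rparr>) s p t"
  using relpow_awalk[OF w] by blast
 have "pre_digraph.awalk (with_proj \<lparr>pverts = {..<n}, parcs = E\<rparr>) s p t" using p s by (simp add: pre_digraph.awalk_def)
 then show ?thesis unfolding dist_in_def wf_digraph.\<mu>_def[OF wf_pair[OF E]]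
  by (intro INF_lower2[of p]) (use cost_one[OF wf_pair[OF E], of p] p(1) in auto)
qed

subsection \<open>The error measure\<close>

definition Dset :: "edge list => edge list => nat set" where
 "Dset es dl = {i + 1 | i. i < length es \<and> es ! i \<in> set dl}"

lemma cur_Dset: "cur es (Dset es dl) = set es - set dl"
proof -
 have "i + 1 \<in> Dset es dl \<longleftrightarrow> es ! i \<in> set dl" if "i < length es" for i using that by (auto simp: Dset_def)
 then have "cur es (Dset es dl) = {es ! i | i. i < length es \<and> es ! i \<notin> set dl}" unfolding cur_def by blast
 also have "\<dots> = set es - set dl" unfolding set_conv_nth[of es] by blast
 finally show ?thesis .
qed

lemma Dset_snoc: "distinct es ==> i < length es ==> Dset es (dl @ [es ! i]) = insert (i + 1) (Dset es dl)"
 unfolding Dset_def by (auto simp: nth_eq_iff_index_eq)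

lemma Dset_sub: "Dset es dl \<subseteq> {1..length es}" "finite (Dset es dl)"
proof -
 show "Dset es dl \<subseteq> {1..length es}" unfolding Dset_def by auto
 then show "finite (Dset es dl)" by (rule finite_subset) simp
qed

text \<open>The number of nodes of the auxiliary graph: the undeleted positions up to the largest
  deleted one, and the two end points of the query.\<close>

definition size_c :: "edge list => edge list => nat" where
 "size_c es dl = card ({1..<Max (insert 0 (Dset es dl)) + 1} - Dset es dl) + 2"

lemma card_Dset:
 assumes "distinct es" "distinct dl" "set dl \<subseteq> set es"
 shows "card (Dset es dl) = length dl"
proof -
 have "bij_betw (\<lambda>i. es ! (i - 1)) (Dset es dl) (set dl)"
  unfolding bij_betw_def
 proof
  show "inj_on (\<lambda>i. es ! (i - 1)) (Dset es dl)"
   using assms(1) by (intro inj_onI) (auto simp: Dset_def nth_eq_iff_index_eq)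
  show "(\<lambda>i. es ! (i - 1)) ` Dset es dl = set dl"
  proof (intro equalityI subsetI)
   fix e assume e: "e \<in> set dl"
   then obtain i where i: "i < length es" "es ! i = e" using assms(3) by (metis in_set_conv_nth subsetD)
   then have "i + 1 \<in> Dset es dl" using e by (auto simp: Dset_def)
   moreover have "es ! (i + 1 - 1) = e" using i by simp
   ultimately show "e \<in> (\<lambda>i. es ! (i - 1)) ` Dset es dl" by (metis imageI)
  qed (auto simp: Dset_def)
 qed
 then have "card (Dset es dl) = card (set dl)" by (rule bij_betw_same_card)
 then show ?thesis using assms(2) by (simp add: distinct_card)
qed

text \<open>The least admissible \<open>j\<close> is \<open>J + 1\<close> for the largest predicted
  position \<open>J\<close> of a deleted edge. All \<open>i\<close> deleted positions lie in
  \<open>{1..J}\<close>, so exactly \<open>J - i\<close> positions there are undeleted. The edge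
  predicted at \<open>J\<close> was in fact deleted at time \<open>i\<close> or earlier, so its own
  error is at least \<open>J - i\<close>.\<close>

lemma eta_bar_eq:
 assumes d: "distinct es'" "distinct es" "set es \<subseteq> set es'" and i: "i \<le> length es"
 shows "eta_bar es' es i = int (Max (insert 0 (Dset es' (take i es)))) - int i"
  and "int (size_c es' (take i es)) = eta_bar es' es i + 2" and "eta_bar es' es i \<le> eta_inf es' es" and "0 \<le> eta_bar es' es i"
proof -
 define D where "D = Dset es' (take i es)"
 define J where "J = Max (insert 0 D)"
 have fD: "finite D" and sD: "D \<subseteq> {1..length es'}" unfolding D_def by (rule Dset_sub)+
 have JD: "d \<le> J" if "d \<in> D" for d unfolding J_def using fD that by simp
 have Jin: "J = 0 \<or> J \<in> D" unfolding J_def using Max_in[of "insert 0 D"] fD by auto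
 have disj: "set (drop (j - 1) es') \<inter> set (take i es) = {} \<longleftrightarrow> J < j" if "1 \<le> j" for j
 proof
  assume e: "set (drop (j - 1) es') \<inter> set (take i es) = {}"
  show "J < j"
  proof (rule ccontr)
   assume "\<not> J < j"
   then have "J \<in> D" "j \<le> J" using Jin that by auto
   then obtain k where k: "J = k + 1" "k < length es'" "es' ! k \<in> set (take i es)" unfolding D_def Dset_def by auto
   have "es' ! k = drop (j - 1) es' ! (k - (j - 1))" "k - (j - 1) < length (drop (j - 1) es')" using k \<open>j \<le> J\<close> that by auto
   then have "es' ! k \<in> set (drop (j - 1) es')" by (metis nth_mem)
   then show False using e k(3) by blast
  qed
 next
  assume J: "J < j"
  show "set (drop (j - 1) es') \<inter> set (take i es) = {}"
  proof (rule ccontr)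
   assume "set (drop (j - 1) es') \<inter> set (take i es) \<noteq> {}"
   then obtain e where e: "e \<in> set (drop (j - 1) es')" "e \<in> set (take i es)" by blast
   then obtain k where k: "k < length (drop (j - 1) es')" "drop (j - 1) es' ! k = e" by (meson in_set_conv_nth)
   then have "j - 1 + k < length es'" "es' ! (j - 1 + k) = e" by auto
   then have "j - 1 + k + 1 \<in> D" unfolding D_def Dset_def using e(2) by blast
   then show False using JD[of "j - 1 + k + 1"] J that by simp
  qed
 qed
 have L: "(LEAST j. 1 \<le> j \<and> set (drop (j - 1) es') \<inter> set (take i es) = {}) = J + 1"
 proof (rule Least_equality)
  show "1 \<le> J + 1 \<and> set (drop (J + 1 - 1) es') \<inter> set (take i es) = {}" using disj[of "J + 1"] by simp
  show "J + 1 \<le> j" if "1 \<le> j \<and> set (drop (j - 1) es') \<inter> set (take i es) = {}" for j using disj[of j] that by simp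
 qed
 show eb: "eta_bar es' es i = int (Max (insert 0 (Dset es' (take i es)))) - int i"
  unfolding eta_bar_def L J_def D_def by simp
 have cD: "card D = i" unfolding D_def using card_Dset[OF d(1), of "take i es"] d i by (auto dest: in_set_takeD)
 have DJ: "D \<subseteq> {1..<J + 1}" using JD sD by (force simp: less_plus1_le)
 have "card ({1..<J + 1} - D) = J - i" using card_Diff_subset[OF fD DJ] cD by simp
 moreover have iJ: "i \<le> J" using card_mono[OF _ DJ] cD by simp
 ultimately show "int (size_c es' (take i es)) = eta_bar es' es i + 2" unfolding size_c_def eb D_def[symmetric] J_def[symmetric] by simp
 show "0 \<le> eta_bar es' es i" using iJ unfolding eb D_def[symmetric] J_def[symmetric] by simp
 have fin: "finite (insert 0 ((\<lambda>e. \<bar>int (pos es e) - int (pos es' e)\<bar>) ` set es))" by simp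
 show "eta_bar es' es i \<le> eta_inf es' es"
 proof (cases "J = 0")
  case True
  then have "eta_bar es' es i \<le> 0" unfolding eb D_def[symmetric] J_def[symmetric] by simp
  also have "0 \<le> eta_inf es' es" unfolding eta_inf_def using fin by (rule Max_ge) simp
  finally show ?thesis .
 next
  case False
  then have "J \<in> D" using Jin by simp
  then obtain k where k: "J = k + 1" "k < length es'" "es' ! k \<in> set (take i es)" unfolding D_def Dset_def by auto
  define e where "e = es' ! k"
  obtain k' where k': "k' < i" "k' < length es" "es ! k' = e" using k(3) unfolding e_def in_set_conv_nth by auto
  have "pos es' e = k + 1" unfolding pos_def
  proof (rule the_equality)
   fix j assume "1 \<le> j \<and> j \<le> length es' \<and> es' ! (j - 1) = e"
   then show "j = k + 1" using nth_eq_iff_index_eq[OF d(1), of "j - 1" k] k(2) unfolding e_def by auto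
  qed (use k in \<open>auto simp: e_def\<close>)
  moreover have "pos es e = k' + 1" unfolding pos_def
  proof (rule the_equality)
   fix j assume "1 \<le> j \<and> j \<le> length es \<and> es ! (j - 1) = e"
   then have j: "j - 1 < length es" "es ! (j - 1) = es ! k'" "1 \<le> j" using k'(3) by auto
   then have "j - 1 = k'" using nth_eq_iff_index_eq[OF d(2) j(1) k'(2)] by blast
   then show "j = k' + 1" using j(3) by simp
  qed (use k' in auto)
  ultimately have "int J - int i \<le> \<bar>int (pos es e) - int (pos es' e)\<bar>" using k(1) k'(1) by simp
  also have "\<dots> \<le> eta_inf es' es" unfolding eta_inf_def using fin by (rule Max_ge) (use k' nth_mem in auto)
  finally show ?thesis unfolding eb D_def[symmetric] J_def[symmetric] .
 qed
qed

subsection \<open>Serving the requests\<close>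

definition good :: "edge list => nat => nat => edge list => nat => nat => nat \<times> ram => bool" where
 "good es h R dl x y p \<longleftrightarrow> fst p \<le> (100 * R + 1000) * (size_c es dl * size_c es dl) \<and>
  (regs (snd p) 1 = 0 \<and> (\<forall>l. (x, y) \<notin> (set es - set dl) ^^ l) \<or>
   regs (snd p) 1 = 1 \<and> (\<exists>l\<le>regs (snd p) 0. (x, y) \<in> (set es - set dl) ^^ l) \<and>
    (\<forall>l. (x, y) \<in> (set es - set dl) ^^ l --> h * regs (snd p) 0 \<le> (h + 1) * l))"

lemma args_rel:
 assumes "rel d s \<sigma>" "bnd d B s" "x \<le> B" "y \<le> B" "online n es h K D s"
 shows "rel d (s\<lparr>vs := (vs s)(0 := x, 1 := y)\<rparr>) (set_args x y \<sigma>)" "bnd d B (s\<lparr>vs := (vs s)(0 := x, 1 := y)\<rparr>)"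
  "online n es h K D (s\<lparr>vs := (vs s)(0 := x, 1 := y)\<rparr>)"
proof -
 show "rel d (s\<lparr>vs := (vs s)(0 := x, 1 := y)\<rparr>) (set_args x y \<sigma>)" using assms(1) by (auto simp: rel_def set_args_def)
 show "bnd d B (s\<lparr>vs := (vs s)(0 := x, 1 := y)\<rparr>)" using assms(2-4) by (auto simp: bnd_def)
 show "online n es h K D (s\<lparr>vs := (vs s)(0 := x, 1 := y)\<rparr>)" by (rule online_cong[OF assms(5)]) auto
qed

text \<open>Induction over the requests, with \<open>dl\<close> the edges deleted so far. Both
  handlers restore \<open>online\<close> and the relation to the machine, so every request meets the
  state that its specification expects. The bound for a query refers to the deletions before
  it.\<close>

lemma serve_online:
 assumes A: "delete A = compc d delete_com" "answer A = compc d query_com"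
  and syn: "csyn d B delete_com" "csyn d B query_com" "2 \<le> d" and W: "B ^ width delete_com < W" "B ^ width query_com < W"
  and B: "64 \<le> B" "2 * (n * n) + 4 \<le> B" "4 * n + 4 \<le> B" "K + 1 \<le> B" and R: "K < 2 ^ R" and h: "0 < h"
  and es: "distinct es" "set es \<subseteq> {..<n} \<times> {..<n}" "length es \<le> n * n"
 shows "online n es h K (Dset es dl) s ==> rel d s \<sigma> ==> bnd d B s ==> distinct (dl @ deletions rs) ==> set (deletions rs) \<subseteq> set es ==>
  (\<forall>x y. Query x y \<in> set rs --> x < n \<and> y < n) ==>
  \<exists>tr. serve W A \<sigma> rs tr \<and> (\<forall>k<length rs. case rs ! k of Delete e => fst (tr ! k) \<le> 200
   | Query x y => good es h R (dl @ deletions (take k rs)) x y (tr ! k))"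
proof (induction rs arbitrary: dl s \<sigma>)
 case Nil
 then show ?case by (intro exI[of _ "[]"]) (simp add: serve.Nil)
next
 case (Cons r rs)
 show ?case
 proof (cases r)
  case (Delete e)
  then have "e \<in> set es" using Cons.prems(5) by simp
  then obtain i where i: "i < length es" "es ! i = e" by (meson in_set_conv_nth)
  have "e \<in> {..<n} \<times> {..<n}" using \<open>e \<in> set es\<close> es(2) by blast
  then have eB: "fst e \<le> B" "snd e \<le> B" using B(3) by (auto simp: mem_Times_iff)
  let ?s = "s\<lparr>vs := (vs s)(0 := fst e, 1 := snd e)\<rparr>"
  note ar = args_rel[OF Cons.prems(2,3) eB Cons.prems(1)]
  have ni: "i + 1 \<notin> Dset es dl"
  proof
   assume "i + 1 \<in> Dset es dl"
   then have "e \<in> set dl" using i(2) by (auto simp: Dset_def)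
   then show False using Cons.prems(4) Delete by simp
  qed
  have "wp B delete_com (\<lambda>s'. online n es h K (insert (i + 1) (Dset es dl)) s' \<and> ck s' \<le> ck ?s + 200) ?s"
   by (rule wp_delete[OF ar(3)]) (use i ni es B in auto)
  then obtain s' t \<sigma>' where s': "online n es h K (insert (i + 1) (Dset es dl)) s' \<and> ck s' \<le> ck ?s + 200"
   "run W (compc d delete_com) (set_args (fst e) (snd e) \<sigma>) t \<sigma>'" "rel d s' \<sigma>'" "bnd d B s'" "ck s' = ck ?s + t"
   by (rule run_wp[OF _ syn(1) ar(1,2) B(1) W(1)])
  have "insert (i + 1) (Dset es dl) = Dset es (dl @ [e])" using Dset_snoc[OF es(1) i(1), of dl] i(2) by simp
  then have "\<exists>tr. serve W A \<sigma>' rs tr \<and> (\<forall>k<length rs. case rs ! k of Delete e => fst (tr ! k) \<le> 200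
   | Query x y => good es h R ((dl @ [e]) @ deletions (take k rs)) x y (tr ! k))"
   by (intro Cons.IH[of "dl @ [e]" s']) (use s' Cons.prems Delete in auto)
  then obtain tr where tr: "serve W A \<sigma>' rs tr" "\<forall>k<length rs. case rs ! k of Delete e => fst (tr ! k) \<le> 200
   | Query x y => good es h R ((dl @ [e]) @ deletions (take k rs)) x y (tr ! k)" by blast
  have "serve W A \<sigma> (r # rs) ((t, \<sigma>') # tr)" by (rule serve.Cons[OF _ tr(1)]) (use Delete s'(2) A in simp)
  moreover have "case (r # rs) ! k of Delete e => fst (((t, \<sigma>') # tr) ! k) \<le> 200
   | Query x y => good es h R (dl @ deletions (take k (r # rs))) x y (((t, \<sigma>') # tr) ! k)" if "k < length (r # rs)" for k
  proof (cases k)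
   case 0
   then show ?thesis using Delete s' by simp
  next
   case (Suc j)
   have "j < length rs" using that Suc by simp
   from tr(2)[rule_format, OF this] show ?thesis unfolding Suc by (simp add: Delete split: request.splits)
  qed
  ultimately show ?thesis by blast
 next
  case (Query x y)
  then have xy: "x < n" "y < n" using Cons.prems(6) by auto
  then have xB: "x \<le> B" "y \<le> B" using B(3) by auto
  let ?s = "s\<lparr>vs := (vs s)(0 := x, 1 := y)\<rparr>"
  note ar = args_rel[OF Cons.prems(2,3) xB Cons.prems(1)]
  define P where "P = (\<lambda>s'. online n es h K (Dset es dl) s' \<and>
   (vs s' 1 = 0 \<and> (\<forall>l. (x, y) \<notin> (set es - set dl) ^^ l) \<or>
    vs s' 1 = 1 \<and> (\<exists>l\<le>vs s' 0. (x, y) \<in> (set es - set dl) ^^ l) \<and> (\<forall>l. (x, y) \<in> (set es - set dl) ^^ l --> h * vs s' 0 \<le> (h + 1) * l)) \<and>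
   ck s' \<le> ck ?s + (100 * R + 1000) * (size_c es dl * size_c es dl))"
  have "wp B query_com P ?s" unfolding P_def size_c_def cur_Dset[symmetric]
   by (rule wp_query[OF ar(3)]) (use xy es B h R in auto)
  then obtain s' t \<sigma>' where s': "P s'"
   "run W (compc d query_com) (set_args x y \<sigma>) t \<sigma>'" "rel d s' \<sigma>'" "bnd d B s'" "ck s' = ck ?s + t"
   by (rule run_wp[OF _ syn(2) ar(1,2) B(1) W(2)])
  have rg: "regs \<sigma>' 0 = vs s' 0" "regs \<sigma>' 1 = vs s' 1" using s'(3) syn(3) by (auto simp: rel_def)
  have g: "good es h R dl x y (t, \<sigma>')" using s'(1,5) unfolding P_def good_def by (simp add: rg)
  have "\<exists>tr. serve W A \<sigma>' rs tr \<and> (\<forall>k<length rs. case rs ! k of Delete e => fst (tr ! k) \<le> 200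
   | Query x y => good es h R (dl @ deletions (take k rs)) x y (tr ! k))"
   by (intro Cons.IH[of dl s']) (use s' Cons.prems Query in \<open>auto simp: P_def\<close>)
  then obtain tr where tr: "serve W A \<sigma>' rs tr" "\<forall>k<length rs. case rs ! k of Delete e => fst (tr ! k) \<le> 200
   | Query x y => good es h R (dl @ deletions (take k rs)) x y (tr ! k)" by blast
  have "serve W A \<sigma> (r # rs) ((t, \<sigma>') # tr)" by (rule serve.Cons[OF _ tr(1)]) (use Query s'(2) A in simp)
  moreover have "case (r # rs) ! k of Delete e => fst (((t, \<sigma>') # tr) ! k) \<le> 200
   | Query x y => good es h R (dl @ deletions (take k (r # rs))) x y (((t, \<sigma>') # tr) ! k)" if "k < length (r # rs)" for k
  proof (cases k)
   case 0
   then show ?thesis using Query g by simp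
  next
   case (Suc j)
   have "j < length rs" using that Suc by simp
   from tr(2)[rule_format, OF this] show ?thesis unfolding Suc by (simp add: Query split: request.splits)
  qed
  ultimately show ?thesis by blast
 qed
qed

subsection \<open>Asymptotics\<close>

text \<open>Three exponents are added: \<open>b1\<close> absorbs the constant, \<open>b2\<close> the
  real exponent and \<open>b3\<close> the finitely many exceptional arguments. The base
  \<open>n + 2\<close> is at least 2 even for \<open>n = 0\<close>.\<close>

lemma bigo_bound:
 fixes f :: "nat => nat"
 assumes "(\<lambda>n. real (f n)) \<in> O(\<lambda>n. real n powr a)"
 shows "\<exists>b. \<forall>n. f n \<le> (n + 2) ^ b"
proof -
 obtain c where c: "c > 0" "eventually (\<lambda>n. norm (real (f n)) \<le> c * norm (real n powr a)) at_top"
  using landau_o.bigE[OF assms] by blast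
 then obtain N0 where N0: "\<And>n. n \<ge> N0 ==> real (f n) \<le> c * real n powr a" unfolding eventually_at_top_linorder by auto
 obtain b1 where b1: "c \<le> 2 ^ b1" using real_arch_pow[of 2 c] by (auto intro: less_imp_le)
 define b2 where "b2 = nat \<lceil>\<bar>a\<bar>\<rceil>"
 define b3 where "b3 = (\<Sum>n<N0. f n)"
 have p2: "k \<le> 2 ^ k" for k :: nat using less_exp[of k] by simp
 have "f n \<le> (n + 2) ^ (b1 + b2 + b3)" for n
 proof (cases "n < N0")
  case True
  have "f n \<le> b3" unfolding b3_def by (rule member_le_sum) (use True in auto)
  also have "\<dots> \<le> 2 ^ b3" by (rule p2)
  also have "\<dots> \<le> (n + 2) ^ b3" by (rule power_mono) auto
  also have "\<dots> \<le> (n + 2) ^ (b1 + b2 + b3)" by (rule power_increasing) auto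
  finally show ?thesis .
 next
  case False
  have "real n powr a \<le> (real n + 2) ^ b2"
  proof (cases "n = 0")
   case False
   have "real n powr a \<le> real n powr real b2" using False by (intro powr_mono) (auto simp: b2_def, linarith)
   also have "\<dots> = real n ^ b2" using False by (simp add: powr_realpow)
   also have "\<dots> \<le> (real n + 2) ^ b2" by (intro power_mono) auto
   finally show ?thesis .
  qed auto
  moreover have "c \<le> (real n + 2) ^ b1"
  proof -
   have "(2::real) ^ b1 \<le> (real n + 2) ^ b1" by (intro power_mono) auto
   then show ?thesis using b1 by linarith
  qed
  ultimately have "c * real n powr a \<le> (real n + 2) ^ b1 * (real n + 2) ^ b2" using c(1) by (intro mult_mono) auto
  then have "real (f n) \<le> (real n + 2) ^ (b1 + b2)" using N0[of n] False by (simp add: power_add)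
  also have "\<dots> \<le> (real n + 2) ^ (b1 + b2 + b3)" by (intro power_increasing) auto
  also have "\<dots> = real ((n + 2) ^ (b1 + b2 + b3))" by (simp add: add.commute)
  finally show ?thesis by (simp only: of_nat_le_iff)
 qed
 then show ?thesis by blast
qed

section \<open>Polynomial bounds for words, and the choice of the multiplication procedure\<close>

definition polyb :: "(nat => nat) => bool" where
 "polyb f \<longleftrightarrow> (\<exists>b. \<forall>n. f n \<le> (n + 2) ^ b)"

lemma polyb_const: "polyb (\<lambda>_. k)"
 unfolding polyb_def
proof (intro exI allI)
 fix n
 have "k \<le> 2 ^ k" using less_exp[of k] by simp
 also have "\<dots> \<le> (n + 2) ^ k" by (rule power_mono) auto
 finally show "k \<le> (n + 2) ^ k" .
qed

lemma polyb_id: "polyb (\<lambda>n. n)"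
 unfolding polyb_def by (intro exI[of _ 1]) simp

lemma polyb_add: "polyb f ==> polyb g ==> polyb (\<lambda>n. f n + g n)"
proof -
 assume "polyb f" "polyb g"
 then obtain b c where bc: "\<And>n. f n \<le> (n + 2) ^ b" "\<And>n. g n \<le> (n + 2) ^ c" unfolding polyb_def by blast
 have "f n + g n \<le> (n + 2) ^ (b + c + 1)" for n
 proof -
  have "(n + 2) ^ b \<le> (n + 2) ^ (b + c)" "(n + 2) ^ c \<le> (n + 2) ^ (b + c)" by (intro power_increasing; simp)+
  then have "f n + g n \<le> 2 * (n + 2) ^ (b + c)" using bc[of n] by linarith
  also have "\<dots> \<le> (n + 2) * (n + 2) ^ (b + c)" by (intro mult_le_mono1) simp
  also have "\<dots> = (n + 2) ^ (b + c + 1)" by (simp add: power_add)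
  finally show ?thesis .
 qed
 then show ?thesis unfolding polyb_def by blast
qed

lemma polyb_mult: "polyb f ==> polyb g ==> polyb (\<lambda>n. f n * g n)"
proof -
 assume "polyb f" "polyb g"
 then obtain b c where bc: "\<And>n. f n \<le> (n + 2) ^ b" "\<And>n. g n \<le> (n + 2) ^ c" unfolding polyb_def by blast
 then have "f n * g n \<le> (n + 2) ^ (b + c)" for n using mult_le_mono[OF bc(1)[of n] bc(2)[of n]] by (simp add: power_add)
 then show ?thesis unfolding polyb_def by blast
qed

lemma polyb_power: "polyb f ==> polyb (\<lambda>n. f n ^ q)"
 by (induction q) (auto intro: polyb_const polyb_mult)

text \<open>The product of two all-one matrices has \<open>n * n\<close> nonzero entries at
  addresses that are zero in the input, and a time unit writes at most one cell.\<close>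

lemma matmul_exponent_ge_2:
 assumes "matmul_time \<omega>"
 shows "2 \<le> \<omega>"
proof -
 obtain P c and T :: "nat => real" where PT: "T \<in> O(\<lambda>N. real N powr \<omega>) \<and>
   (\<forall>N A B. (\<forall>i<N. \<forall>j<N. A i j < capacity 1 N \<and> B i j < capacity 1 N) -->
    (\<exists>t \<sigma>. run (capacity c N) P (matmul_input N A B) t \<sigma> \<and> real t \<le> T N \<and>
     (\<forall>i<N. \<forall>j<N. mem \<sigma> (2 * N\<^sup>2 + i * N + j) = (\<Sum>l<N. A i l * B l j))))"
  using assms[unfolded matmul_time_def, THEN spec, of 1] by (elim exE) (rule that)
 note T = PT[THEN conjunct1] and P = PT[THEN conjunct2, THEN spec, THEN spec, THEN spec, THEN mp]
 have le: "real n powr 2 \<le> T n" if n: "1 \<le> n" for n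
 proof -
  obtain t \<sigma> where r: "run (capacity c n) P (matmul_input n (\<lambda>_ _. 1) (\<lambda>_ _. 1)) t \<sigma>" "real t \<le> T n"
   "\<forall>i<n. \<forall>j<n. mem \<sigma> (2 * n\<^sup>2 + i * n + j) = (\<Sum>l<n. 1 * 1)"
   using P[of n "\<lambda>_ _. 1" "\<lambda>_ _. 1"] by (auto simp: capacity_def)
  let ?X = "{x. mem \<sigma> x \<noteq> mem (matmul_input n (\<lambda>_ _. 1) (\<lambda>_ _. 1)) x}"
  have "(\<lambda>y. 2 * n\<^sup>2 + y) ` {..<n * n} \<subseteq> ?X"
  proof
   fix x assume "x \<in> (\<lambda>y. 2 * n\<^sup>2 + y) ` {..<n * n}"
   then obtain y where y: "y < n * n" "x = 2 * n\<^sup>2 + y" by auto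
   have "y div n < n" "y mod n < n" "y div n * n + y mod n = y" using y(1) n by (auto simp: less_mult_imp_div_less)
   then have "mem \<sigma> x = n" using r(3)[rule_format, of "y div n" "y mod n"] y(2) by (simp add: add.assoc)
   moreover have "mem (matmul_input n (\<lambda>_ _. 1) (\<lambda>_ _. 1)) x = 0" unfolding matmul_input_def y(2) by simp
   ultimately show "x \<in> ?X" using n by simp
  qed
  moreover have "finite ?X" "card ?X \<le> t" using run_mem_changed[OF r(1)] by auto
  ultimately have "card ((\<lambda>y. 2 * n\<^sup>2 + y) ` {..<n * n}) \<le> t" using card_mono le_trans by blast
  then have "n * n \<le> t" by (simp add: card_image)
  then have "real n * real n \<le> T n" using r(2) by (metis of_nat_le_iff of_nat_mult order_trans)
  then show ?thesis using n by (simp add: powr_numeral power2_eq_square)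
 qed
 have "(\<lambda>n. real n powr 2) \<in> O(T)"
  by (rule landau_o.big_mono) (use eventually_ge_at_top[of 1] in eventually_elim, use le in \<open>force intro: order_trans[OF _ abs_ge_self]\<close>)
 then have "(\<lambda>n. real n powr 2) \<in> O(\<lambda>n. real n powr \<omega>)" using T by (rule landau_o.big_trans)
 moreover have "filterlim (\<lambda>n::nat. real n) at_top at_top" by (rule filterlim_real_sequentially)
 ultimately show ?thesis using powr_bigo_iff[of "\<lambda>n::nat. real n" at_top 2 \<omega>] by simp
qed

lemma bigo_double:
 fixes T :: "nat => real"
 assumes "T \<in> O(\<lambda>N. real N powr w)"
 shows "(\<lambda>n. T (2 * n)) \<in> O(\<lambda>n. real n powr w)"
proof -
 have "filterlim (\<lambda>n::nat. 2 * n) at_top at_top" by (rule filterlim_subseq) (simp add: strict_mono_def)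
 from landau_o.big.compose[OF assms this] have "(\<lambda>n. T (2 * n)) \<in> O(\<lambda>n. real (2 * n) powr w)" .
 also have "(\<lambda>n. real (2 * n) powr w) \<in> O(\<lambda>n. real n powr w)"
  by (rule landau_o.bigI[of "2 powr w"]) (auto simp: powr_mult)
 finally show ?thesis .
qed

text \<open>Matrices with entries 0 and 1 already fit into \<open>capacity 1\<close>. Capping the
  exponent at 3 by naive multiplication ensures that \<open>(3 - w) / 2\<close> is nonnegative, so a
  product never costs more than the target bound.\<close>

lemma mm_package:
 assumes "matmul_time \<omega>"
 obtains mm w C q b and \<tau> :: "nat => nat" where "carr mm" "2 \<le> w" "w \<le> \<omega>" "w \<le> 3" "(\<lambda>n. real (\<tau> n)) \<in> O(\<lambda>n. real n powr w)"
  "4 \<le> q" "\<And>n B. (n + 2) ^ b \<le> B ==> mm_spec C mm (2 * n) B ((2 * n + 2) ^ q) (\<tau> n)"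
proof (cases "\<omega> \<le> 3")
 case True
 obtain P c and T :: "nat => real" where PT: "T \<in> O(\<lambda>N. real N powr \<omega>) \<and>
   (\<forall>N A B. (\<forall>i<N. \<forall>j<N. A i j < capacity 1 N \<and> B i j < capacity 1 N) -->
    (\<exists>t \<sigma>. run (capacity c N) P (matmul_input N A B) t \<sigma> \<and> real t \<le> T N \<and>
     (\<forall>i<N. \<forall>j<N. mem \<sigma> (2 * N\<^sup>2 + i * N + j) = (\<Sum>l<N. A i l * B l j))))"
  using assms[unfolded matmul_time_def, THEN spec, of 1] by (elim exE) (rule that)
 note T = PT[THEN conjunct1] and P = PT[THEN conjunct2, THEN spec, THEN spec, THEN spec, THEN mp]
 define \<tau> where "\<tau> n = nat \<lfloor>T (2 * n)\<rfloor>" for n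
 have tau: "(\<lambda>n. real (\<tau> n)) \<in> O(\<lambda>n. real n powr \<omega>)"
 proof -
  have "real (\<tau> n) \<le> \<bar>T (2 * n)\<bar>" for n unfolding \<tau>_def by linarith
  then have "(\<lambda>n. real (\<tau> n)) \<in> O(\<lambda>n. T (2 * n))" by (intro landau_o.big_mono) auto
  then show ?thesis using bigo_double[OF T] by (rule landau_o.big_trans)
 qed
 have spec: "mm_spec (3 * nregs P + 20) (matmul_com P) (2 * n) B ((2 * n + 2) ^ (c + 4)) (\<tau> n)" if B: "(n + 2) ^ (2 * c + 2) \<le> B" for n B
 proof (rule matmul_com_spec[where W = "capacity c (2 * n)"])
  fix A A' :: "nat => nat => nat" assume a: "\<forall>i<2 * n. \<forall>j<2 * n. A i j \<le> 1 \<and> A' i j \<le> 1"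
  have "\<forall>i<2 * n. \<forall>j<2 * n. A i j < capacity 1 (2 * n) \<and> A' i j < capacity 1 (2 * n)"
  proof (intro allI impI)
   fix i j assume "i < 2 * n" "j < 2 * n"
   then have "A i j \<le> 1" "A' i j \<le> 1" using a by blast+
   then show "A i j < capacity 1 (2 * n) \<and> A' i j < capacity 1 (2 * n)" by (simp add: capacity_def)
  qed
  from P[OF this] obtain t \<sigma> where r: "run (capacity c (2 * n)) P (matmul_input (2 * n) A A') t \<sigma>" "real t \<le> T (2 * n)"
   "\<forall>i<2 * n. \<forall>j<2 * n. mem \<sigma> (2 * (2 * n)\<^sup>2 + i * (2 * n) + j) = (\<Sum>l<2 * n. A i l * A' l j)" by blast
  have "t \<le> \<tau> n" using r(2) unfolding \<tau>_def by linarith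
  then show "\<exists>t \<sigma>. run (capacity c (2 * n)) P (matmul_input (2 * n) A A') t \<sigma> \<and> t \<le> \<tau> n \<and>
    (\<forall>i<2 * n. \<forall>j<2 * n. mem \<sigma> (2 * (2 * n)\<^sup>2 + i * (2 * n) + j) = (\<Sum>l<2 * n. A i l * A' l j))" using r by blast
 next
  have n2: "(n + 2) ^ 2 = n * n + 4 * n + 4" by (simp add: power2_eq_square algebra_simps)
  have "2 * n + 2 \<le> (n + 2) ^ 2" unfolding n2 by linarith
  then have "(2 * n + 2) ^ c \<le> ((n + 2) ^ 2) ^ c" by (rule power_mono) simp
  also have "\<dots> = (n + 2) ^ (2 * c)" by (simp add: power_mult)
  also have "\<dots> \<le> (n + 2) ^ (2 * c + 2)" by (rule power_increasing) auto
  finally show "capacity c (2 * n) \<le> B" using B by (simp add: capacity_def)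
  have "(n + 2) ^ 2 \<le> (n + 2) ^ (2 * c + 2)" by (rule power_increasing) auto
  then show "2 * n \<le> B" using B n2 by linarith
  show "capacity c (2 * n) \<le> (2 * n + 2) ^ (c + 4)" unfolding capacity_def by (rule power_increasing) auto
  have "(2 * n + 2) ^ 4 \<le> (2 * n + 2) ^ (c + 4)" by (rule power_increasing) auto
  moreover have "(2 * n + 2) ^ 4 = ((2 * n + 2) ^ 2) ^ 2" by (simp add: power_mult[symmetric])
  moreover have "((2 * n + 2) ^ 2) * 4 \<le> ((2 * n + 2) ^ 2) ^ 2"
   unfolding power2_eq_square[of "(2 * n + 2) ^ 2"] by (intro mult_le_mono2) (simp add: power2_eq_square algebra_simps)
  moreover have "(2 * n + 2) ^ 2 = 4 * (n * n) + 8 * n + 4" by (simp add: power2_eq_square algebra_simps)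
  moreover have "2 * (2 * n * (2 * n)) = 8 * (n * n)" by simp
  ultimately show "2 * (2 * n * (2 * n)) \<le> (2 * n + 2) ^ (c + 4)" by linarith
 qed simp
 show thesis
  by (rule that[of "matmul_com P" \<omega> \<tau> "c + 4" "2 * c + 2"])
   (use carr_matmul matmul_exponent_ge_2[OF assms] True tau spec in auto)
next
 case False
 have tau: "(\<lambda>n. real (2 * n * (2 * n) * (2 * n))) \<in> O(\<lambda>n. real n powr 3)"
  by (rule landau_o.bigI[of 8]) (auto simp: powr_numeral power3_eq_cube)
 have spec: "mm_spec 200 naive_com (2 * n) B ((2 * n + 2) ^ 4) (2 * n * (2 * n) * (2 * n))" if B: "(n + 2) ^ 4 \<le> B" for n B
 proof (rule naive_com_spec)
  have "(2 * n + 2) ^ 4 = ((2 * n + 2) ^ 2) ^ 2" by (simp add: power_mult[symmetric])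
  moreover have "((2 * n + 2) ^ 2) * 4 \<le> ((2 * n + 2) ^ 2) ^ 2"
   unfolding power2_eq_square[of "(2 * n + 2) ^ 2"] by (intro mult_le_mono2) (simp add: power2_eq_square algebra_simps)
  moreover have "(2 * n + 2) ^ 2 = 4 * (n * n) + 8 * n + 4" by (simp add: power2_eq_square algebra_simps)
  ultimately show "3 * (2 * n * (2 * n)) \<le> (2 * n + 2) ^ 4" by simp
  have "(n + 2) ^ 4 = ((n + 2) ^ 2) ^ 2" by (simp add: power_mult[symmetric])
  moreover have "((n + 2) ^ 2) * 4 \<le> ((n + 2) ^ 2) ^ 2"
   unfolding power2_eq_square[of "(n + 2) ^ 2"] by (intro mult_le_mono2) (simp add: power2_eq_square algebra_simps)
  moreover have "(n + 2) ^ 2 = n * n + 4 * n + 4" by (simp add: power2_eq_square algebra_simps)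
  ultimately show "2 * n * (2 * n) \<le> B" using B by simp
 qed simp
 show thesis
  by (rule that[of naive_com 3 "\<lambda>n. 2 * n * (2 * n) * (2 * n)" 4 4])
   (use carr_naive False tau spec in auto)
qed

section \<open>Time bounds as functions of \<open>n\<close>\<close>

definition lgn :: "nat => real" where
 "lgn n = log 2 (2 * real n + 2)"

lemma lgn_ge: "1 \<le> lgn n"
proof -
 have "log 2 2 \<le> log 2 (2 * real n + 2)" by (subst log_le_cancel_iff) auto
 then show ?thesis by (simp add: lgn_def)
qed

text \<open>All scales except the last are below \<open>n\<close>, and lengths double every
  \<open>h\<close> indices. The linear bound serves the word size, the logarithmic one the running
  times.\<close>

lemma levels_bound:
 assumes lo: "levels_ok n es h K s" and h: "0 < h"
 shows "real K \<le> real h * (lgn n + 2) + 2" and "K \<le> n + 1"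
proof -
 have K1: "1 \<le> K" using lo by (simp add: levels_ok_def)
 show "K \<le> n + 1"
 proof (cases "K = 1")
  case False
  then have "slen h (K - 2) < n" using lo K1 by (simp add: levels_ok_def)
  then show ?thesis using slen_ge[OF h, of "K - 2"] by simp
 qed simp
 show "real K \<le> real h * (lgn n + 2) + 2"
 proof (cases "K = 1")
  case True
  have "0 \<le> real h * (lgn n + 2)" using lgn_ge[of n] by simp
  then show ?thesis using True by simp
 next
  case False
  define a where "a = (K - 2) div h"
  have "slen h (K - 2) < n" using lo K1 False by (simp add: levels_ok_def)
  then have "2 ^ a \<le> 2 * n + 2" using slen_exp[OF h, of "K - 2"] unfolding a_def by linarith
  then have "real (2 ^ a) \<le> real (2 * n + 2)" by (simp only: of_nat_le_iff)
  then have "(2::real) ^ a \<le> 2 * real n + 2" by simp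
  then have "real a \<le> lgn n" unfolding lgn_def by (subst le_log_iff) (auto simp: powr_realpow)
  moreover have "K - 2 < h * (a + 1)" unfolding a_def using h dividend_less_times_div[of h "K - 2"] by (simp add: algebra_simps)
  then have "real (K - 2) \<le> real (h * (a + 1))" by (simp only: of_nat_le_iff less_imp_le)
  then have "real (K - 2) \<le> real h * (real a + 1)" by simp
  ultimately have "real (K - 2) \<le> real h * (lgn n + 2)"
   using mult_left_mono[of "real a + 1" "lgn n + 2" "real h"] by linarith
  then show ?thesis using K1 by linarith
 qed
qed

lemma query_bigo:
 assumes "0 < h"
 shows "(\<lambda>n. 9 * (100 * (log 2 (real h * (lgn n + 2) + 2) + 2) + 1000)) \<in> O(\<lambda>n. ln (ln (real n)))"
proof -
 have "(\<lambda>n. 9 * (100 * (log 2 (c * (log 2 (2 * real n + 2) + 2) + 2) + 2) + 1000)) \<in> O(\<lambda>n. ln (ln (real n)))" if "c > 0" for c :: real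
  using that by real_asymp
 from this[of "real h"] assms show ?thesis unfolding lgn_def by simp
qed

text \<open>The balance point: \<open>n * n * \<sigma>\<close> for the scans meets
  \<open>n / \<sigma>\<close> products of cost \<open>n powr w\<close> each. Adding 1 keeps it
  positive for \<open>n = 0\<close>.\<close>

definition sig :: "real => nat => nat" where
 "sig w n = nat \<lceil>real n powr ((w - 1) / 2)\<rceil> + 1"

definition pre_time :: "real => nat => nat => nat => (nat => nat) => nat => real" where
 "pre_time w C q h \<tau> n = 20 * real q + 500 * (real n powr 2 + 1) +
  (2 * real C + 20200) * (real n powr 2 * (real n powr ((w - 1) / 2) + 2) +
   (real (\<tau> n) + real n powr 2) * (lgn n + 4 + real n powr ((3 - w) / 2))) * (real h * (lgn n + 2) + 2)"

lemma pre_time_bound: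
 fixes n K :: nat
 assumes K: "real K \<le> real h * (lgn n + 2) + 2" and L: "real L \<le> lgn n + 2"
  and t: "t \<le> 20 * q + 500 * (n * n + 1) + (2 * C + 20200) * (n * n * sig w n + (\<tau> n + n * n) * (L + n div sig w n + 1)) * (K - 1)"
 shows "real t \<le> pre_time w C q h \<tau> n"
proof -
 have nn: "real n powr 2 = real n * real n" by (cases "n = 0") (auto simp: powr_numeral power2_eq_square)
 have s: "real (sig w n) \<le> real n powr ((w - 1) / 2) + 2" unfolding sig_def by (simp add: of_nat_nat) linarith
 have d: "real (n div sig w n) \<le> real n powr ((3 - w) / 2)"
 proof (cases "n = 0")
  case False
  have "real (n div sig w n) \<le> real n / real (sig w n)" by (rule of_nat_div_le_of_nat)
  also have "\<dots> \<le> real n / real n powr ((w - 1) / 2)"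
  proof -
   have "real n powr ((w - 1) / 2) \<le> real (sig w n)" unfolding sig_def by linarith
   moreover have "0 < real n powr ((w - 1) / 2)" "0 < sig w n" using False by (simp_all add: sig_def)
   ultimately show ?thesis by (intro divide_left_mono mult_pos_pos) auto
  qed
  also have "\<dots> = real n powr (1 - (w - 1) / 2)" using False by (simp add: powr_diff)
  also have "1 - (w - 1) / 2 = (3 - w) / 2" by (simp add: field_simps)
  finally show ?thesis .
 qed simp
 have g: "0 \<le> lgn n" using lgn_ge[of n] by simp
 have "real t \<le> real (20 * q + 500 * (n * n + 1) + (2 * C + 20200) * (n * n * sig w n + (\<tau> n + n * n) * (L + n div sig w n + 1)) * (K - 1))"
  using t by (simp only: of_nat_le_iff)
 also have "\<dots> = 20 * real q + 500 * (real n * real n + 1) +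
  (2 * real C + 20200) * (real n * real n * real (sig w n) + (real (\<tau> n) + real n * real n) * (real L + real (n div sig w n) + 1)) * real (K - 1)" by simp
 also have "\<dots> \<le> 20 * real q + 500 * (real n * real n + 1) +
  (2 * real C + 20200) * (real n * real n * (real n powr ((w - 1) / 2) + 2) +
   (real (\<tau> n) + real n * real n) * (lgn n + 4 + real n powr ((3 - w) / 2))) * (real h * (lgn n + 2) + 2)"
 proof -
  have a: "real n * real n * real (sig w n) \<le> real n * real n * (real n powr ((w - 1) / 2) + 2)" using s by (intro mult_left_mono) auto
  have b: "(real (\<tau> n) + real n * real n) * (real L + real (n div sig w n) + 1) \<le>
   (real (\<tau> n) + real n * real n) * (lgn n + 4 + real n powr ((3 - w) / 2))" using d L by (intro mult_left_mono) auto
  have c: "real (K - 1) \<le> real h * (lgn n + 2) + 2" using K by simp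
  have "0 \<le> (2 * real C + 20200) * (real n * real n * (real n powr ((w - 1) / 2) + 2) +
   (real (\<tau> n) + real n * real n) * (lgn n + 4 + real n powr ((3 - w) / 2)))"
   using g by (intro mult_nonneg_nonneg add_nonneg_nonneg) auto
  from mult_mono[OF mult_left_mono[OF add_mono[OF a b], of "2 * real C + 20200"] c this of_nat_0_le_iff] show ?thesis by simp
 qed
 finally show ?thesis unfolding pre_time_def nn .
qed

text \<open>Both balanced terms have exponent \<open>(3 + w) / 2\<close>. One logarithm comes from
  the doublings of the chunk size, whose products fit because \<open>w \<le> 3\<close>; the other is
  the number of scales.\<close>

lemma pre_time_bigo:
 assumes w: "2 \<le> w" "w \<le> \<omega>" "w \<le> 3" and tau: "(\<lambda>n. real (\<tau> n)) \<in> O(\<lambda>n. real n powr w)"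
 shows "pre_time w C q h \<tau> \<in> O(\<lambda>n. real n powr ((3 + \<omega>) / 2) * (ln (real n))\<^sup>2)"
proof -
 have pw: "(\<lambda>n::nat. real n powr a) \<in> O(\<lambda>n. real n powr b)" if "a \<le> b" for a b :: real
  using powr_bigo_iff[of "\<lambda>n::nat. real n" at_top a b] filterlim_real_sequentially that by simp
 have lg: "(\<lambda>n. lgn n + 2) \<in> O(\<lambda>n. ln (real n))" "(\<lambda>n. lgn n + 4) \<in> O(\<lambda>n. ln (real n))" unfolding lgn_def by real_asymp+
 have one: "(\<lambda>n::nat. c) \<in> O(\<lambda>n. ln (real n))" for c :: real by real_asymp
 define e where "e = (3 + w) / 2"
 let ?g = "\<lambda>n::nat. real n powr e" and ?l = "\<lambda>n::nat. ln (real n)"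
 have mulp: "(\<lambda>n::nat. real n powr a * real n powr b) \<in> O(\<lambda>n. real n powr c)" if "a + b \<le> c" for a b c :: real
  using pw[OF that] by (simp add: powr_add)
 have g1: "f \<in> O(\<lambda>n. ?g n * ?l n)" if "f \<in> O(?g)" for f
  using landau_o.big.mult[OF that one[of 1]] by simp
 have F1: "(\<lambda>n::nat. real n powr 2 * (real n powr ((w - 1) / 2) + 2)) \<in> O(\<lambda>n. ?g n * ?l n)"
 proof (rule g1)
  have "(\<lambda>n::nat. real n powr 2 * real n powr ((w - 1) / 2)) \<in> O(?g)" by (rule mulp) (simp add: e_def field_simps)
  moreover have "(\<lambda>n::nat. real n powr 2 * 2) \<in> O(?g)" using pw[of 2 e] w(1) by (simp add: e_def)
  ultimately show "(\<lambda>n::nat. real n powr 2 * (real n powr ((w - 1) / 2) + 2)) \<in> O(?g)"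
   unfolding distrib_left by (rule sum_in_bigo)
 qed
 have ta: "(\<lambda>n. real (\<tau> n) + real n powr 2) \<in> O(\<lambda>n. real n powr w)" using tau pw[OF w(1)] by (rule sum_in_bigo)
 have F2: "(\<lambda>n. (real (\<tau> n) + real n powr 2) * (lgn n + 4 + real n powr ((3 - w) / 2))) \<in> O(\<lambda>n. ?g n * ?l n)"
  unfolding distrib_left[of _ "lgn _ + 4"]
 proof (rule sum_in_bigo)
  have "(\<lambda>n. real (\<tau> n) + real n powr 2) \<in> O(?g)" using ta pw[of w e] w(3) by (auto simp: e_def field_simps intro: landau_o.big_trans)
  from landau_o.big.mult[OF this lg(2)] show "(\<lambda>n. (real (\<tau> n) + real n powr 2) * (lgn n + 4)) \<in> O(\<lambda>n. ?g n * ?l n)" .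
  have "(\<lambda>n. (real (\<tau> n) + real n powr 2) * real n powr ((3 - w) / 2)) \<in> O(\<lambda>n. real n powr w * real n powr ((3 - w) / 2))"
   by (rule landau_o.big.mult[OF ta]) simp
  moreover have "(\<lambda>n::nat. real n powr w * real n powr ((3 - w) / 2)) \<in> O(?g)" by (rule mulp) (simp add: e_def field_simps)
  ultimately show "(\<lambda>n. (real (\<tau> n) + real n powr 2) * real n powr ((3 - w) / 2)) \<in> O(\<lambda>n. ?g n * ?l n)"
   by (intro g1) (rule landau_o.big_trans)
 qed
 have F3: "(\<lambda>n. real h * (lgn n + 2) + 2) \<in> O(?l)"
 proof (rule sum_in_bigo)
  show "(\<lambda>n. real h * (lgn n + 2)) \<in> O(?l)" using lg(1) by simp
 qed (rule one)
 have F12: "(\<lambda>n. (2 * real C + 20200) * (real n powr 2 * (real n powr ((w - 1) / 2) + 2) +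
   (real (\<tau> n) + real n powr 2) * (lgn n + 4 + real n powr ((3 - w) / 2)))) \<in> O(\<lambda>n. ?g n * ?l n)"
 proof -
  have "(\<lambda>n. real n powr 2 * (real n powr ((w - 1) / 2) + 2) +
   (real (\<tau> n) + real n powr 2) * (lgn n + 4 + real n powr ((3 - w) / 2))) \<in> O(\<lambda>n. ?g n * ?l n)" by (rule sum_in_bigo[OF F1 F2])
  then show ?thesis by simp
 qed
 have F0: "(\<lambda>n. 20 * real q + 500 * (real n powr 2 + 1)) \<in> O(\<lambda>n. ?g n * ?l n * ?l n)"
 proof -
  have c: "(\<lambda>n::nat. a) \<in> O(?g)" for a :: real
  proof -
   have "(\<lambda>n::nat. a) \<in> O(\<lambda>n. real n powr 1)" by real_asymp
   then show ?thesis using pw[of 1 e] w(1) by (auto simp: e_def intro: landau_o.big_trans)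
  qed
  have "(\<lambda>n::nat. 500 * real n powr 2) \<in> O(?g)" using pw[of 2 e] w(1) by (simp add: e_def)
  then have "(\<lambda>n. 500 * real n powr 2 + (20 * real q + 500)) \<in> O(?g)" using c by (rule sum_in_bigo)
  then have "(\<lambda>n. 20 * real q + 500 * (real n powr 2 + 1)) \<in> O(?g)" by (simp add: algebra_simps)
  from landau_o.big.mult[OF g1[OF this] one[of 1]] show ?thesis by simp
 qed
 have "pre_time w C q h \<tau> \<in> O(\<lambda>n. ?g n * ?l n * ?l n)"
  unfolding pre_time_def by (rule sum_in_bigo[OF F0 landau_o.big.mult[OF F12 F3]])
 also have "(\<lambda>n. ?g n * ?l n * ?l n) \<in> O(\<lambda>n. real n powr ((3 + \<omega>) / 2) * (ln (real n))\<^sup>2)"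
  unfolding power2_eq_square mult.assoc by (rule landau_o.big.mult_right) (rule pw, use w(2) in \<open>simp add: e_def\<close>)
 finally show ?thesis .
qed

lemma deletions_append: "deletions (xs @ ys) = deletions xs @ deletions ys"
 by (induction xs rule: deletions.induct) auto

text \<open>The distance is an infimum over walks, so the second inequality is proved as a lower
  bound: the answer divided by \<open>1 + \<epsilon>\<close> is at most the length of every walk.
  Infinite distance corresponds to denominator 0.\<close>

lemma answer_approx:
 assumes g: "good es h R dl x y p" and E: "set es \<subseteq> {..<n} \<times> {..<n}" and x: "x < n" and h: "0 < h" "1 / real h \<le> \<epsilon>" and e: "0 < \<epsilon>"
 shows "dist_in n (set es - set dl) x y \<le> out_val (snd p)" "out_val (snd p) \<le> ereal (1 + \<epsilon>) * dist_in n (set es - set dl) x y"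
proof -
 define F where "F = set es - set dl"
 have F: "F \<subseteq> {..<n} \<times> {..<n}" using E by (auto simp: F_def)
 let ?d = "dist_in n F x y"
 define a where "a = regs (snd p) 0"
 consider "regs (snd p) 1 = 0" "\<And>l. (x, y) \<notin> F ^^ l" |
  l where "regs (snd p) 1 = 1" "l \<le> a" "(x, y) \<in> F ^^ l" "\<And>l. (x, y) \<in> F ^^ l ==> h * a \<le> (h + 1) * l"
  using g unfolding good_def F_def a_def by auto
 then have "?d \<le> out_val (snd p) \<and> out_val (snd p) \<le> ereal (1 + \<epsilon>) * ?d"
 proof cases
  case 1
  have "\<infinity> \<le> ?d" by (rule dist_in_ge[OF F]) (use 1(2) in blast)
  then have "?d = \<infinity>" by simp
  then show ?thesis using 1(1) e by (simp add: out_val_def)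
 next
  case (2 l)
  have ov: "out_val (snd p) = ereal (real a)" using 2(1) by (simp add: out_val_def a_def)
  have "?d \<le> ereal (real l)" by (rule dist_in_le[OF F x 2(3)])
  also have "\<dots> \<le> ereal (real a)" using 2(2) by simp
  finally have up: "?d \<le> out_val (snd p)" using ov by simp
  have "ereal (real a / (1 + \<epsilon>)) \<le> ?d"
  proof (rule dist_in_ge[OF F])
   fix j assume "(x, y) \<in> F ^^ j"
   then have "h * a \<le> (h + 1) * j" by (rule 2(4))
   then have "real (h * a) \<le> real ((h + 1) * j)" by (simp only: of_nat_le_iff)
   then have "real h * real a \<le> (real h + 1) * real j" by (simp add: algebra_simps)
   then have "real a \<le> (real h + 1) * real j / real h" using h(1) by (simp add: pos_le_divide_eq mult.commute)
   also have "\<dots> = (1 + 1 / real h) * real j" using h(1) by (simp add: field_simps)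
   also have "\<dots> \<le> (1 + \<epsilon>) * real j" using h(2) by (intro mult_right_mono) auto
   finally have "real a / (1 + \<epsilon>) \<le> real j" using e by (simp add: pos_divide_le_eq mult.commute)
   then show "ereal (real a / (1 + \<epsilon>)) \<le> ereal (real j)" by simp
  qed
  then have "ereal (1 + \<epsilon>) * ereal (real a / (1 + \<epsilon>)) \<le> ereal (1 + \<epsilon>) * ?d" using e by (intro ereal_mult_left_mono) auto
  moreover have "ereal (1 + \<epsilon>) * ereal (real a / (1 + \<epsilon>)) = ereal (real a)" using e by simp
  ultimately show ?thesis using up ov by simp
 qed
 then show "dist_in n (set es - set dl) x y \<le> out_val (snd p)" "out_val (snd p) \<le> ereal (1 + \<epsilon>) * dist_in n (set es - set dl) x y"
  unfolding F_def by blast+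
qed

text \<open>The number of nodes is \<open>eta_bar + 2\<close>, hence at most three times the maximum
  of 1 and \<open>eta_bar\<close>; squaring gives the factor 9.\<close>

lemma answer_time:
 assumes g: "good es' h R (take i es) x y p" and R: "real R \<le> r" and d: "distinct es'" "distinct es" "set es \<subseteq> set es'" "i \<le> length es"
 shows "real (fst p) \<le> (real_of_int (max 1 (eta_bar es' es i)))\<^sup>2 * (9 * (100 * r + 1000))"
  "real (fst p) \<le> (real_of_int (max 1 (eta_inf es' es)))\<^sup>2 * (9 * (100 * r + 1000))"
proof -
 let ?c = "size_c es' (take i es)" and ?b = "real_of_int (max 1 (eta_bar es' es i))" and ?f = "real_of_int (max 1 (eta_inf es' es))"
 note eb = eta_bar_eq[OF d]
 have r0: "0 \<le> r" using R of_nat_0_le_iff[of R] by linarith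
 have c: "real ?c \<le> 3 * ?b"
 proof -
  have "int ?c \<le> 3 * max 1 (eta_bar es' es i)" using eb(2,4) by linarith
  then have "real_of_int (int ?c) \<le> real_of_int (3 * max 1 (eta_bar es' es i))" by (simp only: of_int_le_iff)
  then show ?thesis by simp
 qed
 have "fst p \<le> (100 * R + 1000) * (?c * ?c)" using g by (simp add: good_def)
 then have "real (fst p) \<le> real ((100 * R + 1000) * (?c * ?c))" by (simp only: of_nat_le_iff)
 also have "\<dots> = (100 * real R + 1000) * (real ?c * real ?c)" by simp
 also have "\<dots> \<le> (100 * r + 1000) * ((3 * ?b) * (3 * ?b))" using R c r0 by (intro mult_mono) auto
 also have "\<dots> = ?b\<^sup>2 * (9 * (100 * r + 1000))" by (simp add: power2_eq_square)
 finally show t: "real (fst p) \<le> ?b\<^sup>2 * (9 * (100 * r + 1000))" .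
 have "?b \<le> ?f" using eb(3) by simp
 then have "?b\<^sup>2 \<le> ?f\<^sup>2" by (intro power_mono) auto
 then have "?b\<^sup>2 * (9 * (100 * r + 1000)) \<le> ?f\<^sup>2 * (9 * (100 * r + 1000))" using r0 by (intro mult_right_mono) auto
 then show "real (fst p) \<le> ?f\<^sup>2 * (9 * (100 * r + 1000))" using t by linarith
qed

theorem theorem3p2:
  fixes \<epsilon> \<omega> :: real
  assumes "\<epsilon> > 0" and "matmul_time \<omega>"
  shows "\<exists>(A :: algorithm) (c :: nat) (Tpre :: nat \<Rightarrow> real) (Tdel :: nat \<Rightarrow> real) (Tqry :: nat \<Rightarrow> real).
    Tpre \<in> O(\<lambda>n. real n powr ((3 + \<omega>) / 2) * (ln (real n))\<^sup>2) \<and>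
    Tdel \<in> O(\<lambda>n. ln (real n)) \<and>
    Tqry \<in> O(\<lambda>n. ln (ln (real n))) \<and>
    (\<forall>n es' rs. valid_input n es' rs \<longrightarrow>
      (\<exists>t\<^sub>0 \<sigma>\<^sub>0 tr.
        run (capacity c n) (preprocess A) (initial_ram n es') t\<^sub>0 \<sigma>\<^sub>0 \<and>
        real t\<^sub>0 \<le> Tpre n \<and>
        serve (capacity c n) A \<sigma>\<^sub>0 rs tr \<and>
        (\<forall>k<length rs.
          case rs ! k of
            Delete e \<Rightarrow> real (fst (tr ! k)) \<le> Tdel n
          | Query s t \<Rightarrow>
              (let es = deletions rs;
                   i = length (deletions (take k rs));
                   d = dist_in n (set es' - set (take i es)) s t;
                   ans = out_val (snd (tr ! k));
                   time = real (fst (tr ! k))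
               in d \<le> ans \<and> ans \<le> ereal (1 + \<epsilon>) * d \<and>
                  time \<le> (real_of_int (max 1 (eta_bar es' es i)))\<^sup>2 * Tqry n \<and>
                  time \<le> (real_of_int (max 1 (eta_inf es' es)))\<^sup>2 * Tqry n))))"
proof -
 obtain mm w C q b and \<tau> :: "nat => nat" where mm: "carr mm" and w: "2 \<le> w" "w \<le> \<omega>" "w \<le> 3"
  and tau: "(\<lambda>n. real (\<tau> n)) \<in> O(\<lambda>n. real n powr w)" and q: "4 \<le> q"
  and spec: "\<And>n B. (n + 2) ^ b \<le> B ==> mm_spec C mm (2 * n) B ((2 * n + 2) ^ q) (\<tau> n)"
  using mm_package[OF assms(2)] by metis
 \<comment> \<open>The number of scales per doubling, chosen so that the stretch
   \<open>1 + 1 / h\<close> is at most \<open>1 + \<epsilon>\<close>.\<close>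
 define h where "h = nat \<lceil>1 / \<epsilon>\<rceil> + 1"
 have h: "0 < h" by (simp add: h_def)
 have heps: "1 / real h \<le> \<epsilon>"
 proof -
  have "1 / \<epsilon> \<le> real h" unfolding h_def by linarith
  then have "1 \<le> real h * \<epsilon>" using assms(1) by (simp add: pos_divide_le_eq)
  then show ?thesis using h by (simp add: pos_divide_le_eq mult.commute)
 qed
 define pre where "pre = pre_com mm h q"
 obtain d1 d2 d3 where syn: "csyn d1 d1 pre" "csyn d2 d2 delete_com" "csyn d3 d3 query_com"
  using ex_csyn[OF carr_pre[OF mm, of h q]] ex_csyn[OF carr_online(1)] ex_csyn[OF carr_online(2)] unfolding pre_def by blast
 define d where "d = d1 + d2 + d3 + 2"
 define wd where "wd = width pre + width delete_com + width query_com"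
 define A where "A = \<lparr>preprocess = compc d pre, delete = compc d delete_com, answer = compc d query_com\<rparr>"
 have "polyb \<tau>" using bigo_bound[OF tau] by (simp add: polyb_def)
 \<comment> \<open>The sum of all lower bounds that the specifications impose on the word bound
   \<open>B\<close>. It is polynomial in \<open>n\<close>, so some power of \<open>n + 2\<close> can
   serve as \<open>B\<close>.\<close>
 define G where "G = (\<lambda>n. (n + 1) * (\<tau> n + n * n) + (n * n + (2 * n + 2) ^ q * (2 * n * n + 2 * n + 1)) + (n + 2) * (n * n) +
  (n + 2) ^ b + (5 * (n * n) + (4 * n + (d + 64))))"
 have "polyb G" unfolding G_def
  by (intro polyb_add polyb_mult polyb_power polyb_const polyb_id \<open>polyb \<tau>\<close>)
 then obtain b' where b': "\<And>n. G n \<le> (n + 2) ^ b'" unfolding polyb_def by blast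
 \<comment> \<open>Intermediate words reach at most \<open>B ^ wd\<close> with
   \<open>B = (n + 2) ^ b'\<close>; one more factor makes the inequality strict.\<close>
 define c where "c = b' * wd + 1"
 define r where "r = (\<lambda>n. log 2 (real h * (lgn n + 2) + 2) + 2)"
 have main: "\<exists>t\<^sub>0 \<sigma>\<^sub>0 tr.
    run (capacity c n) (preprocess A) (initial_ram n es') t\<^sub>0 \<sigma>\<^sub>0 \<and>
    real t\<^sub>0 \<le> pre_time w C q h \<tau> n \<and>
    serve (capacity c n) A \<sigma>\<^sub>0 rs tr \<and>
    (\<forall>k<length rs.
     case rs ! k of
      Delete e => real (fst (tr ! k)) \<le> 200
     | Query s t =>
       (let es = deletions rs;
          i = length (deletions (take k rs));
          d = dist_in n (set es' - set (take i es)) s t;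
          ans = out_val (snd (tr ! k));
          time = real (fst (tr ! k))
        in d \<le> ans \<and> ans \<le> ereal (1 + \<epsilon>) * d \<and>
         time \<le> (real_of_int (max 1 (eta_bar es' es i)))\<^sup>2 * (9 * (100 * r n + 1000)) \<and>
         time \<le> (real_of_int (max 1 (eta_inf es' es)))\<^sup>2 * (9 * (100 * r n + 1000))))"
  if vi: "valid_input n es' rs" for n es' rs
 proof -
  have es: "distinct es'" "set es' \<subseteq> {..<n} \<times> {..<n}" "distinct (deletions rs)" "set (deletions rs) = set es'"
   "\<forall>x y. Query x y \<in> set rs --> x < n \<and> y < n" using vi by (auto simp: valid_input_def)
  have m: "length es' \<le> n * n"
  proof -
   have "card (set es') \<le> card ({..<n} \<times> {..<n})" using es(2) by (intro card_mono) auto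
   then show ?thesis using distinct_card[OF es(1)] by (simp add: card_cartesian_product)
  qed
  define B where "B = (n + 2) ^ b'"
  have GB: "(n + 1) * (\<tau> n + n * n) + (n * n + (2 * n + 2) ^ q * (2 * n * n + 2 * n + 1)) + (n + 2) * (n * n) +
   (n + 2) ^ b + (5 * (n * n) + (4 * n + (d + 64))) \<le> B" using b'[of n] unfolding G_def B_def by simp
  have B: "(n + 1) * (\<tau> n + n * n) \<le> B" "n * n + (2 * n + 2) ^ q * (2 * n * n + 2 * n + 1) \<le> B" "(n + 2) * (n * n) \<le> B"
   "(n + 2) ^ b \<le> B" "5 * (n * n) + 64 \<le> B" "4 * n + 64 \<le> B" "d \<le> B" using GB by linarith+
  have W: "B ^ width pre < capacity c n" "B ^ width delete_com < capacity c n" "B ^ width query_com < capacity c n"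
  proof -
   have lt: "B ^ wd < capacity c n"
   proof -
    have "B ^ wd = (n + 2) ^ (b' * wd)" by (simp add: B_def power_mult)
    also have "\<dots> < (n + 2) ^ (b' * wd + 1)" by (rule power_strict_increasing) auto
    finally show ?thesis by (simp add: capacity_def c_def)
   qed
   have "B ^ k < capacity c n" if "k \<le> wd" for k
   proof -
    have "B ^ k \<le> B ^ wd" using that B(5) by (intro power_increasing) auto
    then show ?thesis using lt by linarith
   qed
   then show "B ^ width pre < capacity c n" "B ^ width delete_com < capacity c n" "B ^ width query_com < capacity c n" by (simp_all add: wd_def)
  qed
  have sy: "csyn d B pre" "csyn d B delete_com" "csyn d B query_com"
   using B(7) by (auto intro!: csyn_mono[OF syn(1)] csyn_mono[OF syn(2)] csyn_mono[OF syn(3)] simp: d_def)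
  \<comment> \<open>The state of the structured language that the initial machine represents, with
    the input split among the arrays by address.\<close>
  define s0 where "s0 = \<lparr>vs = (\<lambda>_. 0)(0 := n, 1 := length es'), ar = (\<lambda>a x. mem (initial_ram n es') (32 * x + a)), ck = 0\<rparr>"
  have mem0: "mem (initial_ram n es') x \<le> n" for x
  proof -
   have "fst (es' ! i) < n \<and> snd (es' ! i) < n" if "i < length es'" for i
   proof -
    have "es' ! i \<in> {..<n} \<times> {..<n}" using es(2) that nth_mem by blast
    then show ?thesis by (auto simp: mem_Times_iff)
   qed
   moreover have "x div 2 < length es'" if "x < 2 * length es'" using that by linarith
   ultimately have "fst (es' ! (x div 2)) \<le> n" "snd (es' ! (x div 2)) \<le> n" if "x < 2 * length es'" using that by (simp_all add: less_imp_le)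
   then show ?thesis by (simp add: initial_ram_def)
  qed
  have rel0: "rel d s0 (initial_ram n es')" by (simp add: rel_def s0_def initial_ram_def)
  have bnd0: "bnd d B s0"
  proof -
   have "mem (initial_ram n es') x \<le> B" for x using mem0[of x] B(6) by linarith
   then show ?thesis using B(5,6) m by (auto simp: bnd_def s0_def)
  qed
  have raw0: "raw_input es' s0" unfolding raw_input_def
  proof (intro allI impI)
   fix i assume i: "i < length es'"
   have "ar s0 (j mod 32) (j div 32) = mem (initial_ram n es') j" for j by (simp add: s0_def)
   from this[of "2 * i"] this[of "2 * i + 1"]
   show "ar s0 (2 * i mod 32) (2 * i div 32) = fst (es' ! i) \<and> ar s0 ((2 * i + 1) mod 32) ((2 * i + 1) div 32) = snd (es' ! i)"
    using i by (simp add: initial_ram_def)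
  qed
  have z0: "\<forall>a<32. \<forall>x\<ge>n * n. ar s0 a x = 0" using m by (auto simp: s0_def initial_ram_def)
  \<comment> \<open>The bound on the doublings of the chunk size, which never exceeds
    \<open>4 * n\<close>.\<close>
  define L where "L = nat \<lfloor>lgn n\<rfloor> + 2"
  have L: "4 * n < 2 ^ (L + 1)" "real L \<le> lgn n + 2"
  proof -
   show "real L \<le> lgn n + 2" unfolding L_def using lgn_ge[of n] by (simp add: of_nat_nat)
   have "lgn n \<le> real (L - 1)" unfolding L_def using lgn_ge[of n] by linarith
   then have "2 powr lgn n \<le> 2 powr real (L - 1)" by simp
   then have "2 * real n + 2 \<le> 2 ^ (L - 1)" by (simp add: lgn_def powr_realpow)
   then have "real (2 * n + 2) \<le> real (2 ^ (L - 1))" by simp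
   then have "2 * n + 2 \<le> 2 ^ (L - 1)" by (simp only: of_nat_le_iff)
   moreover have "(2::nat) ^ (L + 1) = 4 * 2 ^ (L - 1)" unfolding L_def by (simp add: power_add)
   ultimately show "4 * n < 2 ^ (L + 1)" by linarith
  qed
  have "wp B pre (\<lambda>s'. \<exists>K. online n es' h K {} s' \<and> ck s' \<le> ck s0 + 20 * q + 500 * (n * n + 1) +
   (2 * C + 20200) * (n * n * sig w n + (\<tau> n + n * n) * (L + n div sig w n + 1)) * (K - 1)) s0"
   unfolding pre_def
  proof (rule wp_pre[where n = n and \<tau> = "\<tau> n" and \<sigma> = "sig w n" and L = L and C = C])
   show "mm_spec C mm (2 * n) B ((2 * n + 2) ^ q) (\<tau> n)" by (rule spec[OF B(4)])
   show "4 * n + 1 \<le> B" "5 * (n * n) + 4 \<le> B" using B(5,6) by linarith+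
   show "\<forall>x. ar s0 6 x \<le> B"
   proof
    fix x show "ar s0 6 x \<le> B" using mem0[of "32 * x + 6"] B(6) by (simp add: s0_def)
   qed
   show "vs s0 0 = n" "vs s0 1 = length es'" by (simp_all add: s0_def)
   show "0 < sig w n" by (simp add: sig_def)
  qed (fact raw0 z0 es(1) L(1) h m es(2) q B(1) B(2) B(3))+
  then obtain s1 t0 \<sigma>0 where s1: "\<exists>K. online n es' h K {} s1 \<and> ck s1 \<le> ck s0 + 20 * q + 500 * (n * n + 1) +
   (2 * C + 20200) * (n * n * sig w n + (\<tau> n + n * n) * (L + n div sig w n + 1)) * (K - 1)"
   "run (capacity c n) (compc d pre) (initial_ram n es') t0 \<sigma>0" "rel d s1 \<sigma>0" "bnd d B s1" "ck s1 = ck s0 + t0"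
   by (rule run_wp[OF _ sy(1) rel0 bnd0 _ W(1)]) (use B(5) in auto)
  then obtain K where K: "online n es' h K {} s1" "t0 \<le> 20 * q + 500 * (n * n + 1) +
   (2 * C + 20200) * (n * n * sig w n + (\<tau> n + n * n) * (L + n div sig w n + 1)) * (K - 1)" by auto
  have lo: "levels_ok n es' h K s1" using K(1) by (simp add: online_def)
  note Kb = levels_bound[OF lo h]
  have tpre: "real t0 \<le> pre_time w C q h \<tau> n" by (rule pre_time_bound[where \<tau> = \<tau> and n = n and L = L and K = K, OF Kb(1) L(2) K(2)])
  \<comment> \<open>The number of binary search steps, with \<open>2 ^ R\<close> above the number of
    scales. As the latter is logarithmic in \<open>n\<close>, \<open>R\<close> is of order
    \<open>ln (ln n)\<close>.\<close>
  define R where "R = nat \<lfloor>log 2 (real h * (lgn n + 2) + 2)\<rfloor> + 1"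
  have X: "2 \<le> real h * (lgn n + 2) + 2" using lgn_ge[of n] by simp
  have l0: "0 \<le> log 2 (real h * (lgn n + 2) + 2)" using X by (subst zero_le_log_cancel_iff) auto
  have R: "real R \<le> r n" unfolding R_def r_def using l0 by (simp add: of_nat_nat) linarith
  have KR: "K < 2 ^ R"
  proof -
   have "log 2 (real h * (lgn n + 2) + 2) < real R" unfolding R_def using l0 by linarith
   then have "real h * (lgn n + 2) + 2 < 2 powr real R" using X by (subst (asm) log_less_iff) auto
   then have "real h * (lgn n + 2) + 2 < 2 ^ R" by (simp add: powr_realpow)
   then have "real K < 2 ^ R" using Kb(1) by linarith
   then have "real K < real (2 ^ R)" by (simp only: of_nat_power of_nat_numeral)
   then show ?thesis by (simp only: of_nat_less_iff)
  qed
  have D0: "Dset es' [] = {}" by (simp add: Dset_def)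
  have "\<exists>tr. serve (capacity c n) A \<sigma>0 rs tr \<and> (\<forall>k<length rs. case rs ! k of Delete e => fst (tr ! k) \<le> 200
   | Query x y => good es' h R ([] @ deletions (take k rs)) x y (tr ! k))"
  proof (rule serve_online[where B = B and d = d and n = n and K = K and s = s1])
   show "delete A = compc d delete_com" "answer A = compc d query_com" by (simp_all add: A_def)
   show "64 \<le> B" "2 * (n * n) + 4 \<le> B" "4 * n + 4 \<le> B" "K + 1 \<le> B" "2 \<le> d" using B(5,6) Kb(2) by (auto simp: d_def)
   show "online n es' h K (Dset es' []) s1" using K(1) D0 by simp
   show "distinct ([] @ deletions rs)" "set (deletions rs) \<subseteq> set es'" using es(3,4) by auto
  qed (fact sy W(2) W(3) KR h es m s1)+
  then obtain tr where tr: "serve (capacity c n) A \<sigma>0 rs tr" "\<forall>k<length rs. case rs ! k of Delete e => fst (tr ! k) \<le> 200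
   | Query x y => good es' h R (deletions (take k rs)) x y (tr ! k)" unfolding append_Nil by blast
  show ?thesis
  proof (intro exI conjI allI impI)
   show "run (capacity c n) (preprocess A) (initial_ram n es') t0 \<sigma>0" using s1(2) by (simp add: A_def)
   show "real t0 \<le> pre_time w C q h \<tau> n" by (rule tpre)
   show "serve (capacity c n) A \<sigma>0 rs tr" by (rule tr(1))
   fix k assume k: "k < length rs"
   let ?i = "length (deletions (take k rs))"
   have app: "deletions rs = deletions (take k rs) @ deletions (drop k rs)" by (simp add: deletions_append[symmetric])
   have tk: "take ?i (deletions rs) = deletions (take k rs)" by (subst app) simp
   have il: "?i \<le> length (deletions rs)" by (subst app) simp
   show "case rs ! k of
      Delete e => real (fst (tr ! k)) \<le> 200
     | Query s t =>
       (let es = deletions rs;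
          i = length (deletions (take k rs));
          d = dist_in n (set es' - set (take i es)) s t;
          ans = out_val (snd (tr ! k));
          time = real (fst (tr ! k))
        in d \<le> ans \<and> ans \<le> ereal (1 + \<epsilon>) * d \<and>
         time \<le> (real_of_int (max 1 (eta_bar es' es i)))\<^sup>2 * (9 * (100 * r n + 1000)) \<and>
         time \<le> (real_of_int (max 1 (eta_inf es' es)))\<^sup>2 * (9 * (100 * r n + 1000)))"
   proof (cases "rs ! k")
    case (Delete e)
    then show ?thesis using tr(2)[rule_format, OF k] by simp
   next
    case (Query x y)
    then have g: "good es' h R (take ?i (deletions rs)) x y (tr ! k)" using tr(2)[rule_format, OF k] tk by simp
    have x: "x < n" using es(5) Query k nth_mem by metis
    note a1 = answer_approx[OF g es(2) x h heps assms(1)]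
    have "set (deletions rs) \<subseteq> set es'" using es(4) by simp
    note a2 = answer_time[OF g R es(1,3) this il]
    show ?thesis unfolding Query request.case Let_def by (intro conjI a1 a2)
   qed
  qed
 qed
 have t1: "pre_time w C q h \<tau> \<in> O(\<lambda>n. real n powr ((3 + \<omega>) / 2) * (ln (real n))\<^sup>2)" by (rule pre_time_bigo[OF w tau])
 have t2: "(\<lambda>n::nat. 200) \<in> O(\<lambda>n. ln (real n))" by real_asymp
 have t3: "(\<lambda>n. 9 * (100 * r n + 1000)) \<in> O(\<lambda>n. ln (ln (real n)))" unfolding r_def by (rule query_bigo[OF h])
 show ?thesis
  by (intro exI[of _ A] exI[of _ c] exI[of _ "pre_time w C q h \<tau>"] exI[of _ "\<lambda>_. 200"] exI[of _ "\<lambda>n. 9 * (100 * r n + 1000)"] conjI t1 t2 t3 allI impI main)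
qed

end
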